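(* Let $k>0$ and, for $l=1,2$, let $d_{1l},d_{2l}\in\mathbb{S}^1$ with $d_{1l}\neq d_{2l}$, and suppose $n_{d_{11},d_{21}}\nparallel n_{d_{12},d_{22}}$. Let $\Omega\subset\mathbb{R}^2$ be an obstacle and consider one of the four scattering problems: Dirichlet, Neumann or impedance boundary condition (impenetrable obstacle), or the transmission problem (penetrable obstacle). For $\ell\in\mathbb{R}^2$ let $\Omega_\ell:=\{x+\ell: x\in\Omega\}$, and for $l=1,2$ let $u^\infty(\hat x;d_{1l},d_{2l},k)$ and $u^\infty_\ell(\hat x;d_{1l},d_{2l},k)$ be the far-field patterns of the scattered fields generated by the incident field $u^i(x;d_{1l},d_{2l},k)=e^{ikd_{1l}\cdot x}+e^{ikd_{2l}\cdot x}$ for the obstacles $\Omega$ and $\Omega_\ell$, respectively, with the same boundary condition (respectively, in the penetrable case, the same transmission constant $\lambda$ and the same refractive index $n_0$). In the penetrable case assume in addition that $k$ is not a transmission eigenvalue of the interior transmission problem (ITP) in $\Omega$. For $j=1,2$, $n\in\mathbb{Z}$ and $t\in[0,2\pi)$ define the straight line $$L^{(j)}_{n,t}:=\left\{a\,n_{d_{1j},d_{2j}}+\frac{2\pi n+t}{k|d_{1j}-d_{2j}|^2}(d_{1j}-d_{2j})\;:\;a\in\mathbb{R}\right\}.$$ Then there are constants $\tau_1,\tau_2\in(0,2\pi)$ (not depending on $\ell$) such that $$|u^\infty(\hat x;d_{1l},d_{2l},k)|=|u^\infty_\ell(\hat x;d_{1l},d_{2l},k)|\quad\text{for all }\hat x\in\mathbb{S}^1,\;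 l=1,2,$$ holds only for $\ell$ in the countably infinite set of intersection points of a line of the family $\{L^{(1)}_{n,0},L^{(1)}_{n,\tau_1}:n\in\mathbb{Z}\}$ with a line of the family $\{L^{(2)}_{m,0},L^{(2)}_{m,\tau_2}:m\in\mathbb{Z}\}$.
   Context: $\mathbb{S}^1$ is the unit circle in $\mathbb{R}^2$. An obstacle $\Omega\subset\mathbb{R}^2$ is a bounded domain with connected $C^2$-smooth boundary $\Gamma=\partial\Omega$; $\nu$ is the unit outward normal on $\Gamma$. For $d_1\ne d_2$ in $\mathbb{S}^1$, $n_{d_1,d_2}\in\mathbb{S}^1$ denotes a (fixed) choice of one of the two unit vectors with $n_{d_1,d_2}\cdot d_1=n_{d_1,d_2}\cdot d_2$. Impenetrable obstacle: given an incident field $u^i$, the scattered field $u^s$ satisfies $\Delta u^s+k^2u^s=0$ in $\mathbb{R}^2\setminus\overline\Omega$, the boundary condition $\mathscr{B}(u^s)=-\mathscr{B}(u^i)$ on $\Gamma$, and the Sommerfeld radiation condition $\lim_{r\to\infty}r^{1/2}(\partial u^s/\partial r-iku^s)=0$, $r=|x|$. Here $\mathscr{B}(w)=w$ (Dirichlet), $\mathscr{B}(w)=\partial w/\partial\nu$ (Neumann), or $\mathscr{B}(w)=\partial w/\partial\nu+\mu w$ with a constant $\mu$ (impedance). Penetrable obstacle: $u^s$ in $\mathbb{R}^2\setminus\overline\Omega$ and the transmitted field $u$ in $\Omega$ satisfy $\Delta u^s+k^2u^s=0$ in $\mathbb{R}^2\setminus\overline\Omega$, $\Delta u+k^2n_0u=0$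 in $\Omega$, $u^s_+-u_-=-u^i$ and $\partial u^s_+/\partial\nu-\lambda\,\partial u_-/\partial\nu=-\partial u^i/\partial\nu$ on $\Gamma$ (subscripts $+$ and $-$ denote limits from the exterior and the interior), and $u^s$ satisfies the Sommerfeld radiation condition. The refractive index $n_0$ is a constant with $\mathrm{Re}(n_0)>0$, $\mathrm{Im}(n_0)\ge0$, and $\lambda$ is a positive constant. These direct problems are taken to be well-posed (unique solution $u^s$, in $H^1_{loc}(\mathbb{R}^2\setminus\overline\Omega)$, and $u\in H^1(\Omega)$ in the penetrable case). The far-field pattern $u^\infty$ of $u^s$ is defined by $u^s(x)=\frac{e^{ik|x|}}{\sqrt{|x|}}\left(u^\infty(\hat x)+O(1/|x|)\right)$ as $|x|\to\infty$, uniformly in $\hat x=x/|x|\in\mathbb{S}^1$. Interior transmission problem (ITP): find $(u,v)$ with $\Delta u+k^2n_0u=0$ and $\Delta v+k^2v=0$ in $\Omega$, and $u-v=0$, $\lambda\,\partial u/\partial\nu-\partial v/\partial\nu=0$ on $\Gamma$. A number $k>0$ is a transmission eigenvalue if (ITP) has a nontrivial solution. *)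

theory Defs
  imports "HOL-Analysis.Analysis" "HOL-Library.Landau_Symbols"
begin

type_synonym plane = "real ^ 2"
type_synonym field = "plane \<Rightarrow> complex"

definition partial :: "2 \<Rightarrow> (plane \<Rightarrow> 'b::real_normed_vector) \<Rightarrow> plane \<Rightarrow> 'b" where
  "partial i f x = frechet_derivative f (at x) (axis i 1)"

definition C1_on :: "plane set \<Rightarrow> (plane \<Rightarrow> 'b::real_normed_vector) \<Rightarrow> bool" where
  "C1_on S f \<longleftrightarrow> (\<forall>x\<in>S. f differentiable (at x)) \<and> (\<forall>i. continuous_on S (partial i f))"

definition C2_on :: "plane set \<Rightarrow> (plane \<Rightarrow> 'b::real_normed_vector) \<Rightarrow> bool" where
  "C2_on S f \<longleftrightarrow> C1_on S f \<and> (\<forall>i. C1_on S (partial i f))"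

definition laplacian :: "(plane \<Rightarrow> 'b::real_normed_vector) \<Rightarrow> plane \<Rightarrow> 'b" where
  "laplacian f x = (\<Sum>i\<in>UNIV. partial i (partial i f) x)"

text \<open>The equation \<open>\<Delta>u + q u = 0\<close>. Weak solutions are smooth inside \<open>D\<close> after a change on a null
  set, so the equation is imposed pointwise on this representative.\<close>

definition helmholtz :: "complex \<Rightarrow> plane set \<Rightarrow> field \<Rightarrow> bool" where
  "helmholtz q D u \<longleftrightarrow> C2_on D u \<and> (\<forall>x\<in>D. laplacian u x + q * u x = 0)"

text \<open>\<open>C\<^sup>2\<close> boundary: near each boundary point \<open>\<Omega>\<close> is the sublevel set of a \<open>C\<^sup>2\<close> function
  with nonvanishing gradient there; in particular \<open>\<Omega>\<close> lies on one side of its boundary.\<close>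

definition C2_boundary :: "plane set \<Rightarrow> bool" where
  "C2_boundary \<Omega> \<longleftrightarrow> (\<forall>p\<in>frontier \<Omega>. \<exists>U (\<psi> :: plane \<Rightarrow> real).
      open U \<and> p \<in> U \<and> C2_on U \<psi> \<and> (\<exists>i. partial i \<psi> p \<noteq> 0) \<and>
      \<Omega> \<inter> U = {x\<in>U. \<psi> x < 0} \<and> frontier \<Omega> \<inter> U = {x\<in>U. \<psi> x = 0})"

definition obstacle :: "plane set \<Rightarrow> bool" where
  "obstacle \<Omega> \<longleftrightarrow> open \<Omega> \<and> connected \<Omega> \<and> bounded \<Omega> \<and> \<Omega> \<noteq> {} \<and>
     connected (frontier \<Omega>) \<and> C2_boundary \<Omega>"

definition exterior :: "plane set \<Rightarrow> plane set" where
  "exterior \<Omega> = - closure \<Omega>"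

text \<open>Arc length on \<open>\<Gamma>\<close> is the one-dimensional Hausdorff measure. The outer measure below is a metric
  outer measure, hence countably additive on the Borel sets. Bounded covering sets are required
  because \<^const>\<open>diameter\<close> is unspecified on unbounded sets.\<close>

definition hausdorff1_pre :: "real \<Rightarrow> plane set \<Rightarrow> ennreal" where
  "hausdorff1_pre \<delta> A =
     (INF C \<in> {C :: nat \<Rightarrow> plane set. A \<subseteq> (\<Union>n. C n) \<and> (\<forall>n. bounded (C n) \<and> diameter (C n) \<le> \<delta>)}.
        (\<Sum>n. ennreal (diameter (C n))))"

definition hausdorff1 :: "plane set \<Rightarrow> ennreal" where
  "hausdorff1 A = (SUP \<delta>\<in>{0<..}. hausdorff1_pre \<delta> A)"

definition arc_length :: "plane set \<Rightarrow> plane measure" where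
  "arc_length \<Omega> = restrict_space (measure_of UNIV (sets borel) hausdorff1) (frontier \<Omega>)"

text \<open>The squared \<open>H\<^sup>1\<close> norm of a function that is \<open>C\<^sup>1\<close> in the open set \<open>A\<close>, whose weak gradient is
  therefore the classical one.\<close>

definition H1_norm2 :: "plane set \<Rightarrow> field \<Rightarrow> ennreal" where
  "H1_norm2 A u =
     (\<integral>\<^sup>+ x\<in>A. ennreal ((cmod (u x))\<^sup>2 + (\<Sum>i\<in>UNIV. (cmod (partial i u x))\<^sup>2)) \<partial>lborel)"

text \<open>Integrability up to the boundary of \<open>D\<close>: for an exterior domain this is membership in
  \<open>H\<^sup>1\<^sub>l\<^sub>o\<^sub>c\<close> of the closed exterior, for a bounded \<open>D\<close> membership in \<open>H\<^sup>1(D)\<close>.\<close>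

definition in_H1loc :: "plane set \<Rightarrow> field \<Rightarrow> bool" where
  "in_H1loc D u \<longleftrightarrow> C1_on D u \<and> (\<forall>R>0. H1_norm2 (D \<inter> ball 0 R) u < \<infinity>)"

text \<open>The function \<open>g \<in> L\<^sup>2(\<Gamma>)\<close> is the trace on \<open>\<Gamma> = \<partial>\<Omega>\<close> of \<open>u\<close>, given on the side \<open>D\<close>
  of \<open>\<Gamma>\<close> (\<open>D\<close> is \<open>\<Omega>\<close> or its exterior): the trace operator is the continuous extension of the
  restriction \<open>\<phi> \<mapsto> \<phi>|\<Gamma>\<close> of functions that are \<open>C\<^sup>1\<close> up to the boundary.\<close>

definition has_trace :: "plane set \<Rightarrow> plane set \<Rightarrow> field \<Rightarrow> field \<Rightarrow> bool" where
  "has_trace \<Omega> D u g \<longleftrightarrow>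
     g \<in> borel_measurable (arc_length \<Omega>) \<and>
     (\<integral>\<^sup>+ x. ennreal ((cmod (g x))\<^sup>2) \<partial>arc_length \<Omega>) < \<infinity> \<and>
     (\<exists>\<phi> :: nat \<Rightarrow> field.
        (\<forall>n. C1_on UNIV (\<phi> n)) \<and>
        (\<forall>R>0. (\<lambda>n. H1_norm2 (D \<inter> ball 0 R) (\<lambda>x. \<phi> n x - u x)) \<longlonglongrightarrow> 0) \<and>
        (\<lambda>n. \<integral>\<^sup>+ x. ennreal ((cmod (\<phi> n x - g x))\<^sup>2) \<partial>arc_length \<Omega>) \<longlonglongrightarrow> 0)"

definition test_function :: "field \<Rightarrow> bool" where
  "test_function \<phi> \<longleftrightarrow> C1_on UNIV \<phi> \<and> bounded {x. \<phi> x \<noteq> 0}"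

definition pairing :: "plane set \<Rightarrow> field \<Rightarrow> field \<Rightarrow> complex" where
  "pairing \<Omega> g \<phi> = (LINT x|arc_length \<Omega>. g x * \<phi> x)"

text \<open>The normal derivative of an \<open>H\<^sup>1\<close> function with square integrable Laplacian is the functional
  \<open>\<phi> \<mapsto> \<integral>\<^sub>\<Gamma> \<partial>u/\<partial>\<nu> \<phi> ds\<close> given by Green's first identity. The normal \<open>\<nu>\<close> points out of \<open>\<Omega>\<close>,
  whence the sign in the exterior domain. For functions that are \<open>C\<^sup>2\<close> near \<open>\<Gamma>\<close>, such as incident
  fields, both functionals are given by the classical \<open>\<nu> \<bullet> \<nabla>u\<close>.\<close>

definition green_form :: "plane set \<Rightarrow> field \<Rightarrow> field \<Rightarrow> complex" where
  "green_form D u \<phi> =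
     (LINT x:D|lborel. (\<Sum>i\<in>UNIV. partial i u x * partial i \<phi> x) + laplacian u x * \<phi> x)"

definition dnu_int :: "plane set \<Rightarrow> field \<Rightarrow> field \<Rightarrow> complex" where
  "dnu_int \<Omega> u \<phi> = green_form \<Omega> u \<phi>"

definition dnu_ext :: "plane set \<Rightarrow> field \<Rightarrow> field \<Rightarrow> complex" where
  "dnu_ext \<Omega> u \<phi> = - green_form (exterior \<Omega>) u \<phi>"

definition incident_field :: "real \<Rightarrow> field \<Rightarrow> bool" where
  "incident_field k ui \<longleftrightarrow> helmholtz (of_real (k\<^sup>2)) UNIV ui"

definition plane_wave :: "real \<Rightarrow> plane \<Rightarrow> field" where
  "plane_wave k d x = exp (\<i> * of_real (k * (d \<bullet> x)))"

definition two_waves :: "real \<Rightarrow> plane \<Rightarrow> plane \<Rightarrow> field" where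
  "two_waves k d1 d2 x = plane_wave k d1 x + plane_wave k d2 x"

text \<open>The limit along \<^const>\<open>at_infinity\<close> expresses uniformity in the direction \<open>x/|x|\<close>.\<close>

definition sommerfeld :: "real \<Rightarrow> field \<Rightarrow> bool" where
  "sommerfeld k u \<longleftrightarrow>
     ((\<lambda>x. of_real (sqrt (norm x)) *
           (frechet_derivative u (at x) (x /\<^sub>R norm x) - \<i> * of_real k * u x)) \<longlongrightarrow> 0) at_infinity"

definition radiating_field :: "real \<Rightarrow> plane set \<Rightarrow> field \<Rightarrow> bool" where
  "radiating_field k \<Omega> us \<longleftrightarrow>
     in_H1loc (exterior \<Omega>) us \<and> helmholtz (of_real (k\<^sup>2)) (exterior \<Omega>) us \<and> sommerfeld k us"

datatype boundary_condition = Dirichlet | Neumann | Impedance complex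

fun boundary_cond :: "boundary_condition \<Rightarrow> plane set \<Rightarrow> field \<Rightarrow> field \<Rightarrow> bool" where
  "boundary_cond Dirichlet \<Omega> ui us \<longleftrightarrow> has_trace \<Omega> (exterior \<Omega>) us (\<lambda>x. - ui x)"
| "boundary_cond Neumann \<Omega> ui us \<longleftrightarrow>
     (\<forall>\<phi>. test_function \<phi> \<longrightarrow> dnu_ext \<Omega> us \<phi> = - dnu_ext \<Omega> ui \<phi>)"
| "boundary_cond (Impedance \<mu>) \<Omega> ui us \<longleftrightarrow>
     (\<exists>g. has_trace \<Omega> (exterior \<Omega>) us g \<and>
        (\<forall>\<phi>. test_function \<phi> \<longrightarrow>
           dnu_ext \<Omega> us \<phi> + \<mu> * pairing \<Omega> g \<phi> = - (dnu_ext \<Omega> ui \<phi> + \<mu> * pairing \<Omega> ui \<phi>)))"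

definition impenetrable_solution ::
  "boundary_condition \<Rightarrow> real \<Rightarrow> plane set \<Rightarrow> field \<Rightarrow> field \<Rightarrow> bool" where
  "impenetrable_solution bc k \<Omega> ui us \<longleftrightarrow> radiating_field k \<Omega> us \<and> boundary_cond bc \<Omega> ui us"

definition transmission_solution ::
  "complex \<Rightarrow> real \<Rightarrow> real \<Rightarrow> plane set \<Rightarrow> field \<Rightarrow> field \<Rightarrow> field \<Rightarrow> bool" where
  "transmission_solution n0 lam k \<Omega> ui us u \<longleftrightarrow>
     radiating_field k \<Omega> us \<and>
     in_H1loc \<Omega> u \<and> helmholtz (of_real (k\<^sup>2) * n0) \<Omega> u \<and>
     (\<exists>g h. has_trace \<Omega> (exterior \<Omega>) us g \<and> has_trace \<Omega> \<Omega> u h \<and>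
        (AE x in arc_length \<Omega>. g x - h x = - ui x)) \<and>
     (\<forall>\<phi>. test_function \<phi> \<longrightarrow>
        dnu_ext \<Omega> us \<phi> - of_real lam * dnu_int \<Omega> u \<phi> = - dnu_ext \<Omega> ui \<phi>)"

text \<open>\<open>Transmission n0 lam\<close>: refractive index \<open>n0\<close> and transmission constant \<open>lam\<close>.\<close>

datatype scattering_problem =
  Impenetrable boundary_condition | Transmission complex real

fun admissible :: "scattering_problem \<Rightarrow> bool" where
  "admissible (Impenetrable bc) \<longleftrightarrow> True"
| "admissible (Transmission n0 lam) \<longleftrightarrow> Re n0 > 0 \<and> Im n0 \<ge> 0 \<and> lam > 0"

fun scattered_field :: "scattering_problem \<Rightarrow> real \<Rightarrow> plane set \<Rightarrow> field \<Rightarrow> field \<Rightarrow> bool" where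
  "scattered_field (Impenetrable bc) k \<Omega> ui us \<longleftrightarrow> impenetrable_solution bc k \<Omega> ui us"
| "scattered_field (Transmission n0 lam) k \<Omega> ui us \<longleftrightarrow>
     (\<exists>u. transmission_solution n0 lam k \<Omega> ui us u)"

fun well_posed :: "scattering_problem \<Rightarrow> real \<Rightarrow> plane set \<Rightarrow> bool" where
  "well_posed (Impenetrable bc) k \<Omega> \<longleftrightarrow>
     (\<forall>ui. incident_field k ui \<longrightarrow>
        (\<exists>us. impenetrable_solution bc k \<Omega> ui us \<and>
           (\<forall>us'. impenetrable_solution bc k \<Omega> ui us' \<longrightarrow> (\<forall>x\<in>exterior \<Omega>. us' x = us x))))"
| "well_posed (Transmission n0 lam) k \<Omega> \<longleftrightarrow>
     (\<forall>ui. incident_field k ui \<longrightarrow>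
        (\<exists>us u. transmission_solution n0 lam k \<Omega> ui us u \<and>
           (\<forall>us' u'. transmission_solution n0 lam k \<Omega> ui us' u' \<longrightarrow>
              (\<forall>x\<in>exterior \<Omega>. us' x = us x) \<and> (\<forall>x\<in>\<Omega>. u' x = u x))))"

definition has_far_field :: "real \<Rightarrow> field \<Rightarrow> field \<Rightarrow> bool" where
  "has_far_field k us uinf \<longleftrightarrow>
     (\<lambda>x. us x * of_real (sqrt (norm x)) / exp (\<i> * of_real (k * norm x)) - uinf (x /\<^sub>R norm x))
       \<in> O[at_infinity](\<lambda>x. of_real (1 / norm x))"

text \<open>\<open>uinf\<close> is the far-field pattern generated by the incident field \<open>ui\<close>; only its values on the
  unit circle are meaningful.\<close>

definition far_field_pattern ::
  "scattering_problem \<Rightarrow> real \<Rightarrow> plane set \<Rightarrow> field \<Rightarrow> field \<Rightarrow> bool" where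
  "far_field_pattern P k \<Omega> ui uinf \<longleftrightarrow> (\<exists>us. scattered_field P k \<Omega> ui us \<and> has_far_field k us uinf)"

definition itp_solution ::
  "complex \<Rightarrow> real \<Rightarrow> real \<Rightarrow> plane set \<Rightarrow> field \<Rightarrow> field \<Rightarrow> bool" where
  "itp_solution n0 lam k \<Omega> u v \<longleftrightarrow>
     in_H1loc \<Omega> u \<and> in_H1loc \<Omega> v \<and>
     helmholtz (of_real (k\<^sup>2) * n0) \<Omega> u \<and> helmholtz (of_real (k\<^sup>2)) \<Omega> v \<and>
     (\<exists>g h. has_trace \<Omega> \<Omega> u g \<and> has_trace \<Omega> \<Omega> v h \<and> (AE x in arc_length \<Omega>. g x - h x = 0)) \<and>
     (\<forall>\<phi>. test_function \<phi> \<longrightarrow> of_real lam * dnu_int \<Omega> u \<phi> - dnu_int \<Omega> v \<phi> = 0)"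

definition transmission_eigenvalue :: "complex \<Rightarrow> real \<Rightarrow> plane set \<Rightarrow> real \<Rightarrow> bool" where
  "transmission_eigenvalue n0 lam \<Omega> k \<longleftrightarrow>
     k > 0 \<and> (\<exists>u v. itp_solution n0 lam k \<Omega> u v \<and> (\<exists>x\<in>\<Omega>. u x \<noteq> 0 \<or> v x \<noteq> 0))"

text \<open>\<open>line_nt k d1 d2 e n t\<close> is the line \<open>L\<^sub>n\<^sub>,\<^sub>t\<close> for the directions \<open>d1, d2\<close>, where \<open>e\<close> is the
  chosen unit vector with \<open>e \<bullet> d1 = e \<bullet> d2\<close>.\<close>

definition line_nt :: "real \<Rightarrow> plane \<Rightarrow> plane \<Rightarrow> plane \<Rightarrow> int \<Rightarrow> real \<Rightarrow> plane set" where
  "line_nt k d1 d2 e n t =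
     {a *\<^sub>R e + ((2 * pi * of_int n + t) / (k * (norm (d1 - d2))\<^sup>2)) *\<^sub>R (d1 - d2) | a :: real. True}"

definition line_family :: "real \<Rightarrow> plane \<Rightarrow> plane \<Rightarrow> plane \<Rightarrow> real \<Rightarrow> plane set set" where
  "line_family k d1 d2 e \<tau> = (\<Union>n. {line_nt k d1 d2 e n 0, line_nt k d1 d2 e n \<tau>})"

definition intersection_points :: "plane set set \<Rightarrow> plane set set \<Rightarrow> plane set" where
  "intersection_points F G = {x. \<exists>A\<in>F. \<exists>B\<in>G. x \<in> A \<inter> B}"

end

theory Submission imports Defs "HOL-Complex_Analysis.Conformal_Mappings"
begin

text \<open>
  Translating the obstacle by \<open>h\<close> amounts to translating the incident field by \<open>-h\<close>, that is, to multiplying each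
  plane wave of direction \<open>d\<close> by the unimodular constant \<open>plane_wave k d h\<close>, and it multiplies the far-field pattern by a
  unimodular function. If \<open>A\<close> and \<open>B\<close> are the patterns of the two single plane waves, the hypothesis at \<open>h\<close> therefore
  reads \<open>|A + B| = |c1 A + c2 B|\<close> on the circle, with unimodular \<open>c1\<close> and \<open>c2\<close> whose quotient has the phase
  \<open>k h \<bullet> (d1 - d2)\<close>. In a direction where \<open>A B \<noteq> 0\<close> this leaves, modulo \<open>2\<pi>\<close>, the phase zero and at most one more phase
  \<open>\<tau>\<close>: so \<open>h\<close> lies on one of two families of parallel lines. Two incident pairs give two such families in
  independent directions.

  The analytic part is that \<open>A B\<close> does not vanish identically. The Fourier coefficients of a radiating solution on circles
  solve Bessel's equation; the Liouville substitution and a convexity argument show that the coefficients of its pattern decay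
  exponentially. So a pattern extends to an analytic function near the circle, and a product of two patterns vanishes only if
  one factor does. A vanishing pattern forces all Fourier coefficients to decay too fast to be nonzero solutions of Bessel's
  equation (Rellich's lemma), and unique continuation in the connected exterior makes the scattered field zero.

  A zero scattered field means that the plane wave itself satisfies the homogeneous boundary condition. For the
  Dirichlet condition this contradicts \<open>|plane_wave| = 1\<close>. For the Neumann and impedance conditions, Green's identity is
  tested against the conjugate wave times the coordinate directions. For the transmission problem, plane wave and transmitted
  field are a pair of transmission eigenfunctions. Since the boundary condition is imposed in the sense of traces with respect
  to the Hausdorff measure, the boundary is described locally by graphs, which gives the finiteness and positivity of its
  length and shows that the trace of the zero field is zero.
\<close>

section \<open>Partial derivatives and the Helmholtz equation\<close>

lemma has_derivative_partial:
  fixes f :: "plane \<Rightarrow> 'b::real_normed_vector"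
  assumes "f differentiable (at x)"
  shows "(f has_derivative (\<lambda>h. (h$1) *\<^sub>R partial 1 f x + (h$2) *\<^sub>R partial 2 f x)) (at x)"
proof -
  let ?D = "frechet_derivative f (at x)"
  have D: "(f has_derivative ?D) (at x)"
    using assms frechet_derivative_works by blast
  then interpret D: bounded_linear ?D by (rule has_derivative_bounded_linear)
  have "?D h = (h$1) *\<^sub>R partial 1 f x + (h$2) *\<^sub>R partial 2 f x" for h
  proof -
    have "h = (h$1) *\<^sub>R axis 1 1 + (h$2) *\<^sub>R axis 2 1"
      by (simp add: vec_eq_iff forall_2 axis_def)
    then have "?D h = ?D ((h$1) *\<^sub>R axis 1 1 + (h$2) *\<^sub>R axis 2 1)" by simp
    then show ?thesis by (simp add: D.add D.scaleR partial_def)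
  qed
  then have "?D = (\<lambda>h. (h$1) *\<^sub>R partial 1 f x + (h$2) *\<^sub>R partial 2 f x)" by auto
  with D show ?thesis by simp
qed

lemma partial_eqI:
  assumes "(f has_derivative D) (at x)"
  shows "partial i f x = D (axis i 1)"
  using frechet_derivative_at[OF assms] by (simp add: partial_def)

lemma frechet_derivative_partial:
  fixes f :: "plane \<Rightarrow> 'b::real_normed_vector"
  assumes "f differentiable (at x)"
  shows "frechet_derivative f (at x) h = (h$1) *\<^sub>R partial 1 f x + (h$2) *\<^sub>R partial 2 f x"
  using frechet_derivative_at[OF has_derivative_partial[OF assms]] by metis

lemma partial_along_curve:
  fixes f :: "plane \<Rightarrow> 'b::real_normed_vector"
  assumes "f differentiable (at (c t))" "(c has_vector_derivative c') (at t within S)"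
  shows "((\<lambda>t. f (c t)) has_vector_derivative ((c'$1) *\<^sub>R partial 1 f (c t) + (c'$2) *\<^sub>R partial 2 f (c t)))
     (at t within S)"
proof -
  have "((\<lambda>t. f (c t)) has_derivative
      (\<lambda>s. ((s *\<^sub>R c')$1) *\<^sub>R partial 1 f (c t) + ((s *\<^sub>R c')$2) *\<^sub>R partial 2 f (c t))) (at t within S)"
    using has_derivative_compose[OF assms(2)[unfolded has_vector_derivative_def]
        has_derivative_partial[OF assms(1)]] .
  then show ?thesis
    by (simp add: has_vector_derivative_def scaleR_add_right)
qed

lemma differentiable_cong_open:
  assumes "open S" "x \<in> S" "\<And>y. y \<in> S \<Longrightarrow> f y = g y"
  shows "f differentiable (at x) \<longleftrightarrow> g differentiable (at x)"
proof -
  have "(f has_derivative D) (at x) \<longleftrightarrow> (g has_derivative D) (at x)" for D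
    using has_derivative_transform_within_open[of f D x UNIV S g]
      has_derivative_transform_within_open[of g D x UNIV S f] assms by auto
  then show ?thesis by (simp add: differentiable_def)
qed

lemma partial_cong_open:
  assumes "open S" "x \<in> S" "\<And>y. y \<in> S \<Longrightarrow> f y = g y"
  shows "partial i f x = partial i g x"
proof -
  have "(f has_derivative D) (at x) \<longleftrightarrow> (g has_derivative D) (at x)" for D
    using has_derivative_transform_within_open[of f D x UNIV S g]
      has_derivative_transform_within_open[of g D x UNIV S f] assms by auto
  then show ?thesis by (simp add: partial_def frechet_derivative_def)
qed

lemma C1_on_cong:
  assumes "open S" "\<And>y. y \<in> S \<Longrightarrow> f y = g y"
  shows "C1_on S f \<longleftrightarrow> C1_on S g"
  unfolding C1_on_def
  using differentiable_cong_open[OF assms(1) _ assms(2)] partial_cong_open[OF assms(1) _ assms(2)]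
  by (auto cong: continuous_on_cong)

lemma C1_on_subset: "C1_on S f \<Longrightarrow> T \<subseteq> S \<Longrightarrow> C1_on T f"
  unfolding C1_on_def by (meson continuous_on_subset subsetD)

lemma C2_on_subset: "C2_on S f \<Longrightarrow> T \<subseteq> S \<Longrightarrow> C2_on T f"
  unfolding C2_on_def by (meson C1_on_subset)

lemma C1_on_imp_continuous_on: "C1_on S f \<Longrightarrow> continuous_on S f"
  unfolding C1_on_def
  by (simp add: continuous_at_imp_continuous_on differentiable_imp_continuous_within)

lemma C1_on_partialI:
  assumes "\<And>x. x \<in> S \<Longrightarrow> (f has_derivative D x) (at x)"
    and "\<And>i. continuous_on S (\<lambda>x. D x (axis i 1))"
  shows "C1_on S f"
proof -
  have "continuous_on S (partial i f)" for i
    using assms(2)[of i] continuous_on_cong[of S S "partial i f" "\<lambda>x. D x (axis i 1)"]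
      partial_eqI[OF assms(1)] by auto
  then show ?thesis using assms(1) by (auto simp: C1_on_def differentiable_def)
qed

lemma has_derivative_frechet:
  "f differentiable (at x) \<Longrightarrow> (f has_derivative frechet_derivative f (at x)) (at x)"
  using frechet_derivative_works by blast

lemma partial_linear:
  fixes f g :: field
  assumes "f differentiable (at x)" "g differentiable (at x)"
  shows "partial i (\<lambda>x. a * f x + b * g x) x = a * partial i f x + b * partial i g x"
    and "(\<lambda>x. a * f x + b * g x) differentiable (at x)"
proof -
  have "((\<lambda>x. a * f x + b * g x) has_derivative
     (\<lambda>h. a * frechet_derivative f (at x) h + b * frechet_derivative g (at x) h)) (at x)"
    by (intro derivative_intros has_derivative_frechet assms)
  then show "partial i (\<lambda>x. a * f x + b * g x) x = a * partial i f x + b * partial i g x"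
    "(\<lambda>x. a * f x + b * g x) differentiable (at x)"
    by (auto simp: partial_eqI differentiable_def) (simp add: partial_def)
qed

lemma C1_on_linear:
  fixes f g :: field
  assumes "C1_on S f" "C1_on S g"
  shows "C1_on S (\<lambda>x. a * f x + b * g x)"
proof -
  have *: "partial i (\<lambda>x. a * f x + b * g x) x = a * partial i f x + b * partial i g x" if "x \<in> S" for x i
    using partial_linear(1) assms that by (auto simp: C1_on_def)
  have "continuous_on S (\<lambda>x. a * partial i f x + b * partial i g x)" for i
    using assms by (auto simp: C1_on_def intro!: continuous_intros)
  then have "continuous_on S (partial i (\<lambda>x. a * f x + b * g x))" for i
    using * by (auto cong: continuous_on_cong)
  then show ?thesis
    using assms partial_linear(2) by (auto simp: C1_on_def)
qed

lemma partial_mult: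
  fixes f g :: field
  assumes "f differentiable (at x)" "g differentiable (at x)"
  shows "partial i (\<lambda>x. f x * g x) x = f x * partial i g x + partial i f x * g x"
    and "(\<lambda>x. f x * g x) differentiable (at x)"
proof -
  have "((\<lambda>x. f x * g x) has_derivative
     (\<lambda>h. f x * frechet_derivative g (at x) h + frechet_derivative f (at x) h * g x)) (at x)"
    by (intro has_derivative_mult has_derivative_frechet assms)
  then show "partial i (\<lambda>x. f x * g x) x = f x * partial i g x + partial i f x * g x"
    "(\<lambda>x. f x * g x) differentiable (at x)"
    by (auto simp: partial_eqI differentiable_def) (simp add: partial_def)
qed

lemma C1_on_mult:
  fixes f g :: field
  assumes "C1_on S f" "C1_on S g"
  shows "C1_on S (\<lambda>x. f x * g x)"
proof -
  have "continuous_on S (\<lambda>x. f x * partial i g x + partial i f x * g x)" for i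
    using assms C1_on_imp_continuous_on by (auto simp: C1_on_def intro!: continuous_intros)
  then have "continuous_on S (partial i (\<lambda>x. f x * g x))" for i
    using assms partial_mult(1) by (auto simp: C1_on_def cong: continuous_on_cong)
  then show ?thesis
    using assms partial_mult(2) by (auto simp: C1_on_def)
qed

lemma C2_on_linear:
  fixes f g :: field
  assumes "open S" "C2_on S f" "C2_on S g"
  shows "C2_on S (\<lambda>x. a * f x + b * g x)"
proof -
  have "C1_on S (partial i (\<lambda>x. a * f x + b * g x)) \<longleftrightarrow> C1_on S (\<lambda>x. a * partial i f x + b * partial i g x)" for i
    using assms by (intro C1_on_cong partial_linear(1)) (auto simp: C2_on_def C1_on_def)
  then show ?thesis using assms C1_on_linear by (auto simp: C2_on_def)
qed

lemma laplacian_linear: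
  fixes f g :: field
  assumes "open S" "C2_on S f" "C2_on S g" "x \<in> S"
  shows "laplacian (\<lambda>x. a * f x + b * g x) x = a * laplacian f x + b * laplacian g x"
proof -
  have "partial i (partial i (\<lambda>x. a * f x + b * g x)) x
      = partial i (\<lambda>x. a * partial i f x + b * partial i g x) x" for i
    using assms by (intro partial_cong_open[of S] partial_linear(1)) (auto simp: C2_on_def C1_on_def)
  also have "\<dots> i = a * partial i (partial i f) x + b * partial i (partial i g) x" for i
    using assms by (intro partial_linear(1)) (auto simp: C2_on_def C1_on_def)
  finally show ?thesis by (simp add: laplacian_def sum_2 algebra_simps)
qed

lemma helmholtz_linear:
  assumes "open D" "helmholtz q D f" "helmholtz q D g"
  shows "helmholtz q D (\<lambda>x. a * f x + b * g x)"
  unfolding helmholtz_def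
proof (intro conjI ballI)
  show "C2_on D (\<lambda>x. a * f x + b * g x)"
    using assms C2_on_linear by (auto simp: helmholtz_def)
  fix x assume x: "x \<in> D"
  have "laplacian (\<lambda>x. a * f x + b * g x) x = a * laplacian f x + b * laplacian g x"
    using assms(2,3) laplacian_linear[OF assms(1) _ _ x, of f g a b] by (simp add: helmholtz_def)
  then have "laplacian (\<lambda>x. a * f x + b * g x) x + q * (a * f x + b * g x)
     = a * (laplacian f x + q * f x) + b * (laplacian g x + q * g x)"
    by (simp add: distrib_left mult.left_commute)
  then show "laplacian (\<lambda>x. a * f x + b * g x) x + q * (a * f x + b * g x) = 0"
    using assms x by (simp add: helmholtz_def)
qed

lemma has_derivative_shift_iff:
  fixes f :: "'a::real_normed_vector \<Rightarrow> 'b::real_normed_vector"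
  shows "((\<lambda>x. f (x + h)) has_derivative D) (at x) \<longleftrightarrow> (f has_derivative D) (at (x + h))"
proof
  assume "(f has_derivative D) (at (x + h))"
  moreover have "((\<lambda>x. x + h) has_derivative (\<lambda>x. x)) (at x)"
    by (auto intro!: derivative_eq_intros)
  ultimately show "((\<lambda>x. f (x + h)) has_derivative D) (at x)"
    by (rule has_derivative_compose[rotated])
next
  assume *: "((\<lambda>x. f (x + h)) has_derivative D) (at x)"
  have "((\<lambda>y. y - h) has_derivative (\<lambda>x. x)) (at (x + h))"
    by (auto intro!: derivative_eq_intros)
  from has_derivative_compose[OF this, of "\<lambda>x. f (x + h)" D] *
  show "(f has_derivative D) (at (x + h))" by simp
qed

lemma frechet_derivative_shift:
  fixes f :: "'a::real_normed_vector \<Rightarrow> 'b::real_normed_vector"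
  shows "frechet_derivative (\<lambda>x. f (x + h)) (at x) = frechet_derivative f (at (x + h))"
  unfolding frechet_derivative_def has_derivative_shift_iff ..

lemma partial_shift: "partial i (\<lambda>x. f (x + h)) = (\<lambda>x. partial i f (x + h))"
  by (rule ext) (simp add: partial_def frechet_derivative_shift)

lemma laplacian_shift: "laplacian (\<lambda>x. f (x + h)) = (\<lambda>x. laplacian f (x + h))"
  by (rule ext) (simp add: laplacian_def partial_shift)

lemma C1_on_shift:
  assumes "C1_on ((\<lambda>x. x + h) ` S) f"
  shows "C1_on S (\<lambda>x. f (x + h))"
proof -
  have "continuous_on S (\<lambda>x. partial i f (x + h))" for i
    using assms
    by (intro continuous_on_compose2[of "(\<lambda>x. x + h) ` S" "partial i f" S "\<lambda>x. x + h"])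
      (auto simp: C1_on_def intro!: continuous_intros)
  then show ?thesis
    using assms by (auto simp: C1_on_def partial_shift differentiable_def has_derivative_shift_iff)
qed

lemma helmholtz_shift:
  assumes "helmholtz q ((\<lambda>x. x + h) ` S) f"
  shows "helmholtz q S (\<lambda>x. f (x + h))"
  using assms by (auto simp: helmholtz_def C2_on_def laplacian_shift partial_shift intro!: C1_on_shift)

lemma has_derivative_plane_wave:
  "(plane_wave k d has_derivative (\<lambda>h. \<i> * of_real (k * (d \<bullet> h)) * plane_wave k d x)) (at x)"
proof -
  have "((\<lambda>x. \<i> * of_real (k * (d \<bullet> x))) has_derivative (\<lambda>h. \<i> * of_real (k * (d \<bullet> h)))) (at x)"
    by (auto intro!: derivative_eq_intros)
  from has_derivative_compose[OF this DERIV_exp[unfolded has_field_derivative_def]] show ?thesis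
    unfolding plane_wave_def by (simp add: mult.commute mult.left_commute)
qed

lemma partial_plane_wave: "partial i (plane_wave k d) = (\<lambda>x. \<i> * of_real (k * d$i) * plane_wave k d x)"
  by (rule ext) (simp add: partial_eqI[OF has_derivative_plane_wave] inner_axis)

lemma continuous_on_plane_wave [continuous_intros]: "continuous_on S (plane_wave k d)"
  unfolding plane_wave_def by (intro continuous_intros)

lemma C1_on_plane_wave: "C1_on S (plane_wave k d)"
  by (rule C1_on_partialI[OF has_derivative_plane_wave]) (auto intro!: continuous_intros)

lemma partial_cmult_plane_wave:
  "partial i (\<lambda>x. c * plane_wave k d x) = (\<lambda>x. c * (\<i> * of_real (k * d$i) * plane_wave k d x))"
proof
  fix x
  have "((\<lambda>x. c * plane_wave k d x) has_derivative (\<lambda>h. c * (\<i> * of_real (k * (d \<bullet> h)) * plane_wave k d x))) (at x)"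
    by (intro has_derivative_mult_right has_derivative_plane_wave)
  from partial_eqI[OF this] show "partial i (\<lambda>x. c * plane_wave k d x) x = c * (\<i> * of_real (k * d$i) * plane_wave k d x)"
    by (simp add: inner_axis)
qed

lemma incident_plane_wave:
  assumes "norm d = 1"
  shows "incident_field k (plane_wave k d)"
proof -
  have C2: "C2_on UNIV (plane_wave k d)"
    unfolding C2_on_def partial_plane_wave
    using C1_on_linear[OF C1_on_plane_wave C1_on_plane_wave, of UNIV _ k d 0] C1_on_plane_wave by auto
  have "(d$1)\<^sup>2 + (d$2)\<^sup>2 = 1"
    using assms by (simp add: norm_eq_sqrt_inner inner_vec_def sum_2 power2_eq_square)
  then have "complex_of_real ((k * d$1)\<^sup>2 + (k * d$2)\<^sup>2) = of_real (k\<^sup>2)"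
    by (simp add: power_mult_distrib flip: distrib_left)
  then have *: "(of_real (k * d$1))\<^sup>2 + (of_real (k * d$2))\<^sup>2 = (complex_of_real k)\<^sup>2"
    by (metis of_real_add of_real_power)
  have "laplacian (plane_wave k d) x = - (((of_real (k * d$1))\<^sup>2 + (of_real (k * d$2))\<^sup>2) * plane_wave k d x)" for x
    unfolding laplacian_def sum_2 partial_plane_wave partial_cmult_plane_wave
    by (simp add: power2_eq_square algebra_simps)
  then have "laplacian (plane_wave k d) x + of_real (k\<^sup>2) * plane_wave k d x = 0" for x
    using * by simp
  then show ?thesis using C2 by (simp add: incident_field_def helmholtz_def)
qed

lemma plane_wave_shift: "plane_wave k d (x + h) = plane_wave k d h * plane_wave k d x"
  by (simp add: plane_wave_def inner_add_right exp_add algebra_simps)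

lemma norm_plane_wave [simp]: "norm (plane_wave k d x) = 1"
  by (simp add: plane_wave_def flip: cis_conv_exp)

lemma incident_linear:
  "incident_field k f \<Longrightarrow> incident_field k g \<Longrightarrow> incident_field k (\<lambda>x. a * f x + b * g x)"
  unfolding incident_field_def by (rule helmholtz_linear) auto

section \<open>Fourier coefficients on circles and Bessel's equation\<close>

definition unit_dir :: "real \<Rightarrow> plane" where
  "unit_dir \<theta> = cos \<theta> *\<^sub>R axis 1 1 + sin \<theta> *\<^sub>R axis 2 1"

lemma unit_dir_nth [simp]: "unit_dir \<theta> $ 1 = cos \<theta>" "unit_dir \<theta> $ 2 = sin \<theta>"
  by (auto simp: unit_dir_def axis_def)

lemma plane_norm: "norm (x::plane) = sqrt ((x$1)\<^sup>2 + (x$2)\<^sup>2)"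
  by (simp add: norm_eq_sqrt_inner inner_vec_def sum_2 power2_eq_square)

lemma norm_unit_dir [simp]: "norm (unit_dir \<theta>) = 1"
  by (simp add: plane_norm)

lemma norm_scaleR_unit_dir [simp]: "norm (r *\<^sub>R unit_dir \<theta>) = \<bar>r\<bar>"
  by simp

lemma unit_dir_2pi [simp]: "unit_dir (2 * pi) = unit_dir 0"
  by (simp add: unit_dir_def)

lemma unit_dir_exists:
  obtains \<theta> where "\<theta> \<in> {0..2*pi}" "x = norm x *\<^sub>R unit_dir \<theta>"
proof (cases "x = 0")
  case True
  then show ?thesis using that[of 0] by simp
next
  case False
  then have "(x$1 / norm x)\<^sup>2 + (x$2 / norm x)\<^sup>2 = 1"
    by (simp add: plane_norm power_divide vec_eq_iff forall_2 sum_power2_eq_zero_iff flip: add_divide_distrib)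
  from sincos_total_2pi[OF this] obtain t where
    "0 \<le> t" "t < 2 * pi" "x$1 / norm x = cos t" "x$2 / norm x = sin t" by metis
  moreover from this False have "x$1 = norm x * cos t" "x$2 = norm x * sin t"
    by (simp_all flip: \<open>x$1 / norm x = cos t\<close> \<open>x$2 / norm x = sin t\<close>)
  then have "x = norm x *\<^sub>R unit_dir t" by (simp only: vec_eq_iff forall_2) simp
  ultimately show ?thesis using that[of t] by simp
qed

lemma continuous_on_unit_dir [continuous_intros]:
  fixes f :: "'a::t2_space \<Rightarrow> real"
  shows "continuous_on S f \<Longrightarrow> continuous_on S (\<lambda>x. unit_dir (f x))"
  unfolding unit_dir_def
  by (intro continuous_on_add continuous_on_scaleR continuous_on_cos continuous_on_sin continuous_on_const)

lemma has_vector_derivative_circle: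
  "((\<lambda>\<theta>. z + r *\<^sub>R unit_dir \<theta>) has_vector_derivative
     ((- r * sin \<theta>) *\<^sub>R axis 1 1 + (r * cos \<theta>) *\<^sub>R axis 2 1)) (at \<theta> within S)"
  unfolding unit_dir_def
  by (auto intro!: derivative_eq_intros simp: has_vector_derivative_def scaleR_add_right algebra_simps)

lemma has_vector_derivative_ray:
  "((\<lambda>r. z + r *\<^sub>R e) has_vector_derivative e) (at r within S)"
  by (auto intro!: derivative_eq_intros simp: has_vector_derivative_def)

definition fourier_int :: "int \<Rightarrow> (real \<Rightarrow> complex) \<Rightarrow> complex" where
  "fourier_int n f = integral {0..2*pi} (\<lambda>\<theta>. f \<theta> * cis (- (of_int n * \<theta>)))"

lemma fourier_int_has_integral:
  assumes "continuous_on {0..2*pi} f"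
  shows "((\<lambda>\<theta>. f \<theta> * cis (- (of_int n * \<theta>))) has_integral fourier_int n f) {0..2*pi}"
  unfolding fourier_int_def
  by (intro integrable_integral integrable_continuous_real continuous_intros assms)

lemma norm_fourier_int_le:
  assumes "continuous_on {0..2*pi} f" "\<And>\<theta>. \<theta> \<in> {0..2*pi} \<Longrightarrow> norm (f \<theta>) \<le> B"
  shows "norm (fourier_int n f) \<le> 2 * pi * B"
proof -
  have "norm (fourier_int n f) \<le> B * (2 * pi - 0)"
    unfolding fourier_int_def
    using assms by (intro integral_bound) (auto intro!: continuous_intros simp: norm_mult)
  then show ?thesis by (simp add: mult.commute)
qed

lemma fourier_int_has_derivative:
  assumes S: "convex S" "r0 \<in> S"
    and g: "\<And>r \<theta>. r \<in> S \<Longrightarrow> \<theta> \<in> {0..2*pi} \<Longrightarrow> ((\<lambda>r. g r \<theta>) has_vector_derivative g' r \<theta>) (at r within S)"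
    and cont: "\<And>r. r \<in> S \<Longrightarrow> continuous_on {0..2*pi} (g r)"
    and cont': "continuous_on (S \<times> {0..2*pi}) (\<lambda>(r, \<theta>). g' r \<theta>)"
  shows "((\<lambda>r. fourier_int n (g r)) has_vector_derivative fourier_int n (g' r0)) (at r0 within S)"
  unfolding fourier_int_def cbox_interval[symmetric]
proof (rule leibniz_rule_vector_derivative)
  show "((\<lambda>r. g r \<theta> * cis (- (of_int n * \<theta>))) has_vector_derivative g' r \<theta> * cis (- (of_int n * \<theta>))) (at r within S)"
    if "r \<in> S" "\<theta> \<in> cbox 0 (2*pi)" for r \<theta>
    using g[of r \<theta>] that by (auto intro!: derivative_eq_intros)
  show "(\<lambda>\<theta>. g r \<theta> * cis (- (of_int n * \<theta>))) integrable_on cbox 0 (2*pi)" if "r \<in> S" for r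
    using cont[OF that] by (auto intro!: integrable_continuous_real continuous_intros)
  have "continuous_on (S \<times> cbox 0 (2*pi)) (\<lambda>x. (\<lambda>(r, \<theta>). g' r \<theta>) x * cis (- (of_int n * snd x)))"
    using cont' by (intro continuous_intros) auto
  then show "continuous_on (S \<times> cbox 0 (2*pi)) (\<lambda>(r, \<theta>). g' r \<theta> * cis (- (of_int n * \<theta>)))"
    by (simp add: case_prod_unfold)
qed (use S in auto)

definition radial_deriv :: "field \<Rightarrow> plane \<Rightarrow> real \<Rightarrow> real \<Rightarrow> complex" where
  "radial_deriv u z r \<theta> = cos \<theta> *\<^sub>R partial 1 u (z + r *\<^sub>R unit_dir \<theta>) + sin \<theta> *\<^sub>R partial 2 u (z + r *\<^sub>R unit_dir \<theta>)"

definition circle_coeff :: "field \<Rightarrow> plane \<Rightarrow> int \<Rightarrow> real \<Rightarrow> complex" where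
  "circle_coeff u z n r = fourier_int n (\<lambda>\<theta>. u (z + r *\<^sub>R unit_dir \<theta>))"

definition circle_coeff1 :: "field \<Rightarrow> plane \<Rightarrow> int \<Rightarrow> real \<Rightarrow> complex" where
  "circle_coeff1 u z n r = fourier_int n (radial_deriv u z r)"

text \<open>The operator \<open>\<partial>\<^sub>\<theta>\<^sup>2\<close> acts on the \<open>n\<close>-th Fourier
  coefficient as \<open>-n\<^sup>2\<close>, so the Helmholtz equation in polar coordinates becomes an ordinary
  differential equation in the radius.\<close>

lemma bessel_equation:
  fixes S :: "real set" and n :: int
  assumes u: "helmholtz q D u" and S: "convex S"
    and D: "\<And>r \<theta>. r \<in> S \<Longrightarrow> z + r *\<^sub>R unit_dir \<theta> \<in> D"
  obtains a2 where
    "\<And>r. r \<in> S \<Longrightarrow> (circle_coeff u z n has_vector_derivative circle_coeff1 u z n r) (at r within S)"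
    "\<And>r. r \<in> S \<Longrightarrow> (circle_coeff1 u z n has_vector_derivative a2 r) (at r within S)"
    "\<And>r. r \<in> S \<Longrightarrow> of_real (r\<^sup>2) * a2 r + of_real r * circle_coeff1 u z n r
        + (q * of_real (r\<^sup>2) - (of_int n)\<^sup>2) * circle_coeff u z n r = 0"
proof -
  define X where "X r \<theta> = z + r *\<^sub>R unit_dir \<theta>" for r \<theta>
  define v where "v r \<theta> = u (X r \<theta>)" for r \<theta>
  define P where "P i r \<theta> = partial i u (X r \<theta>)" for i r \<theta>
  define Q where "Q i j r \<theta> = partial j (partial i u) (X r \<theta>)" for i j r \<theta>
  define vr where "vr r \<theta> = cos \<theta> *\<^sub>R P 1 r \<theta> + sin \<theta> *\<^sub>R P 2 r \<theta>" for r \<theta>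
  define vrr where "vrr r \<theta> = cos \<theta> *\<^sub>R (cos \<theta> *\<^sub>R Q 1 1 r \<theta> + sin \<theta> *\<^sub>R Q 1 2 r \<theta>)
     + sin \<theta> *\<^sub>R (cos \<theta> *\<^sub>R Q 2 1 r \<theta> + sin \<theta> *\<^sub>R Q 2 2 r \<theta>)" for r \<theta>
  define vt where "vt r \<theta> = (- r * sin \<theta>) *\<^sub>R P 1 r \<theta> + (r * cos \<theta>) *\<^sub>R P 2 r \<theta>" for r \<theta>
  define vtt where "vtt r \<theta> = (- r * cos \<theta>) *\<^sub>R P 1 r \<theta> + (- r * sin \<theta>) *\<^sub>R P 2 r \<theta>
     + (- r * sin \<theta>) *\<^sub>R ((- r * sin \<theta>) *\<^sub>R Q 1 1 r \<theta> + (r * cos \<theta>) *\<^sub>R Q 1 2 r \<theta>)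
     + (r * cos \<theta>) *\<^sub>R ((- r * sin \<theta>) *\<^sub>R Q 2 1 r \<theta> + (r * cos \<theta>) *\<^sub>R Q 2 2 r \<theta>)" for r \<theta>
  have C: "C1_on D u" "\<And>i. C1_on D (partial i u)" using u by (auto simp: helmholtz_def C2_on_def)
  have diff: "u differentiable (at (X r \<theta>))" "partial i u differentiable (at (X r \<theta>))" if "r \<in> S" for r \<theta> i
    using C D[OF that] by (auto simp: C1_on_def X_def)
  have cX: "continuous_on (S \<times> {0..2*pi}) (\<lambda>x. X (fst x) (snd x))"
    unfolding X_def by (intro continuous_intros)
  have XD: "(\<lambda>x. X (fst x) (snd x)) ` (S \<times> {0..2*pi}) \<subseteq> D" using D by (auto simp: X_def)
  have cP: "continuous_on (S \<times> {0..2*pi}) (\<lambda>x. P i (fst x) (snd x))" for i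
    unfolding P_def using C by (intro continuous_on_compose2[OF _ cX XD]) (auto simp: C1_on_def)
  have cQ: "continuous_on (S \<times> {0..2*pi}) (\<lambda>x. Q i j (fst x) (snd x))" for i j
    unfolding Q_def using C by (intro continuous_on_compose2[OF _ cX XD]) (auto simp: C1_on_def)
  have cv: "continuous_on (S \<times> {0..2*pi}) (\<lambda>x. v (fst x) (snd x))"
    unfolding v_def using C(1) C1_on_imp_continuous_on by (intro continuous_on_compose2[OF _ cX XD]) auto
  have slice: "continuous_on {0..2*pi} (f r)" if "r \<in> S" "continuous_on (S \<times> {0..2*pi}) (\<lambda>x. f (fst x) (snd x))"
    for f :: "real \<Rightarrow> real \<Rightarrow> complex" and r
  proof -
    have "continuous_on {0..2*pi} (Pair r)" by (rule continuous_on_Pair[OF continuous_on_const continuous_on_id])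
    from continuous_on_compose2[OF that(2) this] that(1) show ?thesis by auto
  qed
  note ci = continuous_on_add continuous_on_scaleR continuous_on_mult continuous_on_minus continuous_on_cos
    continuous_on_sin continuous_on_snd[OF continuous_on_id] continuous_on_fst[OF continuous_on_id]
  have cvr: "continuous_on (S \<times> {0..2*pi}) (\<lambda>x. vr (fst x) (snd x))"
    unfolding vr_def by (intro ci cP)
  have cvrr: "continuous_on (S \<times> {0..2*pi}) (\<lambda>x. vrr (fst x) (snd x))"
    unfolding vrr_def by (intro ci cQ)
  have cvt: "continuous_on (S \<times> {0..2*pi}) (\<lambda>x. vt (fst x) (snd x))"
    unfolding vt_def by (intro ci cP)
  have cvtt: "continuous_on (S \<times> {0..2*pi}) (\<lambda>x. vtt (fst x) (snd x))"
    unfolding vtt_def by (intro ci cP cQ)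
  have dv: "((\<lambda>r. v r \<theta>) has_vector_derivative vr r \<theta>) (at r within S)" if "r \<in> S" for r \<theta>
    using partial_along_curve[OF diff(1)[OF that, unfolded X_def] has_vector_derivative_ray]
    unfolding v_def vr_def P_def X_def by simp
  have dP: "((\<lambda>r. P i r \<theta>) has_vector_derivative (cos \<theta> *\<^sub>R Q i 1 r \<theta> + sin \<theta> *\<^sub>R Q i 2 r \<theta>)) (at r within S)"
    if "r \<in> S" for i r \<theta>
    using partial_along_curve[OF diff(2)[OF that, unfolded X_def] has_vector_derivative_ray]
    unfolding P_def Q_def X_def by simp
  have dvr: "((\<lambda>r. vr r \<theta>) has_vector_derivative vrr r \<theta>) (at r within S)" if "r \<in> S" for r \<theta>
    unfolding vr_def vrr_def
    by (intro has_vector_derivative_add bounded_linear.has_vector_derivative[OF bounded_linear_scaleR_right] dP that)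
  have tv: "((\<lambda>\<theta>. v r \<theta>) has_vector_derivative vt r \<theta>) (at \<theta> within T)" if "r \<in> S" for r \<theta> T
    using partial_along_curve[OF diff(1)[OF that, unfolded X_def] has_vector_derivative_circle]
    unfolding v_def vt_def P_def X_def by (simp add: axis_def)
  have tP: "((\<lambda>\<theta>. P i r \<theta>) has_vector_derivative ((- r * sin \<theta>) *\<^sub>R Q i 1 r \<theta> + (r * cos \<theta>) *\<^sub>R Q i 2 r \<theta>)) (at \<theta> within T)"
    if "r \<in> S" for i r \<theta> T
    using partial_along_curve[OF diff(2)[OF that, unfolded X_def] has_vector_derivative_circle]
    unfolding P_def Q_def X_def by (simp add: axis_def)
  have tvt: "((\<lambda>\<theta>. vt r \<theta>) has_vector_derivative vtt r \<theta>) (at \<theta> within T)" if "r \<in> S" for r \<theta> T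
    unfolding vt_def
    by (rule has_vector_derivative_eq_rhs[OF has_vector_derivative_add[OF
          has_vector_derivative_scaleR[OF _ tP[OF that, of 1]] has_vector_derivative_scaleR[OF _ tP[OF that, of 2]]]])
      (auto intro!: derivative_eq_intros simp: vtt_def algebra_simps)
  have parts: "((\<lambda>\<theta>. (vtt r \<theta> + (of_int n)\<^sup>2 * v r \<theta>) * cis (- (of_int n * \<theta>))) has_integral 0) {0..2*pi}"
    if r: "r \<in> S" for r
  proof -
    let ?F = "\<lambda>\<theta>. (vt r \<theta> + \<i> * of_int n * v r \<theta>) * cis (- (of_int n * \<theta>))"
    have dcis: "((\<lambda>\<theta>. cis (- (of_int n * \<theta>))) has_vector_derivative - (\<i> * of_int n * cis (- (of_int n * \<theta>)))) (at \<theta> within T)"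
      for \<theta> T
      unfolding has_vector_derivative_def
      by (auto intro!: derivative_eq_intros simp: scaleR_conv_of_real algebra_simps)
    have "((\<lambda>\<theta>. (vtt r \<theta> + (of_int n)\<^sup>2 * v r \<theta>) * cis (- (of_int n * \<theta>))) has_integral (?F (2*pi) - ?F 0)) {0..2*pi}"
    proof (rule fundamental_theorem_of_calculus)
      fix \<theta> :: real
      have "(?F has_vector_derivative
          ((vt r \<theta> + \<i> * of_int n * v r \<theta>) * (- (\<i> * of_int n * cis (- (of_int n * \<theta>))))
            + (vtt r \<theta> + \<i> * of_int n * vt r \<theta>) * cis (- (of_int n * \<theta>)))) (at \<theta> within {0..2*pi})"
        by (intro has_vector_derivative_mult has_vector_derivative_add has_vector_derivative_mult_right dcis tv tvt r)
      moreover have "((vt r \<theta> + \<i> * of_int n * v r \<theta>) * (- (\<i> * of_int n * cis (- (of_int n * \<theta>))))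
            + (vtt r \<theta> + \<i> * of_int n * vt r \<theta>) * cis (- (of_int n * \<theta>)))
          = (vtt r \<theta> + (of_int n)\<^sup>2 * v r \<theta>) * cis (- (of_int n * \<theta>))"
        by (simp add: power2_eq_square algebra_simps)
      ultimately show "(?F has_vector_derivative (vtt r \<theta> + (of_int n)\<^sup>2 * v r \<theta>) * cis (- (of_int n * \<theta>)))
          (at \<theta> within {0..2*pi})" by simp
    qed simp
    moreover have "?F (2*pi) = ?F 0"
    proof -
      have "cis (- (of_int n * (2 * pi))) = 1"
        using cis_multiple_2pi[of "of_int (- n)"] by (simp add: mult_ac)
      then show ?thesis by (simp add: vt_def v_def P_def X_def)
    qed
    ultimately show ?thesis by simp
  qed
  have c1: "circle_coeff1 u z n = (\<lambda>r. fourier_int n (vr r))"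
    unfolding circle_coeff1_def radial_deriv_def vr_def P_def X_def ..
  have c0: "circle_coeff u z n = (\<lambda>r. fourier_int n (v r))"
    unfolding circle_coeff_def v_def X_def ..
  show ?thesis
  proof (rule that)
    show "(circle_coeff u z n has_vector_derivative circle_coeff1 u z n r) (at r within S)" if "r \<in> S" for r
      unfolding c0 c1 using that S dv slice cv cvr
      by (intro fourier_int_has_derivative) (auto simp: case_prod_unfold)
    show "(circle_coeff1 u z n has_vector_derivative fourier_int n (vrr r)) (at r within S)" if "r \<in> S" for r
      unfolding c1 using that S dvr slice cvr cvrr
      by (intro fourier_int_has_derivative) (auto simp: case_prod_unfold)
    fix r assume r: "r \<in> S"
    let ?e = "\<lambda>\<theta>. cis (- (of_int n * \<theta>))"
    have "((\<lambda>\<theta>. of_real (r\<^sup>2) * (vrr r \<theta> * ?e \<theta>) + of_real r * (vr r \<theta> * ?e \<theta>)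
        + (q * of_real (r\<^sup>2) - (of_int n)\<^sup>2) * (v r \<theta> * ?e \<theta>)) has_integral
       (of_real (r\<^sup>2) * fourier_int n (vrr r) + of_real r * fourier_int n (vr r)
        + (q * of_real (r\<^sup>2) - (of_int n)\<^sup>2) * fourier_int n (v r))) {0..2*pi}"
      by (intro has_integral_add has_integral_mult_right fourier_int_has_integral slice r cv cvr cvrr)
    moreover have "of_real (r\<^sup>2) * (vrr r \<theta> * ?e \<theta>) + of_real r * (vr r \<theta> * ?e \<theta>)
        + (q * of_real (r\<^sup>2) - (of_int n)\<^sup>2) * (v r \<theta> * ?e \<theta>)
        = - ((vtt r \<theta> + (of_int n)\<^sup>2 * v r \<theta>) * ?e \<theta>)" for \<theta>
    proof -
      have "Q 1 1 r \<theta> + Q 2 2 r \<theta> + q * v r \<theta> = 0"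
        using u D[OF r] by (auto simp: helmholtz_def laplacian_def sum_2 Q_def v_def X_def)
      then have L: "q * v r \<theta> = - (Q 1 1 r \<theta> + Q 2 2 r \<theta>)" by (metis add.commute eq_neg_iff_add_eq_0)
      have cs: "(complex_of_real (cos \<theta>))\<^sup>2 + (of_real (sin \<theta>))\<^sup>2 = 1"
        by (metis of_real_1 of_real_add of_real_power sin_cos_squared_add2)
      have id: "R\<^sup>2 * (c * (c * q11 + s * q12) + s * (c * q21 + s * q22)) + R * (c * p1 + s * p2)
          + ((- R * c) * p1 + (- R * s) * p2 + (- R * s) * ((- R * s) * q11 + (R * c) * q12)
             + (R * c) * ((- R * s) * q21 + (R * c) * q22)) = R\<^sup>2 * (q11 + q22) * (c\<^sup>2 + s\<^sup>2)"
        for R c s p1 p2 q11 q12 q21 q22 :: complex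
        by algebra
      have "of_real (r\<^sup>2) * vrr r \<theta> + of_real r * vr r \<theta> + vtt r \<theta> = of_real (r\<^sup>2) * (Q 1 1 r \<theta> + Q 2 2 r \<theta>)"
        unfolding vrr_def vr_def vtt_def scaleR_conv_of_real of_real_mult of_real_minus of_real_power
        using id[of "of_real r" "of_real (cos \<theta>)" "Q 1 1 r \<theta>" "of_real (sin \<theta>)" "Q 1 2 r \<theta>" "Q 2 1 r \<theta>"
            "Q 2 2 r \<theta>" "P 1 r \<theta>" "P 2 r \<theta>"]
        by (simp only: cs mult_1_right)
      then have "of_real (r\<^sup>2) * vrr r \<theta> + of_real r * vr r \<theta> = - vtt r \<theta> - of_real (r\<^sup>2) * (q * v r \<theta>)"
        unfolding L by (simp add: algebra_simps)
      then have "(of_real (r\<^sup>2) * vrr r \<theta> + of_real r * vr r \<theta>) * ?e \<theta>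
         = (- vtt r \<theta> - of_real (r\<^sup>2) * (q * v r \<theta>)) * ?e \<theta>" by simp
      then show ?thesis by (simp add: algebra_simps)
    qed
    ultimately have "((\<lambda>\<theta>. - ((vtt r \<theta> + (of_int n)\<^sup>2 * v r \<theta>) * ?e \<theta>)) has_integral
       (of_real (r\<^sup>2) * fourier_int n (vrr r) + of_real r * fourier_int n (vr r)
        + (q * of_real (r\<^sup>2) - (of_int n)\<^sup>2) * fourier_int n (v r))) {0..2*pi}" by simp
    from has_integral_unique[OF this has_integral_neg[OF parts[OF r]]]
    show "of_real (r\<^sup>2) * fourier_int n (vrr r) + of_real r * circle_coeff1 u z n r
        + (q * of_real (r\<^sup>2) - (of_int n)\<^sup>2) * circle_coeff u z n r = 0"
      unfolding c0 c1 by simp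
  qed
qed

section \<open>Solutions of Bessel's equation\<close>

lemma inner_has_real_derivative:
  fixes f g :: "real \<Rightarrow> 'a::real_inner"
  assumes "(f has_vector_derivative f') (at r within S)" "(g has_vector_derivative g') (at r within S)"
  shows "((\<lambda>r. f r \<bullet> g r) has_real_derivative (f r \<bullet> g' + f' \<bullet> g r)) (at r within S)"
  using bounded_bilinear.has_vector_derivative[OF bounded_bilinear_inner assms]
  by (simp add: has_real_derivative_iff_has_vector_derivative)

text \<open>Liouville's substitution \<open>b = \<surd>r a\<close> removes the first order term of Bessel's equation.\<close>

lemma liouville_substitution:
  fixes a a1 a2 :: "real \<Rightarrow> complex" and n :: int
  assumes r: "r > 0"
    and a: "(a has_vector_derivative a1 r) (at r)" "(a1 has_vector_derivative a2 r) (at r)"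
    and eq: "of_real (r\<^sup>2) * a2 r + of_real r * a1 r + (of_real (k\<^sup>2) * of_real (r\<^sup>2) - (of_int n)\<^sup>2) * a r = 0"
  shows "((\<lambda>r. sqrt r *\<^sub>R a r) has_vector_derivative (sqrt r *\<^sub>R a1 r + (1 / (2 * sqrt r)) *\<^sub>R a r)) (at r)"
    and "((\<lambda>r. sqrt r *\<^sub>R a1 r + (1 / (2 * sqrt r)) *\<^sub>R a r) has_vector_derivative
       ((((of_int n)\<^sup>2 - 1/4) / r\<^sup>2 - k\<^sup>2) *\<^sub>R (sqrt r *\<^sub>R a r))) (at r)"
proof -
  have ds: "(sqrt has_real_derivative 1 / (2 * sqrt r)) (at r)"
    using DERIV_real_sqrt[OF r] by (simp add: field_simps)
  have di: "((\<lambda>r. 1 / (2 * sqrt r)) has_real_derivative - (1 / (4 * r * sqrt r))) (at r)"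
    using r by (auto intro!: derivative_eq_intros simp: field_simps power2_eq_square)
  show "((\<lambda>r. sqrt r *\<^sub>R a r) has_vector_derivative (sqrt r *\<^sub>R a1 r + (1 / (2 * sqrt r)) *\<^sub>R a r)) (at r)"
    by (rule has_vector_derivative_scaleR[OF ds a(1)])
  have 2: "((\<lambda>r. sqrt r *\<^sub>R a1 r + (1 / (2 * sqrt r)) *\<^sub>R a r) has_vector_derivative
      (sqrt r *\<^sub>R a2 r + (1 / (2 * sqrt r)) *\<^sub>R a1 r +
       ((1 / (2 * sqrt r)) *\<^sub>R a1 r + (- (1 / (4 * r * sqrt r))) *\<^sub>R a r))) (at r)"
    by (intro has_vector_derivative_add has_vector_derivative_scaleR ds di a)
  define s where "s = complex_of_real (sqrt r)"
  have s: "s \<noteq> 0" "complex_of_real r = s\<^sup>2" using r by (auto simp: s_def simp flip: of_real_power)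
  have "s^4 * a2 r + s\<^sup>2 * a1 r + (of_real (k\<^sup>2) * s^4 - (of_int n)\<^sup>2) * a r = 0"
    using eq by (simp add: s)
  then have A2: "a2 r = - (s\<^sup>2 * a1 r + (of_real (k\<^sup>2) * s^4 - (of_int n)\<^sup>2) * a r) / s^4"
    using s(1) by (simp add: field_simps eq_neg_iff_add_eq_0)
  have "sqrt r *\<^sub>R a2 r + (1 / (2 * sqrt r)) *\<^sub>R a1 r +
       ((1 / (2 * sqrt r)) *\<^sub>R a1 r + (- (1 / (4 * r * sqrt r))) *\<^sub>R a r)
     = s * a2 r + 1 / (2 * s) * a1 r + (1 / (2 * s) * a1 r - 1 / (4 * s\<^sup>2 * s) * a r)"
    by (simp add: scaleR_conv_of_real s(2) flip: s_def)
  also have "\<dots> = ((((of_int n)\<^sup>2 - 1/4) / s^4 - of_real (k\<^sup>2)) * (s * a r))"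
    unfolding A2 using s(1) by (simp add: field_simps power2_eq_square power4_eq_xxxx)
  also have "\<dots> = ((((of_int n)\<^sup>2 - 1/4) / r\<^sup>2 - k\<^sup>2) *\<^sub>R (sqrt r *\<^sub>R a r))"
    by (simp add: scaleR_conv_of_real s(2) flip: s_def)
  finally show "((\<lambda>r. sqrt r *\<^sub>R a1 r + (1 / (2 * sqrt r)) *\<^sub>R a r) has_vector_derivative
       ((((of_int n)\<^sup>2 - 1/4) / r\<^sup>2 - k\<^sup>2) *\<^sub>R (sqrt r *\<^sub>R a r))) (at r)"
    using 2 by simp
qed

lemma abs_inner_le_square_sum:
  fixes x y :: "'a::real_inner"
  shows "\<bar>2 * (x \<bullet> y)\<bar> \<le> x \<bullet> x + y \<bullet> y"
proof -
  have "0 \<le> (x + y) \<bullet> (x + y)" "0 \<le> (x - y) \<bullet> (x - y)" by simp_all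
  then show ?thesis by (simp add: inner_add inner_diff inner_commute)
qed

lemma linear_ode_zero_forward:
  fixes b b1 :: "real \<Rightarrow> complex" and p :: "real \<Rightarrow> real"
  assumes b: "\<And>r. r \<in> {r0..r1} \<Longrightarrow> (b has_vector_derivative b1 r) (at r)"
      "\<And>r. r \<in> {r0..r1} \<Longrightarrow> (b1 has_vector_derivative p r *\<^sub>R b r) (at r)"
    and p: "\<And>r. r \<in> {r0..r1} \<Longrightarrow> \<bar>p r\<bar> \<le> C"
    and init: "b r0 = 0" "b1 r0 = 0" and "r0 \<le> r1"
  shows "b r1 = 0"
proof -
  define E where "E r = b r \<bullet> b r + b1 r \<bullet> b1 r" for r
  define G where "G r = E r * exp (- (1 + C) * r)" for r
  have "G r1 \<le> G r0"
  proof (rule DERIV_nonpos_imp_nonincreasing[OF \<open>r0 \<le> r1\<close>])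
    fix r assume "r0 \<le> r" "r \<le> r1"
    then have r: "r \<in> {r0..r1}" by simp
    let ?E' = "(1 + p r) * (2 * (b r \<bullet> b1 r))"
    have "(E has_real_derivative ((b r \<bullet> b1 r + b1 r \<bullet> b r) + (b1 r \<bullet> (p r *\<^sub>R b r) + (p r *\<^sub>R b r) \<bullet> b1 r))) (at r)"
      unfolding E_def by (intro DERIV_add inner_has_real_derivative b r)
    then have dE: "(E has_real_derivative ?E') (at r)"
      by (rule DERIV_cong) (simp add: inner_commute algebra_simps)
    have "(G has_real_derivative (?E' - (1 + C) * E r) * exp (- (1 + C) * r)) (at r)"
      unfolding G_def by (rule derivative_eq_intros dE refl | simp)+ (simp add: algebra_simps)
    moreover have "?E' \<le> (1 + C) * E r"
    proof -
      have "?E' \<le> \<bar>1 + p r\<bar> * \<bar>2 * (b r \<bullet> b1 r)\<bar>" by (metis abs_ge_self abs_mult)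
      also have "\<dots> \<le> (1 + C) * E r"
        unfolding E_def using p[OF r] abs_inner_le_square_sum[of "b r" "b1 r"] by (intro mult_mono) auto
      finally show ?thesis .
    qed
    ultimately show "\<exists>y. (G has_real_derivative y) (at r) \<and> y \<le> 0"
      by (intro exI[of _ "(?E' - (1 + C) * E r) * exp (- (1 + C) * r)"] conjI) (auto simp: mult_le_0_iff)
  qed
  also have "G r0 = 0" using init by (simp add: G_def E_def)
  finally have "E r1 \<le> 0" by (simp add: G_def mult_le_0_iff not_le)
  then have "b r1 \<bullet> b r1 \<le> 0" unfolding E_def by (smt (verit) inner_ge_zero)
  then show ?thesis by (metis inner_eq_zero_iff inner_ge_zero order_antisym)
qed

text \<open>The energy \<open>E = k\<^sup>2|b|\<^sup>2 + |b'|\<^sup>2\<close> satisfies \<open>|E'| \<le> (c/r\<^sup>2) E\<close>, and \<open>c/r\<^sup>2\<close> is integrable at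
  infinity: a solution cannot decay unless it vanishes. This is the core of Rellich's lemma.\<close>

lemma no_decaying_solution:
  fixes b b1 :: "real \<Rightarrow> complex"
  assumes "k > 0" "R > 0"
    and b: "\<And>r. r > R \<Longrightarrow> (b has_vector_derivative b1 r) (at r)"
      "\<And>r. r > R \<Longrightarrow> (b1 has_vector_derivative (\<nu> / r\<^sup>2 - k\<^sup>2) *\<^sub>R b r) (at r)"
    and lim: "(b \<longlongrightarrow> 0) at_top" "(b1 \<longlongrightarrow> 0) at_top" and "r > R"
  shows "b r = 0"
proof -
  define c where "c = \<bar>\<nu>\<bar> / k"
  define E where "E r = k\<^sup>2 * (b r \<bullet> b r) + b1 r \<bullet> b1 r" for r
  define G where "G r = E r * exp (- c / r)" for r
  have mono: "G r \<le> G s" if "r > R" "r \<le> s" for r s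
  proof (rule DERIV_nonneg_imp_nondecreasing[OF \<open>r \<le> s\<close>])
    fix t assume "r \<le> t" "t \<le> s"
    then have t: "t > R" "t > 0" using that \<open>R > 0\<close> by auto
    let ?E' = "2 * (\<nu> / t\<^sup>2) * (b t \<bullet> b1 t)"
    have "(E has_real_derivative (k\<^sup>2 * (b t \<bullet> b1 t + b1 t \<bullet> b t) + (b1 t \<bullet> ((\<nu> / t\<^sup>2 - k\<^sup>2) *\<^sub>R b t) + ((\<nu> / t\<^sup>2 - k\<^sup>2) *\<^sub>R b t) \<bullet> b1 t))) (at t)"
      unfolding E_def by (intro DERIV_add DERIV_cmult inner_has_real_derivative b t)
    then have dE: "(E has_real_derivative ?E') (at t)"
      by (rule DERIV_cong) (simp add: inner_commute algebra_simps)
    have "((\<lambda>r. exp (- c / r)) has_real_derivative (exp (- c / t) * (c / t\<^sup>2))) (at t)"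
      using t by (auto intro!: derivative_eq_intros simp: power2_eq_square)
    from DERIV_mult[OF dE this]
    have "(G has_real_derivative (?E' + c / t\<^sup>2 * E t) * exp (- c / t)) (at t)"
      unfolding G_def by (rule DERIV_cong) (simp add: algebra_simps)
    moreover have "?E' + c / t\<^sup>2 * E t \<ge> 0"
    proof -
      have "\<bar>2 * k * (b t \<bullet> b1 t)\<bar> \<le> E t"
        using abs_inner_le_square_sum[of "k *\<^sub>R b t" "b1 t"] by (simp add: E_def power2_eq_square mult_ac)
      then have "c / t\<^sup>2 * \<bar>2 * k * (b t \<bullet> b1 t)\<bar> \<le> c / t\<^sup>2 * E t"
        using \<open>k > 0\<close> by (intro mult_left_mono) (auto simp: c_def)
      moreover have "c / t\<^sup>2 * \<bar>2 * k * (b t \<bullet> b1 t)\<bar> = \<bar>?E'\<bar>"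
        using \<open>k > 0\<close> by (simp add: c_def abs_mult)
      moreover have "x \<le> y \<Longrightarrow> x = \<bar>z\<bar> \<Longrightarrow> 0 \<le> z + y" for x y z :: real by auto
      ultimately show ?thesis by blast
    qed
    ultimately show "\<exists>y. (G has_real_derivative y) (at t) \<and> 0 \<le> y"
      by (intro exI[of _ "(?E' + c / t\<^sup>2 * E t) * exp (- c / t)"] conjI) auto
  qed
  have "(E \<longlongrightarrow> k\<^sup>2 * (0 \<bullet> (0::complex)) + 0 \<bullet> (0::complex)) at_top"
    unfolding E_def by (intro tendsto_add tendsto_mult tendsto_const tendsto_inner lim)
  moreover have "((\<lambda>r. exp (- c / r)) \<longlongrightarrow> exp 0) at_top"
    by (intro tendsto_intros tendsto_divide_0[OF tendsto_const] filterlim_at_top_imp_at_infinity filterlim_ident)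
  ultimately have "(G \<longlongrightarrow> 0) at_top"
    unfolding G_def using tendsto_mult by fastforce
  moreover have "\<forall>\<^sub>F s in at_top. G r \<le> G s"
    using eventually_ge_at_top[of r] by eventually_elim (use mono \<open>r > R\<close> in auto)
  ultimately have "G r \<le> 0"
    using tendsto_lowerbound[of G 0 at_top "G r"] by simp
  then have "E r \<le> 0" by (simp add: G_def mult_le_0_iff not_le)
  then have "k\<^sup>2 * (b r \<bullet> b r) \<le> 0" unfolding E_def by (smt (verit) inner_ge_zero)
  then have "b r \<bullet> b r \<le> 0" using \<open>k > 0\<close> by (simp add: mult_le_0_iff)
  then show ?thesis by (metis inner_eq_zero_iff inner_ge_zero order_antisym)
qed

text \<open>A positive function with \<open>f'' \<ge> c\<^sup>2 f\<close> lies below the hyperbolic cosine with the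
  same bounds at both ends, hence is exponentially small in the middle.\<close>

lemma convex_midpoint_decay:
  fixes y y1 y2 :: "real \<Rightarrow> real"
  assumes d: "d \<ge> 0"
    and y: "\<And>r. r \<in> {c-d..c+d} \<Longrightarrow> (y has_real_derivative y1 r) (at r)"
      "\<And>r. r \<in> {c-d..c+d} \<Longrightarrow> (y1 has_real_derivative y2 r) (at r)"
    and conv: "\<And>r. r \<in> {c-d..c+d} \<Longrightarrow> y2 r \<ge> \<kappa>\<^sup>2 * y r"
  shows "2 * cosh (\<kappa> * d) * y c \<le> y (c + d) + y (c - d)"
proof -
  define h where "h s = y (c + s) + y (c - s)" for s
  define h1 where "h1 s = y1 (c + s) - y1 (c - s)" for s
  define h2 where "h2 s = y2 (c + s) + y2 (c - s)" for s
  have chain: "((\<lambda>s. f (c + s)) has_real_derivative f') (at s)" if "(f has_real_derivative f') (at (c + s))" for f f' s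
  proof -
    have "((\<lambda>s. c + s) has_real_derivative 1) (at s)" by (auto intro!: derivative_eq_intros)
    from DERIV_chain2[where g="\<lambda>s. c + s", OF that this] show ?thesis by simp
  qed
  have chain': "((\<lambda>s. f (c - s)) has_real_derivative - f') (at s)" if "(f has_real_derivative f') (at (c - s))" for f f' s
  proof -
    have "((\<lambda>s. c - s) has_real_derivative -1) (at s)" by (auto intro!: derivative_eq_intros)
    from DERIV_chain2[where g="\<lambda>s. c - s", OF that this] show ?thesis by simp
  qed
  have dh: "(h has_real_derivative h1 s) (at s)" if "s \<in> {0..d}" for s
    unfolding h_def h1_def using DERIV_add[OF chain[OF y(1)[of "c + s"]] chain'[OF y(1)[of "c - s"]]] that by auto
  have dh1: "(h1 has_real_derivative h2 s) (at s)" if "s \<in> {0..d}" for s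
    unfolding h1_def h2_def using DERIV_diff[OF chain[OF y(2)[of "c + s"]] chain'[OF y(2)[of "c - s"]]] that by auto
  have h2: "h2 s \<ge> \<kappa>\<^sup>2 * h s" if "s \<in> {0..d}" for s
    using conv[of "c + s"] conv[of "c - s"] that by (simp add: h_def h2_def algebra_simps)
  define w where "w s = h1 s * cosh (\<kappa> * s) - \<kappa> * h s * sinh (\<kappa> * s)" for s
  have w: "w s \<ge> 0" if "s \<in> {0..d}" for s
  proof -
    have "w 0 \<le> w s"
    proof (rule DERIV_nonneg_imp_nondecreasing[where f=w])
      fix t assume "0 \<le> t" "t \<le> s"
      then have t: "t \<in> {0..d}" using that by auto
      have "(w has_real_derivative (h2 t - \<kappa>\<^sup>2 * h t) * cosh (\<kappa> * t)) (at t)"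
        unfolding w_def by (rule derivative_eq_intros dh[OF t] dh1[OF t] refl | simp)+ (simp add: algebra_simps power2_eq_square)
      then show "\<exists>y. (w has_real_derivative y) (at t) \<and> 0 \<le> y"
        using h2[OF t] by (intro exI[of _ "(h2 t - \<kappa>\<^sup>2 * h t) * cosh (\<kappa> * t)"]) auto
    qed (use that in auto)
    then show ?thesis by (simp add: w_def h1_def)
  qed
  have "h 0 / cosh (\<kappa> * 0) \<le> h d / cosh (\<kappa> * d)"
  proof (rule DERIV_nonneg_imp_nondecreasing[where f="\<lambda>s. h s / cosh (\<kappa> * s)", OF d])
    fix t assume "0 \<le> t" "t \<le> d"
    then have t: "t \<in> {0..d}" by auto
    have "((\<lambda>s. h s / cosh (\<kappa> * s)) has_real_derivative w t / (cosh (\<kappa> * t))\<^sup>2) (at t)"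
      unfolding w_def by (rule derivative_eq_intros dh[OF t] refl | simp)+ (simp add: algebra_simps power2_eq_square)
    then show "\<exists>y. ((\<lambda>s. h s / cosh (\<kappa> * s)) has_real_derivative y) (at t) \<and> 0 \<le> y"
      using w[OF t] by (intro exI[of _ "w t / (cosh (\<kappa> * t))\<^sup>2"]) auto
  qed
  then have "h 0 * cosh (\<kappa> * d) \<le> h d" by (simp add: field_simps)
  then show ?thesis by (simp add: h_def algebra_simps)
qed

text \<open>The Wronskian \<open>Im (b' b\<^sup>*)\<close> is constant, hence equal to its limit \<open>k|A|\<^sup>2\<close>.\<close>

lemma wronskian_far_field:
  fixes b b1 :: "real \<Rightarrow> complex" and p :: "real \<Rightarrow> real"
  assumes b: "\<And>r. r > R \<Longrightarrow> (b has_vector_derivative b1 r) (at r)"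
      "\<And>r. r > R \<Longrightarrow> (b1 has_vector_derivative p r *\<^sub>R b r) (at r)"
    and A: "((\<lambda>r. b r / exp (\<i> * of_real (k * r))) \<longlongrightarrow> A) at_top"
    and som: "((\<lambda>r. b1 r - \<i> * of_real k * b r) \<longlongrightarrow> 0) at_top" and r: "r > R"
  shows "k * (cmod A)\<^sup>2 = b1 r \<bullet> (\<i> * b r)"
proof -
  define W where "W r = b1 r \<bullet> (\<i> * b r)" for r
  have dW: "(W has_real_derivative 0) (at t)" if "t > R" for t
  proof -
    have "(W has_real_derivative (b1 t \<bullet> (\<i> * b1 t) + (p t *\<^sub>R b t) \<bullet> (\<i> * b t))) (at t)"
      unfolding W_def by (intro inner_has_real_derivative has_vector_derivative_mult_right b that)
    moreover have "x \<bullet> (\<i> * x) = 0" for x :: complex by (simp add: inner_complex_def)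
    ultimately show ?thesis by (simp del: inner_mult_right)
  qed
  have const: "W s = W r" if "s \<ge> r" for s
  proof -
    have "\<exists>c. \<forall>x\<in>{R<..}. W x = c"
      by (rule has_field_derivative_zero_constant) (auto intro: dW has_field_derivative_at_within)
    then show ?thesis using that r by (metis greaterThan_iff less_le_trans)
  qed
  have nb: "((\<lambda>r. cmod (b r)) \<longlongrightarrow> cmod A) at_top"
    using tendsto_norm[OF A] by (simp add: norm_divide)
  have "((\<lambda>r. (b1 r - \<i> * of_real k * b r) \<bullet> (\<i> * b r)) \<longlongrightarrow> 0) at_top"
  proof (rule Lim_null_comparison)
    show "((\<lambda>r. cmod (b1 r - \<i> * of_real k * b r) * cmod (b r)) \<longlongrightarrow> 0) at_top"
      using tendsto_mult[OF tendsto_norm[OF som] nb] by simp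
    show "\<forall>\<^sub>F r in at_top. norm ((b1 r - \<i> * of_real k * b r) \<bullet> (\<i> * b r)) \<le> cmod (b1 r - \<i> * of_real k * b r) * cmod (b r)"
    proof (intro always_eventually allI)
      fix r show "norm ((b1 r - \<i> * of_real k * b r) \<bullet> (\<i> * b r)) \<le> cmod (b1 r - \<i> * of_real k * b r) * cmod (b r)"
        using Cauchy_Schwarz_ineq2[of "b1 r - \<i> * of_real k * b r" "\<i> * b r"] by (simp add: norm_mult)
    qed
  qed
  moreover have "((\<lambda>r. k * (cmod (b r))\<^sup>2) \<longlongrightarrow> k * (cmod A)\<^sup>2) at_top"
    by (intro tendsto_intros nb)
  ultimately have "((\<lambda>r. (b1 r - \<i> * of_real k * b r) \<bullet> (\<i> * b r) + k * (cmod (b r))\<^sup>2) \<longlongrightarrow> 0 + k * (cmod A)\<^sup>2) at_top"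
    by (rule tendsto_add)
  moreover have "(b1 r - \<i> * of_real k * b r) \<bullet> (\<i> * b r) + k * (cmod (b r))\<^sup>2 = W r" for r
  proof -
    have "(\<i> * of_real k * b r) \<bullet> (\<i> * b r) = k * (cmod (b r))\<^sup>2"
      by (simp add: inner_complex_def cmod_power2) (simp add: power2_eq_square algebra_simps)
    then show ?thesis unfolding W_def inner_diff_left by simp
  qed
  ultimately have "(W \<longlongrightarrow> k * (cmod A)\<^sup>2) at_top" by simp
  moreover have "(W \<longlongrightarrow> W r) at_top"
    by (rule tendsto_eventually, rule eventually_mono[OF eventually_ge_at_top[of r]], rule const)
  ultimately show ?thesis
    using tendsto_unique[OF trivial_limit_at_top_linorder] unfolding W_def by blast
qed

section \<open>Fourier series on the unit circle\<close>

lemma fourier_int_cis: "fourier_int n (\<lambda>\<theta>. cis (of_int j * \<theta>)) = (if j = n then 2 * pi else 0)"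
proof -
  have *: "cis (of_int j * \<theta>) * cis (- (of_int n * \<theta>)) = cis (of_int (j - n) * \<theta>)" for \<theta>
    by (simp add: cis_mult algebra_simps)
  show ?thesis
  proof (cases "j = n")
    case True
    then show ?thesis unfolding fourier_int_def * by (simp add: scaleR_conv_of_real)
  next
    case False
    define m where "m = j - n"
    have m: "m \<noteq> 0" using False by (simp add: m_def)
    have "((\<lambda>\<theta>. cis (of_int m * \<theta>)) has_integral
        (cis (of_int m * (2 * pi)) / (\<i> * of_int m) - cis (of_int m * 0) / (\<i> * of_int m))) {0..2*pi}"
    proof (rule fundamental_theorem_of_calculus)
      fix \<theta> :: real
      have "((\<lambda>\<theta>. cis (of_int m * \<theta>)) has_vector_derivative \<i> * of_int m * cis (of_int m * \<theta>)) (at \<theta> within {0..2*pi})"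
        unfolding has_vector_derivative_def
        by (auto intro!: derivative_eq_intros simp: scaleR_conv_of_real algebra_simps)
      from has_vector_derivative_divide[OF this, of "\<i> * of_int m"]
      show "((\<lambda>\<theta>. cis (of_int m * \<theta>) / (\<i> * of_int m)) has_vector_derivative cis (of_int m * \<theta>)) (at \<theta> within {0..2*pi})"
        using m by simp
    qed simp
    moreover have "cis (of_int m * (2 * pi)) = 1"
      using cis_multiple_2pi[of "of_int m"] by (simp add: mult_ac)
    ultimately show ?thesis
      unfolding fourier_int_def * using False by (simp add: m_def integral_unique)
  qed
qed

lemma fourier_int_linear:
  assumes "continuous_on {0..2*pi} f" "continuous_on {0..2*pi} g"
  shows "fourier_int n (\<lambda>\<theta>. a * f \<theta> + b * g \<theta>) = a * fourier_int n f + b * fourier_int n g"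
proof -
  have "((\<lambda>\<theta>. a * (f \<theta> * cis (- (of_int n * \<theta>))) + b * (g \<theta> * cis (- (of_int n * \<theta>)))) has_integral
     (a * fourier_int n f + b * fourier_int n g)) {0..2*pi}"
    by (intro has_integral_add has_integral_mult_right fourier_int_has_integral assms)
  moreover have "(\<lambda>\<theta>. a * (f \<theta> * cis (- (of_int n * \<theta>))) + b * (g \<theta> * cis (- (of_int n * \<theta>))))
     = (\<lambda>\<theta>. (a * f \<theta> + b * g \<theta>) * cis (- (of_int n * \<theta>)))" by (simp add: algebra_simps)
  ultimately show ?thesis unfolding fourier_int_def by (simp add: integral_unique)
qed

lemma cos_sin_cis:
  "complex_of_real (cos \<theta>) * p + of_real (sin \<theta>) * q = (p - \<i> * q) / 2 * cis \<theta> + (p + \<i> * q) / 2 * cis (- \<theta>)"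
  by (simp add: complex_eq_iff field_simps)

lemma continuous_on_circle:
  assumes "continuous_on (sphere 0 1) f"
  shows "continuous_on T (\<lambda>\<theta>. f (unit_dir \<theta>))"
  by (rule continuous_on_compose2[OF assms continuous_on_unit_dir[OF continuous_on_id]]) auto

lemma continuous_on_circle_polynomial:
  assumes "real_polynomial_function p"
  shows "continuous_on T (\<lambda>\<theta>. complex_of_real (p (unit_dir \<theta>)))"
  by (intro continuous_on_of_real continuous_on_circle continuous_at_imp_continuous_on ballI
      continuous_real_polymonial_function assms)

lemma fourier_int_mult_polynomial:
  fixes p :: "plane \<Rightarrow> real"
  assumes "real_polynomial_function p"
    and "continuous_on {0..2*pi} g" "\<And>n. fourier_int n g = 0"
  shows "fourier_int n (\<lambda>\<theta>. g \<theta> * of_real (p (unit_dir \<theta>))) = 0"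
  using assms
proof (induction p arbitrary: g n)
  case (linear p)
  interpret bounded_linear p by fact
  define \<alpha> \<beta> where "\<alpha> = complex_of_real (p (axis 1 1))" and "\<beta> = complex_of_real (p (axis 2 1))"
  have p: "complex_of_real (p (unit_dir \<theta>)) = (\<alpha> - \<i> * \<beta>) / 2 * cis \<theta> + (\<alpha> + \<i> * \<beta>) / 2 * cis (- \<theta>)" for \<theta>
    unfolding cos_sin_cis[symmetric] by (simp add: unit_dir_def add scaleR \<alpha>_def \<beta>_def)
  have z: "((\<lambda>\<theta>. g \<theta> * cis (- (of_int m * \<theta>))) has_integral 0) {0..2*pi}" for m
    using fourier_int_has_integral[OF linear.prems(1), of m] linear.prems(2)[of m] by simp
  have "((\<lambda>\<theta>. (\<alpha> - \<i> * \<beta>) / 2 * (g \<theta> * cis (- (of_int (n - 1) * \<theta>)))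
      + (\<alpha> + \<i> * \<beta>) / 2 * (g \<theta> * cis (- (of_int (n + 1) * \<theta>)))) has_integral
      ((\<alpha> - \<i> * \<beta>) / 2 * 0 + (\<alpha> + \<i> * \<beta>) / 2 * 0)) {0..2*pi}"
    by (intro has_integral_add has_integral_mult_right z)
  moreover have "(\<alpha> - \<i> * \<beta>) / 2 * (g \<theta> * cis (- (of_int (n - 1) * \<theta>)))
      + (\<alpha> + \<i> * \<beta>) / 2 * (g \<theta> * cis (- (of_int (n + 1) * \<theta>)))
      = g \<theta> * of_real (p (unit_dir \<theta>)) * cis (- (of_int n * \<theta>))" for \<theta>
  proof -
    have "cis (- (of_int (n - 1) * \<theta>)) = cis \<theta> * cis (- (of_int n * \<theta>))"
      "cis (- (of_int (n + 1) * \<theta>)) = cis (- \<theta>) * cis (- (of_int n * \<theta>))"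
      by (simp_all add: cis_mult algebra_simps)
    then show ?thesis unfolding p by (simp only: distrib_left distrib_right mult_ac)
  qed
  ultimately show ?case by (simp add: fourier_int_def integral_unique)
next
  case (const c)
  then show ?case using fourier_int_linear[of g g n "of_real c" 0] by (simp add: mult.commute)
next
  case (add p1 p2)
  have c: "continuous_on {0..2*pi} (\<lambda>\<theta>. g \<theta> * of_real (p (unit_dir \<theta>)))" if "real_polynomial_function p" for p
    by (intro continuous_on_mult add.prems continuous_on_circle_polynomial that)
  show ?case
    using fourier_int_linear[OF c[OF add.hyps(1)] c[OF add.hyps(2)], of n 1 1] add.IH add.prems
    by (simp add: algebra_simps)
next
  case (mult p1 p2)
  have c: "continuous_on {0..2*pi} (\<lambda>\<theta>. g \<theta> * of_real (p1 (unit_dir \<theta>)))"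
    by (intro continuous_on_mult mult.prems continuous_on_circle_polynomial mult.hyps)
  show ?case
    using mult.IH(2)[OF c mult.IH(1)[OF mult.prems]] by (simp add: mult.assoc)
qed

text \<open>Trigonometric polynomials are uniformly dense, so a continuous function orthogonal to all of them has zero
  square integral.\<close>

lemma fourier_unique:
  assumes f: "continuous_on (sphere 0 1) f" and 0: "\<And>n. fourier_int n (\<lambda>\<theta>. f (unit_dir \<theta>)) = 0"
    and x: "x \<in> sphere 0 1"
  shows "f x = 0"
proof -
  have cf: "continuous_on {0..2*pi} (\<lambda>\<theta>. f (unit_dir \<theta>))" by (rule continuous_on_circle[OF f])
  obtain M where M: "\<And>y. y \<in> sphere 0 1 \<Longrightarrow> norm (f y) \<le> M"
    using compact_imp_bounded[OF compact_continuous_image[OF f compact_sphere]] unfolding bounded_iff by blast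
  have "M \<ge> 0" using M[OF x] norm_ge_zero order_trans by blast
  let ?I = "integral {0..2*pi} (\<lambda>\<theta>. f (unit_dir \<theta>) * cnj (f (unit_dir \<theta>)))"
  have small: "norm ?I \<le> 2 * pi * M * e" if e: "e > 0" for e
  proof -
    obtain q where q: "polynomial_function q" "\<And>y. y \<in> sphere 0 1 \<Longrightarrow> norm (cnj (f y) - q y) < e"
      using Stone_Weierstrass_polynomial_function[of "sphere 0 1" "\<lambda>y. cnj (f y)" e] f e
      by (auto intro: continuous_intros)
    have poly: "real_polynomial_function (\<lambda>y. Re (q y))" "real_polynomial_function (\<lambda>y. Im (q y))"
      using q(1) bounded_linear_Re bounded_linear_Im unfolding polynomial_function_def o_def by blast+
    have cq: "continuous_on {0..2*pi} (\<lambda>\<theta>. q (unit_dir \<theta>))"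
      by (intro continuous_on_circle continuous_on_polymonial_function q)
    have cp: "continuous_on {0..2*pi} (\<lambda>\<theta>. f (unit_dir \<theta>) * of_real (p (unit_dir \<theta>)))" if "real_polynomial_function p" for p
      by (intro continuous_on_mult cf continuous_on_circle_polynomial that)
    have "fourier_int 0 (\<lambda>\<theta>. f (unit_dir \<theta>) * q (unit_dir \<theta>)) = 
      fourier_int 0 (\<lambda>\<theta>. 1 * (f (unit_dir \<theta>) * of_real (Re (q (unit_dir \<theta>)))) + \<i> * (f (unit_dir \<theta>) * of_real (Im (q (unit_dir \<theta>)))))"
      by (intro arg_cong[of _ _ "fourier_int 0"] ext) (simp add: complex_eq_iff algebra_simps)
    also have "\<dots> = 0"
      using fourier_int_mult_polynomial[OF poly(1) cf 0] fourier_int_mult_polynomial[OF poly(2) cf 0]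
      by (subst fourier_int_linear) (auto intro: cp poly)
    finally have z: "integral {0..2*pi} (\<lambda>\<theta>. f (unit_dir \<theta>) * q (unit_dir \<theta>)) = 0"
      by (simp add: fourier_int_def)
    have "?I = integral {0..2*pi} (\<lambda>\<theta>. f (unit_dir \<theta>) * cnj (f (unit_dir \<theta>))) - integral {0..2*pi} (\<lambda>\<theta>. f (unit_dir \<theta>) * q (unit_dir \<theta>))"
      using z by simp
    also have "\<dots> = integral {0..2*pi} (\<lambda>\<theta>. f (unit_dir \<theta>) * cnj (f (unit_dir \<theta>)) - f (unit_dir \<theta>) * q (unit_dir \<theta>))"
      by (intro integral_diff[symmetric] integrable_continuous_real continuous_on_mult continuous_on_cnj cf cq)
    also have "norm \<dots> \<le> M * e * (2 * pi - 0)"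
    proof (rule integral_bound)
      show "continuous_on {0..2*pi} (\<lambda>\<theta>. f (unit_dir \<theta>) * cnj (f (unit_dir \<theta>)) - f (unit_dir \<theta>) * q (unit_dir \<theta>))"
        by (intro continuous_on_diff continuous_on_mult continuous_on_cnj cf cq)
      fix \<theta> :: real
      have "norm (f (unit_dir \<theta>) * (cnj (f (unit_dir \<theta>)) - q (unit_dir \<theta>))) \<le> M * e"
        unfolding norm_mult using M[of "unit_dir \<theta>"] q(2)[of "unit_dir \<theta>"] \<open>M \<ge> 0\<close> by (intro mult_mono) auto
      then show "norm (f (unit_dir \<theta>) * cnj (f (unit_dir \<theta>)) - f (unit_dir \<theta>) * q (unit_dir \<theta>)) \<le> M * e"
        by (simp add: right_diff_distrib)
    qed simp
    finally show ?thesis by (simp add: mult_ac)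
  qed
  have "norm ?I \<le> 0"
  proof (rule field_le_epsilon)
    fix e :: real assume "e > 0"
    have "norm ?I \<le> 2 * pi * M * (e / (2 * pi * M + 1))"
      using \<open>e > 0\<close> \<open>M \<ge> 0\<close> by (intro small divide_pos_pos add_nonneg_pos) auto
    also have "\<dots> \<le> e"
    proof -
      have "0 \<le> 2 * pi * M" using \<open>M \<ge> 0\<close> by simp
      then have "2 * pi * M + 1 > 0" by linarith
      moreover have "2 * pi * M * e \<le> e * (2 * pi * M + 1)" using \<open>e > 0\<close> by (simp add: algebra_simps)
      ultimately show ?thesis by (simp add: pos_divide_le_eq)
    qed
    finally show "norm ?I \<le> 0 + e" by simp
  qed
  moreover have "?I = of_real (integral {0..2*pi} (\<lambda>\<theta>. (cmod (f (unit_dir \<theta>)))\<^sup>2))"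
  proof -
    have "(\<lambda>\<theta>. (cmod (f (unit_dir \<theta>)))\<^sup>2) integrable_on {0..2*pi}"
      by (intro integrable_continuous_real continuous_intros cf)
    from integral_linear[OF this bounded_linear_of_real[where 'a=complex]] show ?thesis
      by (simp only: o_def complex_norm_square)
  qed
  ultimately have "integral {0..2*pi} (\<lambda>\<theta>. (cmod (f (unit_dir \<theta>)))\<^sup>2) = 0" by simp
  then have "\<forall>\<theta>\<in>{0..2*pi}. (cmod (f (unit_dir \<theta>)))\<^sup>2 = 0"
    by (subst (asm) integral_eq_0_iff) (auto intro!: continuous_intros cf)
  moreover obtain \<theta> where "\<theta> \<in> {0..2*pi}" "x = norm x *\<^sub>R unit_dir \<theta>" using unit_dir_exists .
  ultimately show ?thesis using x by auto
qed

lemma fourier_int_suminf: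
  fixes j :: "nat \<Rightarrow> int" and c :: "nat \<Rightarrow> complex"
  assumes c: "summable (\<lambda>m. norm (c m))" and j: "inj j"
  shows "fourier_int n (\<lambda>\<theta>. \<Sum>m. c m * cis (of_int (j m) * \<theta>))
      = (if n \<in> range j then 2 * pi * c (the_inv j n) else 0)"
    and "continuous_on T (\<lambda>\<theta>. \<Sum>m. c m * cis (of_int (j m) * \<theta>))"
proof -
  define s where "s N \<theta> = (\<Sum>m<N. c m * cis (of_int (j m) * \<theta>))" for N \<theta>
  have u: "uniform_limit UNIV s (\<lambda>\<theta>. \<Sum>m. c m * cis (of_int (j m) * \<theta>)) sequentially"
    unfolding s_def using Weierstrass_m_test[OF _ c, of UNIV "\<lambda>m \<theta>. c m * cis (of_int (j m) * \<theta>)"]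
    by (simp add: norm_mult)
  have cs: "continuous_on T (s N)" for N T
    unfolding s_def by (intro continuous_intros)
  show cont: "continuous_on T (\<lambda>\<theta>. \<Sum>m. c m * cis (of_int (j m) * \<theta>))" for T
    by (rule continuous_on_subset[OF uniform_limit_theorem[OF _ u]]) (auto simp: cs)
  have fs: "fourier_int n (s N) = (\<Sum>m<N. c m * (if j m = n then 2 * pi else 0))" for N
  proof (induction N)
    case 0 then show ?case by (simp add: s_def fourier_int_def)
  next
    case (Suc N)
    have "s (Suc N) = (\<lambda>\<theta>. 1 * s N \<theta> + c N * cis (of_int (j N) * \<theta>))" by (rule ext) (simp add: s_def)
    then show ?case using Suc
      by (simp only: fourier_int_linear[OF cs continuous_on_cis[OF continuous_on_mult[OF continuous_on_const continuous_on_id]]] fourier_int_cis)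
        simp
  qed
  have "(\<lambda>N. fourier_int n (s N)) \<longlonglongrightarrow> fourier_int n (\<lambda>\<theta>. \<Sum>m. c m * cis (of_int (j m) * \<theta>))"
  proof (rule LIMSEQ_I)
    fix e :: real assume "e > 0"
    then have "\<forall>\<^sub>F N in sequentially. \<forall>\<theta>\<in>UNIV. dist (s N \<theta>) (\<Sum>m. c m * cis (of_int (j m) * \<theta>)) < e / (4 * pi)"
      using u unfolding uniform_limit_iff by simp
    then obtain N0 where N0: "\<And>N \<theta>. N \<ge> N0 \<Longrightarrow> norm (s N \<theta> - (\<Sum>m. c m * cis (of_int (j m) * \<theta>))) < e / (4 * pi)"
      by (auto simp: eventually_sequentially dist_norm)
    have "norm (fourier_int n (s N) - fourier_int n (\<lambda>\<theta>. \<Sum>m. c m * cis (of_int (j m) * \<theta>))) < e" if "N \<ge> N0" for N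
    proof -
      have "fourier_int n (s N) - fourier_int n (\<lambda>\<theta>. \<Sum>m. c m * cis (of_int (j m) * \<theta>))
         = fourier_int n (\<lambda>\<theta>. 1 * s N \<theta> + (-1) * (\<Sum>m. c m * cis (of_int (j m) * \<theta>)))"
        by (subst fourier_int_linear[OF cs cont]) simp
      also have "norm \<dots> \<le> 2 * pi * (e / (4 * pi))"
        using N0[OF that] by (intro norm_fourier_int_le continuous_intros cs cont) (auto intro: less_imp_le)
      also have "\<dots> < e" using \<open>e > 0\<close> by simp
      finally show ?thesis .
    qed
    then show "\<exists>N0. \<forall>N\<ge>N0. norm (fourier_int n (s N) - fourier_int n (\<lambda>\<theta>. \<Sum>m. c m * cis (of_int (j m) * \<theta>))) < e" by blast
  qed
  then have "(\<lambda>m. c m * (if j m = n then 2 * pi else 0)) sums fourier_int n (\<lambda>\<theta>. \<Sum>m. c m * cis (of_int (j m) * \<theta>))"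
    unfolding fs sums_def .
  moreover have "(\<lambda>m. c m * (if j m = n then 2 * pi else 0)) sums (if n \<in> range j then 2 * pi * c (the_inv j n) else 0)"
  proof (cases "n \<in> range j")
    case True
    then obtain m where m: "n = j m" by auto
    then have "(\<lambda>m'. c m' * (if j m' = n then 2 * pi else 0)) = (\<lambda>m'. if m' = m then 2 * pi * c m' else 0)"
      using j by (auto simp: inj_def)
    moreover have "the_inv j n = m" unfolding m by (rule the_inv_f_f[OF j])
    ultimately show ?thesis using True sums_single[of m "\<lambda>m. 2 * pi * c m"] by simp
  next
    case False
    then have "j m \<noteq> n" for m by auto
    then show ?thesis using False by simp
  qed
  ultimately show "fourier_int n (\<lambda>\<theta>. \<Sum>m. c m * cis (of_int (j m) * \<theta>)) = (if n \<in> range j then 2 * pi * c (the_inv j n) else 0)"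
    using sums_unique2 by blast
qed

text \<open>A function on the circle with exponentially decaying Fourier coefficients is the restriction of its Laurent
  series, which is holomorphic in an annulus; hence its zeros are isolated.\<close>

lemma analytic_on_circle_zero:
  assumes A: "continuous_on (sphere 0 1) A"
    and decay: "\<And>n. norm (fourier_int n (\<lambda>\<theta>. A (unit_dir \<theta>))) \<le> C * q ^ nat \<bar>n\<bar>" and q: "0 < q" "q < 1"
    and W: "open W" "w \<in> W" "w \<in> sphere 0 1" "\<And>y. y \<in> W \<inter> sphere 0 1 \<Longrightarrow> A y = 0"
    and x: "x \<in> sphere 0 1"
  shows "A x = 0"
proof -
  define a where "a n = fourier_int n (\<lambda>\<theta>. A (unit_dir \<theta>))" for n
  define f1 where "f1 z = (\<Sum>m. a (int m) * z ^ m)" for z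
  define f2 where "f2 z = (\<Sum>m. a (- int (Suc m)) * z ^ m)" for z
  define G where "G z = f1 z + inverse z * f2 (inverse z)" for z
  have C: "C \<ge> 0" using order_trans[OF norm_ge_zero decay[of 0]] by simp
  have sm: "summable (\<lambda>m. norm (c m * z ^ m))" if "norm z < 1 / q" "\<And>m. norm (c m) \<le> C * q ^ m" for c and z :: complex
  proof (rule summable_comparison_test)
    show "\<exists>N. \<forall>m\<ge>N. norm (norm (c m * z ^ m)) \<le> C * (q * norm z) ^ m"
      using that(2) by (auto simp: norm_mult norm_power power_mult_distrib mult.assoc[symmetric] intro!: mult_right_mono)
    show "summable (\<lambda>m. C * (q * norm z) ^ m)"
      using that(1) q by (intro summable_mult summable_geometric) (auto simp: abs_mult field_simps)
  qed
  have d1: "norm (a (int m)) \<le> C * q ^ m" for m using decay[of "int m"] by (simp add: a_def)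
  have d2: "norm (a (- int (Suc m))) \<le> C * q ^ m" for m
  proof -
    have "norm (a (- int (Suc m))) \<le> C * q ^ Suc m" using decay[of "- int (Suc m)"] by (simp add: a_def del: power_Suc of_nat_Suc)
    also have "\<dots> \<le> C * q ^ m" using C q by (intro mult_left_mono power_decreasing) auto
    finally show ?thesis .
  qed
  have h1: "f1 holomorphic_on ball 0 (1/q)"
  proof (rule power_series_holomorphic[where a="\<lambda>m. a (int m)"])
    fix w :: complex assume "w \<in> ball 0 (1/q)"
    then have "norm w < 1/q" by simp
    then show "(\<lambda>m. a (int m) * (w - 0) ^ m) sums f1 w"
      unfolding f1_def diff_zero by (intro summable_sums summable_norm_cancel[OF sm] d1)
  qed
  have h2: "f2 holomorphic_on ball 0 (1/q)"
  proof (rule power_series_holomorphic[where a="\<lambda>m. a (- int (Suc m))"])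
    fix w :: complex assume "w \<in> ball 0 (1/q)"
    then have "norm w < 1/q" by simp
    then show "(\<lambda>m. a (- int (Suc m)) * (w - 0) ^ m) sums f2 w"
      unfolding f2_def diff_zero by (intro summable_sums summable_norm_cancel[OF sm] d2)
  qed
  define Ann where "Ann = {z :: complex. q < norm (z - 0) \<and> norm (z - 0) < 1/q}"
  have hG: "G holomorphic_on Ann"
  proof -
    have "f1 holomorphic_on Ann" by (rule holomorphic_on_subset[OF h1]) (auto simp: Ann_def)
    moreover have inv: "inverse holomorphic_on Ann" using q by (auto simp: Ann_def intro!: holomorphic_intros)
    moreover have "f2 \<circ> inverse holomorphic_on Ann"
    proof (rule holomorphic_on_compose_gen[OF inv h2])
      show "inverse ` Ann \<subseteq> ball 0 (1/q)"
        using q less_imp_inverse_less[of q] by (auto simp: Ann_def norm_divide inverse_eq_divide)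
    qed
    ultimately show ?thesis unfolding G_def by (auto intro!: holomorphic_intros simp: o_def)
  qed
  have one: "cis \<theta> \<in> Ann" for \<theta> using q by (auto simp: Ann_def)
  have oA: "open Ann" unfolding Ann_def by (intro open_Collect_conj open_Collect_less continuous_intros)
  have cA: "connected Ann" unfolding Ann_def by (rule connected_annulus) simp
  define F where "F y = G (Complex (y$1) (y$2)) - 2 * pi * A y" for y
  have cisC: "Complex (cos \<theta>) (sin \<theta>) = cis \<theta>" for \<theta> by (simp add: complex_eq_iff)
  have F0: "F y = 0" if "y \<in> sphere 0 1" for y
  proof (rule fourier_unique[OF _ _ that])
    have "continuous_on (sphere 0 1) (\<lambda>y::plane. Complex (y$1) (y$2))" by (intro continuous_intros)
    moreover have "(\<lambda>y::plane. Complex (y$1) (y$2)) ` sphere 0 1 \<subseteq> Ann"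
      using q by (auto simp: Ann_def plane_norm cmod_def)
    ultimately have "continuous_on (sphere 0 1) (\<lambda>y::plane. G (Complex (y$1) (y$2)))"
      using continuous_on_compose2[OF holomorphic_on_imp_continuous_on[OF hG]] by blast
    then show "continuous_on (sphere 0 1) F" unfolding F_def by (intro continuous_intros A)
    fix n
    have s1: "summable (\<lambda>m. norm (a (int m)))" using sm[of 1 "\<lambda>m. a (int m)"] d1 q by simp
    have s2: "summable (\<lambda>m. norm (a (- int (Suc m))))" using sm[of 1 "\<lambda>m. a (- int (Suc m))"] d2 q by simp
    have i1: "inj int" and i2: "inj (\<lambda>m. - int (Suc m))" by (auto simp: inj_def)
    note S1 = fourier_int_suminf[OF s1 i1] and S2 = fourier_int_suminf[OF s2 i2]
    have G: "G (cis \<theta>) = 1 * (\<Sum>m. a (int m) * cis (of_int (int m) * \<theta>)) + 1 * (\<Sum>m. a (- int (Suc m)) * cis (of_int (- int (Suc m)) * \<theta>))" for \<theta>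
    proof -
      have "summable (\<lambda>m. a (- int (Suc m)) * cis (- \<theta>) ^ m)"
        using s2 by (intro summable_norm_cancel[of "\<lambda>m. a (- int (Suc m)) * cis (- \<theta>) ^ m"]) (simp add: norm_mult norm_power del: of_nat_Suc)
      then have "inverse (cis \<theta>) * f2 (inverse (cis \<theta>)) = (\<Sum>m. cis (- \<theta>) * (a (- int (Suc m)) * cis (- \<theta>) ^ m))"
        by (simp add: f2_def suminf_mult del: of_nat_Suc)
      also have "\<dots> = (\<Sum>m. a (- int (Suc m)) * cis (of_int (- int (Suc m)) * \<theta>))"
      proof -
        have "cis (- \<theta>) * (a (- int (Suc m)) * cis (- \<theta>) ^ m) = a (- int (Suc m)) * cis (of_int (- int (Suc m)) * \<theta>)" for m
        proof -
          have "cis (of_int (- int (Suc m)) * \<theta>) = cis (- \<theta>) ^ Suc m"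
            unfolding Complex.DeMoivre by (intro arg_cong[of _ _ cis]) (simp add: algebra_simps)
          then show ?thesis by (simp del: of_nat_Suc)
        qed
        then show ?thesis by presburger
      qed
      finally show ?thesis by (simp add: G_def f1_def Complex.DeMoivre del: of_nat_Suc)
    qed
    have "fourier_int n (\<lambda>\<theta>. G (cis \<theta>)) = 2 * pi * a n"
    proof (cases "n \<ge> 0")
      case True
      then have r: "n \<in> range int" by (auto simp: image_iff intro: zero_le_imp_eq_int)
      moreover have "n \<notin> range (\<lambda>m. - int (Suc m))" using True by auto
      moreover have "int (the_inv int n) = n" using f_the_inv_into_f[OF i1 r] .
      ultimately show ?thesis unfolding G fourier_int_linear[OF S1(2) S2(2)] S1(1) S2(1) by (simp del: of_nat_Suc)
    next
      case False
      then have "n = - int (Suc (nat (- n - 1)))" by simp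
      then have r: "n \<in> range (\<lambda>m. - int (Suc m))" by blast
      moreover have "n \<notin> range int" using False by auto
      moreover have "- int (Suc (the_inv (\<lambda>m. - int (Suc m)) n)) = n" using f_the_inv_into_f[OF i2 r] .
      ultimately show ?thesis unfolding G fourier_int_linear[OF S1(2) S2(2)] S1(1) S2(1) by (simp del: of_nat_Suc)
    qed
    moreover have "continuous_on {0..2*pi} (\<lambda>\<theta>. G (cis \<theta>))"
      unfolding G by (intro continuous_intros S1(2) S2(2))
    ultimately show "fourier_int n (\<lambda>\<theta>. F (unit_dir \<theta>)) = 0"
      using fourier_int_linear[of "\<lambda>\<theta>. G (cis \<theta>)" "\<lambda>\<theta>. A (unit_dir \<theta>)" n 1 "- 2 * pi"] continuous_on_circle[OF A]
      by (simp add: F_def cisC a_def)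
  qed
  obtain t where t: "w = norm w *\<^sub>R unit_dir t" using unit_dir_exists by blast
  define V where "V = {z :: complex. vector [Re z, Im z] \<in> W} \<inter> sphere 0 1"
  have cvec: "continuous_on UNIV (\<lambda>z. vector [Re z, Im z] :: plane)"
  proof -
    have "(\<lambda>z. vector [Re z, Im z] :: plane) = (\<lambda>z. Re z *\<^sub>R axis 1 1 + Im z *\<^sub>R axis 2 1)"
      by (auto simp: vec_eq_iff forall_2 axis_def)
    then show ?thesis by (simp only:) (intro continuous_intros)
  qed
  have oV: "open {z :: complex. vector [Re z, Im z] \<in> W}"
    using open_vimage[OF W(1) cvec] by (simp add: vimage_def)
  have GV: "G z = 0" if "z \<in> V" for z
  proof -
    let ?y = "vector [Re z, Im z] :: plane"
    have "?y \<in> W \<inter> sphere 0 1" using that by (auto simp: V_def plane_norm cmod_def)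
    then have "A ?y = 0" "F ?y = 0" using W(4) F0 by blast+
    then show ?thesis by (simp add: F_def)
  qed
  have tV: "cis t islimpt V"
  proof -
    have lim: "cis t islimpt sphere 0 1"
    proof (rule connected_imp_perfect)
      show "connected (sphere 0 1 :: complex set)" by (rule connected_sphere) simp
      show "sphere 0 1 \<noteq> {a}" for a :: complex
      proof
        assume "sphere 0 1 = {a}"
        then have "1 = a" "-1 = a" by (metis singleton_iff mem_sphere_0 norm_one norm_minus_cancel)+
        then show False by simp
      qed
    qed simp
    have tW: "cis t \<in> {z :: complex. vector [Re z, Im z] \<in> W}"
    proof -
      have "vector [Re (cis t), Im (cis t)] = unit_dir t" by (simp add: vec_eq_iff forall_2)
      then show ?thesis using W(2,3) t by simp
    qed
    show ?thesis unfolding V_def islimpt_def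
    proof (intro allI impI)
      fix T assume "cis t \<in> T" "open T"
      then have "cis t \<in> T \<inter> {z. vector [Re z, Im z] \<in> W}" "open (T \<inter> {z. vector [Re z, Im z] \<in> W})"
        using tW oV by blast+
      with lim obtain y where "y \<in> sphere 0 1" "y \<in> T \<inter> {z. vector [Re z, Im z] \<in> W}" "y \<noteq> cis t"
        unfolding islimpt_def by meson
      then show "\<exists>y\<in>{z. vector [Re z, Im z] \<in> W} \<inter> sphere 0 1. y \<in> T \<and> y \<noteq> cis t" by blast
    qed
  qed
  have "G z = 0" if "z \<in> Ann" for z
    by (rule analytic_continuation[OF hG oA cA _ one tV GV that]) (use q in \<open>auto simp: V_def Ann_def\<close>)
  moreover obtain \<theta> where "x = norm x *\<^sub>R unit_dir \<theta>" using unit_dir_exists by blast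
  then have "x = unit_dir \<theta>" using x by simp
  ultimately show ?thesis using F0[OF x] one[of \<theta>] by (simp add: F_def cisC)
qed

section \<open>Radiating solutions and their far fields\<close>

definition radiating_outside :: "real \<Rightarrow> real \<Rightarrow> field \<Rightarrow> bool" where
  "radiating_outside k R u \<longleftrightarrow> helmholtz (of_real (k\<^sup>2)) {x. norm x > R} u \<and> sommerfeld k u"

text \<open>A far-field pattern without a rate of convergence: this weaker notion is stable under translations.\<close>

definition far_limit :: "real \<Rightarrow> field \<Rightarrow> field \<Rightarrow> bool" where
  "far_limit k u A \<longleftrightarrow>
     ((\<lambda>x. u x * of_real (sqrt (norm x)) / exp (\<i> * of_real (k * norm x)) - A (x /\<^sub>R norm x)) \<longlongrightarrow> 0) at_infinity"

definition liouville_coeff :: "field \<Rightarrow> int \<Rightarrow> real \<Rightarrow> complex" where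
  "liouville_coeff u n r = sqrt r *\<^sub>R circle_coeff u 0 n r"

definition liouville_coeff1 :: "field \<Rightarrow> int \<Rightarrow> real \<Rightarrow> complex" where
  "liouville_coeff1 u n r = sqrt r *\<^sub>R circle_coeff1 u 0 n r + (1 / (2 * sqrt r)) *\<^sub>R circle_coeff u 0 n r"

lemma open_outside: "open {x::plane. norm x > R}"
  by (intro open_Collect_less continuous_intros)

lemma continuous_on_outside:
  "helmholtz q D u \<Longrightarrow> continuous_on D u"
  "helmholtz q D u \<Longrightarrow> continuous_on D (partial i u)"
  by (auto simp: helmholtz_def C2_on_def C1_on_imp_continuous_on)

lemma eventually_at_infinity_polar:
  assumes "\<forall>\<^sub>F x in at_infinity. P x"
  shows "\<forall>\<^sub>F r in at_top. \<forall>\<theta>. P (r *\<^sub>R unit_dir \<theta>)"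
proof -
  obtain b where b: "\<And>x. b \<le> norm x \<Longrightarrow> P x" using assms by (auto simp: eventually_at_infinity)
  show ?thesis
    using eventually_ge_at_top[of "max b 0"] by eventually_elim (auto intro!: b)
qed

lemma continuous_on_along_circle:
  assumes "continuous_on D f" "\<And>\<theta>. z + r *\<^sub>R unit_dir \<theta> \<in> D"
  shows "continuous_on T (\<lambda>\<theta>. f (z + r *\<^sub>R unit_dir \<theta>))"
  by (rule continuous_on_compose2[OF assms(1)])
    (use assms(2) in \<open>auto intro!: continuous_on_add continuous_on_scaleR continuous_on_const continuous_on_unit_dir continuous_on_id\<close>)

lemma continuous_on_radial_deriv:
  assumes "\<And>i. continuous_on D (partial i f)" "\<And>\<theta>. z + r *\<^sub>R unit_dir \<theta> \<in> D"
  shows "continuous_on T (radial_deriv f z r)"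
  unfolding radial_deriv_def
  by (intro continuous_on_add continuous_on_scaleR continuous_on_cos continuous_on_sin continuous_on_id
      continuous_on_along_circle[OF assms(1)] assms(2))

lemma tendsto_fourier_int_at_top:
  assumes c: "\<forall>\<^sub>F r in at_top. continuous_on {0..2*pi} (g r)"
    and e: "\<And>e. e > 0 \<Longrightarrow> \<forall>\<^sub>F r::real in at_top. \<forall>\<theta>. norm (g r \<theta>) \<le> e"
  shows "((\<lambda>r. fourier_int n (g r)) \<longlongrightarrow> 0) at_top"
proof (rule tendstoI)
  fix e :: real assume "e > 0"
  have "\<forall>\<^sub>F r in at_top. \<forall>\<theta>. norm (g r \<theta>) \<le> e / (4 * pi)" using \<open>e > 0\<close> by (intro e) auto
  with c show "\<forall>\<^sub>F r in at_top. dist (fourier_int n (g r)) 0 < e"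
  proof eventually_elim
    case (elim r)
    have "norm (fourier_int n (g r)) \<le> 2 * pi * (e / (4 * pi))"
      using elim by (intro norm_fourier_int_le) auto
    also have "\<dots> < e" using \<open>e > 0\<close> by simp
    finally show ?case by simp
  qed
qed

lemma far_limit_continuous:
  assumes u: "helmholtz q {x. norm x > R} u" and far: "far_limit k u A"
  shows "continuous_on (sphere 0 1) A"
proof -
  define f where "f r x = u (r *\<^sub>R x) * of_real (sqrt r) / exp (\<i> * of_real (k * r))" for r x
  have "uniform_limit (sphere 0 1) f A at_top"
    unfolding uniform_limit_iff
  proof (intro allI impI)
    fix e :: real assume "e > 0"
    then have "\<forall>\<^sub>F x in at_infinity. norm (u x * of_real (sqrt (norm x)) / exp (\<i> * of_real (k * norm x)) - A (x /\<^sub>R norm x)) < e"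
      using far unfolding far_limit_def tendsto_iff by (simp add: dist_norm)
    from eventually_at_infinity_polar[OF this] eventually_gt_at_top[of 0]
    show "\<forall>\<^sub>F r in at_top. \<forall>x\<in>sphere 0 1. dist (f r x) (A x) < e"
    proof eventually_elim
      case (elim r)
      show ?case
      proof
        fix x :: plane assume "x \<in> sphere 0 1"
        moreover obtain \<theta> where "x = norm x *\<^sub>R unit_dir \<theta>" using unit_dir_exists by blast
        ultimately have "x = unit_dir \<theta>" by simp
        then show "dist (f r x) (A x) < e" using elim(1)[rule_format, of \<theta>] elim(2)
          by (simp add: f_def dist_norm)
      qed
    qed
  qed
  moreover have "\<forall>\<^sub>F r in at_top. continuous_on (sphere 0 1) (f r)"
    using eventually_gt_at_top[of "max R 0"]
  proof eventually_elim
    case (elim r)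
    have "continuous_on (sphere 0 1) (\<lambda>x. u (r *\<^sub>R x))"
      using elim by (intro continuous_on_compose2[OF continuous_on_outside(1)[OF u]] continuous_intros) auto
    then show ?case unfolding f_def by (intro continuous_intros) auto
  qed
  ultimately show ?thesis
    by (intro uniform_limit_theorem[where F=at_top and f=f]) (auto simp: trivial_limit_at_top_linorder)
qed

context
  fixes k R :: real and u A :: field
  assumes k: "k > 0" and R: "R \<ge> 0" and rad: "radiating_outside k R u" and far: "far_limit k u A"
begin

lemma u_helmholtz: "helmholtz (of_real (k\<^sup>2)) {x. norm x > R} u"
  using rad by (simp add: radiating_outside_def)

lemma outside_polar: "r > R \<Longrightarrow> 0 + r *\<^sub>R unit_dir \<theta> \<in> {x. norm x > R}"
  using R by simp

lemma liouville_coeff_derivs: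
  assumes r: "r > R"
  shows "(liouville_coeff u n has_vector_derivative liouville_coeff1 u n r) (at r)"
    and "(liouville_coeff1 u n has_vector_derivative
        (((of_int n)\<^sup>2 - 1/4) / r\<^sup>2 - k\<^sup>2) *\<^sub>R liouville_coeff u n r) (at r)"
proof -
  obtain a2 where a2:
    "\<And>r. r \<in> {R<..} \<Longrightarrow> (circle_coeff u 0 n has_vector_derivative circle_coeff1 u 0 n r) (at r within {R<..})"
    "\<And>r. r \<in> {R<..} \<Longrightarrow> (circle_coeff1 u 0 n has_vector_derivative a2 r) (at r within {R<..})"
    "\<And>r. r \<in> {R<..} \<Longrightarrow> of_real (r\<^sup>2) * a2 r + of_real r * circle_coeff1 u 0 n r
        + (of_real (k\<^sup>2) * of_real (r\<^sup>2) - (of_int n)\<^sup>2) * circle_coeff u 0 n r = 0"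
    using bessel_equation[OF u_helmholtz, of "{R<..}" 0 n] outside_polar by auto
  have at: "at r within {R<..} = at r" using r by (intro at_within_open) auto
  have r': "r \<in> {R<..}" "r > 0" using r R by auto
  note L = liouville_substitution[where a="circle_coeff u 0 n" and ?a1.0="circle_coeff1 u 0 n" and ?a2.0=a2 and k=k and n=n, OF r'(2) a2(1)[OF r'(1), unfolded at] a2(2)[OF r'(1), unfolded at] a2(3)[OF r'(1)]]
  show "(liouville_coeff u n has_vector_derivative liouville_coeff1 u n r) (at r)"
    using L(1) unfolding liouville_coeff_def liouville_coeff1_def .
  show "(liouville_coeff1 u n has_vector_derivative
        (((of_int n)\<^sup>2 - 1/4) / r\<^sup>2 - k\<^sup>2) *\<^sub>R liouville_coeff u n r) (at r)"
    using L(2) unfolding liouville_coeff_def liouville_coeff1_def .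
qed

lemma continuous_A: "continuous_on (sphere 0 1) A"
  by (rule far_limit_continuous[OF u_helmholtz far])

lemma liouville_coeff_limit:
  "((\<lambda>r. liouville_coeff u n r / exp (\<i> * of_real (k * r))) \<longlongrightarrow> fourier_int n (\<lambda>\<theta>. A (unit_dir \<theta>))) at_top"
proof -
  define g where "g r \<theta> = of_real (sqrt r) / exp (\<i> * of_real (k * r)) * u (0 + r *\<^sub>R unit_dir \<theta>) + (-1) * A (unit_dir \<theta>)" for r \<theta>
  have cu: "continuous_on {0..2*pi} (\<lambda>\<theta>. u (0 + r *\<^sub>R unit_dir \<theta>))" if "r > R" for r
    by (rule continuous_on_along_circle[OF continuous_on_outside(1)[OF u_helmholtz] outside_polar[OF that]])
  have cA: "continuous_on {0..2*pi} (\<lambda>\<theta>. A (unit_dir \<theta>))" by (rule continuous_on_circle[OF continuous_A])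
  have "((\<lambda>r. fourier_int n (g r)) \<longlongrightarrow> 0) at_top"
  proof (rule tendsto_fourier_int_at_top)
    show "\<forall>\<^sub>F r in at_top. continuous_on {0..2*pi} (g r)"
      using eventually_gt_at_top[of R] unfolding g_def
      by eventually_elim (intro continuous_on_add continuous_on_mult continuous_on_const cu cA)
    fix e :: real assume "e > 0"
    then have "\<forall>\<^sub>F x in at_infinity. norm (u x * of_real (sqrt (norm x)) / exp (\<i> * of_real (k * norm x)) - A (x /\<^sub>R norm x)) < e"
      using far unfolding far_limit_def tendsto_iff by (simp add: dist_norm)
    from eventually_at_infinity_polar[OF this] eventually_gt_at_top[of 0]
    show "\<forall>\<^sub>F r in at_top. \<forall>\<theta>. norm (g r \<theta>) \<le> e"
      by eventually_elim (auto simp: g_def mult.commute less_imp_le)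
  qed
  moreover have "\<forall>\<^sub>F r in at_top. fourier_int n (g r) =
      liouville_coeff u n r / exp (\<i> * of_real (k * r)) - fourier_int n (\<lambda>\<theta>. A (unit_dir \<theta>))"
    using eventually_gt_at_top[of R]
  proof eventually_elim
    case (elim r)
    show ?case unfolding g_def fourier_int_linear[OF cu[OF elim] cA]
      by (simp add: liouville_coeff_def circle_coeff_def scaleR_conv_of_real)
  qed
  ultimately have "((\<lambda>r. liouville_coeff u n r / exp (\<i> * of_real (k * r)) - fourier_int n (\<lambda>\<theta>. A (unit_dir \<theta>))) \<longlongrightarrow> 0) at_top"
    by (rule Lim_transform_eventually)
  then show ?thesis by (simp add: LIM_zero_iff)
qed

lemma liouville_coeff_sommerfeld:
  "((\<lambda>r. liouville_coeff1 u n r - \<i> * of_real k * liouville_coeff u n r) \<longlongrightarrow> 0) at_top"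
proof -
  define g where "g r \<theta> = of_real (sqrt r) * radial_deriv u 0 r \<theta> + (- \<i> * of_real k * of_real (sqrt r)) * u (0 + r *\<^sub>R unit_dir \<theta>)" for r \<theta>
  have cu: "continuous_on {0..2*pi} (\<lambda>\<theta>. u (0 + r *\<^sub>R unit_dir \<theta>))" if "r > R" for r
    by (rule continuous_on_along_circle[OF continuous_on_outside(1)[OF u_helmholtz] outside_polar[OF that]])
  have cr: "continuous_on {0..2*pi} (radial_deriv u 0 r)" if "r > R" for r
    by (rule continuous_on_radial_deriv[OF continuous_on_outside(2)[OF u_helmholtz] outside_polar[OF that]])
  have 1: "((\<lambda>r. fourier_int n (g r)) \<longlongrightarrow> 0) at_top"
  proof (rule tendsto_fourier_int_at_top)
    show "\<forall>\<^sub>F r in at_top. continuous_on {0..2*pi} (g r)"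
      using eventually_gt_at_top[of R] unfolding g_def
      by eventually_elim (intro continuous_on_add continuous_on_mult continuous_on_const cu cr)
    fix e :: real assume "e > 0"
    have "sommerfeld k u" using rad by (simp add: radiating_outside_def)
    with \<open>e > 0\<close> have "\<forall>\<^sub>F x in at_infinity. norm (of_real (sqrt (norm x)) *
           (frechet_derivative u (at x) (x /\<^sub>R norm x) - \<i> * of_real k * u x)) < e"
      unfolding sommerfeld_def tendsto_iff by (simp add: dist_norm)
    from eventually_at_infinity_polar[OF this] eventually_gt_at_top[of R]
    show "\<forall>\<^sub>F r in at_top. \<forall>\<theta>. norm (g r \<theta>) \<le> e"
    proof eventually_elim
      case (elim r)
      show ?case
      proof
        fix \<theta>
        have r: "r > 0" using elim(2) R by simp
        have "u differentiable (at (0 + r *\<^sub>R unit_dir \<theta>))"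
          using u_helmholtz outside_polar[OF elim(2)] unfolding helmholtz_def C2_on_def C1_on_def by blast
        then have "radial_deriv u 0 r \<theta> = frechet_derivative u (at (r *\<^sub>R unit_dir \<theta>)) (unit_dir \<theta>)"
          by (simp add: frechet_derivative_partial radial_deriv_def)
        then show "norm (g r \<theta>) \<le> e" using elim(1)[rule_format, of \<theta>] r
          by (simp add: g_def algebra_simps)
      qed
    qed
  qed
  have nz: "((\<lambda>r. liouville_coeff u n r * of_real (1 / (2 * r))) \<longlongrightarrow> 0) at_top"
  proof (rule tendsto_norm_zero_cancel)
    have "((\<lambda>r. norm (liouville_coeff u n r / exp (\<i> * of_real (k * r))) * (1 / (2 * r))) \<longlongrightarrow> norm (fourier_int n (\<lambda>\<theta>. A (unit_dir \<theta>))) * 0) at_top"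
      (is "(?f \<longlongrightarrow> _) _")
    proof (intro tendsto_mult tendsto_norm liouville_coeff_limit)
      show "((\<lambda>r::real. 1 / (2 * r)) \<longlongrightarrow> 0) at_top" by (intro tendsto_divide_0[OF tendsto_const] filterlim_at_top_imp_at_infinity filterlim_tendsto_pos_mult_at_top[OF tendsto_const] filterlim_ident) simp
    qed
    moreover have "\<forall>\<^sub>F r in at_top. norm (liouville_coeff u n r / exp (\<i> * of_real (k * r))) * (1 / (2 * r)) = norm (liouville_coeff u n r * of_real (1 / (2 * r)))"
      using eventually_gt_at_top[of 0] by eventually_elim (simp add: norm_divide norm_mult)
    ultimately show "((\<lambda>r. norm (liouville_coeff u n r * of_real (1 / (2 * r)))) \<longlongrightarrow> 0) at_top"
      by (subst (asm) mult_zero_right) (rule Lim_transform_eventually)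
  qed
  have "\<forall>\<^sub>F r in at_top. fourier_int n (g r) + liouville_coeff u n r * of_real (1 / (2 * r))
     = liouville_coeff1 u n r - \<i> * of_real k * liouville_coeff u n r"
    using eventually_gt_at_top[of R]
  proof eventually_elim
    case (elim r)
    have r: "r > 0" using elim R by simp
    have "sqrt r * (1 / (2 * r)) = 1 / (2 * sqrt r)" using r by (simp add: field_simps)
    then have "complex_of_real (sqrt r) * of_real (1 / (2 * r)) = of_real (1 / (2 * sqrt r))"
      by (metis of_real_mult)
    then have "liouville_coeff u n r * of_real (1 / (2 * r)) = of_real (1 / (2 * sqrt r)) * circle_coeff u 0 n r"
      unfolding liouville_coeff_def scaleR_conv_of_real by (metis mult.assoc mult.commute)
    then show ?case unfolding g_def fourier_int_linear[OF cr[OF elim] cu[OF elim]]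
      by (simp add: liouville_coeff_def liouville_coeff1_def circle_coeff_def circle_coeff1_def scaleR_conv_of_real)
  qed
  from Lim_transform_eventually[OF _ this, of 0] tendsto_add[OF 1 nz] show ?thesis by simp
qed

text \<open>For large \<open>n\<close> the coefficient is convex over a fixed range of radii, so bounds at both ends
  make it exponentially small between them. The conserved Wronskian transfers this smallness to infinity, that is, to
  the far field.\<close>

lemma far_coeff_decay:
  obtains C q where "0 < q" "q < 1"
    "\<And>n. norm (fourier_int n (\<lambda>\<theta>. A (unit_dir \<theta>))) \<le> C * q ^ nat \<bar>n\<bar>"
proof -
  define \<rho> where "\<rho> = R + 3"
  define c where "c = R + 2"
  have \<rho>: "\<rho> > 0" using R by (simp add: \<rho>_def)
  define K where "K = cball (0::plane) \<rho> - ball 0 (R + 1)"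
  have K: "compact K" unfolding K_def by (intro compact_diff) auto
  have Ksub: "K \<subseteq> {x. norm x > R}" by (auto simp: K_def)
  have "bounded (u ` K)" "\<And>i. bounded (partial i u ` K)"
    by (intro compact_imp_bounded compact_continuous_image[OF _ K] continuous_on_subset[OF _ Ksub]
        continuous_on_outside[OF u_helmholtz])+
  then obtain M M1 M2 where M: "\<And>x. x \<in> K \<Longrightarrow> norm (u x) \<le> M"
      "\<And>x. x \<in> K \<Longrightarrow> norm (partial 1 u x) \<le> M1" "\<And>x. x \<in> K \<Longrightarrow> norm (partial 2 u x) \<le> M2"
    unfolding bounded_iff image_iff by (metis imageI)
  have inK: "0 + r *\<^sub>R unit_dir \<theta> \<in> K" if "r \<in> {c - 1..c + 1}" for r \<theta>
    using that R by (auto simp: K_def c_def \<rho>_def)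
  have out: "r > R" if "r \<in> {c - 1..c + 1}" for r using that by (auto simp: c_def)
  have cc: "c \<in> {c - 1..c + 1}" by simp
  have M0: "M \<ge> 0" "M1 \<ge> 0" "M2 \<ge> 0"
    using M[OF inK[OF cc, of 0]] by (meson norm_ge_zero order_trans)+
  have bound: "norm (circle_coeff u 0 n r) \<le> 2 * pi * M" if "r \<in> {c - 1..c + 1}" for n r
    unfolding circle_coeff_def
    by (intro norm_fourier_int_le M inK that
        continuous_on_along_circle[OF continuous_on_outside(1)[OF u_helmholtz] outside_polar[OF out[OF that]]])
  have bound1: "norm (circle_coeff1 u 0 n c) \<le> 2 * pi * (M1 + M2)" for n
    unfolding circle_coeff1_def
  proof (rule norm_fourier_int_le)
    show "continuous_on {0..2 * pi} (radial_deriv u 0 c)"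
      by (rule continuous_on_radial_deriv[OF continuous_on_outside(2)[OF u_helmholtz] outside_polar[OF out[OF cc]]])
    fix \<theta>
    have "norm (radial_deriv u 0 c \<theta>) \<le> \<bar>cos \<theta>\<bar> * norm (partial 1 u (0 + c *\<^sub>R unit_dir \<theta>)) + \<bar>sin \<theta>\<bar> * norm (partial 2 u (0 + c *\<^sub>R unit_dir \<theta>))"
      unfolding radial_deriv_def by (rule order_trans[OF norm_triangle_ineq]) simp
    also have "\<dots> \<le> 1 * M1 + 1 * M2"
      using M inK[OF cc] M0 by (intro add_mono mult_mono) auto
    finally show "norm (radial_deriv u 0 c \<theta>) \<le> M1 + M2" by simp
  qed
  define B where "B = sqrt \<rho> * (2 * pi * M)"
  define B1 where "B1 = sqrt \<rho> * (2 * pi * (M1 + M2)) + 2 * pi * M"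
  have B0: "B \<ge> 0" "B1 \<ge> 0" using M0 \<rho> by (auto simp: B_def B1_def)
  have lb: "norm (liouville_coeff u n r) \<le> B" if r: "r \<in> {c - 1..c + 1}" for n r
  proof -
    have "\<bar>sqrt r\<bar> \<le> sqrt \<rho>" using r R by (auto simp: c_def \<rho>_def)
    then show ?thesis unfolding liouville_coeff_def B_def norm_scaleR
      using bound[OF r] \<rho> by (intro mult_mono) auto
  qed
  have lb1: "norm (liouville_coeff1 u n c) \<le> B1" for n
  proof -
    have s: "\<bar>sqrt c\<bar> \<le> sqrt \<rho>" using R by (auto simp: c_def \<rho>_def)
    have "sqrt c \<ge> 1" using R by (simp add: c_def)
    then have "1 \<le> 2 * sqrt c" by linarith
    then have "1 / (2 * sqrt c) \<le> 1" "0 \<le> 1 / (2 * sqrt c)" by (auto simp only: divide_le_eq_1 zero_le_divide_iff)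
    then have s': "\<bar>1 / (2 * sqrt c)\<bar> \<le> 1" by (simp only: abs_of_nonneg)
    have "norm (liouville_coeff1 u n c) \<le> \<bar>sqrt c\<bar> * norm (circle_coeff1 u 0 n c) + \<bar>1 / (2 * sqrt c)\<bar> * norm (circle_coeff u 0 n c)"
      unfolding liouville_coeff1_def by (rule order_trans[OF norm_triangle_ineq]) simp
    also have "\<dots> \<le> sqrt \<rho> * (2 * pi * (M1 + M2)) + 1 * (2 * pi * M)"
      using bound[OF cc] bound1 s s' \<rho> by (intro add_mono mult_mono) auto
    finally show ?thesis by (simp add: B1_def)
  qed
  define N where "N = 1/2 + 2 * k\<^sup>2 * \<rho>\<^sup>2"
  have N0: "N > 0" unfolding N_def by (intro add_pos_nonneg) auto
  define a where "a n = norm (fourier_int n (\<lambda>\<theta>. A (unit_dir \<theta>)))" for n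
  have big: "k * (a n)\<^sup>2 \<le> 2 * B * B1 * exp (- (\<bar>of_int n\<bar> / (2 * \<rho>)))" if n: "(of_int n)\<^sup>2 \<ge> N" for n
  proof -
    define b where "b = liouville_coeff u n"
    define b1 where "b1 = liouville_coeff1 u n"
    define p where "p r = ((of_int n)\<^sup>2 - 1/4) / r\<^sup>2 - k\<^sup>2" for r
    define \<kappa> where "\<kappa> = \<bar>of_int n\<bar> / \<rho>"
    note d = liouville_coeff_derivs[of _ n, folded b_def b1_def, folded p_def]
    have conv: "2 * (b1 r \<bullet> b1 r) + 2 * p r * (b r \<bullet> b r) \<ge> \<kappa>\<^sup>2 * (b r \<bullet> b r)" if r: "r \<in> {c - 1..c + 1}" for r
    proof -
      have r': "0 < r" "r \<le> \<rho>" using r R by (auto simp: c_def \<rho>_def)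
      have q: "(of_int n)\<^sup>2 - 1/4 \<ge> (0::real)" 
      proof -
        have "N \<ge> 1/2" by (simp add: N_def)
        with n show ?thesis by linarith
      qed
      have "2 * (((of_int n)\<^sup>2 - 1/4) / \<rho>\<^sup>2 - k\<^sup>2) - (of_int n)\<^sup>2 / \<rho>\<^sup>2 = ((of_int n)\<^sup>2 - N) / \<rho>\<^sup>2"
        using \<rho> by (simp add: N_def field_simps)
      then have "\<kappa>\<^sup>2 \<le> 2 * (((of_int n)\<^sup>2 - 1/4) / \<rho>\<^sup>2 - k\<^sup>2)"
      proof -
        have "0 \<le> ((of_int n)\<^sup>2 - N) / \<rho>\<^sup>2" using n by simp
        moreover have "\<kappa>\<^sup>2 = (of_int n)\<^sup>2 / \<rho>\<^sup>2" by (simp add: \<kappa>_def power_divide)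
        ultimately show ?thesis
          using \<open>2 * (((of_int n)\<^sup>2 - 1/4) / \<rho>\<^sup>2 - k\<^sup>2) - (of_int n)\<^sup>2 / \<rho>\<^sup>2 = ((of_int n)\<^sup>2 - N) / \<rho>\<^sup>2\<close>
          by linarith
      qed
      also have "((of_int n)\<^sup>2 - 1/4) / \<rho>\<^sup>2 \<le> ((of_int n)\<^sup>2 - 1/4) / r\<^sup>2"
        using q r' by (intro divide_left_mono power_mono mult_pos_pos) auto
      finally have "\<kappa>\<^sup>2 \<le> 2 * p r" by (simp add: p_def)
      then have "\<kappa>\<^sup>2 * (b r \<bullet> b r) \<le> 2 * p r * (b r \<bullet> b r)" by (intro mult_right_mono) auto
      then show ?thesis using inner_ge_zero[of "b1 r"] by linarith
    qed
    have "2 * cosh (\<kappa> * 1) * (b c \<bullet> b c) \<le> b (c + 1) \<bullet> b (c + 1) + b (c - 1) \<bullet> b (c - 1)"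
    proof (rule convex_midpoint_decay[where ?y1.0="\<lambda>r. 2 * (b r \<bullet> b1 r)" and ?y2.0="\<lambda>r. 2 * (b1 r \<bullet> b1 r) + 2 * p r * (b r \<bullet> b r)"])
      fix r assume r: "r \<in> {c - 1..c + 1}"
      show "((\<lambda>r. b r \<bullet> b r) has_real_derivative 2 * (b r \<bullet> b1 r)) (at r)"
        using inner_has_real_derivative[OF d(1)[OF out[OF r]] d(1)[OF out[OF r]]] by (simp add: inner_commute)
      show "((\<lambda>r. 2 * (b r \<bullet> b1 r)) has_real_derivative 2 * (b1 r \<bullet> b1 r) + 2 * p r * (b r \<bullet> b r)) (at r)"
        using DERIV_cmult[OF inner_has_real_derivative[OF d(1)[OF out[OF r]] d(2)[OF out[OF r]]], of 2]
        by (simp add: algebra_simps)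
      show "\<kappa>\<^sup>2 * (b r \<bullet> b r) \<le> 2 * (b1 r \<bullet> b1 r) + 2 * p r * (b r \<bullet> b r)" by (rule conv[OF r])
    qed simp
    also have "\<dots> \<le> B\<^sup>2 + B\<^sup>2"
      unfolding power2_norm_eq_inner[symmetric] b_def by (intro add_mono power_mono lb) auto
    finally have "2 * cosh \<kappa> * (norm (b c))\<^sup>2 \<le> 2 * B\<^sup>2" by (simp add: power2_norm_eq_inner)
    moreover have "exp \<kappa> * (norm (b c))\<^sup>2 \<le> 2 * cosh \<kappa> * (norm (b c))\<^sup>2"
      by (intro mult_right_mono) (auto simp: cosh_def)
    ultimately have "exp \<kappa> * (norm (b c))\<^sup>2 \<le> 2 * B\<^sup>2" by linarith
    then have "(norm (b c))\<^sup>2 \<le> 2 * B\<^sup>2 * exp (- \<kappa>)" by (simp add: exp_minus field_simps)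
    also have "\<dots> \<le> (2 * B * exp (- \<kappa> / 2))\<^sup>2"
      by (simp add: power_mult_distrib flip: exp_of_nat_mult)
    finally have nb: "norm (b c) \<le> 2 * B * exp (- \<kappa> / 2)"
      by (rule power2_le_imp_le) (use B0 in auto)
    have "k * (a n)\<^sup>2 = b1 c \<bullet> (\<i> * b c)"
      unfolding a_def
      by (rule wronskian_far_field[OF d, of R, OF _ _ liouville_coeff_limit[of n, folded b_def]
            liouville_coeff_sommerfeld[of n, folded b_def b1_def] out[OF cc]])
    also have "\<dots> \<le> norm (b1 c) * norm (\<i> * b c)" by (rule norm_cauchy_schwarz)
    also have "norm (\<i> * b c) = norm (b c)" by (simp add: norm_mult)
    also have "norm (b1 c) * norm (b c) \<le> B1 * (2 * B * exp (- \<kappa> / 2))"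
      using nb lb1[of n] B0 by (intro mult_mono[OF _ nb]) (auto simp: b1_def)
    finally show ?thesis by (simp add: \<kappa>_def mult_ac)
  qed
  obtain MA where MA: "\<And>x. x \<in> sphere 0 1 \<Longrightarrow> norm (A x) \<le> MA"
    using compact_imp_bounded[OF compact_continuous_image[OF continuous_A compact_sphere]] unfolding bounded_iff by blast
  have aM: "a n \<le> 2 * pi * MA" for n
    unfolding a_def by (intro norm_fourier_int_le continuous_on_circle[OF continuous_A] MA) auto
  define q where "q = exp (- (1 / (4 * \<rho>)))"
  have q: "0 < q" "q < 1" using \<rho> by (auto simp: q_def)
  define m where "m = nat \<lceil>N\<rceil>"
  define C where "C = sqrt (2 * B * B1 / k) + 2 * pi * \<bar>MA\<bar> / q ^ m"
  have "a n \<le> C * q ^ nat \<bar>n\<bar>" for n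
  proof (cases "(of_int n)\<^sup>2 \<ge> N")
    case True
    have qn: "(q ^ nat \<bar>n\<bar>)\<^sup>2 = exp (- (\<bar>of_int n\<bar> / (2 * \<rho>)))"
      using \<rho> by (simp add: q_def field_simps flip: exp_of_nat_mult)
    have "(a n)\<^sup>2 \<le> 2 * B * B1 / k * (q ^ nat \<bar>n\<bar>)\<^sup>2"
      using big[OF True] k unfolding qn by (simp add: field_simps)
    also have "\<dots> = (sqrt (2 * B * B1 / k) * q ^ nat \<bar>n\<bar>)\<^sup>2"
      using B0 k by (simp add: power_mult_distrib)
    finally have "a n \<le> sqrt (2 * B * B1 / k) * q ^ nat \<bar>n\<bar>"
      by (rule power2_le_imp_le) (use B0 k q in auto)
    also have "\<dots> \<le> C * q ^ nat \<bar>n\<bar>" using q by (intro mult_right_mono) (auto simp: C_def)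
    finally show ?thesis .
  next
    case False
    have "nat \<bar>n\<bar> \<le> m"
    proof -
      have "real_of_int \<bar>n\<bar> \<le> (of_int n)\<^sup>2"
      proof -
        have "\<bar>n\<bar> \<le> n\<^sup>2" by (metis abs_le_self_iff abs_ge_zero int_one_le_iff_zero_less le_less mult_le_cancel_right1 not_less power2_abs power2_eq_square)
        then show ?thesis by (metis of_int_le_iff of_int_power)
      qed
      also have "\<dots> \<le> N" using False by simp
      also have "\<dots> \<le> of_int \<lceil>N\<rceil>" by simp
      finally show ?thesis by (simp add: m_def)
    qed
    then have "q ^ m \<le> q ^ nat \<bar>n\<bar>" using q by (intro power_decreasing) auto
    have "a n \<le> 2 * pi * \<bar>MA\<bar>" using aM[of n] by (smt (verit) mult_left_mono pi_gt_zero)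
    also have "\<dots> = 2 * pi * \<bar>MA\<bar> / q ^ m * q ^ m" using q by simp
    also have "\<dots> \<le> C * q ^ nat \<bar>n\<bar>"
      using \<open>q ^ m \<le> q ^ nat \<bar>n\<bar>\<close> q B0 k by (intro mult_mono) (auto simp: C_def)
    finally show ?thesis .
  qed
  then show ?thesis using that q unfolding a_def by blast
qed

text \<open>Rellich's lemma: a zero pattern forces every Fourier coefficient, times the square root of the radius, to
  tend to zero, which no nonzero solution of Bessel's equation does.\<close>

lemma zero_far_field_imp_zero:
  assumes A0: "\<And>x. x \<in> sphere 0 1 \<Longrightarrow> A x = 0" and x: "norm x > R"
  shows "u x = 0"
proof -
  have a0: "fourier_int n (\<lambda>\<theta>. A (unit_dir \<theta>)) = 0" for n by (simp add: A0 fourier_int_def)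
  have b0: "liouville_coeff u n r = 0" if "r > R" for n r
  proof -
    have l: "((\<lambda>r. norm (liouville_coeff u n r)) \<longlongrightarrow> 0) at_top"
      using tendsto_norm[OF liouville_coeff_limit[of n]] by (simp add: a0 norm_divide)
    then have l0: "((\<lambda>r. liouville_coeff u n r) \<longlongrightarrow> 0) at_top" by (rule tendsto_norm_zero_cancel)
    have "((\<lambda>r. (liouville_coeff1 u n r - \<i> * of_real k * liouville_coeff u n r) + \<i> * of_real k * liouville_coeff u n r) \<longlongrightarrow> 0 + \<i> * of_real k * 0) at_top"
      by (intro tendsto_add tendsto_mult tendsto_const l0 liouville_coeff_sommerfeld)
    then have l1: "((\<lambda>r. liouville_coeff1 u n r) \<longlongrightarrow> 0) at_top" by simp
    define R' where "R' = (R + r) / 2"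
    have R': "R' > 0" "R' < r" "R' \<ge> R" using that R by (auto simp: R'_def)
    show ?thesis
      by (rule no_decaying_solution[OF k R'(1) liouville_coeff_derivs[of _ n] l0 l1 R'(2)]) (use R' in auto)
  qed
  define r where "r = norm x"
  have r: "r > R" "r > 0" using x R by (auto simp: r_def)
  define f where "f y = u (r *\<^sub>R y)" for y
  have cf: "continuous_on (sphere 0 1) f"
    unfolding f_def using r
    by (intro continuous_on_compose2[OF continuous_on_outside(1)[OF u_helmholtz]] continuous_intros) auto
  have f0: "fourier_int n (\<lambda>\<theta>. f (unit_dir \<theta>)) = 0" for n
    using b0[OF r(1), of n] r by (simp add: liouville_coeff_def circle_coeff_def f_def)
  have "f (x /\<^sub>R r) = 0"
    by (rule fourier_unique[OF cf f0]) (use r in \<open>simp add: r_def\<close>)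
  then show ?thesis using r by (simp add: f_def)
qed

end

text \<open>The far-field pattern of a radiating field is analytic, so it cannot vanish on an arc unless it vanishes identically.\<close>

theorem far_field_product_nonzero:
  assumes k: "k > 0" "R \<ge> 0"
    and u: "radiating_outside k R u" "far_limit k u A" and v: "radiating_outside k R v" "far_limit k v B"
    and AB: "\<And>x. x \<in> sphere 0 1 \<Longrightarrow> A x * B x = 0"
  shows "(\<forall>x. norm x > R \<longrightarrow> u x = 0) \<or> (\<forall>x. norm x > R \<longrightarrow> v x = 0)"
proof (cases "\<forall>x\<in>sphere 0 1. A x = 0")
  case True
  then show ?thesis using zero_far_field_imp_zero[OF k u] by blast
next
  case False
  then obtain w where w: "w \<in> sphere 0 1" "A w \<noteq> 0" by blast
  have "\<exists>W. open W \<and> w \<in> W \<and> (\<forall>y\<in>W \<inter> sphere 0 1. A y \<noteq> 0)"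
  proof -
    have "openin (top_of_set (sphere 0 1)) (sphere 0 1 \<inter> A -` (- {0}))"
      using continuous_openin_preimage_gen[OF continuous_A[OF k u], of "- {0}"] by auto
    then obtain W where "open W" "sphere 0 1 \<inter> A -` (- {0}) = sphere 0 1 \<inter> W" by (auto simp: openin_open)
    then show ?thesis using w by blast
  qed
  then obtain W where W: "open W" "w \<in> W" "\<And>y. y \<in> W \<inter> sphere 0 1 \<Longrightarrow> A y \<noteq> 0" by blast
  obtain C q where q: "0 < q" "q < 1" "\<And>n. norm (fourier_int n (\<lambda>\<theta>. B (unit_dir \<theta>))) \<le> C * q ^ nat \<bar>n\<bar>"
    using far_coeff_decay[OF k v] by blast
  have "B x = 0" if "x \<in> sphere 0 1" for x
    by (rule analytic_on_circle_zero[OF continuous_A[OF k v] q(3,1,2) W(1,2) w(1) _ that])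
      (use W(3) AB in auto)
  then show ?thesis using zero_far_field_imp_zero[OF k v] by blast
qed

section \<open>Unique continuation\<close>

text \<open>The Fourier coefficients on circles about the centre are bounded solutions of Bessel's equation that
  vanish near the centre, and a solution of a linear ordinary differential equation with zero data vanishes.\<close>

lemma zero_in_concentric_ball:
  fixes k :: real
  assumes u: "helmholtz (of_real (k\<^sup>2)) (ball z \<rho>) u" and \<delta>: "\<delta> > 0" "\<And>x. x \<in> ball z \<delta> \<Longrightarrow> u x = 0"
    and x: "x \<in> ball z \<rho>"
  shows "u x = 0"
proof (cases "x \<in> ball z \<delta>")
  case True
  then show ?thesis by (rule \<delta>)
next
  case False
  define r1 where "r1 = norm (x - z)"
  define r0 where "r0 = \<delta> / 2"
  have r: "0 < r0" "r0 < \<delta>" "r0 \<le> r1" "r1 < \<rho>"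
    using \<delta> x False by (auto simp: r0_def r1_def dist_norm norm_minus_commute)
  let ?S = "{0<..<\<rho>}"
  have S: "z + r *\<^sub>R unit_dir \<theta> \<in> ball z \<rho>" if "r \<in> ?S" for r \<theta> using that by (simp add: dist_norm)
  have zero: "circle_coeff u z n r1 = 0" for n
  proof -
    let ?a = "circle_coeff u z n" and ?a1 = "circle_coeff1 u z n"
    obtain a2 where a2:
      "\<And>r. r \<in> ?S \<Longrightarrow> (?a has_vector_derivative ?a1 r) (at r within ?S)"
      "\<And>r. r \<in> ?S \<Longrightarrow> (?a1 has_vector_derivative a2 r) (at r within ?S)"
      "\<And>r. r \<in> ?S \<Longrightarrow> of_real (r\<^sup>2) * a2 r + of_real r * ?a1 r
        + (of_real (k\<^sup>2) * of_real (r\<^sup>2) - (of_int n)\<^sup>2) * ?a r = 0"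
      using bessel_equation[OF u, of ?S z n] S by auto
    define b b1 where "b r = sqrt r *\<^sub>R ?a r" and "b1 r = sqrt r *\<^sub>R ?a1 r + (1 / (2 * sqrt r)) *\<^sub>R ?a r" for r
    define p where "p r = ((of_int n)\<^sup>2 - 1/4) / r\<^sup>2 - k\<^sup>2" for r
    have d: "(b has_vector_derivative b1 r) (at r)" "(b1 has_vector_derivative p r *\<^sub>R b r) (at r)" if "r \<in> {r0..r1}" for r
    proof -
      have r': "r \<in> ?S" "r > 0" using that r by auto
      have at: "at r within ?S = at r" using r' by (intro at_within_open) auto
      note L = liouville_substitution[where a="?a" and ?a1.0="?a1" and ?a2.0=a2 and k=k and n=n,
          OF r'(2) a2(1)[OF r'(1), unfolded at] a2(2)[OF r'(1), unfolded at] a2(3)[OF r'(1)]]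
      show "(b has_vector_derivative b1 r) (at r)" using L(1) unfolding b_def b1_def .
      show "(b1 has_vector_derivative p r *\<^sub>R b r) (at r)" using L(2) unfolding b_def b1_def p_def .
    qed
    have "continuous_on {r0..r1} p" unfolding p_def using r by (intro continuous_intros) auto
    then have "bounded (p ` {r0..r1})" by (intro compact_imp_bounded compact_continuous_image) auto
    then obtain C where C: "\<And>r. r \<in> {r0..r1} \<Longrightarrow> \<bar>p r\<bar> \<le> C"
      unfolding bounded_iff by (metis imageI real_norm_def)
    have near: "z + r0 *\<^sub>R unit_dir \<theta> \<in> ball z \<delta>" for \<theta> using r by (simp add: dist_norm)
    have "partial i u (z + r0 *\<^sub>R unit_dir \<theta>) = 0" for i \<theta>
    proof -
      have "partial i u (z + r0 *\<^sub>R unit_dir \<theta>) = partial i (\<lambda>x. 0) (z + r0 *\<^sub>R unit_dir \<theta>)"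
        by (rule partial_cong_open[OF open_ball near]) (rule \<delta>)
      then show ?thesis using partial_eqI[OF has_derivative_const] by metis
    qed
    then have "b1 r0 = 0" "b r0 = 0"
      using \<delta>(2)[OF near] by (simp_all add: b_def b1_def circle_coeff_def circle_coeff1_def radial_deriv_def fourier_int_def)
    then have "b r1 = 0"
      by (intro linear_ode_zero_forward[OF d C _ _ r(3)]) auto
    then show ?thesis using r by (simp add: b_def)
  qed
  define f where "f y = u (z + r1 *\<^sub>R y)" for y
  have r1: "r1 > 0" using r by simp
  have cf: "continuous_on (sphere 0 1) f"
    unfolding f_def using r
    by (intro continuous_on_compose2[OF continuous_on_outside(1)[OF u]] continuous_intros) (auto simp: dist_norm)
  have "f ((x - z) /\<^sub>R r1) = 0"
    by (rule fourier_unique[OF cf]) (use zero r1 in \<open>auto simp: circle_coeff_def f_def r1_def\<close>)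
  then show ?thesis using r1 by (simp add: f_def)
qed

text \<open>The points near which \<open>u\<close> vanishes form an open set. It is also relatively closed, because
  zeros propagate from a small ball to a concentric ball of uniform size.\<close>

theorem unique_continuation:
  fixes k :: real
  assumes D: "open D" "connected D" and u: "helmholtz (of_real (k\<^sup>2)) D u"
    and W: "open W" "W \<noteq> {}" "W \<subseteq> D" "\<And>x. x \<in> W \<Longrightarrow> u x = 0" and x: "x \<in> D"
  shows "u x = 0"
proof -
  define Z where "Z = interior {x \<in> D. u x = 0}"
  have Z: "open Z" "Z \<subseteq> D" "\<And>x. x \<in> Z \<Longrightarrow> u x = 0" using interior_subset by (auto simp: Z_def)
  have "W \<subseteq> Z" unfolding Z_def using W by (intro interior_maximal) auto
  have closed: "y \<in> Z" if y: "y \<in> D" "y \<in> closure Z" for y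
  proof -
    obtain \<epsilon> where \<epsilon>: "\<epsilon> > 0" "ball y (2 * \<epsilon>) \<subseteq> D"
      using open_contains_ball[of D] D(1) y(1) by (metis field_sum_of_halves half_gt_zero mult_2)
    obtain z where z: "z \<in> Z" "dist z y < \<epsilon>" using y(2) \<epsilon>(1) by (auto simp: closure_approachable)
    have sub: "ball z \<epsilon> \<subseteq> D" using \<epsilon>(2) z(2) dist_triangle_less_add[of _ z] 
      by (intro order_trans[OF _ \<epsilon>(2)]) (auto simp: mem_ball dist_commute, metis dist_commute dist_triangle_less_add mult_2)
    obtain \<delta> where \<delta>: "\<delta> > 0" "ball z \<delta> \<subseteq> Z" using Z(1) z(1) open_contains_ball by blast
    have hz: "helmholtz (of_real (k\<^sup>2)) (ball z \<epsilon>) u"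
      using u sub C2_on_subset unfolding helmholtz_def by blast
    have "u w = 0" if "w \<in> ball z \<epsilon>" for w
      by (rule zero_in_concentric_ball[OF hz \<delta>(1) _ that]) (use \<delta>(2) Z(3) in blast)
    then have "ball z \<epsilon> \<subseteq> Z" unfolding Z_def using sub by (intro interior_maximal) auto
    then show ?thesis using z(2) by auto
  qed
  have "D \<subseteq> Z"
  proof (rule ccontr)
    assume "\<not> D \<subseteq> Z"
    then have "- closure Z \<inter> D \<noteq> {}" using closed by blast
    moreover have "Z \<inter> D \<noteq> {}" using \<open>W \<subseteq> Z\<close> W by blast
    moreover have "D \<subseteq> Z \<union> - closure Z" using closed by blast
    moreover have "Z \<inter> - closure Z \<inter> D = {}" using closure_subset by blast
    ultimately show False using connectedD[OF D(2) Z(1) open_Compl[OF closed_closure]] by blast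
  qed
  then show ?thesis using Z(3) x by blast
qed

section \<open>Interior gradient estimate\<close>

lemma vector_derivative_bound:
  fixes f :: "real \<Rightarrow> 'a::real_normed_vector"
  assumes "\<And>x. x \<in> {a..b} \<Longrightarrow> (f has_vector_derivative f' x) (at x within {a..b})"
    and "\<And>x. x \<in> {a..b} \<Longrightarrow> norm (f' x) \<le> B" and "a \<le> b"
  shows "norm (f b - f a) \<le> B * (b - a)"
proof -
  have "norm (f b - f a) \<le> B * norm (b - a)"
  proof (rule differentiable_bound[of "{a..b}"])
    fix x assume x: "x \<in> {a..b}"
    show "(f has_derivative (\<lambda>h. h *\<^sub>R f' x)) (at x within {a..b})"
      using assms(1)[OF x] by (simp add: has_vector_derivative_def)
    show "onorm (\<lambda>h. h *\<^sub>R f' x) \<le> B"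
      by (rule onorm_le) (use mult_right_mono[OF assms(2)[OF x] abs_ge_zero] in \<open>simp add: mult.commute\<close>)
  qed (use assms(3) in auto)
  then show ?thesis using assms(3) by simp
qed

text \<open>For \<open>n = \<plusminus>1\<close> the function \<open>c = a' + a/r\<close> satisfies \<open>c' = -k\<^sup>2 a\<close> and \<open>(r a)' = r c\<close>, so \<open>c(0) = 2 a'(0)\<close>,
  a combination of the partial derivatives at the centre, is controlled by the supremum of \<open>u\<close>.\<close>

lemma gradient_estimate_coeff:
  fixes k :: real and n :: int
  assumes u: "helmholtz (of_real (k\<^sup>2)) D u" and D: "cball z 1 \<subseteq> D"
    and M: "\<And>x. x \<in> cball z 1 \<Longrightarrow> norm (u x) \<le> M" and n: "n = 1 \<or> n = -1"
  shows "norm (circle_coeff1 u z n 0) \<le> 2 * pi * M * (1 + k\<^sup>2)"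
proof -
  let ?a = "circle_coeff u z n" and ?a1 = "circle_coeff1 u z n"
  define B where "B = 2 * pi * M"
  let ?I = "{0..1::real}"
  have S: "z + r *\<^sub>R unit_dir \<theta> \<in> cball z 1" if "r \<in> ?I" for r \<theta> using that by (simp add: dist_norm)
  have S': "z + r *\<^sub>R unit_dir \<theta> \<in> D" if "r \<in> ?I" for r \<theta> using S[OF that] D by blast
  obtain a2 where a2:
      "\<And>r. r \<in> ?I \<Longrightarrow> (?a has_vector_derivative ?a1 r) (at r within ?I)"
      "\<And>r. r \<in> ?I \<Longrightarrow> (?a1 has_vector_derivative a2 r) (at r within ?I)"
      "\<And>r. r \<in> ?I \<Longrightarrow> of_real (r\<^sup>2) * a2 r + of_real r * ?a1 r
        + (of_real (k\<^sup>2) * of_real (r\<^sup>2) - (of_int n)\<^sup>2) * ?a r = 0"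
    using bessel_equation[OF u, of ?I z n] S' by auto
  have aB: "norm (?a r) \<le> B" if r: "r \<in> ?I" for r
    unfolding circle_coeff_def B_def
    by (intro norm_fourier_int_le M S r continuous_on_along_circle[OF continuous_on_outside(1)[OF u] S'[OF r]])
  have B0: "B \<ge> 0" using order_trans[OF norm_ge_zero aB[of 0]] by simp
  have a0: "?a 0 = 0"
    using n fourier_int_linear[OF continuous_on_const continuous_on_const, of n "u z" 1 0 0]
      fourier_int_cis[of n 0] by (auto simp: circle_coeff_def)
  have n2: "(of_int n)\<^sup>2 = (1::complex)" using n by auto
  define c where "c r = ?a1 r + ?a r / of_real r" for r
  have dc: "(c has_vector_derivative - of_real (k\<^sup>2) * ?a r) (at r within T)" if r: "r \<in> {0<..1}" and T: "T \<subseteq> ?I" for r T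
  proof -
    have r': "r \<in> ?I" "r \<noteq> 0" using r by auto
    have di: "((\<lambda>r. 1 / complex_of_real r) has_vector_derivative - (1 / of_real (r\<^sup>2))) (at r within ?I)"
      unfolding has_vector_derivative_def using r'
      by (auto intro!: derivative_eq_intros simp: scaleR_conv_of_real field_simps power2_eq_square)
    have "((\<lambda>r. ?a1 r + ?a r * (1 / of_real r)) has_vector_derivative
        (a2 r + (?a r * (- (1 / of_real (r\<^sup>2))) + ?a1 r * (1 / of_real r)))) (at r within ?I)"
      by (intro has_vector_derivative_add has_vector_derivative_mult a2 r' di)
    moreover have "a2 r + (?a r * (- (1 / of_real (r\<^sup>2))) + ?a1 r * (1 / of_real r)) = - of_real (k\<^sup>2) * ?a r"
    proof -
      have "of_real (r\<^sup>2) * (a2 r + (?a r * (- (1 / of_real (r\<^sup>2))) + ?a1 r * (1 / of_real r)) + of_real (k\<^sup>2) * ?a r)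
        = of_real (r\<^sup>2) * a2 r + of_real r * ?a1 r + (of_real (k\<^sup>2) * of_real (r\<^sup>2) - (of_int n)\<^sup>2) * ?a r"
        using r'(2) by (simp add: n2 n2[unfolded power2_eq_square] field_simps power2_eq_square)
      then have "of_real (r\<^sup>2) * (a2 r + (?a r * (- (1 / of_real (r\<^sup>2))) + ?a1 r * (1 / of_real r)) + of_real (k\<^sup>2) * ?a r) = 0"
        using a2(3)[OF r'(1)] by simp
      then show ?thesis using r'(2) by (simp only: mult_eq_0_iff of_real_eq_0_iff zero_eq_power2) (simp add: eq_neg_iff_add_eq_0)
    qed
    ultimately have "(c has_vector_derivative - of_real (k\<^sup>2) * ?a r) (at r within ?I)"
      unfolding c_def by simp
    then show ?thesis using has_vector_derivative_within_subset T by blast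
  qed
  define c0 where "c0 = 2 * ?a1 0"
  have climit: "(c \<longlongrightarrow> c0) (at_right 0)"
  proof -
    have at: "at 0 within ?I = at_right (0::real)" by (simp add: at_within_Icc_at_right)
    have "(?a1 \<longlongrightarrow> ?a1 0) (at 0 within ?I)"
      using has_vector_derivative_continuous[OF a2(2)[of 0]] by (simp add: continuous_within)
    moreover have "((\<lambda>r. ?a r / of_real r) \<longlongrightarrow> ?a1 0) (at 0 within ?I)"
    proof -
      have "((\<lambda>r. (1 / norm (r - 0)) *\<^sub>R (?a r - (?a 0 + (r - 0) *\<^sub>R ?a1 0))) \<longlongrightarrow> 0) (at_right 0)"
        using a2(1)[of 0] unfolding has_vector_derivative_def has_derivative_within by (simp add: at)
      moreover have "\<forall>\<^sub>F r in at_right 0. (1 / norm (r - 0)) *\<^sub>R (?a r - (?a 0 + (r - 0) *\<^sub>R ?a1 0)) = ?a r / of_real r - ?a1 0"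
        using eventually_at_right_less[of 0]
        by eventually_elim (simp add: a0 scaleR_conv_of_real field_simps)
      ultimately have "((\<lambda>r. ?a r / of_real r - ?a1 0) \<longlongrightarrow> 0) (at_right 0)"
        by (rule Lim_transform_eventually)
      then show ?thesis by (simp add: at LIM_zero_iff)
    qed
    ultimately have "(c \<longlongrightarrow> ?a1 0 + ?a1 0) (at 0 within ?I)" unfolding c_def by (rule tendsto_add)
    then show ?thesis unfolding at c0_def mult_2 .
  qed
  have cdiff: "norm (c r - c0) \<le> B * k\<^sup>2 * r" if r: "r \<in> {0<..1}" for r
  proof -
    have "norm (c r - c s) \<le> B * k\<^sup>2 * (r - s)" if s: "0 < s" "s \<le> r" for s
    proof (rule vector_derivative_bound[where f'="\<lambda>t. - of_real (k\<^sup>2) * ?a t"])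
      fix t assume t: "t \<in> {s..r}"
      then show "(c has_vector_derivative - of_real (k\<^sup>2) * ?a t) (at t within {s..r})"
        using s r by (intro dc) auto
      have "norm (?a t) \<le> B" using t s r by (intro aB) auto
      then show "norm (- of_real (k\<^sup>2) * ?a t) \<le> B * k\<^sup>2"
        by (simp add: norm_mult norm_power mult.commute[of B] mult_left_mono)
    qed (rule s)
    moreover have "((\<lambda>s. norm (c r - c s)) \<longlongrightarrow> norm (c r - c0)) (at_right 0)"
      by (intro tendsto_intros climit)
    moreover have "((\<lambda>s. B * k\<^sup>2 * (r - s)) \<longlongrightarrow> B * k\<^sup>2 * (r - 0)) (at_right 0)"
      by (intro tendsto_intros)
    moreover have "\<forall>\<^sub>F s in at_right 0. 0 < s \<and> s \<le> r"
      unfolding eventually_at_right_field using r by (auto intro!: exI[of _ r])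
    ultimately have "norm (c r - c0) \<le> B * k\<^sup>2 * (r - 0)"
      by (intro tendsto_le[where F="at_right (0::real)"]) (auto elim: eventually_mono)
    then show ?thesis by simp
  qed
  define g where "g r = of_real r * ?a r - of_real (r\<^sup>2) * (c0 / 2)" for r
  have "norm (g 1 - g 0) \<le> B * k\<^sup>2 * (1 - 0)"
  proof (rule vector_derivative_bound[where f'="\<lambda>r. of_real r * ?a1 r + ?a r - of_real r * c0"])
    fix r :: real assume r: "r \<in> {0..1}"
    have d1: "(complex_of_real has_vector_derivative 1) (at r within ?I)"
      unfolding has_vector_derivative_def by (auto intro!: derivative_eq_intros simp: scaleR_conv_of_real)
    have d2: "((\<lambda>r. complex_of_real (r\<^sup>2) * (c0/2)) has_vector_derivative of_real r * c0) (at r within ?I)"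
      unfolding has_vector_derivative_def by (auto intro!: derivative_eq_intros simp: scaleR_conv_of_real)
    show "(g has_vector_derivative of_real r * ?a1 r + ?a r - of_real r * c0) (at r within {0..1})"
      unfolding g_def using has_vector_derivative_diff[OF has_vector_derivative_mult[OF d1 a2(1)[OF r]] d2] by simp
    show "norm (of_real r * ?a1 r + ?a r - of_real r * c0) \<le> B * k\<^sup>2"
    proof (cases "r = 0")
      case True
      then show ?thesis using B0 by (simp add: a0)
    next
      case False
      then have r': "r \<in> {0<..1}" using r by auto
      have "of_real r * ?a1 r + ?a r - of_real r * c0 = of_real r * (c r - c0)"
        using False by (simp add: c_def algebra_simps)
      then have "norm (of_real r * ?a1 r + ?a r - of_real r * c0) = r * norm (c r - c0)"
        using r by (simp add: norm_mult)
      also have "\<dots> \<le> 1 * (B * k\<^sup>2 * 1)"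
        using cdiff[OF r'] r' B0 by (intro mult_mono order_trans[OF cdiff[OF r']] mult_nonneg_nonneg) auto
      finally show ?thesis by simp
    qed
  qed simp
  then have g1: "norm (?a 1 - c0 / 2) \<le> B * k\<^sup>2" by (simp add: g_def)
  have "norm (c0 / 2) = norm (?a 1 - (?a 1 - c0 / 2))" by simp
  also have "\<dots> \<le> norm (?a 1) + norm (?a 1 - c0 / 2)" by (rule norm_triangle_ineq4)
  also have "\<dots> \<le> B + B * k\<^sup>2" using g1 aB[of 1] by (intro add_mono) auto
  finally show ?thesis by (simp add: c0_def B_def algebra_simps)
qed

theorem gradient_estimate:
  fixes k :: real
  assumes u: "helmholtz (of_real (k\<^sup>2)) D u" and D: "cball z 1 \<subseteq> D"
    and M: "\<And>x. x \<in> cball z 1 \<Longrightarrow> norm (u x) \<le> M"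
  shows "norm (partial i u z) \<le> 2 * M * (1 + k\<^sup>2)"
proof -
  define P1 P2 where "P1 = partial 1 u z" and "P2 = partial 2 u z"
  have f: "circle_coeff1 u z n 0 = (P1 - \<i> * P2) / 2 * (if 1 = n then 2 * pi else 0) + (P1 + \<i> * P2) / 2 * (if -1 = n then 2 * pi else 0)" for n
  proof -
    have "radial_deriv u z 0 = (\<lambda>\<theta>. (P1 - \<i> * P2) / 2 * cis (of_int 1 * \<theta>) + (P1 + \<i> * P2) / 2 * cis (of_int (-1) * \<theta>))"
      using cos_sin_cis[of _ P1 P2] by (auto simp: radial_deriv_def P1_def P2_def scaleR_conv_of_real)
    moreover have "continuous_on T (\<lambda>\<theta>. cis (of_int j * \<theta>))" for T j by (intro continuous_intros)
    ultimately show ?thesis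
      by (simp only: circle_coeff1_def fourier_int_linear fourier_int_cis)
  qed
  define E where "E = 2 * M * (1 + k\<^sup>2)"
  have "circle_coeff1 u z 1 0 = pi * (P1 - \<i> * P2)" "circle_coeff1 u z (-1) 0 = pi * (P1 + \<i> * P2)"
    unfolding f by (simp_all add: field_simps)
  then have "norm (pi * (P1 - \<i> * P2)) \<le> pi * E" "norm (pi * (P1 + \<i> * P2)) \<le> pi * E"
    using gradient_estimate_coeff[OF u D M, of 1] gradient_estimate_coeff[OF u D M, of "-1"]
    by (simp_all only: E_def mult_ac simp_thms)
  then have E: "norm (P1 - \<i> * P2) \<le> E" "norm (P1 + \<i> * P2) \<le> E"
    by (simp_all add: norm_mult)
  have "2 * P1 = (P1 - \<i> * P2) + (P1 + \<i> * P2)" "2 * \<i> * P2 = (P1 + \<i> * P2) - (P1 - \<i> * P2)"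
    by simp_all
  then have "norm (2 * P1) \<le> norm (P1 - \<i> * P2) + norm (P1 + \<i> * P2)"
      "norm (2 * \<i> * P2) \<le> norm (P1 + \<i> * P2) + norm (P1 - \<i> * P2)"
    using norm_triangle_ineq norm_triangle_ineq4 by metis+
  then have "norm (2 * P1) \<le> 2 * E" "norm (2 * \<i> * P2) \<le> 2 * E" using E by linarith+
  then have "norm P1 \<le> E" "norm P2 \<le> E" by (simp_all add: norm_mult)
  then show ?thesis unfolding E_def P1_def P2_def using exhaust_2[of i] by auto
qed

section \<open>Translating radiating fields\<close>

lemma direction_shift_bound:
  fixes x h :: "'a::real_normed_vector"
  assumes "x \<noteq> 0"
  shows "norm ((x + h) /\<^sub>R norm (x + h) - x /\<^sub>R norm x) \<le> 2 * norm h / norm x"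
proof (cases "x + h = 0")
  case True
  then have "norm h = norm x" by (metis add.inverse_inverse add_eq_0_iff norm_minus_cancel)
  then show ?thesis using True assms by simp
next
  case False
  let ?y = "x + h"
  have "?y /\<^sub>R norm ?y - x /\<^sub>R norm x = (inverse (norm ?y) - inverse (norm x)) *\<^sub>R ?y + h /\<^sub>R norm x"
    by (simp add: algebra_simps)
  then have "norm (?y /\<^sub>R norm ?y - x /\<^sub>R norm x) \<le> \<bar>inverse (norm ?y) - inverse (norm x)\<bar> * norm ?y + norm h / norm x"
    using norm_triangle_ineq[of "(inverse (norm ?y) - inverse (norm x)) *\<^sub>R ?y" "h /\<^sub>R norm x"]
    by (simp add: divide_inverse mult.commute)
  also have "\<bar>inverse (norm ?y) - inverse (norm x)\<bar> * norm ?y = \<bar>(inverse (norm ?y) - inverse (norm x)) * norm ?y\<bar>"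
    by (simp add: abs_mult)
  also have "(inverse (norm ?y) - inverse (norm x)) * norm ?y = (norm x - norm ?y) / norm x"
    using False assms by (simp add: field_simps)
  also have "\<bar>(norm x - norm ?y) / norm x\<bar> \<le> norm h / norm x"
    using norm_triangle_ineq3[of x ?y] by (simp add: abs_divide divide_right_mono)
  finally show ?thesis by simp
qed

lemma norm_shift_expansion:
  fixes x h :: "'a::real_inner"
  assumes "x \<noteq> 0"
  shows "\<bar>norm (x + h) - norm x - x \<bullet> h / norm x\<bar> \<le> 2 * (norm h)\<^sup>2 / norm x"
proof -
  define X Y where "X = norm x" and "Y = norm (x + h)"
  have X: "X > 0" "Y \<ge> 0" using assms by (auto simp: X_def Y_def)
  have "Y\<^sup>2 = X\<^sup>2 + 2 * (x \<bullet> h) + (norm h)\<^sup>2"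
    unfolding X_def Y_def power2_norm_eq_inner by (simp add: inner_add inner_commute algebra_simps)
  then have "(Y - X) * (Y + X) = 2 * (x \<bullet> h) + (norm h)\<^sup>2" by (simp add: power2_eq_square algebra_simps)
  then have "Y - X = (2 * (x \<bullet> h) + (norm h)\<^sup>2) / (X + Y)" using X by (simp add: field_simps)
  then have "Y - X - x \<bullet> h / X = (x \<bullet> h / X) * ((X - Y) / (X + Y)) + (norm h)\<^sup>2 / (X + Y)"
  proof -
    have "X + Y \<noteq> 0" using X by simp
    then have "(2 * p + q) / (X + Y) - p / X = p / X * ((X - Y) / (X + Y)) + q / (X + Y)" for p q
      using X by (simp add: divide_simps) (simp add: algebra_simps)
    then show ?thesis unfolding \<open>Y - X = _\<close> .
  qed
  also have "\<bar>\<dots>\<bar> \<le> \<bar>x \<bullet> h / X\<bar> * \<bar>(X - Y) / (X + Y)\<bar> + \<bar>(norm h)\<^sup>2 / (X + Y)\<bar>"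
    by (rule order_trans[OF abs_triangle_ineq]) (simp only: abs_mult order_refl)
  also have "\<dots> \<le> norm h * (norm h / X) + (norm h)\<^sup>2 / X"
  proof (intro add_mono mult_mono)
    show "\<bar>x \<bullet> h / X\<bar> \<le> norm h"
      using Cauchy_Schwarz_ineq2[of x h] X by (simp add: abs_divide divide_le_eq mult.commute flip: X_def)
    have "\<bar>X - Y\<bar> \<le> norm h" using norm_triangle_ineq3[of x "x + h"] by (simp add: X_def Y_def)
    then show "\<bar>(X - Y) / (X + Y)\<bar> \<le> norm h / X"
      using X by (simp add: abs_divide) (intro frac_le; simp)
    show "\<bar>(norm h)\<^sup>2 / (X + Y)\<bar> \<le> (norm h)\<^sup>2 / X"
      using X by (simp add: abs_divide) (intro frac_le; simp)
  qed auto
  finally show ?thesis by (simp add: X_def Y_def power2_eq_square)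
qed

lemma inverse_norm_tendsto_0: "((\<lambda>x::plane. c / norm x) \<longlongrightarrow> 0) at_infinity"
  by (intro tendsto_divide_0[OF tendsto_const] filterlim_at_top_imp_at_infinity filterlim_norm_at_top)

lemma eventually_nonzero_at_infinity: "\<forall>\<^sub>F x::plane in at_infinity. norm x > r"
  by (rule eventually_compose_filterlim[OF eventually_gt_at_top filterlim_norm_at_top])

lemma filterlim_shift_at_infinity: "filterlim (\<lambda>x::plane. x + h) at_infinity at_infinity"
proof -
  have "filterlim (\<lambda>x::plane. h + x) at_infinity at_infinity"
    by (rule tendsto_add_filterlim_at_infinity[OF tendsto_const filterlim_ident])
  then show ?thesis by (simp add: add.commute)
qed

lemma direction_shift_tendsto:
  "((\<lambda>x::plane. (x + h) /\<^sub>R norm (x + h) - x /\<^sub>R norm x) \<longlongrightarrow> 0) at_infinity"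
  by (rule Lim_null_comparison[OF _ inverse_norm_tendsto_0[of "2 * norm h"]])
    (use eventually_nonzero_at_infinity[of 0] in \<open>auto elim!: eventually_mono intro: direction_shift_bound\<close>)

lemma norm_ratio_tendsto:
  "((\<lambda>x::plane. sqrt (norm x) / sqrt (norm (x + h))) \<longlongrightarrow> 1) at_infinity"
proof -
  have "((\<lambda>x::plane. norm (x + h) / norm x - 1) \<longlongrightarrow> 0) at_infinity"
  proof (rule Lim_null_comparison[OF _ inverse_norm_tendsto_0[of "norm h"]])
    show "\<forall>\<^sub>F x::plane in at_infinity. norm (norm (x + h) / norm x - 1) \<le> norm h / norm x"
      using eventually_nonzero_at_infinity[of 0]
    proof eventually_elim
      case (elim x)
      have "norm (x + h) / norm x - 1 = (norm (x + h) - norm x) / norm x" using elim by (simp add: field_simps)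
      then show ?case using elim norm_triangle_ineq3[of "x + h" x] by (simp add: abs_divide divide_right_mono)
    qed
  qed
  then have "((\<lambda>x::plane. norm (x + h) / norm x) \<longlongrightarrow> 1) at_infinity" by (simp add: LIM_zero_iff)
  then have "((\<lambda>x::plane. 1 / sqrt (norm (x + h) / norm x)) \<longlongrightarrow> 1 / sqrt 1) at_infinity"
    by (intro tendsto_intros) auto
  then show ?thesis by (simp add: real_sqrt_divide)
qed

lemma continuous_direction_shift:
  fixes A :: field
  assumes A: "continuous_on (sphere 0 1) A"
  shows "((\<lambda>x. A ((x + h) /\<^sub>R norm (x + h)) - A (x /\<^sub>R norm x)) \<longlongrightarrow> 0) at_infinity"
proof (rule tendstoI)
  fix e :: real assume "e > 0"
  have "uniformly_continuous_on (sphere 0 1) A" by (rule compact_uniformly_continuous[OF A compact_sphere])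
  then obtain d where d: "d > 0" "\<And>x y. x \<in> sphere 0 1 \<Longrightarrow> y \<in> sphere 0 1 \<Longrightarrow> dist y x < d \<Longrightarrow> dist (A y) (A x) < e"
    unfolding uniformly_continuous_on_def using \<open>e > 0\<close> by metis
  have "\<forall>\<^sub>F x::plane in at_infinity. norm ((x + h) /\<^sub>R norm (x + h) - x /\<^sub>R norm x) < d"
    using tendstoD[OF direction_shift_tendsto d(1)] by simp
  with eventually_nonzero_at_infinity[of "norm h"]
  show "\<forall>\<^sub>F x in at_infinity. dist (A ((x + h) /\<^sub>R norm (x + h)) - A (x /\<^sub>R norm x)) 0 < e"
  proof eventually_elim
    case (elim x)
    have "x \<noteq> 0" "x + h \<noteq> 0" using elim(1) by (auto simp: add_eq_0_iff)
    then show ?case using d(2)[of "x /\<^sub>R norm x" "(x + h) /\<^sub>R norm (x + h)"] elim(2)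
      by (simp add: dist_norm)
  qed
qed

lemma far_limit_bounded:
  assumes A: "continuous_on (sphere 0 1) A" and far: "far_limit k u A"
  obtains M where "\<forall>\<^sub>F x in at_infinity. norm (u x) * sqrt (norm x) \<le> M"
proof -
  obtain MA where MA: "\<And>x. x \<in> sphere 0 1 \<Longrightarrow> norm (A x) \<le> MA"
    using compact_imp_bounded[OF compact_continuous_image[OF A compact_sphere]] unfolding bounded_iff by blast
  have "\<forall>\<^sub>F x in at_infinity. norm (u x * of_real (sqrt (norm x)) / exp (\<i> * of_real (k * norm x)) - A (x /\<^sub>R norm x)) < 1"
    using tendstoD[OF far[unfolded far_limit_def], of 1] by (simp add: dist_norm)
  with eventually_nonzero_at_infinity[of 0]
  have "\<forall>\<^sub>F x in at_infinity. norm (u x) * sqrt (norm x) \<le> MA + 1"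
  proof eventually_elim
    case (elim x)
    let ?w = "u x * of_real (sqrt (norm x)) / exp (\<i> * of_real (k * norm x))"
    have "norm ?w \<le> norm (?w - A (x /\<^sub>R norm x)) + norm (A (x /\<^sub>R norm x))"
      using norm_triangle_ineq[of "?w - A (x /\<^sub>R norm x)" "A (x /\<^sub>R norm x)"] by simp
    also have "\<dots> \<le> 1 + MA" using elim MA[of "x /\<^sub>R norm x"] by simp
    finally show ?case by (simp add: norm_divide norm_mult)
  qed
  then show ?thesis using that by blast
qed

theorem far_limit_shift:
  assumes A: "continuous_on (sphere 0 1) A" and far: "far_limit k u A"
  shows "far_limit k (\<lambda>x. u (x + h)) (\<lambda>x. exp (\<i> * of_real (k * (x \<bullet> h))) * A x)"
proof -
  define f where "f x = u x * of_real (sqrt (norm x)) / exp (\<i> * of_real (k * norm x))" for x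
  define s where "s x = complex_of_real (sqrt (norm x) / sqrt (norm (x + h)))" for x
  define E where "E x = exp (\<i> * complex_of_real (k * (norm (x + h) - norm x)))" for x
  define E0 where "E0 x = exp (\<i> * complex_of_real (k * ((x /\<^sub>R norm x) \<bullet> h)))" for x
  define a where "a x = A (x /\<^sub>R norm x)" for x
  have s1: "(s \<longlongrightarrow> 1) at_infinity"
    unfolding s_def using tendsto_of_real[OF norm_ratio_tendsto[of h], where 'a=complex] by simp
  have f0: "((\<lambda>x. f (x + h) - a (x + h)) \<longlongrightarrow> 0) at_infinity"
    using filterlim_compose[OF far[unfolded far_limit_def] filterlim_shift_at_infinity[of h]] unfolding f_def a_def .
  have a0: "((\<lambda>x. a (x + h) - a x) \<longlongrightarrow> 0) at_infinity"
    unfolding a_def by (rule continuous_direction_shift[OF A])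
  obtain MA where MA: "\<And>x. x \<in> sphere 0 1 \<Longrightarrow> norm (A x) \<le> MA"
    using compact_imp_bounded[OF compact_continuous_image[OF A compact_sphere]] unfolding bounded_iff by blast
  have ab: "\<forall>\<^sub>F x in at_infinity. norm (a x) \<le> MA"
    using eventually_nonzero_at_infinity[of 0] by eventually_elim (auto simp: a_def intro!: MA)
  have nE: "norm (E x) = 1" "norm (E0 x) = 1" for x by (simp_all add: E_def E0_def)
  have phase: "((\<lambda>x. E x - E0 x) \<longlongrightarrow> 0) at_infinity"
  proof -
    define \<phi> where "\<phi> x = k * (norm (x + h) - norm x - x \<bullet> h / norm x)" for x
    have "(\<phi> \<longlongrightarrow> 0) at_infinity"
    proof (rule Lim_null_comparison[OF _ inverse_norm_tendsto_0[of "\<bar>k\<bar> * (2 * (norm h)\<^sup>2)"]])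
      show "\<forall>\<^sub>F x in at_infinity. norm (\<phi> x) \<le> \<bar>k\<bar> * (2 * (norm h)\<^sup>2) / norm x"
        using eventually_nonzero_at_infinity[of 0]
      proof eventually_elim
        case (elim x)
        have "norm (\<phi> x) = \<bar>k\<bar> * \<bar>norm (x + h) - norm x - x \<bullet> h / norm x\<bar>" by (simp add: \<phi>_def abs_mult)
        also have "\<dots> \<le> \<bar>k\<bar> * (2 * (norm h)\<^sup>2 / norm x)"
          using elim by (intro mult_left_mono norm_shift_expansion) auto
        finally show ?case by simp
      qed
    qed
    then have "((\<lambda>x. exp (\<i> * complex_of_real (\<phi> x))) \<longlongrightarrow> exp (\<i> * of_real 0)) at_infinity"
      by (intro tendsto_intros)
    then have "((\<lambda>x. exp (\<i> * complex_of_real (\<phi> x)) - 1) \<longlongrightarrow> 0) at_infinity" by (simp add: LIM_zero_iff)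
    then have "((\<lambda>x. norm (exp (\<i> * complex_of_real (\<phi> x)) - 1)) \<longlongrightarrow> 0) at_infinity" by (rule tendsto_norm_zero)
    moreover have "norm (exp (\<i> * complex_of_real (\<phi> x)) - 1) = norm (E x - E0 x)" for x
    proof -
      have "E x = E0 x * exp (\<i> * complex_of_real (\<phi> x))"
        unfolding E_def E0_def exp_add[symmetric] \<phi>_def
        by (intro arg_cong[of _ _ exp]) (simp add: algebra_simps divide_inverse)
      then have "E x - E0 x = E0 x * (exp (\<i> * complex_of_real (\<phi> x)) - 1)" by (simp add: algebra_simps)
      then show ?thesis by (simp only: norm_mult nE mult_1)
    qed
    ultimately show ?thesis by (simp only: tendsto_norm_zero_iff)
  qed
  have T1: "((\<lambda>x. (f (x + h) - a (x + h)) * s x * E x) \<longlongrightarrow> 0) at_infinity"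
    by (rule tendsto_norm_zero_cancel)
      (use tendsto_norm[OF tendsto_mult[OF f0 s1]] in \<open>simp add: norm_mult nE\<close>)
  have T2: "((\<lambda>x. (a (x + h) - a x) * s x * E x) \<longlongrightarrow> 0) at_infinity"
    by (rule tendsto_norm_zero_cancel)
      (use tendsto_norm[OF tendsto_mult[OF a0 s1]] in \<open>simp add: norm_mult nE\<close>)
  have T3: "((\<lambda>x. a x * ((s x - 1) * E x + (E x - E0 x))) \<longlongrightarrow> 0) at_infinity"
  proof (rule Lim_null_comparison)
    have "((\<lambda>x. s x - 1) \<longlongrightarrow> 0) at_infinity" using s1 by (simp add: LIM_zero_iff)
    then have "((\<lambda>x. MA * (norm (s x - 1) + norm (E x - E0 x))) \<longlongrightarrow> MA * (norm (0::complex) + norm (0::complex))) at_infinity"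
      by (intro tendsto_intros phase)
    then show "((\<lambda>x. MA * (norm (s x - 1) + norm (E x - E0 x))) \<longlongrightarrow> 0) at_infinity" by simp
    show "\<forall>\<^sub>F x in at_infinity. norm (a x * ((s x - 1) * E x + (E x - E0 x))) \<le> MA * (norm (s x - 1) + norm (E x - E0 x))"
      using ab
    proof eventually_elim
      case (elim x)
      have "norm ((s x - 1) * E x + (E x - E0 x)) \<le> norm (s x - 1) + norm (E x - E0 x)"
        using norm_triangle_ineq[of "(s x - 1) * E x" "E x - E0 x"] by (simp add: norm_mult nE)
      moreover have "MA \<ge> 0" using elim norm_ge_zero order_trans by blast
      ultimately show ?case unfolding norm_mult using elim by (intro mult_mono) auto
    qed
  qed
  have "((\<lambda>x. (f (x + h) - a (x + h)) * s x * E x + (a (x + h) - a x) * s x * E x + a x * ((s x - 1) * E x + (E x - E0 x))) \<longlongrightarrow> 0 + 0 + 0) at_infinity"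
    by (intro tendsto_add T1 T2 T3)
  moreover have "\<forall>\<^sub>F x in at_infinity. (f (x + h) - a (x + h)) * s x * E x + (a (x + h) - a x) * s x * E x + a x * ((s x - 1) * E x + (E x - E0 x))
     = u (x + h) * of_real (sqrt (norm x)) / exp (\<i> * of_real (k * norm x)) - E0 x * a x"
    using eventually_nonzero_at_infinity[of "norm h"]
  proof eventually_elim
    case (elim x)
    have y: "x + h \<noteq> 0" using elim by (auto simp: add_eq_0_iff)
    have "f (x + h) * s x * E x = u (x + h) * of_real (sqrt (norm x)) / exp (\<i> * of_real (k * norm x))"
      using y by (simp add: f_def s_def E_def right_diff_distrib exp_diff)
    then show ?case by (simp add: algebra_simps)
  qed
  ultimately have "((\<lambda>x. u (x + h) * of_real (sqrt (norm x)) / exp (\<i> * of_real (k * norm x)) - E0 x * a x) \<longlongrightarrow> 0) at_infinity"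
    by (simp add: Lim_transform_eventually)
  then show ?thesis unfolding far_limit_def E0_def a_def .
qed

text \<open>The radiation condition involves the derivative in the direction \<open>x/|x|\<close>, which changes by \<open>O(1/|x|)\<close> under a
  translation; the gradient estimate controls the resulting error.\<close>

theorem sommerfeld_shift:
  assumes u: "helmholtz (of_real (k\<^sup>2)) {x. norm x > R} u" and som: "sommerfeld k u"
    and A: "continuous_on (sphere 0 1) A" and far: "far_limit k u A"
  shows "sommerfeld k (\<lambda>x. u (x + h))"
proof -
  obtain M where M: "\<forall>\<^sub>F x in at_infinity. norm (u x) * sqrt (norm x) \<le> M" using far_limit_bounded[OF A far] .
  obtain b where b: "\<And>x. norm x \<ge> b \<Longrightarrow> norm (u x) * sqrt (norm x) \<le> M"
    using M by (auto simp: eventually_at_infinity)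
  define C where "C = 2 * \<bar>M\<bar> * (1 + k\<^sup>2)"
  have grad: "norm (partial i u y) \<le> C" if y: "norm y > \<bar>b\<bar> + \<bar>R\<bar> + 2" for i y
    unfolding C_def
  proof (rule gradient_estimate[OF u])
    have lower: "norm x > \<bar>b\<bar> + \<bar>R\<bar> + 1" if "x \<in> cball y 1" for x
      using that y norm_triangle_ineq[of "y - x" x] by (simp add: dist_norm)
    show "cball y 1 \<subseteq> {x. norm x > R}" using lower by fastforce
    fix x assume x: "x \<in> cball y 1"
    have "norm (u x) * 1 \<le> norm (u x) * sqrt (norm x)"
      using lower[OF x] by (intro mult_left_mono) auto
    also have "\<dots> \<le> M" using lower[OF x] by (intro b) linarith
    finally show "norm (u x) \<le> \<bar>M\<bar>" by simp
  qed
  have "C \<ge> 0" by (simp add: C_def)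
  define F where "F y = of_real (sqrt (norm y)) * (frechet_derivative u (at y) (y /\<^sub>R norm y) - \<i> * of_real k * u y)" for y
  have "((\<lambda>x. F (x + h)) \<longlongrightarrow> 0) at_infinity"
    using filterlim_compose[OF som[unfolded sommerfeld_def] filterlim_shift_at_infinity[of h]] unfolding F_def .
  from tendsto_mult[OF tendsto_of_real[OF norm_ratio_tendsto[of h], where 'a=complex] this]
  have T1: "((\<lambda>x. of_real (sqrt (norm x) / sqrt (norm (x + h))) * F (x + h)) \<longlongrightarrow> 0) at_infinity" by simp
  define d where "d x = x /\<^sub>R norm x - (x + h) /\<^sub>R norm (x + h)" for x
  have T2: "((\<lambda>x. of_real (sqrt (norm x)) * frechet_derivative u (at (x + h)) (d x)) \<longlongrightarrow> 0) at_infinity"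
  proof (rule Lim_null_comparison)
    show "((\<lambda>x::plane. 4 * C * norm h / sqrt (norm x)) \<longlongrightarrow> 0) at_infinity"
      by (intro tendsto_divide_0[OF tendsto_const] filterlim_at_top_imp_at_infinity
          filterlim_compose[OF sqrt_at_top filterlim_norm_at_top])
    show "\<forall>\<^sub>F x in at_infinity. norm (of_real (sqrt (norm x)) * frechet_derivative u (at (x + h)) (d x))
        \<le> 4 * C * norm h / sqrt (norm x)"
      using eventually_nonzero_at_infinity[of "norm h + \<bar>b\<bar> + \<bar>R\<bar> + 2"]
    proof eventually_elim
      case (elim x)
      have ny: "norm (x + h) > \<bar>b\<bar> + \<bar>R\<bar> + 2"
        using elim norm_triangle_ineq4[of "x + h" h] by simp
      then have "u differentiable (at (x + h))"
        using u by (auto simp: helmholtz_def C2_on_def C1_on_def)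
      then have "norm (frechet_derivative u (at (x + h)) (d x)) \<le> \<bar>d x $ 1\<bar> * norm (partial 1 u (x + h)) + \<bar>d x $ 2\<bar> * norm (partial 2 u (x + h))"
        using norm_triangle_ineq[of "(d x $ 1) *\<^sub>R partial 1 u (x + h)" "(d x $ 2) *\<^sub>R partial 2 u (x + h)"]
        by (simp add: frechet_derivative_partial)
      also have "\<dots> \<le> norm (d x) * C + norm (d x) * C"
        using grad[OF ny] component_le_norm_cart[of "d x"] by (intro add_mono mult_mono) auto
      also have "\<dots> \<le> 4 * C * norm h / norm x"
      proof -
        have "x \<noteq> 0" using elim by (auto simp: not_less intro!: add_nonneg_nonneg) (smt (verit) norm_ge_zero)
        then have "norm (d x) \<le> 2 * norm h / norm x"
          using direction_shift_bound[of x h] by (simp add: d_def norm_minus_commute)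
        then have "2 * C * norm (d x) \<le> 2 * C * (2 * norm h / norm x)" using \<open>C \<ge> 0\<close> by (intro mult_left_mono) auto
        then show ?thesis by (simp add: mult_ac)
      qed
      finally have "norm (of_real (sqrt (norm x)) * frechet_derivative u (at (x + h)) (d x)) \<le> sqrt (norm x) * (4 * C * norm h / norm x)"
        using mult_left_mono[of _ _ "sqrt (norm x)"] by (simp only: norm_mult norm_of_real real_norm_def abs_of_nonneg real_sqrt_ge_zero norm_ge_zero)
      also have "\<dots> = 4 * C * norm h / sqrt (norm x)"
      proof -
        have "sqrt (norm x) * (c / norm x) = c / sqrt (norm x)" for c
          by (metis div_by_0 divide_divide_eq_right mult.commute norm_ge_zero real_div_sqrt times_divide_eq_left times_divide_eq_right)
        then show ?thesis .
      qed
      finally show ?case .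
    qed
  qed
  have "((\<lambda>x. of_real (sqrt (norm x) / sqrt (norm (x + h))) * F (x + h) + of_real (sqrt (norm x)) * frechet_derivative u (at (x + h)) (d x)) \<longlongrightarrow> 0 + 0) at_infinity"
    by (intro tendsto_add T1 T2)
  moreover have "\<forall>\<^sub>F x in at_infinity. of_real (sqrt (norm x) / sqrt (norm (x + h))) * F (x + h) + of_real (sqrt (norm x)) * frechet_derivative u (at (x + h)) (d x)
     = of_real (sqrt (norm x)) * (frechet_derivative (\<lambda>x. u (x + h)) (at x) (x /\<^sub>R norm x) - \<i> * of_real k * u (x + h))"
    using eventually_nonzero_at_infinity[of "norm h + \<bar>R\<bar>"]
  proof eventually_elim
    case (elim x)
    have ny: "norm (x + h) > \<bar>R\<bar>"
      using elim norm_triangle_ineq4[of "x + h" h] by simp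
    then have diff: "u differentiable (at (x + h))"
      using u by (auto simp: helmholtz_def C2_on_def C1_on_def)
    interpret D: bounded_linear "frechet_derivative u (at (x + h))"
      using has_derivative_bounded_linear[OF has_derivative_frechet[OF diff]] .
    have "norm (x + h) > 0" using ny by (meson abs_ge_zero order_le_less_trans)
    then have "of_real (sqrt (norm x) / sqrt (norm (x + h))) * F (x + h)
      = of_real (sqrt (norm x)) * (frechet_derivative u (at (x + h)) ((x + h) /\<^sub>R norm (x + h)) - \<i> * of_real k * u (x + h))"
      by (simp add: F_def)
    then show ?case unfolding frechet_derivative_shift d_def D.diff by (simp add: algebra_simps)
  qed
  ultimately show ?thesis unfolding sommerfeld_def by (simp add: Lim_transform_eventually)
qed

section \<open>One-dimensional Hausdorff measure\<close>

definition fine_cover :: "real \<Rightarrow> plane set \<Rightarrow> (nat \<Rightarrow> plane set) \<Rightarrow> bool" where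
  "fine_cover \<delta> A C \<longleftrightarrow> A \<subseteq> (\<Union>n. C n) \<and> (\<forall>n. bounded (C n) \<and> diameter (C n) \<le> \<delta>)"

lemma hausdorff1_pre_le:
  "fine_cover \<delta> A C \<Longrightarrow> hausdorff1_pre \<delta> A \<le> (\<Sum>n. ennreal (diameter (C n)))"
  unfolding hausdorff1_pre_def fine_cover_def by (intro INF_lower) auto

lemma hausdorff1_pre_greatest:
  assumes "\<And>C. fine_cover \<delta> A C \<Longrightarrow> x \<le> (\<Sum>n. ennreal (diameter (C n)))"
  shows "x \<le> hausdorff1_pre \<delta> A"
  unfolding hausdorff1_pre_def using assms by (intro INF_greatest) (auto simp: fine_cover_def)

lemma hausdorff1_pre_mono: "A \<subseteq> B \<Longrightarrow> hausdorff1_pre \<delta> A \<le> hausdorff1_pre \<delta> B"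
  by (rule hausdorff1_pre_greatest, rule hausdorff1_pre_le) (auto simp: fine_cover_def)

lemma hausdorff1_pre_antimono: "\<delta> \<le> \<delta>' \<Longrightarrow> hausdorff1_pre \<delta>' A \<le> hausdorff1_pre \<delta> A"
  by (rule hausdorff1_pre_greatest, rule hausdorff1_pre_le) (auto simp: fine_cover_def intro: order_trans)

lemma hausdorff1_pre_le_hausdorff1: "\<delta> > 0 \<Longrightarrow> hausdorff1_pre \<delta> A \<le> hausdorff1 A"
  unfolding hausdorff1_def by (intro SUP_upper) auto

lemma hausdorff1_leI: "(\<And>\<delta>. \<delta> > 0 \<Longrightarrow> hausdorff1_pre \<delta> A \<le> x) \<Longrightarrow> hausdorff1 A \<le> x"
  unfolding hausdorff1_def by (intro SUP_least) auto

lemma hausdorff1_mono: "A \<subseteq> B \<Longrightarrow> hausdorff1 A \<le> hausdorff1 B"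
  by (rule hausdorff1_leI) (meson hausdorff1_pre_le_hausdorff1 hausdorff1_pre_mono order_trans)

lemma hausdorff1_empty [simp]: "hausdorff1 {} = 0"
proof -
  have "hausdorff1 {} \<le> 0"
  proof (rule hausdorff1_leI)
    fix \<delta> :: real assume "\<delta> > 0"
    then have "hausdorff1_pre \<delta> {} \<le> (\<Sum>n::nat. ennreal (diameter ({} :: plane set)))"
      by (intro hausdorff1_pre_le) (auto simp: fine_cover_def)
    then show "hausdorff1_pre \<delta> {} \<le> 0" by simp
  qed
  then show ?thesis by simp
qed

lemma hausdorff1_pre_UN: "hausdorff1_pre \<delta> (\<Union>i. A i) \<le> (\<Sum>i. hausdorff1_pre \<delta> (A i))"
proof (cases "\<exists>i. hausdorff1_pre \<delta> (A i) = \<infinity>")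
  case True
  then obtain i where "hausdorff1_pre \<delta> (A i) = \<infinity>" by blast
  then have "(\<Sum>i. hausdorff1_pre \<delta> (A i)) = \<infinity>"
    using sum_le_suminf[of "\<lambda>i. hausdorff1_pre \<delta> (A i)" "{i}"] by (simp add: top_unique)
  then show ?thesis by simp
next
  case False
  show ?thesis
  proof (rule ennreal_le_epsilon)
    fix e :: real assume e: "e > 0"
    have "\<exists>C. fine_cover \<delta> (A i) C \<and> (\<Sum>n. ennreal (diameter (C n))) \<le> hausdorff1_pre \<delta> (A i) + ennreal (e * (1/2)^Suc i)" for i
      using INF_approx_ennreal[of "e * (1/2)^Suc i", OF _ hausdorff1_pre_def[of \<delta> "A i"]] False e
      unfolding fine_cover_def by (auto simp: less_imp_le)
    then obtain C where C: "\<And>i. fine_cover \<delta> (A i) (C i)"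
      "\<And>i. (\<Sum>n. ennreal (diameter (C i n))) \<le> hausdorff1_pre \<delta> (A i) + ennreal (e * (1/2)^Suc i)" by metis
    define D where "D m = (case prod_decode m of (i, n) \<Rightarrow> C i n)" for m
    have "fine_cover \<delta> (\<Union>i. A i) D"
      unfolding fine_cover_def
    proof (intro conjI allI subsetI)
      fix x assume "x \<in> (\<Union>i. A i)"
      then obtain i n where "x \<in> C i n" using C(1) unfolding fine_cover_def by blast
      then have "x \<in> D (prod_encode (i, n))" by (simp add: D_def)
      then show "x \<in> (\<Union>m. D m)" by blast
    qed (use C(1) in \<open>auto simp: D_def fine_cover_def split: prod.splits\<close>)
    then have "hausdorff1_pre \<delta> (\<Union>i. A i) \<le> (\<Sum>m. ennreal (diameter (D m)))" by (rule hausdorff1_pre_le)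
    also have "\<dots> = (\<Sum>m. (\<lambda>(i, n). ennreal (diameter (C i n))) (prod_decode m))"
      by (simp add: D_def case_prod_unfold)
    also have "\<dots> = (\<Sum>i. \<Sum>n. ennreal (diameter (C i n)))"
      by (rule suminf_ennreal_2dimen) simp
    also have "\<dots> \<le> (\<Sum>i. hausdorff1_pre \<delta> (A i) + ennreal (e * (1/2)^Suc i))"
      by (intro suminf_le C) auto
    also have "\<dots> = (\<Sum>i. hausdorff1_pre \<delta> (A i)) + (\<Sum>i. ennreal (e * (1/2)^Suc i))"
      by (intro suminf_add[symmetric]) auto
    also have "(\<Sum>i. ennreal (e * (1/2)^Suc i)) = ennreal (\<Sum>i. e * (1/2)^Suc i)"
      using e by (intro suminf_ennreal2 summable_mult) (auto simp: power_half_series[THEN sums_summable] simp del: power_Suc)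
    also have "(\<Sum>i. e * (1/2)^Suc i) = e"
      using sums_mult[OF power_half_series, of e] by (simp add: sums_iff)
    finally show "hausdorff1_pre \<delta> (\<Union>i. A i) \<le> (\<Sum>i. hausdorff1_pre \<delta> (A i)) + ennreal e" .
  qed
qed

lemma hausdorff1_UN: "hausdorff1 (\<Union>i. A i) \<le> (\<Sum>i::nat. hausdorff1 (A i))"
proof (rule hausdorff1_leI)
  fix \<delta> :: real assume "\<delta> > 0"
  have "hausdorff1_pre \<delta> (\<Union>i. A i) \<le> (\<Sum>i. hausdorff1_pre \<delta> (A i))" by (rule hausdorff1_pre_UN)
  also have "\<dots> \<le> (\<Sum>i. hausdorff1 (A i))"
    by (intro suminf_le hausdorff1_pre_le_hausdorff1 \<open>\<delta> > 0\<close>) auto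
  finally show "hausdorff1_pre \<delta> (\<Union>i. A i) \<le> (\<Sum>i. hausdorff1 (A i))" .
qed

lemma hausdorff1_Un: "hausdorff1 (A \<union> B) \<le> hausdorff1 A + hausdorff1 B"
proof -
  have "hausdorff1 (\<Union>i. binaryset A B i) \<le> (\<Sum>i. hausdorff1 (binaryset A B i))" by (rule hausdorff1_UN)
  also have "(\<Union>i. binaryset A B i) = A \<union> B" by (rule UN_binaryset_eq)
  also have "(\<Sum>i. hausdorff1 (binaryset A B i)) = hausdorff1 A + hausdorff1 B"
    by (rule suminf_binaryset_eq) simp
  finally show ?thesis .
qed

text \<open>Sets of diameter less than \<open>d\<close> cannot meet both of two sets at distance \<open>d\<close>, so a fine cover of
  the union splits into covers of the two parts.\<close>

lemma hausdorff1_separated: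
  assumes "d > 0" and sep: "\<And>x y. x \<in> A \<Longrightarrow> y \<in> B \<Longrightarrow> d \<le> dist x y"
  shows "hausdorff1 A + hausdorff1 B \<le> hausdorff1 (A \<union> B)"
proof -
  have pre: "hausdorff1_pre \<delta> A + hausdorff1_pre \<delta> B \<le> hausdorff1_pre \<delta> (A \<union> B)" if "0 < \<delta>" "\<delta> < d" for \<delta>
  proof (rule hausdorff1_pre_greatest)
    fix C assume C: "fine_cover \<delta> (A \<union> B) C"
    define CA where "CA n = (if C n \<inter> A \<noteq> {} then C n else {})" for n
    define CB where "CB n = (if C n \<inter> B \<noteq> {} then C n else {})" for n
    have "fine_cover \<delta> A CA" "fine_cover \<delta> B CB"
      using C that by (fastforce simp: fine_cover_def CA_def CB_def)+
    then have "hausdorff1_pre \<delta> A + hausdorff1_pre \<delta> B \<le> (\<Sum>n. ennreal (diameter (CA n))) + (\<Sum>n. ennreal (diameter (CB n)))"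
      by (intro add_mono hausdorff1_pre_le)
    also have "\<dots> = (\<Sum>n. ennreal (diameter (CA n)) + ennreal (diameter (CB n)))"
      by (intro suminf_add) auto
    also have "\<dots> \<le> (\<Sum>n. ennreal (diameter (C n)))"
    proof (intro suminf_le)
      fix n
      have "C n \<inter> A = {} \<or> C n \<inter> B = {}"
      proof (rule ccontr)
        assume "\<not> ?thesis"
        then obtain x y where xy: "x \<in> C n" "x \<in> A" "y \<in> C n" "y \<in> B" by blast
        then have "dist x y \<le> diameter (C n)" using C diameter_bounded_bound[of "C n" x y] by (auto simp: fine_cover_def)
        also have "\<dots> \<le> \<delta>" using C by (auto simp: fine_cover_def)
        finally show False using sep[OF xy(2,4)] that by simp
      qed
      then show "ennreal (diameter (CA n)) + ennreal (diameter (CB n)) \<le> ennreal (diameter (C n))"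
        by (auto simp: CA_def CB_def)
    qed auto
    finally show "hausdorff1_pre \<delta> A + hausdorff1_pre \<delta> B \<le> (\<Sum>n. ennreal (diameter (C n)))" .
  qed
  have both: "hausdorff1_pre \<delta> A + hausdorff1_pre \<delta>' B \<le> hausdorff1 (A \<union> B)" if "\<delta> > 0" "\<delta>' > 0" for \<delta> \<delta>'
  proof -
    define \<epsilon> where "\<epsilon> = min (d / 2) (min \<delta> \<delta>')"
    have \<epsilon>: "\<epsilon> > 0" "\<epsilon> < d" "\<epsilon> \<le> \<delta>" "\<epsilon> \<le> \<delta>'" using that assms(1) by (auto simp: \<epsilon>_def)
    have "hausdorff1_pre \<delta> A + hausdorff1_pre \<delta>' B \<le> hausdorff1_pre \<epsilon> A + hausdorff1_pre \<epsilon> B"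
      by (intro add_mono hausdorff1_pre_antimono \<epsilon>)
    also have "\<dots> \<le> hausdorff1_pre \<epsilon> (A \<union> B)" by (rule pre[OF \<epsilon>(1,2)])
    also have "\<dots> \<le> hausdorff1 (A \<union> B)" by (rule hausdorff1_pre_le_hausdorff1[OF \<epsilon>(1)])
    finally show ?thesis .
  qed
  have left: "hausdorff1_pre \<delta> A + hausdorff1 B \<le> hausdorff1 (A \<union> B)" if "\<delta> > 0" for \<delta>
  proof -
    have "hausdorff1_pre \<delta> A + (SUP \<delta>'\<in>{0<..}. hausdorff1_pre \<delta>' B) = (SUP \<delta>'\<in>{0<..}. hausdorff1_pre \<delta> A + hausdorff1_pre \<delta>' B)"
      by (rule ennreal_SUP_add_right) (metis empty_iff greaterThan_iff zero_less_one)
    also have "\<dots> \<le> hausdorff1 (A \<union> B)" using both that by (intro SUP_least) auto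
    finally show ?thesis by (simp only: hausdorff1_def[of B])
  qed
  have "(SUP \<delta>\<in>{0<..}. hausdorff1_pre \<delta> A) + hausdorff1 B = (SUP \<delta>\<in>{0<..}. hausdorff1_pre \<delta> A + hausdorff1 B)"
    by (rule ennreal_SUP_add_left[symmetric]) (metis empty_iff greaterThan_iff zero_less_one)
  also have "\<dots> \<le> hausdorff1 (A \<union> B)" using left by (intro SUP_least) auto
  finally show ?thesis by (simp only: hausdorff1_def[of A])
qed

text \<open>Additivity on sets at positive distance is enough for measurability (Caratheodory): a closed set is
  approximated from outside by shells at positive distance from it.\<close>

lemma hausdorff1_caratheodory_closed:
  assumes "closed F"
  shows "hausdorff1 (X \<inter> F) + hausdorff1 (X - F) \<le> hausdorff1 X"
proof (cases "F = {} \<or> hausdorff1 X = \<infinity>")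
  case True
  then show ?thesis by auto
next
  case False
  then have F: "F \<noteq> {}" and fin: "hausdorff1 X < \<infinity>" by (auto simp: less_top)
  define g where "g x = infdist x F" for x
  have gl: "\<bar>g x - g y\<bar> \<le> dist x y" for x y unfolding g_def
    using infdist_triangle[of x F y] infdist_triangle[of y F x] by (simp add: dist_commute abs_le_iff)
  have g0: "g x > 0" if "x \<notin> F" for x
    using in_closed_iff_infdist_zero[OF assms F] that infdist_nonneg[of x F] unfolding g_def by (metis le_less)
  define A where "A n = {x \<in> X. 1 / real (Suc n) \<le> g x}" for n
  define Rg where "Rg n = A (Suc n) - A n" for n
  have RX: "Rg n \<subseteq> X" for n by (auto simp: Rg_def A_def)
  have RA: "Rg n \<subseteq> A m" if "n < m" for n m
  proof
    fix x assume "x \<in> Rg n"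
    then have "x \<in> X" "1 / real (Suc (Suc n)) \<le> g x" by (auto simp: Rg_def A_def)
    moreover have "1 / real (Suc m) \<le> 1 / real (Suc (Suc n))" using that by (intro divide_left_mono) auto
    ultimately show "x \<in> A m" by (simp add: A_def)
  qed
  have even: "(\<Sum>j<N. hausdorff1 (Rg (2 * j + p))) \<le> hausdorff1 (\<Union>j<N. Rg (2 * j + p))" for N p
  proof (induction N)
    case (Suc N)
    have "hausdorff1 (\<Union>j<N. Rg (2 * j + p)) + hausdorff1 (Rg (2 * N + p)) \<le> hausdorff1 ((\<Union>j<N. Rg (2 * j + p)) \<union> Rg (2 * N + p))"
    proof (cases "N = 0")
      case False
      define m where "m = 2 * N + p"
      have m: "m \<ge> 1" using False by (simp add: m_def)
      show ?thesis
      proof (rule hausdorff1_separated[of "1 / real m - 1 / real (Suc m)"])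
        show "0 < 1 / real m - 1 / real (Suc m)"
          using m divide_strict_left_mono[of "real m" "real (Suc m)" 1] by simp
        fix x y assume x: "x \<in> (\<Union>j<N. Rg (2 * j + p))" and y: "y \<in> Rg (2 * N + p)"
        then obtain j where "j < N" "x \<in> Rg (2 * j + p)" by blast
        moreover have "2 * j + p < m - 1" using \<open>j < N\<close> by (simp add: m_def)
        ultimately have "x \<in> A (m - 1)" using RA by blast
        then have "1 / real m \<le> g x" using m by (simp add: A_def)
        moreover have "g y < 1 / real (Suc m)" using y RX by (auto simp: Rg_def A_def m_def)
        ultimately show "1 / real m - 1 / real (Suc m) \<le> dist x y" using gl[of x y] by linarith
      qed
    qed simp
    moreover have "(\<Sum>j<N. hausdorff1 (Rg (2 * j + p))) + hausdorff1 (Rg (2 * N + p))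
        \<le> hausdorff1 (\<Union>j<N. Rg (2 * j + p)) + hausdorff1 (Rg (2 * N + p))"
      by (intro add_right_mono Suc)
    moreover have "(\<Union>j<N. Rg (2 * j + p)) \<union> Rg (2 * N + p) = (\<Union>j<Suc N. Rg (2 * j + p))"
      by (auto simp: lessThan_Suc)
    ultimately show ?case by (simp only: sum.lessThan_Suc)
  qed simp
  have evenX: "(\<Sum>j<N. hausdorff1 (Rg (2 * j + p))) \<le> hausdorff1 X" for N p
    by (rule order_trans[OF even]) (intro hausdorff1_mono UN_least RX)
  define r where "r n = enn2real (hausdorff1 (Rg n))" for n
  have rfin: "ennreal (r n) = hausdorff1 (Rg n)" for n
    unfolding r_def using hausdorff1_mono[OF RX[of n]] fin by (intro ennreal_enn2real) auto
  have r0: "r n \<ge> 0" for n by (simp add: r_def)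
  define h where "h = enn2real (hausdorff1 X)"
  have h: "ennreal h = hausdorff1 X" "h \<ge> 0" unfolding h_def using fin by (auto intro: ennreal_enn2real)
  have part: "(\<Sum>j<N. r (2 * j + p)) \<le> h" for N p
    using evenX[of p N] by (simp add: rfin[symmetric] h(1)[symmetric] sum_ennreal r0 h(2))
  have "(\<Sum>n<N. r n) \<le> 2 * h" for N
  proof -
    have "(\<Sum>n<N. r n) \<le> (\<Sum>n<2*N. r n)" by (rule sum_mono2) (auto simp: r0)
    also have "\<dots> = (\<Sum>j<N. r (2 * j + 0)) + (\<Sum>j<N. r (2 * j + 1))" by (induction N) auto
    also have "\<dots> \<le> 2 * h" using part[of 0 N] part[of 1 N] by linarith
    finally show ?thesis .
  qed
  then have sr: "summable r" by (intro summableI_nonneg_bounded[of r "2 * h"] r0)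
  show ?thesis
  proof (rule ennreal_le_epsilon)
    fix e :: real assume "e > 0"
    obtain n where n: "norm (\<Sum>i. r (i + n)) < e" using suminf_exist_split[OF \<open>e > 0\<close> sr] by blast
    have "X - F \<subseteq> A n \<union> (\<Union>i. Rg (i + n))"
    proof
      fix x assume x: "x \<in> X - F"
      have ex: "\<exists>m. x \<in> A m"
      proof -
        obtain m where "1 / real (Suc m) < g x" using g0[of x] x reals_Archimedean[of "g x"] by (auto simp: inverse_eq_divide)
        then show ?thesis using x by (auto simp: A_def intro: less_imp_le)
      qed
      define m where "m = (LEAST m. x \<in> A m)"
      have m: "x \<in> A m" unfolding m_def using ex by (rule LeastI_ex)
      show "x \<in> A n \<union> (\<Union>i. Rg (i + n))"
      proof (cases "m \<le> n")
        case True
        have "1 / real (Suc n) \<le> 1 / real (Suc m)" using True by (intro divide_left_mono) auto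
        then have "x \<in> A n" using m by (auto simp: A_def)
        then show ?thesis by simp
      next
        case False
        then obtain m' where m': "m = Suc m'" "n \<le> m'" by (cases m) auto
        have "x \<notin> A m'" using m' not_less_Least[of m' "\<lambda>m. x \<in> A m"] by (simp add: m_def)
        then have "x \<in> Rg ((m' - n) + n)" using m m' by (simp add: Rg_def)
        then show ?thesis by blast
      qed
    qed
    then have "hausdorff1 (X - F) \<le> hausdorff1 (A n) + hausdorff1 (\<Union>i. Rg (i + n))"
      by (meson hausdorff1_Un hausdorff1_mono order_trans)
    also have "hausdorff1 (\<Union>i. Rg (i + n)) \<le> (\<Sum>i. hausdorff1 (Rg (i + n)))" by (rule hausdorff1_UN)
    also have "\<dots> = ennreal (\<Sum>i. r (i + n))"
      unfolding rfin[symmetric] by (intro suminf_ennreal2 r0 summable_ignore_initial_segment sr)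
    also have "\<dots> \<le> ennreal e" using n by (intro ennreal_leI) auto
    finally have "hausdorff1 (X - F) \<le> hausdorff1 (A n) + ennreal e" by simp
    then have "hausdorff1 (X \<inter> F) + hausdorff1 (X - F) \<le> hausdorff1 (X \<inter> F) + hausdorff1 (A n) + ennreal e"
      by (metis add.assoc add_left_mono)
    also have "hausdorff1 (X \<inter> F) + hausdorff1 (A n) \<le> hausdorff1 ((X \<inter> F) \<union> A n)"
    proof (rule hausdorff1_separated[of "1 / real (Suc n)"])
      fix x y assume "x \<in> X \<inter> F" "y \<in> A n"
      then have "g x = 0" "1 / real (Suc n) \<le> g y" by (auto simp: g_def A_def)
      then show "1 / real (Suc n) \<le> dist x y" using gl[of x y] by linarith
    qed simp
    also have "\<dots> \<le> hausdorff1 X" by (rule hausdorff1_mono) (auto simp: A_def)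
    finally show "hausdorff1 (X \<inter> F) + hausdorff1 (X - F) \<le> hausdorff1 X + ennreal e" by simp
  qed
qed

lemma measure_space_hausdorff1: "measure_space UNIV (sets borel) hausdorff1"
proof -
  interpret P: sigma_algebra UNIV "UNIV :: plane set set" by (metis Pow_UNIV sigma_algebra_Pow)
  let ?L = "lambda_system UNIV (UNIV :: plane set set) hausdorff1"
  have "outer_measure_space (UNIV :: plane set set) hausdorff1"
    by (auto simp: outer_measure_space_def positive_def increasing_def countably_subadditive_def
        intro: hausdorff1_mono hausdorff1_UN)
  then have L: "measure_space UNIV ?L hausdorff1" by (rule P.caratheodory_lemma)
  have cl: "F \<in> ?L" if "closed F" for F
  proof -
    have "hausdorff1 (F \<inter> X) + hausdorff1 ((UNIV - F) \<inter> X) = hausdorff1 X" for X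
    proof (rule antisym)
      show "hausdorff1 (F \<inter> X) + hausdorff1 ((UNIV - F) \<inter> X) \<le> hausdorff1 X"
        using hausdorff1_caratheodory_closed[OF that, of X] by (simp add: Int_commute Diff_eq)
      have "hausdorff1 ((F \<inter> X) \<union> ((UNIV - F) \<inter> X)) \<le> hausdorff1 (F \<inter> X) + hausdorff1 ((UNIV - F) \<inter> X)"
        by (rule hausdorff1_Un)
      moreover have "(F \<inter> X) \<union> ((UNIV - F) \<inter> X) = X" by blast
      ultimately show "hausdorff1 X \<le> hausdorff1 (F \<inter> X) + hausdorff1 ((UNIV - F) \<inter> X)" by simp
    qed
    then show ?thesis by (simp add: lambda_system_def)
  qed
  have "sigma_sets UNIV (Collect closed) \<subseteq> ?L"
    using L cl by (intro sigma_algebra.sigma_sets_subset) (auto simp: measure_space_def)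
  then have "sets borel \<subseteq> ?L" unfolding borel_eq_closed by (subst sets_measure_of) auto
  then show ?thesis
    using L sets.sigma_algebra_axioms[of "borel :: plane measure"]
    unfolding measure_space_def positive_def countably_additive_def by auto
qed

definition hausdorff_measure :: "plane measure" where
  "hausdorff_measure = measure_of UNIV (sets borel) hausdorff1"

lemma sets_hausdorff_measure [simp, measurable_cong]: "sets hausdorff_measure = sets borel"
  unfolding hausdorff_measure_def using sets.sigma_sets_eq[of "borel :: plane measure"]
  by (subst sets_measure_of) (simp_all only: space_borel subset_UNIV Pow_UNIV)

lemma space_hausdorff_measure [simp]: "space hausdorff_measure = UNIV"
  unfolding hausdorff_measure_def by (rule space_measure_of) simp

lemma emeasure_hausdorff_measure: "A \<in> sets borel \<Longrightarrow> emeasure hausdorff_measure A = hausdorff1 A"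
  using measure_space_hausdorff1 sets_hausdorff_measure
  by (intro emeasure_measure_of[OF hausdorff_measure_def]) (auto simp: measure_space_def)

lemma arc_length_eq: "arc_length \<Omega> = restrict_space hausdorff_measure (frontier \<Omega>)"
  unfolding arc_length_def hausdorff_measure_def ..

lemma space_arc_length [simp]: "space (arc_length \<Omega>) = frontier \<Omega>"
  by (simp add: arc_length_eq space_restrict_space)

lemma sets_arc_length: "sets (arc_length \<Omega>) = {A. A \<in> sets borel \<and> A \<subseteq> frontier \<Omega>}"
  using sets_restrict_space_iff[of "frontier \<Omega>" hausdorff_measure] by (auto simp: arc_length_eq)

lemma emeasure_arc_length:
  "A \<in> sets borel \<Longrightarrow> A \<subseteq> frontier \<Omega> \<Longrightarrow> emeasure (arc_length \<Omega>) A = hausdorff1 A"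
  unfolding arc_length_eq by (subst emeasure_restrict_space) (auto simp: emeasure_hausdorff_measure)

lemma nn_integral_arc_length:
  "(\<integral>\<^sup>+x. f x \<partial>arc_length \<Omega>) = (\<integral>\<^sup>+x. f x * indicator (frontier \<Omega>) x \<partial>hausdorff_measure)"
  unfolding arc_length_eq by (subst nn_integral_restrict_space) auto

lemma borel_measurable_arc_length:
  "f \<in> borel_measurable borel \<Longrightarrow> f \<in> borel_measurable (arc_length \<Omega>)"
  unfolding arc_length_eq by (intro measurable_restrict_space1) (simp add: measurable_cong_sets[OF sets_hausdorff_measure refl])

section \<open>Translations, projections and graphs\<close>

lemma translation_diameter: "diameter ((\<lambda>x. x + h) ` S) = diameter (S :: plane set)"
proof -
  have "(\<lambda>(x, y). dist x y) ` (((\<lambda>x. x + h) ` S) \<times> ((\<lambda>x. x + h) ` S)) = (\<lambda>(x, y). dist x y) ` (S \<times> S)"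
    by (force simp: image_iff)
  then show ?thesis by (simp add: diameter_def case_prod_unfold)
qed

lemma bounded_translation_plus: "bounded ((\<lambda>x. x + h) ` S) \<longleftrightarrow> bounded (S :: plane set)"
  using bounded_translation[of S h] bounded_translation[of "(\<lambda>x. x + h) ` S" "-h"]
  by (auto simp: image_image add.commute)

lemma hausdorff1_translation: "hausdorff1 ((\<lambda>x. x + h) ` A) = hausdorff1 A"
proof -
  have le: "hausdorff1_pre \<delta> ((\<lambda>x. x + h) ` A) \<le> hausdorff1_pre \<delta> A" for \<delta> h A
  proof (rule hausdorff1_pre_greatest)
    fix C assume "fine_cover \<delta> A C"
    then have "fine_cover \<delta> ((\<lambda>x. x + h) ` A) (\<lambda>n. (\<lambda>x. x + h) ` C n)"
      by (fastforce simp: fine_cover_def translation_diameter bounded_translation_plus)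
    from hausdorff1_pre_le[OF this]
    show "hausdorff1_pre \<delta> ((\<lambda>x. x + h) ` A) \<le> (\<Sum>n. ennreal (diameter (C n)))" by (simp add: translation_diameter)
  qed
  have "hausdorff1_pre \<delta> ((\<lambda>x. x + h) ` A) = hausdorff1_pre \<delta> A" for \<delta>
    using le[of \<delta> h A] le[of \<delta> "-h" "(\<lambda>x. x + h) ` A"] by (simp add: image_image)
  then show ?thesis by (simp add: hausdorff1_def)
qed

lemma hausdorff1_ge_projection:
  fixes f :: "plane \<Rightarrow> real"
  assumes f: "\<And>x y. \<bar>f x - f y\<bar> \<le> dist x y" and sub: "{a..b} \<subseteq> f ` A"
  shows "ennreal (b - a) \<le> hausdorff1 A"
proof -
  have "ennreal (b - a) \<le> hausdorff1_pre 1 A"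
  proof (rule hausdorff1_pre_greatest)
    fix C assume C: "fine_cover 1 A C"
    define J where "J n = (if C n = {} then {} else {Inf (f ` C n) .. Sup (f ` C n)})" for n
    have bd: "bdd_below (f ` C n)" "bdd_above (f ` C n)" for n
    proof -
      have "bounded (f ` C n)"
      proof (cases "C n = {}")
        case False
        then obtain x where x: "x \<in> C n" by blast
        have "bounded (C n)" using C by (simp add: fine_cover_def)
        then have "dist x y \<le> diameter (C n)" if "y \<in> C n" for y using x that diameter_bounded_bound by blast
        then have "dist (f x) (f y) \<le> diameter (C n)" if "y \<in> C n" for y
          using f[of x y] that by (force simp: dist_real_def)
        then show ?thesis unfolding bounded_def by blast
      qed simp
      then show "bdd_below (f ` C n)" "bdd_above (f ` C n)" by (auto simp: bounded_imp_bdd_below bounded_imp_bdd_above)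
    qed
    have "ennreal (b - a) \<le> emeasure lborel {a..b}" by (cases "a \<le> b") (auto simp: ennreal_neg)
    also have "\<dots> \<le> emeasure lborel (\<Union>n. J n)"
    proof (rule emeasure_mono)
      show "{a..b} \<subseteq> (\<Union>n. J n)"
      proof
        fix t assume "t \<in> {a..b}"
        then obtain x where x: "x \<in> A" "t = f x" using sub by blast
        then obtain n where "x \<in> C n" using C by (auto simp: fine_cover_def)
        then have "t \<in> J n" using x bd[of n] by (auto simp: J_def intro: cInf_lower cSup_upper)
        then show "t \<in> (\<Union>n. J n)" by blast
      qed
    qed (auto simp: J_def)
    also have "\<dots> \<le> (\<Sum>n. emeasure lborel (J n))"
      by (rule emeasure_subadditive_countably) (auto simp: J_def)
    also have "\<dots> \<le> (\<Sum>n. ennreal (diameter (C n)))"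
    proof (intro suminf_le)
      fix n
      show "emeasure lborel (J n) \<le> ennreal (diameter (C n))"
      proof (cases "C n = {}")
        case False
        have bC: "bounded (C n)" using C by (simp add: fine_cover_def)
        have "f x \<le> f y + diameter (C n)" if "x \<in> C n" "y \<in> C n" for x y
          using diameter_bounded_bound[OF bC that] f[of x y] by linarith
        then have "Sup (f ` C n) \<le> f y + diameter (C n)" if "y \<in> C n" for y
          using False that by (intro cSup_least) auto
        then have "Sup (f ` C n) - diameter (C n) \<le> Inf (f ` C n)"
          using False by (intro cInf_greatest) (auto simp: algebra_simps)
        then have "Sup (f ` C n) - Inf (f ` C n) \<le> diameter (C n)" by simp
        moreover have "Inf (f ` C n) \<le> Sup (f ` C n)" using False bd[of n] by (intro cInf_le_cSup) auto
        ultimately show ?thesis using False by (simp add: J_def ennreal_leI)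
      qed (simp add: J_def)
    qed auto
    finally show "ennreal (b - a) \<le> (\<Sum>n. ennreal (diameter (C n)))" .
  qed
  also have "\<dots> \<le> hausdorff1 A" by (rule hausdorff1_pre_le_hausdorff1) simp
  finally show ?thesis .
qed

text \<open>On a set that is a Lipschitz graph over an axis, arc length is at most a multiple of the length of the projection.\<close>

lemma hausdorff1_graph_le:
  fixes f :: "plane \<Rightarrow> real"
  assumes L: "L \<ge> 0" and K: "\<And>x y. x \<in> K \<Longrightarrow> y \<in> K \<Longrightarrow> dist x y \<le> L * \<bar>f x - f y\<bar>"
    and fK: "f ` K \<subseteq> {-m..m}" and B: "B \<in> sets borel"
  shows "hausdorff1 (K \<inter> f -` B) \<le> ennreal L * emeasure lborel B"
proof (rule hausdorff1_leI)
  fix \<delta> :: real assume \<delta>: "\<delta> > 0"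
  define M where "M = \<bar>m\<bar> + 1"
  define B' where "B' = B \<inter> {-M..M}"
  have B': "B' \<in> sets borel" "B' \<subseteq> cbox (-M) M" using B by (auto simp: B'_def)
  have KB: "K \<inter> f -` B \<subseteq> K \<inter> f -` B'" using fK by (force simp: B'_def M_def)
  have LL: "emeasure lborel B' \<le> emeasure lborel B" using B by (intro emeasure_mono) (auto simp: B'_def)
  have "hausdorff1_pre \<delta> (K \<inter> f -` B') \<le> ennreal L * emeasure lborel B'"
  proof (rule ennreal_le_epsilon)
    fix e :: real assume "e > 0"
    define \<eta> where "\<eta> = e / (L + 1)"
    have \<eta>: "\<eta> > 0" "L * \<eta> \<le> e" using \<open>e > 0\<close> L by (auto simp: \<eta>_def field_simps)
    obtain V where V: "open V" "B' \<subseteq> V" "emeasure lebesgue (V - B') < ennreal \<eta>"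
      using sets_lebesgue_outer_open[of B' \<eta>] B'(1) \<eta>(1) by (metis sets_completionI_sets sets_lborel)
    have VB: "emeasure lborel V \<le> emeasure lborel B' + ennreal \<eta>"
    proof -
      have "emeasure lborel V \<le> emeasure lborel B' + emeasure lborel (V - B')"
        using emeasure_subadditive[of B' lborel "V - B'"] B'(1) V(1,2) by (simp add: Un_absorb1)
      also have "emeasure lborel (V - B') \<le> ennreal \<eta>"
        using V(1,3) B'(1) by (simp add: emeasure_completion less_imp_le)
      finally show ?thesis by simp
    qed
    define \<rho> where "\<rho> = \<delta> / (2 * (L + 1))"
    have \<rho>: "\<rho> > 0" "L * (2 * \<rho>) \<le> \<delta>" using \<delta> L by (auto simp: \<rho>_def field_simps)
    define g where "g x = (if x \<in> V then V \<inter> ball x \<rho> else ball x 1)" for x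
    have "gauge g" unfolding gauge_def g_def using V(1) \<rho>(1) by auto
    moreover have "box (-M) M \<noteq> {}" by (auto simp: M_def box_real)
    ultimately obtain \<D> where \<D>: "countable \<D>" "\<And>K. K \<in> \<D> \<Longrightarrow> interior K \<noteq> {} \<and> (\<exists>c d. K = cbox c d)"
      "pairwise (\<lambda>A B. interior A \<inter> interior B = {}) \<D>" "\<And>K. K \<in> \<D> \<Longrightarrow> \<exists>x\<in>B' \<inter> K. K \<subseteq> g x" "B' \<subseteq> \<Union>\<D>"
      using covering_lemma[OF B'(2), of g] by metis
    have DV: "J \<subseteq> V" "\<exists>x. J \<subseteq> ball x \<rho>" if "J \<in> \<D>" for J
      using \<D>(4)[OF that] V(2) by (auto simp: g_def split: if_splits)
    define J where "J n = (if n \<in> to_nat_on \<D> ` \<D> then from_nat_into \<D> n else {})" for n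
    have JD: "J n \<in> \<D> \<or> J n = {}" for n using \<D>(1) by (auto simp: J_def)
    have cov: "B' \<subseteq> (\<Union>n. J n)"
    proof
      fix t assume "t \<in> B'"
      then obtain I where I: "I \<in> \<D>" "t \<in> I" using \<D>(5) by blast
      then have "J (to_nat_on \<D> I) = I" using \<D>(1) by (simp add: J_def)
      then show "t \<in> (\<Union>n. J n)" using I by blast
    qed
    have disj: "disjoint_family (\<lambda>n. interior (J n))"
      unfolding disjoint_family_on_def
    proof (intro ballI impI)
      fix m n :: nat assume "m \<noteq> n"
      show "interior (J m) \<inter> interior (J n) = {}"
      proof (cases "m \<in> to_nat_on \<D> ` \<D> \<and> n \<in> to_nat_on \<D> ` \<D>")
        case True
        then obtain I I' where "I \<in> \<D>" "I' \<in> \<D>" "m = to_nat_on \<D> I" "n = to_nat_on \<D> I'" by blast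
        then show ?thesis using \<open>m \<noteq> n\<close> \<D>(1,3) unfolding pairwise_def J_def by auto
      qed (auto simp: J_def)
    qed
    define len where "len n = measure lborel (J n)" for n
    have J: "J n = {} \<or> (\<exists>c d. c \<le> d \<and> J n = {c..d})" for n
      using JD[of n] \<D>(2)[of "J n"] by (metis cbox_interval atLeastatMost_empty_iff2)
    have emJ: "emeasure lborel (interior (J n)) = ennreal (len n)" for n
      using J[of n] by (auto simp: len_def interior_atLeastAtMost_real)
    have sumlen: "(\<Sum>n. ennreal (len n)) \<le> emeasure lborel V"
    proof -
      have "(\<Sum>n. ennreal (len n)) = emeasure lborel (\<Union>n. interior (J n))"
        unfolding emJ[symmetric] by (rule suminf_emeasure[OF _ disj]) auto
      also have "\<dots> \<le> emeasure lborel V"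
        using DV(1) JD V(1) interior_subset by (intro emeasure_mono) (auto, fastforce)
      finally show ?thesis .
    qed
    define C where "C n = K \<inter> f -` J n" for n
    have dC: "dist x y \<le> L * len n" "L * len n \<le> \<delta>" if "x \<in> C n" "y \<in> C n" for x y n
    proof -
      have "J n \<noteq> {}" using that by (auto simp: C_def)
      then obtain c d where cd: "c \<le> d" "J n = {c..d}" using J[of n] by blast
      have "\<bar>f x - f y\<bar> \<le> d - c" using that cd by (auto simp: C_def)
      then show "dist x y \<le> L * len n"
        using K[of x y] that L cd by (auto simp: C_def len_def intro: order_trans mult_left_mono)
      have "J n \<in> \<D>" using JD[of n] cd by force
      then obtain z where "J n \<subseteq> ball z \<rho>" using DV(2) by blast
      then have "c \<in> ball z \<rho>" "d \<in> ball z \<rho>" using cd by auto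
      then have "d - c \<le> 2 * \<rho>" by (auto simp: dist_real_def)
      then have "L * (d - c) \<le> L * (2 * \<rho>)" using L by (intro mult_left_mono) auto
      then show "L * len n \<le> \<delta>" using \<rho>(2) cd by (simp add: len_def)
    qed
    have "fine_cover \<delta> (K \<inter> f -` B') C"
      unfolding fine_cover_def
    proof (intro conjI allI)
      show "K \<inter> f -` B' \<subseteq> (\<Union>n. C n)" using cov unfolding C_def by blast
      fix n
      show "bounded (C n)" unfolding bounded_two_points using dC(1) by blast
      show "diameter (C n) \<le> \<delta>"
      proof (rule diameter_le)
        fix x y assume "x \<in> C n" "y \<in> C n"
        from dC[OF this] show "norm (x - y) \<le> \<delta>" by (simp add: dist_norm)
      qed (use \<delta> in auto)
    qed
    then have "hausdorff1_pre \<delta> (K \<inter> f -` B') \<le> (\<Sum>n. ennreal (diameter (C n)))" by (rule hausdorff1_pre_le)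
    also have "\<dots> \<le> (\<Sum>n. ennreal L * ennreal (len n))"
    proof (intro suminf_le)
      fix n
      have "diameter (C n) \<le> L * len n"
      proof (rule diameter_le)
        fix x y assume "x \<in> C n" "y \<in> C n"
        from dC(1)[OF this] show "norm (x - y) \<le> L * len n" by (simp add: dist_norm)
      qed (use L in \<open>auto simp: len_def\<close>)
      then show "ennreal (diameter (C n)) \<le> ennreal L * ennreal (len n)"
        using L by (simp add: ennreal_mult'[symmetric] ennreal_leI)
    qed auto
    also have "\<dots> = ennreal L * (\<Sum>n. ennreal (len n))" by simp
    also have "\<dots> \<le> ennreal L * (emeasure lborel B' + ennreal \<eta>)"
      by (intro mult_left_mono order_trans[OF sumlen VB]) auto
    also have "\<dots> \<le> ennreal L * emeasure lborel B' + ennreal e"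
      using \<eta> L by (simp add: distrib_left ennreal_mult'[symmetric] ennreal_leI add_left_mono)
    finally show "hausdorff1_pre \<delta> (K \<inter> f -` B') \<le> ennreal L * emeasure lborel B' + ennreal e" .
  qed
  then show "hausdorff1_pre \<delta> (K \<inter> f -` B) \<le> ennreal L * emeasure lborel B"
    by (meson KB LL hausdorff1_pre_mono mult_left_mono order_trans zero_le)
qed

section \<open>Local geometry of the boundary\<close>

definition square :: "plane \<Rightarrow> real \<Rightarrow> plane set" where
  "square p \<delta> = {x. \<forall>i. \<bar>x$i - p$i\<bar> < \<delta>}"

lemma square_iff: "x \<in> square p \<delta> \<longleftrightarrow> \<bar>x$1 - p$1\<bar> < \<delta> \<and> \<bar>x$2 - p$2\<bar> < \<delta>"
  by (simp add: square_def forall_2)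

lemma open_square: "open (square p \<delta>)"
  unfolding square_def forall_2
  by (intro open_Collect_conj open_Collect_less continuous_intros)

lemma convex_square: "convex (square p \<delta>)"
proof -
  have s: "square p \<delta> = (\<Inter>i. {x. (axis i 1) \<bullet> x < p$i + \<delta>} \<inter> {x. (axis i 1) \<bullet> x > p$i - \<delta>})"
    by (auto simp: square_def abs_less_iff inner_axis' algebra_simps)
  show ?thesis unfolding s by (intro convex_Inter ballI convex_Int) (auto intro: convex_Int convex_halfspace_lt convex_halfspace_gt)
qed

lemma center_in_square [simp]: "\<delta> > 0 \<Longrightarrow> p \<in> square p \<delta>" by (simp add: square_def)

lemma plane_norm_le: "norm (x::plane) \<le> \<bar>x$1\<bar> + \<bar>x$2\<bar>"
  using norm_le_l1_cart[of x] by (simp add: sum_2)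

lemma square_subset_ball: "square p \<delta> \<subseteq> ball p (2 * \<delta>)"
proof
  fix x assume "x \<in> square p \<delta>"
  then show "x \<in> ball p (2 * \<delta>)"
    using plane_norm_le[of "x - p"] by (simp add: square_iff dist_norm norm_minus_commute)
qed

lemma other_index: "i \<noteq> j \<Longrightarrow> (\<forall>m. P (m::2)) \<longleftrightarrow> P i \<and> P j"
  using exhaust_2[of i] exhaust_2[of j] by (auto simp: forall_2)

lemma closure_eq_Un_frontier: "closure \<Omega> = \<Omega> \<union> frontier \<Omega>"
  using closure_subset interior_subset by (auto simp: frontier_def)

lemma exterior_iff: "x \<in> exterior \<Omega> \<longleftrightarrow> x \<notin> \<Omega> \<and> x \<notin> frontier \<Omega>"
  by (simp add: exterior_def closure_eq_Un_frontier)

lemma open_exterior: "open (exterior \<Omega>)"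
  by (simp add: exterior_def open_Compl)

text \<open>Near a boundary point the complement of \<open>\<Omega>\<close> has the uniform cone property: the defining function is strictly
  increasing along a cone around a coordinate axis.\<close>

lemma boundary_cone:
  assumes \<Omega>: "C2_boundary \<Omega>" and p: "p \<in> frontier \<Omega>"
  obtains i j :: 2 and \<sigma> \<delta> L :: real where "i \<noteq> j" "\<sigma> = 1 \<or> \<sigma> = -1" "\<delta> > 0" "L \<ge> 0"
    "\<And>x y. x \<in> square p \<delta> \<Longrightarrow> y \<in> square p \<delta> \<Longrightarrow> x \<notin> \<Omega> \<Longrightarrow> L * \<bar>y$j - x$j\<bar> < \<sigma> * (y$i - x$i) \<Longrightarrow> y \<in> exterior \<Omega>"
proof -
  obtain U and \<psi> :: "plane \<Rightarrow> real" and i where U: "open U" "p \<in> U" and C2: "C2_on U \<psi>" and i: "partial i \<psi> p \<noteq> 0"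
    and O: "\<Omega> \<inter> U = {x\<in>U. \<psi> x < 0}" and F: "frontier \<Omega> \<inter> U = {x\<in>U. \<psi> x = 0}"
    using bspec[OF \<Omega>[unfolded C2_boundary_def] p] by (elim exE conjE) (rule that)
  define j :: 2 where "j = (if i = 1 then 2 else 1)"
  have ij: "i \<noteq> j" by (simp add: j_def)
  define \<sigma> where "\<sigma> = sgn (partial i \<psi> p)"
  have \<sigma>: "\<sigma> = 1 \<or> \<sigma> = -1" using i by (auto simp: \<sigma>_def sgn_real_def)
  define m where "m = \<bar>partial i \<psi> p\<bar> / 2"
  define M where "M = \<bar>partial j \<psi> p\<bar> + 1"
  have m: "m > 0" "\<sigma> * partial i \<psi> p > m" using i by (auto simp: m_def \<sigma>_def sgn_real_def abs_if)
  have M: "M > 0" "\<bar>partial j \<psi> p\<bar> < M" by (auto simp: M_def)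
  have C: "continuous_on U (partial n \<psi>)" and D: "\<And>x. x \<in> U \<Longrightarrow> \<psi> differentiable (at x)" for n
    using C2 by (auto simp: C2_on_def C1_on_def)
  have isC: "isCont (partial n \<psi>) p" for n using C[of n] U continuous_on_eq_continuous_at by blast
  have tn: "(partial n \<psi> \<longlongrightarrow> partial n \<psi> p) (nhds p)" for n
    using isC[of n] by (simp add: isCont_def tendsto_at_iff_tendsto_nhds)
  have "\<forall>\<^sub>F x in nhds p. \<sigma> * partial i \<psi> x > m"
    by (rule order_tendstoD(1)[OF tendsto_mult[OF tendsto_const tn] m(2)])
  moreover have "\<forall>\<^sub>F x in nhds p. \<bar>partial j \<psi> x\<bar> < M"
    by (rule order_tendstoD(2)[OF tendsto_rabs[OF tn] M(2)])
  moreover have "\<forall>\<^sub>F x in nhds p. x \<in> U" using U eventually_nhds by blast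
  ultimately have "\<forall>\<^sub>F x in nhds p. \<sigma> * partial i \<psi> x > m \<and> \<bar>partial j \<psi> x\<bar> < M \<and> x \<in> U" by eventually_elim auto
  then obtain r where r: "r > 0" "\<And>x. dist x p < r \<Longrightarrow> \<sigma> * partial i \<psi> x > m \<and> \<bar>partial j \<psi> x\<bar> < M \<and> x \<in> U"
    unfolding eventually_nhds_metric by blast
  define \<delta> where "\<delta> = r / 2"
  define L where "L = M / m"
  have near: "\<sigma> * partial i \<psi> x > m" "\<bar>partial j \<psi> x\<bar> < M" "x \<in> U" if "x \<in> square p \<delta>" for x
    using r(2)[of x] square_subset_ball[of p \<delta>] that by (auto simp: \<delta>_def dist_commute subset_iff)
  have "y \<in> exterior \<Omega>" if x: "x \<in> square p \<delta>" and y: "y \<in> square p \<delta>" and xO: "x \<notin> \<Omega>"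
    and xy: "L * \<bar>y$j - x$j\<bar> < \<sigma> * (y$i - x$i)" for x y
  proof -
    define g where "g t = \<psi> (x + t *\<^sub>R (y - x))" for t
    have "g 0 < g 1"
    proof (rule DERIV_pos_imp_increasing[where f=g])
      fix t :: real assume t: "0 \<le> t" "t \<le> 1"
      have z: "x + t *\<^sub>R (y - x) \<in> square p \<delta>"
        using convexD[OF convex_square x y, of "1 - t" t] t by (simp add: algebra_simps)
      let ?z = "x + t *\<^sub>R (y - x)"
      have "(g has_vector_derivative ((y - x)$1 *\<^sub>R partial 1 \<psi> ?z + (y - x)$2 *\<^sub>R partial 2 \<psi> ?z)) (at t)"
        unfolding g_def by (rule partial_along_curve[OF D[OF near(3)[OF z]] has_vector_derivative_ray])
      moreover have "(y - x)$1 *\<^sub>R partial 1 \<psi> ?z + (y - x)$2 *\<^sub>R partial 2 \<psi> ?z = (y - x)$i * partial i \<psi> ?z + (y - x)$j * partial j \<psi> ?z"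
        using ij exhaust_2[of i] exhaust_2[of j] by auto
      ultimately have d: "(g has_real_derivative ((y - x)$i * partial i \<psi> ?z + (y - x)$j * partial j \<psi> ?z)) (at t)"
        by (simp add: has_real_derivative_iff_has_vector_derivative)
      define a b where "a = \<sigma> * (y$i - x$i)" and "b = y$j - x$j"
      have ab: "L * \<bar>b\<bar> < a" "0 \<le> L * \<bar>b\<bar>" using xy m M by (auto simp: a_def b_def L_def)
      have "M * \<bar>b\<bar> = m * (L * \<bar>b\<bar>)" using m by (simp add: L_def)
      also have "\<dots> < m * a" using ab m by (intro mult_strict_left_mono) auto
      also have "\<dots> \<le> (\<sigma> * partial i \<psi> ?z) * a" using near(1)[OF z] ab by (intro mult_right_mono) auto
      also have "\<dots> = (y - x)$i * partial i \<psi> ?z" using \<sigma> by (auto simp: a_def)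
      finally have "M * \<bar>b\<bar> < (y - x)$i * partial i \<psi> ?z" .
      moreover have "\<bar>b * partial j \<psi> ?z\<bar> \<le> M * \<bar>b\<bar>"
        using mult_right_mono[OF less_imp_le[OF near(2)[OF z]] abs_ge_zero[of b]] by (simp add: abs_mult mult.commute)
      ultimately have "0 < (y - x)$i * partial i \<psi> ?z + (y - x)$j * partial j \<psi> ?z"
        unfolding b_def by simp
      then show "\<exists>d. (g has_real_derivative d) (at t) \<and> 0 < d" using d by blast
    qed simp
    moreover have "\<psi> x \<ge> 0" using O near(3)[OF x] xO by force
    ultimately have "\<psi> y > 0" by (simp add: g_def)
    then show ?thesis using O F near(3)[OF y] unfolding exterior_iff by force
  qed
  moreover have "\<delta> > 0" "L \<ge> 0" using r m M by (auto simp: \<delta>_def L_def)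
  ultimately show ?thesis using that[OF ij \<sigma>] by blast
qed

lemma frontier_not_in_open: "open \<Omega> \<Longrightarrow> p \<in> frontier \<Omega> \<Longrightarrow> p \<notin> \<Omega>"
  using frontier_disjoint_eq by blast

lemma exterior_locally_connected:
  assumes \<Omega>: "open \<Omega>" "C2_boundary \<Omega>" and p: "p \<in> frontier \<Omega>"
  obtains N where "open N" "p \<in> N" "connected (exterior \<Omega> \<inter> N)" "p \<in> closure (exterior \<Omega>)"
proof -
  obtain i j :: 2 and \<sigma> \<delta> L :: real where ij: "i \<noteq> j" and \<sigma>: "\<sigma> = 1 \<or> \<sigma> = -1" and \<delta>: "\<delta> > 0" and L: "L \<ge> 0"
    and cone: "\<And>x y. x \<in> square p \<delta> \<Longrightarrow> y \<in> square p \<delta> \<Longrightarrow> x \<notin> \<Omega> \<Longrightarrow> L * \<bar>y$j - x$j\<bar> < \<sigma> * (y$i - x$i) \<Longrightarrow> y \<in> exterior \<Omega>"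
    by (rule boundary_cone[OF \<Omega>(2) p]) (rule that)
  have pO: "p \<notin> \<Omega>" by (rule frontier_not_in_open[OF \<Omega>(1) p])
  have sq: "x \<in> square p \<delta> \<longleftrightarrow> \<bar>x$i - p$i\<bar> < \<delta> \<and> \<bar>x$j - p$j\<bar> < \<delta>" for x
    unfolding square_def by (simp add: other_index[OF ij])
  define \<delta>' where "\<delta>' = min \<delta> (\<delta> / (2 * (L + 1)))"
  have \<delta>': "\<delta>' > 0" "\<delta>' \<le> \<delta>" using \<delta> L by (auto simp: \<delta>'_def)
  have L\<delta>: "L * t \<le> \<delta> / 2" if "t \<le> \<delta>'" "t \<ge> 0" for t
  proof -
    have "L * t \<le> (L + 1) * (\<delta> / (2 * (L + 1)))" using that L by (intro mult_mono) (auto simp: \<delta>'_def)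
    also have "(L + 1) * (\<delta> / (2 * (L + 1))) = \<delta> / 2" using L by (simp add: field_simps)
    finally show ?thesis .
  qed
  define N where "N = {x :: plane. \<bar>x$j - p$j\<bar> < \<delta>' \<and> \<bar>x$i - p$i\<bar> < \<delta>}"
  have Nsq: "N \<subseteq> square p \<delta>" using \<delta>' by (auto simp: N_def sq)
  have oN: "open N" unfolding N_def by (intro open_Collect_conj open_Collect_less continuous_intros)
  have pN: "p \<in> N" using \<delta> \<delta>' by (simp add: N_def)
  have high: "x \<in> exterior \<Omega>" if "x \<in> N" "\<delta> / 2 < \<sigma> * (x$i - p$i)" for x
    using cone[of p x] that Nsq pO \<delta> L\<delta>[of "\<bar>x$j - p$j\<bar>"] by (auto simp: N_def subset_iff)
  define q where "q = p + (\<sigma> * (3/4) * \<delta>) *\<^sub>R axis i 1"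
  define up where "up x = x + (p$i + \<sigma> * (3/4) * \<delta> - x$i) *\<^sub>R axis i 1" for x :: plane
  have ax: "axis i 1 $ i = (1::real)" "axis i 1 $ j = (0::real)" using ij by (auto simp: axis_def)
  have s2: "\<sigma> * \<sigma> = 1" "\<bar>\<sigma>\<bar> = 1" using \<sigma> by auto
  have convN: "convex N"
  proof -
    have "N = {x. axis j 1 \<bullet> x < p$j + \<delta>'} \<inter> {x. axis j 1 \<bullet> x > p$j - \<delta>'} \<inter> {x. axis i 1 \<bullet> x < p$i + \<delta>} \<inter> {x. axis i 1 \<bullet> x > p$i - \<delta>}"
      by (auto simp: N_def abs_less_iff inner_axis' algebra_simps)
    then show ?thesis by (simp only:) (intro convex_Int convex_halfspace_lt convex_halfspace_gt)
  qed
  have qN: "q \<in> N" using \<delta> \<delta>' s2 by (simp add: N_def q_def ax abs_mult)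
  have upN: "up x \<in> N" if "x \<in> N" for x using that \<delta> s2 by (simp add: N_def up_def ax abs_mult)
  have comp: "connected_component (exterior \<Omega> \<inter> N) x q" if x: "x \<in> exterior \<Omega> \<inter> N" for x
  proof -
    have "closed_segment (up x) q \<subseteq> exterior \<Omega> \<inter> N"
    proof
      fix z assume z: "z \<in> closed_segment (up x) q"
      then have zN: "z \<in> N" using closed_segment_subset[OF upN qN convN] x by blast
      obtain t where "z = (1 - t) *\<^sub>R up x + t *\<^sub>R q" using z by (auto simp: closed_segment_def)
      then have "z$i = (1 - t) * up x $ i + t * q $ i" by (simp only: vector_add_component vector_scaleR_component real_scaleR_def)
      moreover have "up x $ i = p$i + \<sigma> * (3/4) * \<delta>" "q $ i = p$i + \<sigma> * (3/4) * \<delta>"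
        by (simp_all add: up_def q_def ax)
      ultimately have "z$i = p$i + \<sigma> * (3/4) * \<delta>" by (simp only: flip: distrib_right) simp
      then have "\<sigma> * (z$i - p$i) = (\<sigma> * \<sigma>) * (3/4) * \<delta>" by simp
      then show "z \<in> exterior \<Omega> \<inter> N" using high[OF zN] \<delta> zN by (simp add: s2)
    qed
    moreover have "closed_segment x (up x) \<subseteq> exterior \<Omega> \<inter> N"
    proof
      fix z assume z: "z \<in> closed_segment x (up x)"
      then have zN: "z \<in> N" using closed_segment_subset[OF _ upN convN] x by blast
      obtain t where t: "0 \<le> t" "t \<le> 1" "z = (1 - t) *\<^sub>R x + t *\<^sub>R up x" using z by (auto simp: closed_segment_def)
      define a where "a = \<sigma> * (x$i - p$i)"
      have zi: "z$i - p$i = (1 - t) * (x$i - p$i) + t * (\<sigma> * (3/4) * \<delta>)" and zj: "z$j = x$j"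
        unfolding t(3) by (simp_all add: up_def ax algebra_simps)
      have za: "\<sigma> * (z$i - p$i) = (1 - t) * a + t * (3/4 * \<delta>)"
      proof -
        have "\<sigma> * (z$i - p$i) = (1 - t) * a + t * ((\<sigma> * \<sigma>) * (3/4 * \<delta>))" unfolding zi a_def by (simp add: algebra_simps)
        then show ?thesis by (simp add: s2)
      qed
      have "z \<in> exterior \<Omega>"
      proof (cases "\<delta> / 2 < a")
        case True
        have "(1 - t) * (\<delta>/2) + t * (\<delta>/2) < \<sigma> * (z$i - p$i)"
        proof (cases "t = 0")
          case False
          then have "t * (\<delta>/2) < t * (3/4 * \<delta>)" using t \<delta> by simp
          moreover have "(1 - t) * (\<delta>/2) \<le> (1 - t) * a" using True t by (intro mult_left_mono) auto
          ultimately show ?thesis unfolding za by linarith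
        qed (use True za in simp)
        moreover have "(1 - t) * (\<delta>/2) + t * (\<delta>/2) = \<delta>/2" by (simp flip: distrib_right)
        ultimately show ?thesis using high[OF zN] by (simp only:)
      next
        case False
        show ?thesis
        proof (cases "t = 0")
          case True
          then show ?thesis using t x by simp
        next
          case t0: False
          have "\<sigma> * (z$i - x$i) = \<sigma> * (z$i - p$i) - a" by (simp add: a_def algebra_simps)
          also have "\<dots> = t * (3/4 * \<delta> - a)" unfolding za by (simp add: algebra_simps)
          also have "\<dots> > 0" using t t0 False \<delta> by (intro mult_pos_pos) auto
          finally show ?thesis using cone[of x z] x zN Nsq zj exterior_iff by auto
        qed
      qed
      then show "z \<in> exterior \<Omega> \<inter> N" using zN by simp
    qed
    ultimately have "connected_component (exterior \<Omega> \<inter> N) x (up x)" "connected_component (exterior \<Omega> \<inter> N) (up x) q"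
      unfolding connected_component_def by (meson connected_segment ends_in_segment)+
    then show ?thesis by (rule connected_component_trans)
  qed
  have "connected (exterior \<Omega> \<inter> N)"
    unfolding connected_iff_connected_component using comp connected_component_sym connected_component_trans by meson
  moreover have "p \<in> closure (exterior \<Omega>)"
    unfolding closure_approachable
  proof (intro allI impI)
    fix e :: real assume "e > 0"
    define t where "t = min (e / 2) (\<delta> / 2)"
    have t: "t > 0" "t < e" "t < \<delta>" using \<open>e > 0\<close> \<delta> by (auto simp: t_def)
    let ?y = "p + (\<sigma> * t) *\<^sub>R axis i 1"
    have "?y \<in> square p \<delta>" using t s2 \<delta> by (simp add: sq ax abs_mult)
    moreover have "\<sigma> * (?y$i - p$i) = (\<sigma> * \<sigma>) * t" by (simp add: ax)
    ultimately have "?y \<in> exterior \<Omega>" using cone[of p ?y] pO \<delta> t by (simp add: ax s2 mult.assoc[symmetric])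
    moreover have "dist ?y p < e" using t s2 by (simp add: dist_norm abs_mult)
    ultimately show "\<exists>y\<in>exterior \<Omega>. dist y p < e" by blast
  qed
  ultimately show ?thesis using that oN pN by blast
qed

text \<open>Every component of the exterior reaches the boundary, near each boundary point the exterior is a connected
  graph side, and the boundary is connected; so all components coincide.\<close>

theorem connected_exterior:
  assumes "obstacle \<Omega>"
  shows "connected (exterior \<Omega>)"
proof (rule connectedI)
  fix A B assume AB: "open A" "open B" "A \<inter> exterior \<Omega> \<noteq> {}" "B \<inter> exterior \<Omega> \<noteq> {}"
    "A \<inter> B \<inter> exterior \<Omega> = {}" "exterior \<Omega> \<subseteq> A \<union> B"
  have \<Omega>: "open \<Omega>" "C2_boundary \<Omega>" "connected (frontier \<Omega>)" "\<Omega> \<noteq> {}"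
    using assms by (auto simp: obstacle_def)
  define G where "G S = \<Union>{N. open N \<and> N \<inter> exterior \<Omega> \<subseteq> S}" for S
  have oG: "open (G S)" for S unfolding G_def by (intro open_Union) auto
  have cover: "frontier \<Omega> \<subseteq> G A \<union> G B"
  proof
    fix p assume p: "p \<in> frontier \<Omega>"
    obtain N where N: "open N" "p \<in> N" "connected (exterior \<Omega> \<inter> N)"
      using exterior_locally_connected[OF \<Omega>(1,2) p] by blast
    have "A \<inter> (exterior \<Omega> \<inter> N) = {} \<or> B \<inter> (exterior \<Omega> \<inter> N) = {}"
      using connectedD[OF N(3) AB(1,2)] AB(5,6) by blast
    then have "N \<inter> exterior \<Omega> \<subseteq> B \<or> N \<inter> exterior \<Omega> \<subseteq> A" using AB(6) by blast
    then show "p \<in> G A \<union> G B" using N unfolding G_def by blast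
  qed
  have disj: "G A \<inter> G B \<inter> frontier \<Omega> = {}"
  proof (rule ccontr)
    assume "\<not> ?thesis"
    then obtain p N N' where p: "p \<in> frontier \<Omega>" "open N" "p \<in> N" "N \<inter> exterior \<Omega> \<subseteq> A"
      "open N'" "p \<in> N'" "N' \<inter> exterior \<Omega> \<subseteq> B" unfolding G_def by blast
    have "p \<in> closure (exterior \<Omega>)" using exterior_locally_connected[OF \<Omega>(1,2) p(1)] by blast
    then have "(N \<inter> N') \<inter> exterior \<Omega> \<noteq> {}"
      using p open_Int_closure_eq_empty[of "N \<inter> N'" "exterior \<Omega>"] by blast
    then show False using p AB(5) by blast
  qed
  have meet: "G S \<inter> frontier \<Omega> \<noteq> {}"
    if S: "open S" "open S'" "S \<inter> exterior \<Omega> \<noteq> {}" "S \<inter> S' \<inter> exterior \<Omega> = {}" "exterior \<Omega> \<subseteq> S \<union> S'"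
      and c: "frontier \<Omega> \<subseteq> G S \<union> G S'" for S S'
  proof -
    define E where "E = S \<inter> exterior \<Omega>"
    have oE: "open E" unfolding E_def using S open_exterior by blast
    have "frontier E \<noteq> {}"
    proof
      assume "frontier E = {}"
      then have "E = {} \<or> E = UNIV" using frontier_eq_empty by blast
      moreover have "E \<inter> \<Omega> = {}" using exterior_iff by (auto simp: E_def)
      ultimately show False using S(3) \<Omega>(4) by (auto simp: E_def)
    qed
    then obtain p where p: "p \<in> frontier E" by blast
    have pc: "p \<in> closure E" "p \<notin> E" using p oE frontier_not_in_open by (auto simp: frontier_def)
    have dis: "T \<inter> E \<noteq> {}" if "open T" "p \<in> T" for T
      using that pc(1) open_Int_closure_eq_empty by blast
    have "p \<notin> exterior \<Omega>"
    proof
      assume "p \<in> exterior \<Omega>"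
      then have "p \<in> S'" using pc(2) S(5) by (auto simp: E_def)
      then show False using dis[OF S(2)] S(4) by (auto simp: E_def)
    qed
    moreover have "p \<notin> \<Omega>" using dis[OF \<Omega>(1)] exterior_iff by (auto simp: E_def)
    ultimately have pf: "p \<in> frontier \<Omega>" by (simp add: exterior_iff)
    have "p \<notin> G S'"
    proof
      assume "p \<in> G S'"
      then obtain N where "open N" "p \<in> N" "N \<inter> exterior \<Omega> \<subseteq> S'" unfolding G_def by blast
      then show False using dis[of N] S(4) by (auto simp: E_def)
    qed
    then show ?thesis using c pf by blast
  qed
  have "G A \<inter> frontier \<Omega> \<noteq> {}" by (rule meet[OF AB(1,2,3,5,6) cover])
  moreover have "G B \<inter> frontier \<Omega> \<noteq> {}" by (rule meet[OF AB(2,1,4)]) (use AB cover in auto)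
  ultimately show False
    using connectedD[OF \<Omega>(3) oG[of A] oG[of B]] cover disj by blast
qed

section \<open>Graph patches of the boundary\<close>

text \<open>A compact piece of the boundary that is a Lipschitz graph over the axis \<open>j\<close>, with a collar of width \<open>\<eta>\<close> in
  the direction \<open>\<sigma>\<close> along the axis \<open>i\<close> contained in the exterior.\<close>

definition graph_patch :: "plane set \<Rightarrow> plane set \<Rightarrow> 2 \<Rightarrow> 2 \<Rightarrow> real \<Rightarrow> real \<Rightarrow> real \<Rightarrow> bool" where
  "graph_patch \<Omega> K i j \<sigma> \<eta> L \<longleftrightarrow> compact K \<and> K \<subseteq> frontier \<Omega> \<and> i \<noteq> j \<and> (\<sigma> = 1 \<or> \<sigma> = -1) \<and> \<eta> > 0 \<and> L \<ge> 0 \<and>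
     (\<forall>x\<in>K. \<forall>y\<in>K. dist x y \<le> L * \<bar>x$j - y$j\<bar>) \<and>
     (\<forall>x\<in>K. \<forall>s. 0 < s \<and> s < \<eta> \<longrightarrow> x + (\<sigma> * s) *\<^sub>R axis i 1 \<in> exterior \<Omega>)"

lemma graph_patch_exists:
  assumes \<Omega>: "open \<Omega>" "C2_boundary \<Omega>" and p: "p \<in> frontier \<Omega>"
  obtains N K i j \<sigma> \<eta> L where "open N" "p \<in> N" "frontier \<Omega> \<inter> N \<subseteq> K" "graph_patch \<Omega> K i j \<sigma> \<eta> L"
proof -
  obtain i j :: 2 and \<sigma> \<delta> L :: real where ij: "i \<noteq> j" and \<sigma>: "\<sigma> = 1 \<or> \<sigma> = -1" and \<delta>: "\<delta> > 0" and L: "L \<ge> 0"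
    and cone: "\<And>x y. x \<in> square p \<delta> \<Longrightarrow> y \<in> square p \<delta> \<Longrightarrow> x \<notin> \<Omega> \<Longrightarrow> L * \<bar>y$j - x$j\<bar> < \<sigma> * (y$i - x$i) \<Longrightarrow> y \<in> exterior \<Omega>"
    by (rule boundary_cone[OF \<Omega>(2) p]) (rule that)
  define K where "K = frontier \<Omega> \<inter> {x. \<forall>i. \<bar>x$i - p$i\<bar> \<le> \<delta> / 2}"
  have sq: "x \<in> square p \<delta> \<longleftrightarrow> \<bar>x$i - p$i\<bar> < \<delta> \<and> \<bar>x$j - p$j\<bar> < \<delta>" for x
    unfolding square_def by (simp add: other_index[OF ij])
  have Kp: "x \<in> frontier \<Omega>" "\<bar>x$i - p$i\<bar> \<le> \<delta> / 2" "\<bar>x$j - p$j\<bar> \<le> \<delta> / 2" "x \<notin> \<Omega>" "x \<in> square p \<delta>" if "x \<in> K" for x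
    using that \<delta> frontier_not_in_open[OF \<Omega>(1)] unfolding K_def by (auto simp: other_index[OF ij] sq)
  have "closed {x :: plane. \<forall>i. \<bar>x$i - p$i\<bar> \<le> \<delta> / 2}"
    unfolding forall_2 by (intro closed_Collect_conj closed_Collect_le continuous_intros)
  moreover have "bounded {x :: plane. \<forall>i. \<bar>x$i - p$i\<bar> \<le> \<delta> / 2}"
  proof (rule bounded_subset[OF bounded_ball[of p "2 * \<delta>"]])
    have "{x :: plane. \<forall>i. \<bar>x$i - p$i\<bar> \<le> \<delta> / 2} \<subseteq> square p \<delta>"
      using \<delta> unfolding square_def forall_2 by auto
    then show "{x :: plane. \<forall>i. \<bar>x$i - p$i\<bar> \<le> \<delta> / 2} \<subseteq> ball p (2 * \<delta>)"
      using square_subset_ball[of p \<delta>] by blast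
  qed
  ultimately have "compact K" unfolding K_def
    by (intro compact_Int_closed[of "{x :: plane. \<forall>i. \<bar>x$i - p$i\<bar> \<le> \<delta> / 2}" "frontier \<Omega>", unfolded Int_commute[of _ "frontier \<Omega>"]])
      (auto simp: compact_eq_bounded_closed)
  moreover have "K \<subseteq> frontier \<Omega>" by (auto simp: K_def)
  moreover have "dist x y \<le> (L + 1) * \<bar>x$j - y$j\<bar>" if "x \<in> K" "y \<in> K" for x y
  proof -
    have no: "\<not> L * \<bar>y$j - x$j\<bar> < \<sigma> * (y$i - x$i)" if "x \<in> K" "y \<in> K" for x y
      using cone[of x y] Kp[OF that(1)] Kp[OF that(2)] by (auto simp: exterior_iff)
    have "\<bar>x$i - y$i\<bar> \<le> L * \<bar>x$j - y$j\<bar>"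
      using no[OF that] no[OF that(2,1)] \<sigma> by (auto simp: abs_minus_commute)
    then show ?thesis
      using plane_norm_le[of "x - y"] ij exhaust_2[of i] exhaust_2[of j] by (auto simp: dist_norm algebra_simps)
  qed
  moreover have "x + (\<sigma> * s) *\<^sub>R axis i 1 \<in> exterior \<Omega>" if x: "x \<in> K" and s: "0 < s" "s < \<delta> / 2" for x s
  proof -
    let ?y = "x + (\<sigma> * s) *\<^sub>R axis i 1"
    have ax: "axis i 1 $ i = (1::real)" "axis i 1 $ j = (0::real)" using ij by (auto simp: axis_def)
    have "?y \<in> square p \<delta>" 
    proof -
      have "\<bar>x$i + \<sigma> * s - p$i\<bar> \<le> \<bar>x$i - p$i\<bar> + s" using \<sigma> s(1) by auto
      then show ?thesis using Kp(2,3)[OF x] s \<delta> unfolding sq by (simp add: ax)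
    qed
    moreover have "\<sigma> * (?y$i - x$i) > 0" using \<sigma> s by (auto simp: ax)
    ultimately show ?thesis using cone[of x ?y] Kp[OF x] by (simp add: ax)
  qed
  ultimately have "graph_patch \<Omega> K i j \<sigma> (\<delta> / 2) (L + 1)"
    unfolding graph_patch_def using ij \<sigma> \<delta> L by auto
  moreover have "frontier \<Omega> \<inter> square p (\<delta> / 2) \<subseteq> K" by (auto simp: K_def square_def less_imp_le)
  ultimately show ?thesis using that[of "square p (\<delta> / 2)"] \<delta> open_square by simp
qed

lemma frontier_finite_patches:
  assumes "obstacle \<Omega>"
  obtains \<K> where "finite \<K>" "frontier \<Omega> = \<Union>\<K>" "\<And>K. K \<in> \<K> \<Longrightarrow> \<exists>i j \<sigma> \<eta> L. graph_patch \<Omega> K i j \<sigma> \<eta> L"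
proof -
  have \<Omega>: "open \<Omega>" "C2_boundary \<Omega>" "bounded \<Omega>" using assms by (auto simp: obstacle_def)
  have "compact (frontier \<Omega>)" by (rule compact_frontier_bounded[OF \<Omega>(3)])
  define good where "good K \<longleftrightarrow> (\<exists>i j \<sigma> \<eta> L. graph_patch \<Omega> K i j \<sigma> \<eta> L)" for K
  define \<N> where "\<N> = {N. open N \<and> (\<exists>K. frontier \<Omega> \<inter> N \<subseteq> K \<and> good K)}"
  have "frontier \<Omega> \<subseteq> \<Union>\<N>"
  proof
    fix p assume "p \<in> frontier \<Omega>"
    then show "p \<in> \<Union>\<N>"
    proof (rule graph_patch_exists[OF \<Omega>(1,2)])
      fix N K i j \<sigma> \<eta> L
      assume "open N" "p \<in> N" "frontier \<Omega> \<inter> N \<subseteq> K" "graph_patch \<Omega> K i j \<sigma> \<eta> L"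
      then have "N \<in> \<N>" unfolding \<N>_def good_def by blast
      then show "p \<in> \<Union>\<N>" using \<open>p \<in> N\<close> by blast
    qed
  qed
  then obtain \<F> where \<F>: "\<F> \<subseteq> \<N>" "finite \<F>" "frontier \<Omega> \<subseteq> \<Union>\<F>"
    by (rule compactE[OF \<open>compact (frontier \<Omega>)\<close>]) (auto simp: \<N>_def)
  then have "\<forall>N\<in>\<F>. \<exists>K. frontier \<Omega> \<inter> N \<subseteq> K \<and> good K"
    unfolding \<N>_def by blast
  from bchoice[OF this] obtain k where k: "\<And>N. N \<in> \<F> \<Longrightarrow> frontier \<Omega> \<inter> N \<subseteq> k N \<and> good (k N)"
    by blast
  have kf: "k N \<subseteq> frontier \<Omega>" if "N \<in> \<F>" for N using k[OF that] by (auto simp: graph_patch_def good_def)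
  have fk: "frontier \<Omega> = \<Union>(k ` \<F>)"
  proof
    show "frontier \<Omega> \<subseteq> \<Union>(k ` \<F>)" using \<F>(3) k by blast
    show "\<Union>(k ` \<F>) \<subseteq> frontier \<Omega>" using kf by blast
  qed
  have gk: "\<exists>i j \<sigma> \<eta> L. graph_patch \<Omega> K i j \<sigma> \<eta> L" if "K \<in> k ` \<F>" for K
    using that k unfolding good_def by blast
  show ?thesis by (rule that[OF finite_imageI[OF \<F>(2)] fk gk])
qed

lemma graph_patch_measure:
  assumes P: "graph_patch \<Omega> K i j \<sigma> \<eta> L" and B: "B \<in> sets borel"
  shows "hausdorff1 (K \<inter> (\<lambda>x. x$j) -` B) \<le> ennreal L * emeasure lborel B"
proof -
  have "bounded K" using P by (auto simp: graph_patch_def compact_imp_bounded)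
  then obtain m where m: "\<And>x. x \<in> K \<Longrightarrow> norm x \<le> m" by (auto simp: bounded_iff)
  show ?thesis
  proof (rule hausdorff1_graph_le[OF _ _ _ B])
    have "x $ j \<in> {-m..m}" if "x \<in> K" for x
      using m[OF that] component_le_norm_cart[of x j] by auto
    then show "(\<lambda>x. x $ j) ` K \<subseteq> {-m..m}" by blast
  qed (use P in \<open>auto simp: graph_patch_def\<close>)
qed

lemma hausdorff1_frontier_finite:
  assumes "obstacle \<Omega>"
  shows "hausdorff1 (frontier \<Omega>) < \<infinity>"
proof -
  obtain \<K> where \<K>: "finite \<K>" "frontier \<Omega> = \<Union>\<K>" "\<And>K. K \<in> \<K> \<Longrightarrow> \<exists>i j \<sigma> \<eta> L. graph_patch \<Omega> K i j \<sigma> \<eta> L"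
    using frontier_finite_patches[OF assms] by blast
  have K: "hausdorff1 K < \<infinity>" if inK: "K \<in> \<K>" for K
  proof -
    obtain i j \<sigma> \<eta> L where P: "graph_patch \<Omega> K i j \<sigma> \<eta> L" using \<K>(3)[OF inK] by blast
    have "bounded K" using P by (auto simp: graph_patch_def compact_imp_bounded)
    then obtain m where m: "\<And>x. x \<in> K \<Longrightarrow> norm x \<le> m" by (auto simp: bounded_iff)
    have "x $ j \<in> {-m..m}" if "x \<in> K" for x
      using m[OF that] component_le_norm_cart[of x j] by auto
    then have "K = K \<inter> (\<lambda>x. x$j) -` {-m..m}" by blast
    then have "hausdorff1 K \<le> ennreal L * emeasure lborel {-m..m}"
      using graph_patch_measure[OF P, of "{-m..m}"] by simp
    also have "\<dots> < \<infinity>" by (cases "-m \<le> m") (auto simp: ennreal_mult_less_top)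
    finally show ?thesis .
  qed
  have "hausdorff1 (\<Union>\<F>) < \<infinity>" if "finite \<F>" "\<F> \<subseteq> \<K>" for \<F>
    using that
  proof (induction rule: finite_induct)
    case (insert A \<F>)
    have "hausdorff1 (A \<union> \<Union>\<F>) \<le> hausdorff1 A + hausdorff1 (\<Union>\<F>)" by (rule hausdorff1_Un)
    also have "\<dots> < \<infinity>" using insert K by (auto simp: less_top)
    finally show ?case by simp
  qed simp
  then show ?thesis using \<K> by simp
qed

lemma hausdorff1_frontier_pos:
  assumes "obstacle \<Omega>"
  shows "hausdorff1 (frontier \<Omega>) > 0"
proof -
  have \<Omega>: "open \<Omega>" "bounded \<Omega>" "\<Omega> \<noteq> {}" using assms by (auto simp: obstacle_def)
  then obtain c r where c: "r > 0" "ball c r \<subseteq> \<Omega>" using open_contains_ball by blast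
  obtain R where R: "\<And>x. x \<in> \<Omega> \<Longrightarrow> norm x \<le> R" using \<Omega>(2) by (auto simp: bounded_iff)
  have "{c$1 - r/2 .. c$1 + r/2} \<subseteq> (\<lambda>x. x$1) ` frontier \<Omega>"
  proof
    fix t assume t: "t \<in> {c$1 - r/2 .. c$1 + r/2}"
    define l where "l = {x :: plane. x$1 = t}"
    have "convex l"
    proof -
      have "l = {x. axis 1 1 \<bullet> x = t}" by (auto simp: l_def inner_axis')
      then show ?thesis by (simp add: convex_hyperplane)
    qed
    then have "connected l" by (rule convex_connected)
    moreover have "l \<inter> \<Omega> \<noteq> {}"
    proof -
      have "norm ((t - c$1) *\<^sub>R (axis 1 1 :: plane)) = \<bar>t - c$1\<bar>" by simp
      also have "\<dots> < r" using t c(1) by (auto simp: abs_less_iff)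
      finally have "c + (t - c$1) *\<^sub>R axis 1 1 \<in> ball c r" by (simp add: dist_norm)
      moreover have "c + (t - c$1) *\<^sub>R axis 1 1 \<in> l" by (simp add: l_def axis_def)
      ultimately show ?thesis using c(2) by blast
    qed
    moreover have "l - \<Omega> \<noteq> {}"
    proof -
      define y :: plane where "y = t *\<^sub>R axis 1 1 + (\<bar>R\<bar> + 1) *\<^sub>R axis 2 1"
      have "y \<in> l" by (simp add: l_def y_def axis_def)
      moreover have "norm y > R" using component_le_norm_cart[of y 2] by (simp add: y_def axis_def)
      ultimately show ?thesis using R[of y] by force
    qed
    ultimately have "l \<inter> frontier \<Omega> \<noteq> {}" by (rule connected_Int_frontier)
    then show "t \<in> (\<lambda>x. x$1) ` frontier \<Omega>" by (auto simp: l_def)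
  qed
  then have "ennreal ((c$1 + r/2) - (c$1 - r/2)) \<le> hausdorff1 (frontier \<Omega>)"
    by (rule hausdorff1_ge_projection[rotated])
      (metis component_le_norm_cart dist_norm vector_minus_component)
  then show ?thesis using c by (auto intro: less_le_trans[of 0 "ennreal r"])
qed

section \<open>Traces on graph patches\<close>

lemma Basis_plane: "(Basis :: plane set) = {axis 1 1, axis 2 1}"
  by (auto simp: Basis_vec_def UNIV_2)

lemma lborel_plane:
  assumes ij: "i \<noteq> j"
  shows "lborel = distr (lborel \<Otimes>\<^sub>M lborel) borel (\<lambda>p. fst p *\<^sub>R axis j 1 + snd p *\<^sub>R axis i 1 :: plane)"
proof (rule lborel_eqI)
  let ?T = "\<lambda>p :: real \<times> real. fst p *\<^sub>R axis j 1 + snd p *\<^sub>R axis i 1 :: plane"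
  fix l u :: plane assume le: "\<And>b. b \<in> Basis \<Longrightarrow> l \<bullet> b \<le> u \<bullet> b"
  have le': "l$n \<le> u$n" for n using le[of "axis n 1"] exhaust_2[of n] by (auto simp: Basis_plane inner_axis)
  have ax: "axis i 1 $ i = (1::real)" "axis i 1 $ j = (0::real)" "axis j 1 $ j = (1::real)" "axis j 1 $ i = (0::real)"
    using ij by (auto simp: axis_def)
  have m: "?T \<in> borel_measurable (lborel \<Otimes>\<^sub>M lborel)" by measurable
  have "?T -` box l u \<inter> space (lborel \<Otimes>\<^sub>M lborel) = {l$j<..<u$j} \<times> {l$i<..<u$i}"
    by (auto simp: mem_box_cart other_index[OF ij] ax space_pair_measure)
  then have "emeasure (distr (lborel \<Otimes>\<^sub>M lborel) borel ?T) (box l u) = emeasure (lborel \<Otimes>\<^sub>M lborel) ({l$j<..<u$j} \<times> {l$i<..<u$i})"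
    using m by (subst emeasure_distr) auto
  also have "\<dots> = ennreal (u$j - l$j) * ennreal (u$i - l$i)"
    using le' by (subst lborel.emeasure_pair_measure_Times) auto
  also have "\<dots> = ennreal ((u$j - l$j) * (u$i - l$i))" using le' by (simp add: ennreal_mult)
  also have "(u$j - l$j) * (u$i - l$i) = (\<Prod>b\<in>Basis. (u - l) \<bullet> b)"
    using ij exhaust_2[of i] exhaust_2[of j] by (auto simp: Basis_plane inner_axis axis_eq_axis mult.commute)
  finally show "emeasure (distr (lborel \<Otimes>\<^sub>M lborel) borel ?T) (box l u) = ennreal (\<Prod>b\<in>Basis. (u - l) \<bullet> b)" .
qed simp

lemma nn_integral_plane:
  assumes ij: "i \<noteq> j" and F: "F \<in> borel_measurable (borel :: plane measure)"
  shows "(\<integral>\<^sup>+x. F x \<partial>lborel) = (\<integral>\<^sup>+t. \<integral>\<^sup>+y. F (t *\<^sub>R axis j 1 + y *\<^sub>R axis i 1) \<partial>lborel \<partial>lborel)"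
proof -
  let ?T = "\<lambda>p :: real \<times> real. fst p *\<^sub>R axis j 1 + snd p *\<^sub>R axis i 1 :: plane"
  have m: "?T \<in> measurable (lborel \<Otimes>\<^sub>M lborel) borel" by measurable
  have "(\<integral>\<^sup>+x. F x \<partial>lborel) = (\<integral>\<^sup>+p. F (?T p) \<partial>(lborel \<Otimes>\<^sub>M lborel))"
    by (subst lborel_plane[OF ij], rule nn_integral_distr[OF m]) (simp add: F)
  also have "\<dots> = (\<integral>\<^sup>+t. \<integral>\<^sup>+y. F (?T (t, y)) \<partial>lborel \<partial>lborel)"
    by (rule lborel.nn_integral_fst[symmetric]) (rule measurable_compose[OF m F])
  finally show ?thesis by simp
qed

lemma graph_patch_null:
  assumes P: "graph_patch \<Omega> K i j \<sigma> \<eta> L"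
  shows "K \<in> null_sets lborel"
proof -
  have K: "K \<in> sets borel" "i \<noteq> j" using P by (auto simp: graph_patch_def borel_compact)
  have Kd: "dist x y \<le> L * \<bar>x$j - y$j\<bar>" if "x \<in> K" "y \<in> K" for x y using P that by (auto simp: graph_patch_def)
  have ax: "axis i 1 $ i = (1::real)" "axis i 1 $ j = (0::real)" "axis j 1 $ j = (1::real)" "axis j 1 $ i = (0::real)"
    using K(2) by (auto simp: axis_def)
  have inner: "(\<integral>\<^sup>+y. indicator K (t *\<^sub>R axis j 1 + y *\<^sub>R axis i 1 :: plane) \<partial>lborel) = (\<integral>\<^sup>+(y::real). 0 \<partial>lborel)" for t
  proof (rule nn_integral_cong_AE)
    let ?T = "\<lambda>y. t *\<^sub>R axis j 1 + y *\<^sub>R axis i 1 :: plane"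
    have "y = y'" if "?T y \<in> K" "?T y' \<in> K" for y y'
    proof -
      have "dist (?T y) (?T y') \<le> 0" using Kd[OF that] by (simp add: ax)
      then have "?T y $ i = ?T y' $ i" by simp
      then show ?thesis by (simp add: ax)
    qed
    then obtain y0 where y0: "\<And>y. y \<noteq> y0 \<Longrightarrow> ?T y \<notin> K" by metis
    have "AE y in lborel. y \<noteq> y0" by (rule AE_lborel_singleton)
    then show "AE y in lborel. (indicator K (?T y) :: ennreal) = 0"
      by eventually_elim (use y0 in auto)
  qed
  have "emeasure lborel K = (\<integral>\<^sup>+x. indicator K x \<partial>lborel)" using K by simp
  also have "\<dots> = (\<integral>\<^sup>+t. \<integral>\<^sup>+y. indicator K (t *\<^sub>R axis j 1 + y *\<^sub>R axis i 1) \<partial>lborel \<partial>lborel)"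
    using K by (intro nn_integral_plane) auto
  also have "\<dots> = 0" unfolding inner by simp
  finally show ?thesis using K by (intro null_setsI) auto
qed

lemma frontier_null:
  assumes "obstacle \<Omega>"
  shows "frontier \<Omega> \<in> null_sets lborel"
proof -
  obtain \<K> where \<K>: "finite \<K>" "frontier \<Omega> = \<Union>\<K>" "\<And>K. K \<in> \<K> \<Longrightarrow> \<exists>i j \<sigma> \<eta> L. graph_patch \<Omega> K i j \<sigma> \<eta> L"
    using frontier_finite_patches[OF assms] by blast
  have "K \<in> null_sets lborel" if "K \<in> \<K>" for K using \<K>(3)[OF that] graph_patch_null by blast
  then have "(\<Union>K\<in>\<K>. K) \<in> null_sets lborel"
    by (intro null_sets_UN' countable_finite \<K>)
  then show ?thesis by (simp add: \<K>(2))
qed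

text \<open>The fundamental theorem of calculus bounds a boundary value by its integral over a segment and by that of
  the derivative.\<close>

lemma one_dimensional_trace:
  fixes c c' :: "real \<Rightarrow> complex"
  assumes \<eta>: "\<eta> > 0" and dc: "\<And>s. (c has_vector_derivative c' s) (at s)" and cc': "continuous_on UNIV c'"
  shows "ennreal ((cmod (c 0))\<^sup>2) \<le> ennreal (1 / \<eta> + 1) *
     (\<integral>\<^sup>+s. ennreal ((cmod (c s))\<^sup>2 + (cmod (c' s))\<^sup>2) * indicator {0<..<\<eta>} s \<partial>lborel)"
proof -
  define h where "h s = (cmod (c s))\<^sup>2 + (cmod (c' s))\<^sup>2" for s
  have cc: "continuous_on UNIV c"
    using dc by (auto simp: continuous_on_eq_continuous_within intro: has_vector_derivative_continuous has_vector_derivative_at_within)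
  have ch: "continuous_on S h" for S unfolding h_def
    by (intro continuous_intros continuous_on_subset[OF cc] continuous_on_subset[OF cc']) auto
  define H where "H s = integral {-1..s} h" for s
  have dH: "(H has_real_derivative h s) (at s)" if "s \<in> {0..\<eta>}" for s
  proof -
    have "(H has_real_derivative h s) (at s within {-1..\<eta>+1})"
      unfolding H_def by (rule integral_has_real_derivative[OF ch]) (use that in auto)
    then show ?thesis using at_within_Icc_at[of "-1" s "\<eta> + 1"] that by auto
  qed
  define W where "W s = (1/\<eta> + 1) * H s + (1 - s/\<eta>) * (c s \<bullet> c s)" for s
  have "W 0 \<le> W \<eta>"
  proof (rule DERIV_nonneg_imp_nondecreasing[where f=W])
    fix s assume "0 \<le> s" "s \<le> \<eta>"
    then have s: "s \<in> {0..\<eta>}" by simp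
    have dl: "((\<lambda>s. 1 - s/\<eta>) has_real_derivative - (1/\<eta>)) (at s)" using \<eta> by (auto intro!: derivative_eq_intros)
    have "(W has_real_derivative ((1/\<eta> + 1) * h s + (- (1/\<eta>) * (c s \<bullet> c s) + (c s \<bullet> c' s + c' s \<bullet> c s) * (1 - s/\<eta>)))) (at s)"
      unfolding W_def by (intro DERIV_add DERIV_cmult dH[OF s] DERIV_mult dl inner_has_real_derivative dc)
    moreover have "0 \<le> (1/\<eta> + 1) * h s + (- (1/\<eta>) * (c s \<bullet> c s) + (c s \<bullet> c' s + c' s \<bullet> c s) * (1 - s/\<eta>))"
    proof -
      define x where "x = 2 * (c s \<bullet> c' s)"
      have hs: "h s = c s \<bullet> c s + c' s \<bullet> c' s" by (simp add: h_def power2_norm_eq_inner)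
      have x: "\<bar>x\<bar> \<le> h s" using abs_inner_le_square_sum[of "c s" "c' s"] by (simp add: hs x_def)
      have "0 \<le> 1 - s/\<eta>" "1 - s/\<eta> \<le> 1" using s \<eta> by auto
      then have "\<bar>x * (1 - s/\<eta>)\<bar> \<le> h s * 1"
        unfolding abs_mult using x by (intro mult_mono) auto
      moreover have "(1/\<eta>) * (c s \<bullet> c s) \<le> (1/\<eta>) * h s" using \<eta> by (intro mult_left_mono) (auto simp: hs)
      moreover have "\<bar>X\<bar> \<le> Y * 1 \<Longrightarrow> Z \<le> V \<Longrightarrow> 0 \<le> V + Y - Z + X" for X Y Z V :: real by auto
      ultimately have "0 \<le> (1/\<eta>) * h s + h s - (1/\<eta>) * (c s \<bullet> c s) + x * (1 - s/\<eta>)" by blast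
      then show ?thesis by (simp add: x_def inner_commute algebra_simps)
    qed
    ultimately show "\<exists>y. (W has_real_derivative y) (at s) \<and> 0 \<le> y" by blast
  qed (use \<eta> in simp)
  then have "(cmod (c 0))\<^sup>2 \<le> (1/\<eta> + 1) * (H \<eta> - H 0)"
    using \<eta> by (simp add: W_def power2_norm_eq_inner algebra_simps)
  then have "ennreal ((cmod (c 0))\<^sup>2) \<le> ennreal ((1/\<eta> + 1) * (H \<eta> - H 0))" by (rule ennreal_leI)
  also have "\<dots> = ennreal (1/\<eta> + 1) * ennreal (H \<eta> - H 0)" using \<eta> by (intro ennreal_mult') auto
  also have "ennreal (H \<eta> - H 0) = (\<integral>\<^sup>+s. ennreal (h s) * indicator {0..\<eta>} s \<partial>lborel)"
    by (rule nn_integral_FTC_Icc[symmetric])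
      (use \<eta> dH in \<open>auto simp: h_def intro!: borel_measurable_continuous_onI ch[unfolded h_def]\<close>)
  also have "\<dots> = (\<integral>\<^sup>+s. ennreal (h s) * indicator {0<..<\<eta>} s \<partial>lborel)"
  proof (rule nn_integral_cong_AE)
    have "AE s in lborel. s \<noteq> 0" "AE s in lborel. s \<noteq> \<eta>" by (rule AE_lborel_singleton)+
    then show "AE s in lborel. ennreal (h s) * indicator {0..\<eta>} s = ennreal (h s) * indicator {0<..<\<eta>} s"
      by eventually_elim (auto simp: indicator_def)
  qed
  finally show ?thesis by (simp add: h_def)
qed

text \<open>The one-dimensional estimate along the vertical segments is integrated over the graph, whose length
  measure is comparable to Lebesgue measure of the base.\<close>

lemma graph_patch_trace:
  assumes P: "graph_patch \<Omega> K i j \<sigma> \<eta> L" and KR: "\<And>x. x \<in> K \<Longrightarrow> norm x + \<eta> \<le> R" and \<phi>: "C1_on UNIV \<phi>"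
  shows "(\<integral>\<^sup>+x. ennreal ((cmod (\<phi> x))\<^sup>2) * indicator K x \<partial>hausdorff_measure)
     \<le> ennreal L * (ennreal (1 / \<eta> + 1) * H1_norm2 (exterior \<Omega> \<inter> ball 0 R) \<phi>)"
proof -
  have K: "compact K" "K \<in> sets borel" and ij: "i \<noteq> j" and \<sigma>: "\<sigma> = 1 \<or> \<sigma> = -1" and \<eta>: "\<eta> > 0" and L: "L \<ge> 0"
    and Kd: "\<And>x y. x \<in> K \<Longrightarrow> y \<in> K \<Longrightarrow> dist x y \<le> L * \<bar>x$j - y$j\<bar>"
    and collar: "\<And>x s. x \<in> K \<Longrightarrow> 0 < s \<Longrightarrow> s < \<eta> \<Longrightarrow> x + (\<sigma> * s) *\<^sub>R axis i 1 \<in> exterior \<Omega>"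
    using P by (auto simp: graph_patch_def borel_compact)
  have ax: "axis i 1 $ i = (1::real)" "axis i 1 $ j = (0::real)" "axis j 1 $ j = (1::real)" "axis j 1 $ i = (0::real)"
    using ij by (auto simp: axis_def)
  let ?f = "\<lambda>x :: plane. x$j"
  define T where "T = ?f ` K"
  define G where "G t = (SOME x. x \<in> K \<and> x$j = t)" for t
  have G: "G t \<in> K" "G t $ j = t" if "t \<in> T" for t
    using someI_ex[of "\<lambda>x. x \<in> K \<and> x$j = t"] that unfolding G_def T_def by auto
  have GK: "G (x$j) = x" if "x \<in> K" for x
    using Kd[of "G (x$j)" x] G[of "x$j"] that by (simp add: T_def)
  have "compact T" unfolding T_def by (intro compact_continuous_image continuous_intros K)
  then have T: "T \<in> sets borel" by (rule borel_compact)
  have "L-lipschitz_on T G"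
  proof (rule lipschitz_onI[OF _ L])
    fix s t assume st: "s \<in> T" "t \<in> T"
    show "dist (G s) (G t) \<le> L * dist s t"
      using Kd[OF G(1)[OF st(1)] G(1)[OF st(2)]] by (simp add: G(2)[OF st(1)] G(2)[OF st(2)] dist_real_def)
  qed
  then have cG: "continuous_on T G" by (rule lipschitz_on_continuous_on)
  define G' where "G' t = (if t \<in> T then G t else 0)" for t
  have mG [measurable]: "G' \<in> borel_measurable borel"
    unfolding G'_def by (intro borel_measurable_continuous_on_if T cG continuous_intros)
  have c\<phi>: "continuous_on UNIV \<phi>" "\<And>m. continuous_on UNIV (partial m \<phi>)" "\<And>x. \<phi> differentiable (at x)"
    using \<phi> C1_on_imp_continuous_on by (auto simp: C1_on_def)
  define F where "F x = ennreal ((cmod (\<phi> x))\<^sup>2)" for x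
  have mF: "F \<in> borel_measurable borel" unfolding F_def
    by (intro measurable_compose[OF _ measurable_ennreal] borel_measurable_continuous_onI continuous_intros c\<phi>)
  define Fg where "Fg t = F (G' t) * indicator T t" for t
  have mFg: "Fg \<in> borel_measurable borel" unfolding Fg_def
    using T mF by (intro borel_measurable_times_ennreal measurable_compose[OF mG mF]) auto
  define \<mu> where "\<mu> = distr (restrict_space hausdorff_measure K) borel ?f"
  have mf: "?f \<in> measurable (restrict_space hausdorff_measure K) borel"
    by (intro measurable_restrict_space1) (simp add: measurable_cong_sets[OF sets_hausdorff_measure refl] borel_measurable_continuous_onI continuous_intros)
  have le: "\<mu> \<le> density lborel (\<lambda>_. ennreal L)"
  proof (subst le_measure)
    show "sets \<mu> = sets (density lborel (\<lambda>_. ennreal L))" by (simp add: \<mu>_def)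
    show "\<forall>A\<in>sets \<mu>. emeasure \<mu> A \<le> emeasure (density lborel (\<lambda>_. ennreal L)) A"
    proof
      fix A assume "A \<in> sets \<mu>"
      then have A: "A \<in> sets borel" by (simp add: \<mu>_def)
      have mA: "?f -` A \<in> sets borel"
        using measurable_sets[OF borel_measurable_continuous_onI[of ?f] A] by (simp add: continuous_intros)
      have "emeasure \<mu> A = emeasure (restrict_space hausdorff_measure K) (?f -` A \<inter> K)"
        unfolding \<mu>_def using mf A by (subst emeasure_distr) (auto simp: space_restrict_space)
      also have "\<dots> = emeasure hausdorff_measure (?f -` A \<inter> K)"
        using K by (intro emeasure_restrict_space) auto
      also have "\<dots> = hausdorff1 (K \<inter> ?f -` A)" using K mA by (subst emeasure_hausdorff_measure) (auto simp: Int_commute)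
      also have "\<dots> \<le> ennreal L * emeasure lborel A" by (rule graph_patch_measure[OF P A])
      also have "\<dots> = emeasure (density lborel (\<lambda>_. ennreal L)) A"
        using A by (subst emeasure_density) (auto simp: nn_integral_cmult_indicator)
      finally show "emeasure \<mu> A \<le> emeasure (density lborel (\<lambda>_. ennreal L)) A" .
    qed
  qed
  have "(\<integral>\<^sup>+x. F x * indicator K x \<partial>hausdorff_measure) = (\<integral>\<^sup>+x. Fg (?f x) * indicator K x \<partial>hausdorff_measure)"
    by (intro nn_integral_cong) (auto simp: Fg_def G'_def T_def GK split: split_indicator)
  also have "\<dots> = (\<integral>\<^sup>+x. Fg (?f x) \<partial>restrict_space hausdorff_measure K)"
    using K by (subst nn_integral_restrict_space) auto
  also have "\<dots> = (\<integral>\<^sup>+t. Fg t \<partial>\<mu>)" unfolding \<mu>_def using nn_integral_distr[OF mf, of Fg] mFg by simp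
  also have "\<dots> \<le> (\<integral>\<^sup>+t. Fg t \<partial>density lborel (\<lambda>_. ennreal L))"
    using le by (intro nn_integral_mono_measure) (auto simp: \<mu>_def)
  also have "\<dots> = (\<integral>\<^sup>+t. ennreal L * Fg t \<partial>lborel)"
    using mFg by (subst nn_integral_density) auto
  also have "\<dots> = ennreal L * (\<integral>\<^sup>+t. Fg t \<partial>lborel)"
    using mFg by (intro nn_integral_cmult) auto
  also have "(\<integral>\<^sup>+t. Fg t \<partial>lborel) \<le> ennreal (1/\<eta> + 1) * H1_norm2 (exterior \<Omega> \<inter> ball 0 R) \<phi>"
  proof -
    let ?E = "exterior \<Omega> \<inter> ball 0 R"
    have mE: "?E \<in> sets borel" by (intro sets.Int borel_open open_exterior open_ball)
    define h where "h x = ennreal ((cmod (\<phi> x))\<^sup>2 + (cmod (partial i \<phi> x))\<^sup>2)" for x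
    define hE where "hE x = h x * indicator ?E x" for x
    have mh: "h \<in> borel_measurable borel" unfolding h_def
      by (intro measurable_compose[OF _ measurable_ennreal] borel_measurable_continuous_onI continuous_intros c\<phi>)
    have mhE: "hE \<in> borel_measurable borel" unfolding hE_def using mh mE by (intro borel_measurable_times_ennreal) auto
    let ?X = "\<lambda>t y. t *\<^sub>R axis j 1 + y *\<^sub>R axis i 1 :: plane"
    have mX: "(\<lambda>y. hE (?X t y)) \<in> borel_measurable borel" for t
      by (intro measurable_compose[OF _ mhE] borel_measurable_continuous_onI continuous_intros)
    have key: "Fg t \<le> ennreal (1/\<eta> + 1) * (\<integral>\<^sup>+y. hE (?X t y) \<partial>lborel)" for t
    proof (cases "t \<in> T")
      case True
      define x where "x = G t"
      have x: "x \<in> K" "x $ j = t" using G[OF True] by (auto simp: x_def)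
      define c where "c s = \<phi> (x + (\<sigma> * s) *\<^sub>R axis i 1)" for s
      define c' where "c' s = \<sigma> *\<^sub>R partial i \<phi> (x + (\<sigma> * s) *\<^sub>R axis i 1)" for s
      have dc: "(c has_vector_derivative c' s) (at s)" for s
      proof -
        have "((\<lambda>s. x + (\<sigma> * s) *\<^sub>R axis i 1) has_vector_derivative \<sigma> *\<^sub>R axis i 1) (at s)"
          unfolding has_vector_derivative_def by (auto intro!: derivative_eq_intros simp: mult.commute)
        from partial_along_curve[where f=\<phi>, OF c\<phi>(3) this]
        show ?thesis unfolding c_def c'_def using exhaust_2[of i] by (auto simp: axis_def)
      qed
      have cc': "continuous_on UNIV c'" unfolding c'_def
        by (intro continuous_intros continuous_on_compose2[OF c\<phi>(2)]) auto
      have "Fg t = ennreal ((cmod (c 0))\<^sup>2)" using True by (simp add: Fg_def F_def G'_def c_def x_def)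
      also have "\<dots> \<le> ennreal (1/\<eta> + 1) * (\<integral>\<^sup>+s. ennreal ((cmod (c s))\<^sup>2 + (cmod (c' s))\<^sup>2) * indicator {0<..<\<eta>} s \<partial>lborel)"
        by (rule one_dimensional_trace[OF \<eta> dc cc'])
      also have "(\<integral>\<^sup>+s. ennreal ((cmod (c s))\<^sup>2 + (cmod (c' s))\<^sup>2) * indicator {0<..<\<eta>} s \<partial>lborel)
          \<le> (\<integral>\<^sup>+s. hE (?X t (x$i + \<sigma> * s)) \<partial>lborel)"
      proof (rule nn_integral_mono)
        fix s :: real
        have X: "?X t (x$i + \<sigma> * s) = x + (\<sigma> * s) *\<^sub>R axis i 1"
          unfolding vec_eq_iff other_index[OF ij] using x by (simp add: ax)
        have "x + (\<sigma> * s) *\<^sub>R axis i 1 \<in> ?E" if s: "s \<in> {0<..<\<eta>}"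
        proof -
          have "norm (x + (\<sigma> * s) *\<^sub>R axis i 1) \<le> norm x + \<bar>\<sigma> * s\<bar>"
            using norm_triangle_ineq[of x "(\<sigma> * s) *\<^sub>R axis i (1::real)"] by simp
          also have "\<bar>\<sigma> * s\<bar> = s" using \<sigma> s by auto
          finally have "norm (x + (\<sigma> * s) *\<^sub>R axis i 1) < R" using KR[OF x(1)] s by auto
          then show ?thesis using collar[OF x(1)] s by simp
        qed
        moreover have "cmod (c' s) = cmod (partial i \<phi> (x + (\<sigma> * s) *\<^sub>R axis i 1))" using \<sigma> by (auto simp: c'_def)
        ultimately show "ennreal ((cmod (c s))\<^sup>2 + (cmod (c' s))\<^sup>2) * indicator {0<..<\<eta>} s \<le> hE (?X t (x$i + \<sigma> * s))"
          unfolding X hE_def h_def c_def by (auto split: split_indicator)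
      qed
      also have "\<dots> = (\<integral>\<^sup>+y. hE (?X t y) \<partial>lborel)"
        using nn_integral_real_affine[OF mX[of t], of \<sigma> "x$i"] \<sigma> by auto
      finally show ?thesis by (simp add: mult_left_mono)
    qed (simp add: Fg_def)
    have "(\<integral>\<^sup>+t. Fg t \<partial>lborel) \<le> (\<integral>\<^sup>+t. ennreal (1/\<eta> + 1) * (\<integral>\<^sup>+y. hE (?X t y) \<partial>lborel) \<partial>lborel)"
      by (intro nn_integral_mono key)
    also have "\<dots> = ennreal (1/\<eta> + 1) * (\<integral>\<^sup>+t. \<integral>\<^sup>+y. hE (?X t y) \<partial>lborel \<partial>lborel)"
    proof (rule nn_integral_cmult)
      have "(\<lambda>p. hE (?X (fst p) (snd p))) \<in> borel_measurable (lborel \<Otimes>\<^sub>M lborel)"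
        by (rule measurable_compose[OF _ mhE]) measurable
      from lborel.borel_measurable_nn_integral_fst[OF this]
      show "(\<lambda>t. \<integral>\<^sup>+y. hE (?X t y) \<partial>lborel) \<in> borel_measurable lborel" by simp
    qed
    also have "(\<integral>\<^sup>+t. \<integral>\<^sup>+y. hE (?X t y) \<partial>lborel \<partial>lborel) = (\<integral>\<^sup>+x. hE x \<partial>lborel)"
      by (rule nn_integral_plane[OF ij mhE, symmetric])
    also have "\<dots> \<le> H1_norm2 ?E \<phi>"
      unfolding H1_norm2_def hE_def h_def
    proof (intro nn_integral_mono mult_right_mono ennreal_leI add_left_mono)
      fix x show "(cmod (partial i \<phi> x))\<^sup>2 \<le> (\<Sum>i\<in>UNIV. (cmod (partial i \<phi> x))\<^sup>2)"
        by (rule member_le_sum) auto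
    qed auto
    finally show ?thesis by (simp add: mult_left_mono)
  qed
  finally show ?thesis by (simp add: F_def mult_left_mono)
qed

lemma square_norm_split: "(cmod a)\<^sup>2 \<le> 2 * (cmod b)\<^sup>2 + 2 * (cmod (b - a))\<^sup>2"
proof -
  have "cmod a \<le> cmod b + cmod (b - a)" using norm_triangle_ineq4[of b "b - a"] by simp
  then have "(cmod a)\<^sup>2 \<le> (cmod b + cmod (b - a))\<^sup>2" by (intro power_mono) auto
  also have "\<dots> \<le> 2 * (cmod b)\<^sup>2 + 2 * (cmod (b - a))\<^sup>2"
    using zero_le_power2[of "cmod b - cmod (b - a)"] by (simp add: power2_eq_square algebra_simps)
  finally show ?thesis .
qed

text \<open>A trace is a limit of boundary values of smooth approximations in the Sobolev norm; the patchwise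
  estimates bound these by the norm, which tends to zero.\<close>

theorem trace_of_zero:
  assumes \<Omega>: "obstacle \<Omega>" and tr: "has_trace \<Omega> (exterior \<Omega>) u g" and u: "\<And>x. x \<in> exterior \<Omega> \<Longrightarrow> u x = 0"
  shows "AE x in arc_length \<Omega>. g x = 0"
proof -
  obtain \<K> where \<K>: "finite \<K>" "frontier \<Omega> = \<Union>\<K>" "\<And>K. K \<in> \<K> \<Longrightarrow> \<exists>i j \<sigma> \<eta> L. graph_patch \<Omega> K i j \<sigma> \<eta> L"
    using frontier_finite_patches[OF \<Omega>] by blast
  have mg: "g \<in> borel_measurable (arc_length \<Omega>)" using tr by (simp add: has_trace_def)
  obtain \<phi> :: "nat \<Rightarrow> field" where \<phi>: "\<And>n. C1_on UNIV (\<phi> n)"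
      "\<And>R. R > 0 \<Longrightarrow> (\<lambda>n. H1_norm2 (exterior \<Omega> \<inter> ball 0 R) (\<lambda>x. \<phi> n x - u x)) \<longlonglongrightarrow> 0"
      "(\<lambda>n. \<integral>\<^sup>+ x. ennreal ((cmod (\<phi> n x - g x))\<^sup>2) \<partial>arc_length \<Omega>) \<longlonglongrightarrow> 0"
    using tr unfolding has_trace_def by blast
  have H1: "H1_norm2 (exterior \<Omega> \<inter> ball 0 R) (\<lambda>x. \<phi> n x - u x) = H1_norm2 (exterior \<Omega> \<inter> ball 0 R) (\<phi> n)" for n R
    unfolding H1_norm2_def
  proof (rule nn_integral_cong)
    fix x
    show "ennreal ((cmod (\<phi> n x - u x))\<^sup>2 + (\<Sum>i\<in>UNIV. (cmod (partial i (\<lambda>x. \<phi> n x - u x) x))\<^sup>2)) * indicator (exterior \<Omega> \<inter> ball 0 R) x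
      = ennreal ((cmod (\<phi> n x))\<^sup>2 + (\<Sum>i\<in>UNIV. (cmod (partial i (\<phi> n) x))\<^sup>2)) * indicator (exterior \<Omega> \<inter> ball 0 R) x"
    proof (cases "x \<in> exterior \<Omega>")
      case True
      then have "partial i (\<lambda>x. \<phi> n x - u x) x = partial i (\<phi> n) x" for i
        by (intro partial_cong_open[OF open_exterior]) (auto simp: u)
      then show ?thesis using u[OF True] by simp
    qed simp
  qed
  have "AE x in arc_length \<Omega>. x \<in> K \<longrightarrow> g x = 0" if inK: "K \<in> \<K>" for K
  proof -
    obtain i j \<sigma> \<eta> L where P: "graph_patch \<Omega> K i j \<sigma> \<eta> L" using \<K>(3)[OF inK] by blast
    have K: "compact K" "K \<subseteq> frontier \<Omega>" and \<eta>: "\<eta> > 0" using P by (auto simp: graph_patch_def)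
    then obtain m where m: "\<And>x. x \<in> K \<Longrightarrow> norm x \<le> m" using compact_imp_bounded[OF K(1)] by (auto simp: bounded_iff)
    define R where "R = \<bar>m\<bar> + \<eta>"
    have R: "R > 0" "\<And>x. x \<in> K \<Longrightarrow> norm x + \<eta> \<le> R" using \<eta> m by (force simp: R_def)+
    have mK: "K \<in> sets (arc_length \<Omega>)" using K by (simp add: sets_arc_length borel_compact)
    have m\<phi>: "\<phi> n \<in> borel_measurable (arc_length \<Omega>)" for n
      by (intro borel_measurable_arc_length borel_measurable_continuous_onI C1_on_imp_continuous_on \<phi>)
    define a where "a n = (\<integral>\<^sup>+x. ennreal ((cmod (\<phi> n x))\<^sup>2) * indicator K x \<partial>arc_length \<Omega>)" for n
    define b where "b n = (\<integral>\<^sup>+x. ennreal ((cmod (\<phi> n x - g x))\<^sup>2) \<partial>arc_length \<Omega>)" for n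
    have a_eq: "a n = (\<integral>\<^sup>+x. ennreal ((cmod (\<phi> n x))\<^sup>2) * indicator K x \<partial>hausdorff_measure)" for n
      unfolding a_def nn_integral_arc_length using K(2) by (intro nn_integral_cong) (auto split: split_indicator)
    define C where "C = ennreal L * ennreal (1 / \<eta> + 1)"
    have aC: "a n \<le> C * H1_norm2 (exterior \<Omega> \<inter> ball 0 R) (\<phi> n)" for n
      unfolding a_eq C_def using graph_patch_trace[OF P R(2) \<phi>(1)] by (simp add: mult.assoc)
    have lim0: "(\<lambda>n. C * H1_norm2 (exterior \<Omega> \<inter> ball 0 R) (\<phi> n)) \<longlonglongrightarrow> C * 0"
      using \<phi>(2)[OF R(1)] unfolding H1 by (intro ennreal_tendsto_cmult) (auto simp: C_def ennreal_mult_less_top)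
    have a0: "a \<longlonglongrightarrow> 0"
      by (rule tendsto_sandwich[OF _ _ tendsto_const]) (use aC lim0 in \<open>auto intro: always_eventually\<close>)
    have b0: "b \<longlonglongrightarrow> 0" unfolding b_def by (rule \<phi>(3))
    define c where "c = (\<integral>\<^sup>+x. ennreal ((cmod (g x))\<^sup>2) * indicator K x \<partial>arc_length \<Omega>)"
    have cab: "c \<le> 2 * a n + 2 * b n" for n
    proof -
      have "c \<le> (\<integral>\<^sup>+x. 2 * (ennreal ((cmod (\<phi> n x))\<^sup>2) * indicator K x) + 2 * ennreal ((cmod (\<phi> n x - g x))\<^sup>2) \<partial>arc_length \<Omega>)"
        unfolding c_def
      proof (rule nn_integral_mono)
        fix x
        have "ennreal ((cmod (g x))\<^sup>2) \<le> ennreal (2 * (cmod (\<phi> n x))\<^sup>2 + 2 * (cmod (\<phi> n x - g x))\<^sup>2)"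
          by (intro ennreal_leI square_norm_split)
        also have "\<dots> = 2 * ennreal ((cmod (\<phi> n x))\<^sup>2) + 2 * ennreal ((cmod (\<phi> n x - g x))\<^sup>2)"
          by (simp add: ennreal_plus ennreal_mult')
        finally show "ennreal ((cmod (g x))\<^sup>2) * indicator K x \<le> 2 * (ennreal ((cmod (\<phi> n x))\<^sup>2) * indicator K x) + 2 * ennreal ((cmod (\<phi> n x - g x))\<^sup>2)"
          by (auto split: split_indicator)
      qed
      also have "\<dots> = 2 * a n + 2 * b n"
        unfolding a_def b_def using m\<phi> mg mK
        by (subst nn_integral_add) (auto simp: nn_integral_cmult)
      finally show ?thesis .
    qed
    have "(\<lambda>n. 2 * a n + 2 * b n) \<longlonglongrightarrow> 2 * 0 + 2 * 0"
      by (intro tendsto_add ennreal_tendsto_cmult a0 b0) auto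
    then have "c \<le> 0" using cab by (intro LIMSEQ_le_const[of "\<lambda>n. 2 * a n + 2 * b n"]) auto
    then have "c = 0" by simp
    then have "AE x in arc_length \<Omega>. ennreal ((cmod (g x))\<^sup>2) * indicator K x = 0"
      unfolding c_def using mg mK by (subst (asm) nn_integral_0_iff_AE) auto
    then show ?thesis by eventually_elim (auto simp: indicator_def)
  qed
  then have "AE x in arc_length \<Omega>. \<forall>K\<in>\<K>. x \<in> K \<longrightarrow> g x = 0" by (intro AE_finite_allI \<K>(1))
  moreover have "AE x in arc_length \<Omega>. x \<in> frontier \<Omega>" using AE_space[of "arc_length \<Omega>"] by simp
  ultimately show ?thesis by eventually_elim (auto simp: \<K>(2))
qed

section \<open>Linearity of the scattering problem\<close>

lemma square_norm_lincomb: "(cmod (a * x + b * y))\<^sup>2 \<le> 2 * (cmod a)\<^sup>2 * (cmod x)\<^sup>2 + 2 * (cmod b)\<^sup>2 * (cmod y)\<^sup>2"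
  using square_norm_split[of "a * x + b * y" "a * x"] by (simp add: norm_mult power_mult_distrib)

definition H1_density :: "field \<Rightarrow> plane \<Rightarrow> real" where
  "H1_density u x = (cmod (u x))\<^sup>2 + (\<Sum>i\<in>UNIV. (cmod (partial i u x))\<^sup>2)"

lemma H1_density_nonneg [simp]: "0 \<le> H1_density u x"
  by (simp add: H1_density_def sum_nonneg)

lemma H1_norm2_eq: "H1_norm2 A u = (\<integral>\<^sup>+x. ennreal (H1_density u x) * indicator A x \<partial>lborel)"
  by (simp add: H1_norm2_def H1_density_def)

lemma H1_density_lincomb:
  assumes "u differentiable (at x)" "v differentiable (at x)"
  shows "H1_density (\<lambda>x. a * u x + b * v x) x \<le> 2 * (cmod a)\<^sup>2 * H1_density u x + 2 * (cmod b)\<^sup>2 * H1_density v x"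
  unfolding H1_density_def partial_linear(1)[OF assms] sum_2
  using square_norm_lincomb[of a "u x" b "v x"] square_norm_lincomb[of a "partial 1 u x" b "partial 1 v x"]
    square_norm_lincomb[of a "partial 2 u x" b "partial 2 v x"]
  by (simp add: distrib_left)

lemma measurable_on_open:
  fixes F :: "plane \<Rightarrow> real"
  assumes "open A" "continuous_on A F"
  shows "(\<lambda>x. ennreal (F x) * indicator A x) \<in> borel_measurable borel"
proof -
  have "(\<lambda>x. indicator A x *\<^sub>R F x) \<in> borel_measurable borel"
    using assms by (intro borel_measurable_continuous_on_indicator) auto
  then have "(\<lambda>x. ennreal (indicator A x *\<^sub>R F x)) \<in> borel_measurable borel" by measurable
  moreover have "(\<lambda>x. ennreal (indicator A x *\<^sub>R F x)) = (\<lambda>x. ennreal (F x) * indicator A x)"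
    by (auto split: split_indicator)
  ultimately show ?thesis by simp
qed

lemma continuous_on_H1_density: "C1_on A u \<Longrightarrow> continuous_on A (H1_density u)"
  unfolding H1_density_def using C1_on_imp_continuous_on by (auto simp: C1_on_def intro!: continuous_intros)

lemma H1_density_measurable: "open A \<Longrightarrow> C1_on A u \<Longrightarrow> (\<lambda>x. ennreal (H1_density u x) * indicator A x) \<in> borel_measurable borel"
  by (intro measurable_on_open continuous_on_H1_density)

lemma H1_norm2_lincomb:
  assumes A: "open A" and u: "C1_on A u" "C1_on A v"
  shows "H1_norm2 A (\<lambda>x. a * u x + b * v x) \<le> ennreal (2 * (cmod a)\<^sup>2) * H1_norm2 A u + ennreal (2 * (cmod b)\<^sup>2) * H1_norm2 A v"
proof -
  have "H1_norm2 A (\<lambda>x. a * u x + b * v x) \<le> (\<integral>\<^sup>+x. ennreal (2 * (cmod a)\<^sup>2) * (ennreal (H1_density u x) * indicator A x)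
     + ennreal (2 * (cmod b)\<^sup>2) * (ennreal (H1_density v x) * indicator A x) \<partial>lborel)"
    unfolding H1_norm2_eq
  proof (rule nn_integral_mono)
    fix x
    show "ennreal (H1_density (\<lambda>x. a * u x + b * v x) x) * indicator A x \<le> ennreal (2 * (cmod a)\<^sup>2) * (ennreal (H1_density u x) * indicator A x)
     + ennreal (2 * (cmod b)\<^sup>2) * (ennreal (H1_density v x) * indicator A x)"
    proof (cases "x \<in> A")
      case True
      then have d: "u differentiable (at x)" "v differentiable (at x)" using u by (auto simp: C1_on_def)
      have "ennreal (H1_density (\<lambda>x. a * u x + b * v x) x) \<le> ennreal (2 * (cmod a)\<^sup>2 * H1_density u x + 2 * (cmod b)\<^sup>2 * H1_density v x)"
        by (intro ennreal_leI H1_density_lincomb d)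
      also have "\<dots> = ennreal (2 * (cmod a)\<^sup>2) * ennreal (H1_density u x) + ennreal (2 * (cmod b)\<^sup>2) * ennreal (H1_density v x)"
        by (subst ennreal_plus) (auto simp: ennreal_mult')
      finally show ?thesis using True by simp
    qed simp
  qed
  also have "\<dots> = ennreal (2 * (cmod a)\<^sup>2) * H1_norm2 A u + ennreal (2 * (cmod b)\<^sup>2) * H1_norm2 A v"
    unfolding H1_norm2_eq using H1_density_measurable[OF A] u
    by (subst nn_integral_add) (auto simp: nn_integral_cmult)
  finally show ?thesis .
qed

lemma in_H1loc_linear:
  assumes D: "open D" and u: "in_H1loc D u" "in_H1loc D v"
  shows "in_H1loc D (\<lambda>x. a * u x + b * v x)"
  unfolding in_H1loc_def
proof (intro conjI allI impI)
  show "C1_on D (\<lambda>x. a * u x + b * v x)" using u C1_on_linear by (auto simp: in_H1loc_def)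
  fix R :: real assume "R > 0"
  have "H1_norm2 (D \<inter> ball 0 R) (\<lambda>x. a * u x + b * v x) \<le> ennreal (2 * (cmod a)\<^sup>2) * H1_norm2 (D \<inter> ball 0 R) u + ennreal (2 * (cmod b)\<^sup>2) * H1_norm2 (D \<inter> ball 0 R) v"
    using D u by (intro H1_norm2_lincomb) (auto simp: in_H1loc_def intro: C1_on_subset)
  also have "\<dots> < \<infinity>" using u \<open>R > 0\<close> by (auto simp: in_H1loc_def ennreal_mult_less_top)
  finally show "H1_norm2 (D \<inter> ball 0 R) (\<lambda>x. a * u x + b * v x) < \<infinity>" .
qed

lemma sommerfeld_linear:
  assumes d: "\<forall>\<^sub>F x in at_infinity. u differentiable (at x)" "\<forall>\<^sub>F x in at_infinity. v differentiable (at x)"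
    and s: "sommerfeld k u" "sommerfeld k v"
  shows "sommerfeld k (\<lambda>x. a * u x + b * v x)"
proof -
  let ?S = "\<lambda>u x. of_real (sqrt (norm x)) * (frechet_derivative u (at x) (x /\<^sub>R norm x) - \<i> * of_real k * u x)"
  have "((\<lambda>x. a * ?S u x + b * ?S v x) \<longlongrightarrow> a * 0 + b * 0) at_infinity"
    using s unfolding sommerfeld_def by (intro tendsto_intros)
  moreover have "\<forall>\<^sub>F x in at_infinity. a * ?S u x + b * ?S v x = ?S (\<lambda>x. a * u x + b * v x) x"
    using d
  proof eventually_elim
    case (elim x)
    have "frechet_derivative (\<lambda>x. a * u x + b * v x) (at x) h = a * frechet_derivative u (at x) h + b * frechet_derivative v (at x) h" for h
      unfolding frechet_derivative_partial[OF partial_linear(2)[OF elim]] partial_linear(1)[OF elim]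
        frechet_derivative_partial[OF elim(1)] frechet_derivative_partial[OF elim(2)]
      by (simp add: scaleR_add_right algebra_simps)
    then show ?case by (simp add: algebra_simps)
  qed
  ultimately show ?thesis unfolding sommerfeld_def by (simp add: Lim_transform_eventually)
qed

lemma eventually_exterior:
  assumes "bounded \<Omega>"
  shows "\<forall>\<^sub>F x in at_infinity. x \<in> exterior \<Omega>"
proof -
  have "bounded (closure \<Omega>)" using assms by (rule bounded_closure)
  then obtain b where "\<And>x. x \<in> closure \<Omega> \<Longrightarrow> norm x \<le> b" by (auto simp: bounded_iff)
  then have out: "norm x > b \<Longrightarrow> x \<in> exterior \<Omega>" for x by (force simp: exterior_def)
  show ?thesis by (rule eventually_mono[OF eventually_nonzero_at_infinity[of b] out])
qed

lemma radiating_field_linear: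
  assumes \<Omega>: "bounded \<Omega>" and u: "radiating_field k \<Omega> u" "radiating_field k \<Omega> v"
  shows "radiating_field k \<Omega> (\<lambda>x. a * u x + b * v x)"
  unfolding radiating_field_def
proof (intro conjI)
  show "in_H1loc (exterior \<Omega>) (\<lambda>x. a * u x + b * v x)" "helmholtz (complex_of_real (k\<^sup>2)) (exterior \<Omega>) (\<lambda>x. a * u x + b * v x)"
    using u in_H1loc_linear[OF open_exterior] helmholtz_linear[OF open_exterior] by (auto simp: radiating_field_def)
  have "\<forall>\<^sub>F x in at_infinity. w differentiable (at x)" if "radiating_field k \<Omega> w" for w
    by (rule eventually_mono[OF eventually_exterior[OF \<Omega>]])
      (use that in \<open>auto simp: radiating_field_def in_H1loc_def C1_on_def\<close>)
  then show "sommerfeld k (\<lambda>x. a * u x + b * v x)"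
    using u by (intro sommerfeld_linear) (auto simp: radiating_field_def)
qed

lemma square_integral_lincomb:
  assumes "f \<in> borel_measurable M" "g \<in> borel_measurable M"
  shows "(\<integral>\<^sup>+x. ennreal ((cmod (a * f x + b * g x))\<^sup>2) \<partial>M)
    \<le> ennreal (2 * (cmod a)\<^sup>2) * (\<integral>\<^sup>+x. ennreal ((cmod (f x))\<^sup>2) \<partial>M) + ennreal (2 * (cmod b)\<^sup>2) * (\<integral>\<^sup>+x. ennreal ((cmod (g x))\<^sup>2) \<partial>M)"
proof -
  have "(\<integral>\<^sup>+x. ennreal ((cmod (a * f x + b * g x))\<^sup>2) \<partial>M)
    \<le> (\<integral>\<^sup>+x. ennreal (2 * (cmod a)\<^sup>2) * ennreal ((cmod (f x))\<^sup>2) + ennreal (2 * (cmod b)\<^sup>2) * ennreal ((cmod (g x))\<^sup>2) \<partial>M)"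
  proof (rule nn_integral_mono)
    fix x
    have "ennreal ((cmod (a * f x + b * g x))\<^sup>2) \<le> ennreal (2 * (cmod a)\<^sup>2 * (cmod (f x))\<^sup>2 + 2 * (cmod b)\<^sup>2 * (cmod (g x))\<^sup>2)"
      by (intro ennreal_leI square_norm_lincomb)
    also have "\<dots> = ennreal (2 * (cmod a)\<^sup>2) * ennreal ((cmod (f x))\<^sup>2) + ennreal (2 * (cmod b)\<^sup>2) * ennreal ((cmod (g x))\<^sup>2)"
      by (subst ennreal_plus) (auto simp: ennreal_mult')
    finally show "ennreal ((cmod (a * f x + b * g x))\<^sup>2) \<le> ennreal (2 * (cmod a)\<^sup>2) * ennreal ((cmod (f x))\<^sup>2) + ennreal (2 * (cmod b)\<^sup>2) * ennreal ((cmod (g x))\<^sup>2)" .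
  qed
  also have "\<dots> = ennreal (2 * (cmod a)\<^sup>2) * (\<integral>\<^sup>+x. ennreal ((cmod (f x))\<^sup>2) \<partial>M) + ennreal (2 * (cmod b)\<^sup>2) * (\<integral>\<^sup>+x. ennreal ((cmod (g x))\<^sup>2) \<partial>M)"
    using assms by (subst nn_integral_add) (auto simp: nn_integral_cmult)
  finally show ?thesis .
qed

lemma has_trace_linear:
  assumes D: "open D" and u: "C1_on D u" "C1_on D v"
    and tr: "has_trace \<Omega> D u f" "has_trace \<Omega> D v g"
  shows "has_trace \<Omega> D (\<lambda>x. a * u x + b * v x) (\<lambda>x. a * f x + b * g x)"
proof -
  let ?M = "arc_length \<Omega>"
  have m: "f \<in> borel_measurable ?M" "g \<in> borel_measurable ?M"
    and fin: "(\<integral>\<^sup>+x. ennreal ((cmod (f x))\<^sup>2) \<partial>?M) < \<infinity>" "(\<integral>\<^sup>+x. ennreal ((cmod (g x))\<^sup>2) \<partial>?M) < \<infinity>"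
    using tr by (auto simp: has_trace_def)
  obtain \<phi> :: "nat \<Rightarrow> field" where \<phi>: "\<And>n. C1_on UNIV (\<phi> n)"
      "\<And>R. R > 0 \<Longrightarrow> (\<lambda>n. H1_norm2 (D \<inter> ball 0 R) (\<lambda>x. \<phi> n x - u x)) \<longlonglongrightarrow> 0"
      "(\<lambda>n. \<integral>\<^sup>+ x. ennreal ((cmod (\<phi> n x - f x))\<^sup>2) \<partial>?M) \<longlonglongrightarrow> 0"
    using tr(1) unfolding has_trace_def by blast
  obtain \<psi> :: "nat \<Rightarrow> field" where \<psi>: "\<And>n. C1_on UNIV (\<psi> n)"
      "\<And>R. R > 0 \<Longrightarrow> (\<lambda>n. H1_norm2 (D \<inter> ball 0 R) (\<lambda>x. \<psi> n x - v x)) \<longlonglongrightarrow> 0"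
      "(\<lambda>n. \<integral>\<^sup>+ x. ennreal ((cmod (\<psi> n x - g x))\<^sup>2) \<partial>?M) \<longlonglongrightarrow> 0"
    using tr(2) unfolding has_trace_def by blast
  have sub: "C1_on (D \<inter> ball 0 R) (\<lambda>x. w x - w' x)" if "C1_on UNIV w" "C1_on D w'" for w w' :: field and R
    using C1_on_linear[OF C1_on_subset[OF that(1) subset_UNIV] C1_on_subset[OF that(2) Int_lower1], of "ball 0 R" 1 "-1"] by simp
  have eq: "a * w x + b * w' x - (a * z x + b * z' x) = a * (w x - z x) + b * (w' x - z' x)" for w w' z z' :: field and x
    by (simp add: algebra_simps)
  have lim: "(\<lambda>n. ennreal (2 * (cmod a)\<^sup>2) * s n + ennreal (2 * (cmod b)\<^sup>2) * t n) \<longlonglongrightarrow> 0"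
    if "s \<longlonglongrightarrow> 0" "t \<longlonglongrightarrow> 0" for s t :: "nat \<Rightarrow> ennreal"
  proof -
    have "(\<lambda>n. ennreal (2 * (cmod a)\<^sup>2) * s n + ennreal (2 * (cmod b)\<^sup>2) * t n) \<longlonglongrightarrow> ennreal (2 * (cmod a)\<^sup>2) * 0 + ennreal (2 * (cmod b)\<^sup>2) * 0"
      by (intro tendsto_add ennreal_tendsto_cmult that) auto
    then show ?thesis by simp
  qed
  have m\<phi>: "\<phi> n \<in> borel_measurable ?M" "\<psi> n \<in> borel_measurable ?M" for n
    by (intro borel_measurable_arc_length borel_measurable_continuous_onI C1_on_imp_continuous_on \<phi> \<psi>)+
  show ?thesis unfolding has_trace_def
  proof (intro conjI exI[of _ "\<lambda>n x. a * \<phi> n x + b * \<psi> n x"] allI impI)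
    show "(\<lambda>x. a * f x + b * g x) \<in> borel_measurable ?M" using m by measurable
    show "(\<integral>\<^sup>+x. ennreal ((cmod (a * f x + b * g x))\<^sup>2) \<partial>?M) < \<infinity>"
      using fin by (intro le_less_trans[OF square_integral_lincomb[OF m]]) (auto simp: ennreal_mult_less_top)
    show "C1_on UNIV (\<lambda>x. a * \<phi> n x + b * \<psi> n x)" for n by (intro C1_on_linear \<phi> \<psi>)
    show "(\<lambda>n. H1_norm2 (D \<inter> ball 0 R) (\<lambda>x. a * \<phi> n x + b * \<psi> n x - (a * u x + b * v x))) \<longlonglongrightarrow> 0" if R: "R > 0" for R
    proof (rule tendsto_sandwich[OF _ _ tendsto_const lim[OF \<phi>(2)[OF R] \<psi>(2)[OF R]]])
      show "\<forall>\<^sub>F n in sequentially. H1_norm2 (D \<inter> ball 0 R) (\<lambda>x. a * \<phi> n x + b * \<psi> n x - (a * u x + b * v x))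
         \<le> ennreal (2 * (cmod a)\<^sup>2) * H1_norm2 (D \<inter> ball 0 R) (\<lambda>x. \<phi> n x - u x) + ennreal (2 * (cmod b)\<^sup>2) * H1_norm2 (D \<inter> ball 0 R) (\<lambda>x. \<psi> n x - v x)"
        unfolding eq using D by (intro always_eventually allI H1_norm2_lincomb sub \<phi> \<psi> u) auto
    qed simp
    show "(\<lambda>n. \<integral>\<^sup>+ x. ennreal ((cmod (a * \<phi> n x + b * \<psi> n x - (a * f x + b * g x)))\<^sup>2) \<partial>?M) \<longlonglongrightarrow> 0"
    proof (rule tendsto_sandwich[OF _ _ tendsto_const lim[OF \<phi>(3) \<psi>(3)]])
      show "\<forall>\<^sub>F n in sequentially. (\<integral>\<^sup>+ x. ennreal ((cmod (a * \<phi> n x + b * \<psi> n x - (a * f x + b * g x)))\<^sup>2) \<partial>?M)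
        \<le> ennreal (2 * (cmod a)\<^sup>2) * (\<integral>\<^sup>+ x. ennreal ((cmod (\<phi> n x - f x))\<^sup>2) \<partial>?M) + ennreal (2 * (cmod b)\<^sup>2) * (\<integral>\<^sup>+ x. ennreal ((cmod (\<psi> n x - g x))\<^sup>2) \<partial>?M)"
        unfolding eq using m m\<phi> by (intro always_eventually allI square_integral_lincomb borel_measurable_diff) auto
    qed simp
  qed
qed

lemma continuous_on_frontier_bounded:
  fixes w :: field
  assumes "obstacle \<Omega>" "continuous_on UNIV w"
  obtains M where "M \<ge> 0" "\<And>x. x \<in> frontier \<Omega> \<Longrightarrow> cmod (w x) \<le> M"
proof -
  have "compact (frontier \<Omega>)" using assms by (auto simp: obstacle_def intro: compact_frontier_bounded)
  then have "bounded (w ` frontier \<Omega>)"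
    using assms by (intro compact_imp_bounded compact_continuous_image) (auto intro: continuous_on_subset)
  then obtain M where "\<And>x. x \<in> frontier \<Omega> \<Longrightarrow> cmod (w x) \<le> M" by (auto simp: bounded_iff)
  then show ?thesis using that[of "\<bar>M\<bar>"] by force
qed

lemma finite_arc_length:
  assumes "obstacle \<Omega>"
  shows "finite_measure (arc_length \<Omega>)"
proof (rule finite_measureI)
  have "emeasure (arc_length \<Omega>) (space (arc_length \<Omega>)) = hausdorff1 (frontier \<Omega>)"
    by (simp add: emeasure_arc_length)
  then show "emeasure (arc_length \<Omega>) (space (arc_length \<Omega>)) \<noteq> \<infinity>"
    using hausdorff1_frontier_finite[OF assms] by simp
qed

lemma continuous_square_integral:
  fixes w :: field
  assumes \<Omega>: "obstacle \<Omega>" and w: "continuous_on UNIV w"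
  shows "w \<in> borel_measurable (arc_length \<Omega>)" "(\<integral>\<^sup>+x. ennreal ((cmod (w x))\<^sup>2) \<partial>arc_length \<Omega>) < \<infinity>"
proof -
  show "w \<in> borel_measurable (arc_length \<Omega>)" by (intro borel_measurable_arc_length borel_measurable_continuous_onI w)
  interpret finite_measure "arc_length \<Omega>" by (rule finite_arc_length[OF \<Omega>])
  obtain M where M: "M \<ge> 0" "\<And>x. x \<in> frontier \<Omega> \<Longrightarrow> cmod (w x) \<le> M" using continuous_on_frontier_bounded[OF assms] by blast
  have "(\<integral>\<^sup>+x. ennreal ((cmod (w x))\<^sup>2) \<partial>arc_length \<Omega>) \<le> (\<integral>\<^sup>+x. ennreal (M\<^sup>2) \<partial>arc_length \<Omega>)"
    using M by (intro nn_integral_mono ennreal_leI power_mono) auto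
  also have "\<dots> < \<infinity>"
  proof -
    have "emeasure (arc_length \<Omega>) (frontier \<Omega>) < top"
      using emeasure_finite[of "frontier \<Omega>"] unfolding infinity_ennreal_def less_top .
    then show ?thesis by (simp add: ennreal_mult_less_top)
  qed
  finally show "(\<integral>\<^sup>+x. ennreal ((cmod (w x))\<^sup>2) \<partial>arc_length \<Omega>) < \<infinity>" .
qed

lemma norm_mult_le_squares: "cmod (a * b) \<le> (cmod a)\<^sup>2 + (cmod b)\<^sup>2"
proof -
  have "0 \<le> cmod a * cmod b" by simp
  moreover have "(cmod a - cmod b)\<^sup>2 = (cmod a)\<^sup>2 + (cmod b)\<^sup>2 - 2 * (cmod a * cmod b)"
    by (simp add: power2_eq_square algebra_simps)
  then have "2 * (cmod a * cmod b) \<le> (cmod a)\<^sup>2 + (cmod b)\<^sup>2"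
    using zero_le_power2[of "cmod a - cmod b"] by linarith
  ultimately show ?thesis unfolding norm_mult by linarith
qed

lemma integrable_mult_L2:
  fixes f g :: "'a \<Rightarrow> complex"
  assumes m: "f \<in> borel_measurable M" "g \<in> borel_measurable M"
    and fin: "(\<integral>\<^sup>+x. ennreal ((cmod (f x))\<^sup>2) \<partial>M) < \<infinity>" "(\<integral>\<^sup>+x. ennreal ((cmod (g x))\<^sup>2) \<partial>M) < \<infinity>"
  shows "integrable M (\<lambda>x. f x * g x)"
proof (rule integrableI_bounded)
  show "(\<lambda>x. f x * g x) \<in> borel_measurable M" using m by measurable
  have "(\<integral>\<^sup>+x. ennreal (cmod (f x * g x)) \<partial>M) \<le> (\<integral>\<^sup>+x. ennreal ((cmod (f x))\<^sup>2) + ennreal ((cmod (g x))\<^sup>2) \<partial>M)"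
  proof (rule nn_integral_mono)
    fix x
    have "cmod (f x * g x) \<le> (cmod (f x))\<^sup>2 + (cmod (g x))\<^sup>2"
      by (rule norm_mult_le_squares)
    then show "ennreal (cmod (f x * g x)) \<le> ennreal ((cmod (f x))\<^sup>2) + ennreal ((cmod (g x))\<^sup>2)"
      by (simp add: ennreal_plus[symmetric] del: ennreal_plus)
  qed
  also have "\<dots> < \<infinity>" using m fin by (subst nn_integral_add) auto
  finally show "(\<integral>\<^sup>+x. ennreal (norm (f x * g x)) \<partial>M) < \<infinity>" .
qed

lemma test_function_continuous: "test_function \<phi> \<Longrightarrow> continuous_on UNIV \<phi>"
  by (simp add: test_function_def C1_on_imp_continuous_on)

lemma pairing_linear:
  assumes \<Omega>: "obstacle \<Omega>" and \<phi>: "test_function \<phi>"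
    and m: "f \<in> borel_measurable (arc_length \<Omega>)" "g \<in> borel_measurable (arc_length \<Omega>)"
    and fin: "(\<integral>\<^sup>+x. ennreal ((cmod (f x))\<^sup>2) \<partial>arc_length \<Omega>) < \<infinity>" "(\<integral>\<^sup>+x. ennreal ((cmod (g x))\<^sup>2) \<partial>arc_length \<Omega>) < \<infinity>"
  shows "pairing \<Omega> (\<lambda>x. a * f x + b * g x) \<phi> = a * pairing \<Omega> f \<phi> + b * pairing \<Omega> g \<phi>"
proof -
  note c = continuous_square_integral[OF \<Omega> test_function_continuous[OF \<phi>]]
  have "(\<lambda>x. (a * f x + b * g x) * \<phi> x) = (\<lambda>x. a * (f x * \<phi> x) + b * (g x * \<phi> x))" by (simp add: algebra_simps)
  then show ?thesis unfolding pairing_def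
    using integrable_mult_L2[OF m(1) c(1) fin(1) c(2)] integrable_mult_L2[OF m(2) c(1) fin(2) c(2)] by simp
qed

definition green_integrand :: "field \<Rightarrow> field \<Rightarrow> plane \<Rightarrow> complex" where
  "green_integrand u \<phi> x = (\<Sum>i\<in>UNIV. partial i u x * partial i \<phi> x) + laplacian u x * \<phi> x"

lemma green_form_eq: "green_form D u \<phi> = (LINT x:D|lborel. green_integrand u \<phi> x)"
  by (simp add: green_form_def green_integrand_def)

lemma test_function_support:
  assumes "test_function \<phi>"
  obtains R where "R > 0" "\<And>x. x \<notin> ball 0 R \<Longrightarrow> \<phi> x = 0 \<and> (\<forall>i. partial i \<phi> x = 0)"
proof -
  obtain b where b: "\<And>x. \<phi> x \<noteq> 0 \<Longrightarrow> norm x \<le> b"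
    using assms by (auto simp: test_function_def bounded_iff)
  have *: "\<phi> x = 0 \<and> (\<forall>i. partial i \<phi> x = 0)" if "x \<notin> ball 0 (\<bar>b\<bar> + 1)" for x
  proof -
    have z: "\<phi> y = 0" if "y \<in> {y. norm y > \<bar>b\<bar>}" for y using b[of y] that by force
    have x: "x \<in> {y. norm y > \<bar>b\<bar>}" using that by simp
    have "partial i \<phi> x = partial i (\<lambda>x. 0) x" for i
      by (rule partial_cong_open[OF open_outside x z])
    then show ?thesis using z[OF x] partial_eqI[OF has_derivative_const] by metis
  qed
  show ?thesis by (rule that[OF _ *]) auto
qed

lemma helmholtz_laplacian: "helmholtz q D u \<Longrightarrow> x \<in> D \<Longrightarrow> laplacian u x = - (q * u x)"
  by (simp add: helmholtz_def eq_neg_iff_add_eq_0)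

lemma continuous_on_green_integrand:
  assumes u: "helmholtz q D u" and \<phi>: "C1_on UNIV \<phi>"
  shows "continuous_on D (green_integrand u \<phi>)"
proof -
  have "green_integrand u \<phi> x = (\<Sum>i\<in>UNIV. partial i u x * partial i \<phi> x) + (- q * u x) * \<phi> x" if "x \<in> D" for x
    using helmholtz_laplacian[OF u that] by (simp add: green_integrand_def)
  moreover have "continuous_on D (\<lambda>x. (\<Sum>i\<in>UNIV. partial i u x * partial i \<phi> x) + (- q * u x) * \<phi> x)"
    using \<phi> C1_on_imp_continuous_on[OF \<phi>]
    by (intro continuous_intros continuous_on_outside[OF u]) (auto simp: C1_on_def intro: continuous_on_subset)
  ultimately show ?thesis by (simp cong: continuous_on_cong)
qed

lemma finite_H1_norm2_ball:
  assumes "C1_on UNIV w"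
  shows "H1_norm2 (A \<inter> ball 0 R) w < \<infinity>"
proof -
  have "bounded (H1_density w ` cball 0 R)"
    using continuous_on_H1_density[OF assms] by (intro compact_imp_bounded compact_continuous_image) (auto intro: continuous_on_subset)
  then obtain M where M: "\<And>x. x \<in> cball 0 R \<Longrightarrow> H1_density w x \<le> M" unfolding bounded_iff by (metis abs_le_D1 imageI real_norm_def)
  have "H1_norm2 (A \<inter> ball 0 R) w \<le> (\<integral>\<^sup>+x. ennreal M * indicator (cball (0::plane) R) x \<partial>lborel)"
    unfolding H1_norm2_eq by (intro nn_integral_mono) (auto split: split_indicator intro!: ennreal_leI M)
  also have "\<dots> = ennreal M * emeasure lborel (cball (0::plane) R)" by (simp add: nn_integral_cmult_indicator)
  also have "\<dots> < \<infinity>" using emeasure_lborel_cball_finite[of "0::plane" R] by (simp add: ennreal_mult_less_top)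
  finally show ?thesis .
qed

lemma green_integrable:
  assumes D: "open D" and u: "in_H1loc D u" "helmholtz q D u" and \<phi>: "test_function \<phi>"
  shows "set_integrable lborel D (green_integrand u \<phi>)"
proof -
  obtain R where R: "R > 0" "\<And>x. x \<notin> ball 0 R \<Longrightarrow> \<phi> x = 0 \<and> (\<forall>i. partial i \<phi> x = 0)"
    using test_function_support[OF \<phi>] by blast
  have C\<phi>: "C1_on UNIV \<phi>" using \<phi> by (simp add: test_function_def)
  let ?E = "D \<inter> ball 0 R"
  define C where "C = 2 + cmod q"
  have C: "C \<ge> 0" by (simp add: C_def)
  have bound: "cmod (green_integrand u \<phi> x) \<le> C * H1_density u x + C * H1_density \<phi> x" if "x \<in> D" for x
  proof -
    have L: "laplacian u x = - (q * u x)" by (rule helmholtz_laplacian[OF u(2) that])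
    have "cmod (green_integrand u \<phi> x) \<le> cmod (partial 1 u x * partial 1 \<phi> x) + cmod (partial 2 u x * partial 2 \<phi> x) + cmod (q * (u x * \<phi> x))"
      unfolding green_integrand_def sum_2 L
      by (rule order_trans[OF norm_triangle_ineq add_mono[OF norm_triangle_ineq]]) (simp add: mult.assoc)
    also have "\<dots> \<le> ((cmod (partial 1 u x))\<^sup>2 + (cmod (partial 1 \<phi> x))\<^sup>2) + ((cmod (partial 2 u x))\<^sup>2 + (cmod (partial 2 \<phi> x))\<^sup>2)
        + cmod q * ((cmod (u x))\<^sup>2 + (cmod (\<phi> x))\<^sup>2)"
      unfolding norm_mult[of q] by (intro add_mono mult_left_mono norm_mult_le_squares) auto
    also have "\<dots> \<le> C * H1_density u x + C * H1_density \<phi> x"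
    proof -
      have g: "a1 + b1 + (a2 + b2) + c * (a0 + b0) \<le> (2 + c) * (a0 + (a1 + a2)) + (2 + c) * (b0 + (b1 + b2))"
        if "0 \<le> a0" "0 \<le> a1" "0 \<le> a2" "0 \<le> b0" "0 \<le> b1" "0 \<le> b2" "0 \<le> c" for a0 a1 a2 b0 b1 b2 c :: real
      proof -
        have "0 \<le> c * a1" "0 \<le> c * a2" "0 \<le> c * b1" "0 \<le> c * b2" using that by simp_all
        then show ?thesis using that by (simp add: algebra_simps)
      qed
      show ?thesis unfolding H1_density_def sum_2 C_def by (rule g) auto
    qed
    finally show ?thesis .
  qed
  show ?thesis unfolding set_integrable_def
  proof (rule integrableI_bounded)
    show "(\<lambda>x. indicator D x *\<^sub>R green_integrand u \<phi> x) \<in> borel_measurable lborel"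
      using borel_measurable_continuous_on_indicator[OF borel_open[OF D] continuous_on_green_integrand[OF u(2) C\<phi>]] by simp
    have "(\<integral>\<^sup>+x. ennreal (norm (indicator D x *\<^sub>R green_integrand u \<phi> x)) \<partial>lborel)
       \<le> (\<integral>\<^sup>+x. ennreal C * (ennreal (H1_density u x) * indicator ?E x) + ennreal C * (ennreal (H1_density \<phi> x) * indicator ?E x) \<partial>lborel)"
    proof (rule nn_integral_mono)
      fix x
      show "ennreal (norm (indicator D x *\<^sub>R green_integrand u \<phi> x)) \<le> ennreal C * (ennreal (H1_density u x) * indicator ?E x) + ennreal C * (ennreal (H1_density \<phi> x) * indicator ?E x)"
      proof (cases "x \<in> ?E")
        case True
        have "ennreal (cmod (green_integrand u \<phi> x)) \<le> ennreal (C * H1_density u x + C * H1_density \<phi> x)"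
          using bound True by (intro ennreal_leI) auto
        also have "\<dots> = ennreal C * ennreal (H1_density u x) + ennreal C * ennreal (H1_density \<phi> x)"
          using C by (subst ennreal_plus) (auto simp: ennreal_mult')
        finally show ?thesis using True by simp
      next
        case False
        then have "x \<notin> D \<or> green_integrand u \<phi> x = 0" using R(2)[of x] by (auto simp: green_integrand_def)
        then show ?thesis by auto
      qed
    qed
    also have "\<dots> = ennreal C * H1_norm2 ?E u + ennreal C * H1_norm2 ?E \<phi>"
    proof -
      have "C1_on D u" using u(1) by (simp add: in_H1loc_def)
      then have "C1_on ?E u" "C1_on ?E \<phi>"
        using C1_on_subset[OF _ Int_lower1] C1_on_subset[OF C\<phi> subset_UNIV] by blast+
      then have m: "(\<lambda>x. ennreal (H1_density u x) * indicator ?E x) \<in> borel_measurable borel"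
          "(\<lambda>x. ennreal (H1_density \<phi> x) * indicator ?E x) \<in> borel_measurable borel"
        using D by (auto intro!: H1_density_measurable)
      show ?thesis
        unfolding H1_norm2_eq using m by (subst nn_integral_add) (auto simp: nn_integral_cmult)
    qed
    also have "\<dots> < \<infinity>"
      using u(1) R(1) finite_H1_norm2_ball[OF C\<phi>] by (auto simp: in_H1loc_def ennreal_mult_less_top)
    finally show "(\<integral>\<^sup>+x. ennreal (norm (indicator D x *\<^sub>R green_integrand u \<phi> x)) \<partial>lborel) < \<infinity>" .
  qed
qed

lemma green_form_linear:
  assumes D: "open D" and u: "in_H1loc D u" "helmholtz q D u" "in_H1loc D v" "helmholtz q D v" and \<phi>: "test_function \<phi>"
  shows "green_form D (\<lambda>x. a * u x + b * v x) \<phi> = a * green_form D u \<phi> + b * green_form D v \<phi>"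
proof -
  have C2: "C2_on D u" "C2_on D v" using u by (auto simp: helmholtz_def)
  have pt: "green_integrand (\<lambda>x. a * u x + b * v x) \<phi> x = a * green_integrand u \<phi> x + b * green_integrand v \<phi> x" if "x \<in> D" for x
  proof -
    have d: "u differentiable (at x)" "v differentiable (at x)" using C2 that by (auto simp: C2_on_def C1_on_def)
    show ?thesis unfolding green_integrand_def sum_2 laplacian_linear[OF D C2 that] partial_linear(1)[OF d]
      by (simp add: algebra_simps)
  qed
  have "green_form D (\<lambda>x. a * u x + b * v x) \<phi> = (LINT x:D|lborel. a * green_integrand u \<phi> x + b * green_integrand v \<phi> x)"
    unfolding green_form_eq using D pt by (intro set_lebesgue_integral_cong) auto
  also have "\<dots> = a * green_form D u \<phi> + b * green_form D v \<phi>"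
    unfolding green_form_eq
    using green_integrable[OF D u(1,2) \<phi>] green_integrable[OF D u(3,4) \<phi>]
    by (subst set_integral_add(2)) auto
  finally show ?thesis .
qed

lemma incident_in_H1loc: "C1_on UNIV w \<Longrightarrow> in_H1loc D w"
  unfolding in_H1loc_def using finite_H1_norm2_ball C1_on_subset by blast

lemma incident_fieldD:
  assumes "incident_field k w"
  shows "C1_on UNIV w" "continuous_on UNIV w" "in_H1loc D w" "helmholtz (of_real (k\<^sup>2)) D w"
proof -
  show C: "C1_on UNIV w" using assms by (simp add: incident_field_def helmholtz_def C2_on_def)
  then show "continuous_on UNIV w" "in_H1loc D w" by (rule C1_on_imp_continuous_on, rule incident_in_H1loc)
  show "helmholtz (of_real (k\<^sup>2)) D w" using assms C2_on_subset by (auto simp: incident_field_def helmholtz_def)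
qed

lemma dnu_ext_linear:
  assumes "in_H1loc (exterior \<Omega>) u" "helmholtz q (exterior \<Omega>) u" "in_H1loc (exterior \<Omega>) v" "helmholtz q (exterior \<Omega>) v"
    and "test_function \<phi>"
  shows "dnu_ext \<Omega> (\<lambda>x. a * u x + b * v x) \<phi> = a * dnu_ext \<Omega> u \<phi> + b * dnu_ext \<Omega> v \<phi>"
  unfolding dnu_ext_def using green_form_linear[OF open_exterior assms] by simp

lemma boundary_cond_linear:
  assumes \<Omega>: "obstacle \<Omega>" and inc: "incident_field k ui" "incident_field k vi"
    and rad: "radiating_field k \<Omega> us" "radiating_field k \<Omega> vs"
    and bc: "boundary_cond bc \<Omega> ui us" "boundary_cond bc \<Omega> vi vs"
  shows "boundary_cond bc \<Omega> (\<lambda>x. a * ui x + b * vi x) (\<lambda>x. a * us x + b * vs x)"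
proof -
  have H: "in_H1loc (exterior \<Omega>) us" "helmholtz (of_real (k\<^sup>2)) (exterior \<Omega>) us"
    "in_H1loc (exterior \<Omega>) vs" "helmholtz (of_real (k\<^sup>2)) (exterior \<Omega>) vs"
    using rad by (auto simp: radiating_field_def)
  have C: "C1_on (exterior \<Omega>) us" "C1_on (exterior \<Omega>) vs" using H by (auto simp: in_H1loc_def)
  note I = incident_fieldD[OF inc(1)] incident_fieldD[OF inc(2)]
  note ds = dnu_ext_linear[OF H] and di = dnu_ext_linear[OF I(3,4) I(7,8)]
  show ?thesis
  proof (cases bc)
    case Dirichlet
    then show ?thesis
      using has_trace_linear[OF open_exterior C, of \<Omega> "\<lambda>x. - ui x" "\<lambda>x. - vi x" a b] bc by simp
  next
    case Neumann
    then show ?thesis using bc by (auto simp: ds di algebra_simps)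
  next
    case (Impedance \<mu>)
    obtain f where f: "has_trace \<Omega> (exterior \<Omega>) us f"
      "\<And>\<phi>. test_function \<phi> \<Longrightarrow> dnu_ext \<Omega> us \<phi> + \<mu> * pairing \<Omega> f \<phi> = - (dnu_ext \<Omega> ui \<phi> + \<mu> * pairing \<Omega> ui \<phi>)"
      using bc(1) Impedance by auto
    obtain g where g: "has_trace \<Omega> (exterior \<Omega>) vs g"
      "\<And>\<phi>. test_function \<phi> \<Longrightarrow> dnu_ext \<Omega> vs \<phi> + \<mu> * pairing \<Omega> g \<phi> = - (dnu_ext \<Omega> vi \<phi> + \<mu> * pairing \<Omega> vi \<phi>)"
      using bc(2) Impedance by auto
    have m: "f \<in> borel_measurable (arc_length \<Omega>)" "g \<in> borel_measurable (arc_length \<Omega>)"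
      "(\<integral>\<^sup>+x. ennreal ((cmod (f x))\<^sup>2) \<partial>arc_length \<Omega>) < \<infinity>" "(\<integral>\<^sup>+x. ennreal ((cmod (g x))\<^sup>2) \<partial>arc_length \<Omega>) < \<infinity>"
      using f(1) g(1) by (auto simp: has_trace_def)
    note cu = continuous_square_integral[OF \<Omega> I(2)] and cv = continuous_square_integral[OF \<Omega> I(6)]
    have "dnu_ext \<Omega> (\<lambda>x. a * us x + b * vs x) \<phi> + \<mu> * pairing \<Omega> (\<lambda>x. a * f x + b * g x) \<phi>
       = - (dnu_ext \<Omega> (\<lambda>x. a * ui x + b * vi x) \<phi> + \<mu> * pairing \<Omega> (\<lambda>x. a * ui x + b * vi x) \<phi>)"
      if \<phi>: "test_function \<phi>" for \<phi>
    proof -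
      have "dnu_ext \<Omega> (\<lambda>x. a * us x + b * vs x) \<phi> + \<mu> * pairing \<Omega> (\<lambda>x. a * f x + b * g x) \<phi>
         = a * (dnu_ext \<Omega> us \<phi> + \<mu> * pairing \<Omega> f \<phi>) + b * (dnu_ext \<Omega> vs \<phi> + \<mu> * pairing \<Omega> g \<phi>)"
        unfolding ds[OF \<phi>] pairing_linear[OF \<Omega> \<phi> m] by (simp add: algebra_simps)
      also have "\<dots> = - (dnu_ext \<Omega> (\<lambda>x. a * ui x + b * vi x) \<phi> + \<mu> * pairing \<Omega> (\<lambda>x. a * ui x + b * vi x) \<phi>)"
        unfolding f(2)[OF \<phi>] g(2)[OF \<phi>] di[OF \<phi>] pairing_linear[OF \<Omega> \<phi> cu(1) cv(1) cu(2) cv(2)] by (simp add: algebra_simps)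
      finally show ?thesis .
    qed
    then show ?thesis using has_trace_linear[OF open_exterior C f(1) g(1), of a b] Impedance by auto
  qed
qed

lemma transmission_solution_linear:
  assumes \<Omega>: "obstacle \<Omega>" and inc: "incident_field k ui" "incident_field k vi"
    and sol: "transmission_solution n0 lam k \<Omega> ui us u" "transmission_solution n0 lam k \<Omega> vi vs v"
  shows "transmission_solution n0 lam k \<Omega> (\<lambda>x. a * ui x + b * vi x) (\<lambda>x. a * us x + b * vs x) (\<lambda>x. a * u x + b * v x)"
proof -
  have O: "open \<Omega>" "bounded \<Omega>" using \<Omega> by (auto simp: obstacle_def)
  have rad: "radiating_field k \<Omega> us" "radiating_field k \<Omega> vs" using sol by (auto simp: transmission_solution_def)
  have H: "in_H1loc (exterior \<Omega>) us" "helmholtz (of_real (k\<^sup>2)) (exterior \<Omega>) us"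
    "in_H1loc (exterior \<Omega>) vs" "helmholtz (of_real (k\<^sup>2)) (exterior \<Omega>) vs"
    using rad by (auto simp: radiating_field_def)
  have Hi: "in_H1loc \<Omega> u" "helmholtz (of_real (k\<^sup>2) * n0) \<Omega> u" "in_H1loc \<Omega> v" "helmholtz (of_real (k\<^sup>2) * n0) \<Omega> v"
    using sol by (auto simp: transmission_solution_def)
  have C: "C1_on (exterior \<Omega>) us" "C1_on (exterior \<Omega>) vs" "C1_on \<Omega> u" "C1_on \<Omega> v" using H Hi by (auto simp: in_H1loc_def)
  note I = incident_fieldD[OF inc(1)] incident_fieldD[OF inc(2)]
  note ds = dnu_ext_linear[OF H] and di = dnu_ext_linear[OF I(3,4) I(7,8)]
  obtain f1 f2 where f: "has_trace \<Omega> (exterior \<Omega>) us f1" "has_trace \<Omega> \<Omega> u f2" "AE x in arc_length \<Omega>. f1 x - f2 x = - ui x"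
    using sol(1) unfolding transmission_solution_def by blast
  obtain g1 g2 where g: "has_trace \<Omega> (exterior \<Omega>) vs g1" "has_trace \<Omega> \<Omega> v g2" "AE x in arc_length \<Omega>. g1 x - g2 x = - vi x"
    using sol(2) unfolding transmission_solution_def by blast
  have sd: "dnu_ext \<Omega> us \<phi> - of_real lam * dnu_int \<Omega> u \<phi> = - dnu_ext \<Omega> ui \<phi>"
    "dnu_ext \<Omega> vs \<phi> - of_real lam * dnu_int \<Omega> v \<phi> = - dnu_ext \<Omega> vi \<phi>" if "test_function \<phi>" for \<phi>
    using sol that unfolding transmission_solution_def by blast+
  show ?thesis unfolding transmission_solution_def
  proof (intro conjI allI impI)
    show "radiating_field k \<Omega> (\<lambda>x. a * us x + b * vs x)" by (rule radiating_field_linear[OF O(2) rad])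
    show "in_H1loc \<Omega> (\<lambda>x. a * u x + b * v x)" by (rule in_H1loc_linear[OF O(1) Hi(1,3)])
    show "helmholtz (of_real (k\<^sup>2) * n0) \<Omega> (\<lambda>x. a * u x + b * v x)" by (rule helmholtz_linear[OF O(1) Hi(2,4)])
    have "AE x in arc_length \<Omega>. (a * f1 x + b * g1 x) - (a * f2 x + b * g2 x) = - (a * ui x + b * vi x)"
      using f(3) g(3)
    proof eventually_elim
      case (elim x)
      have "(a * f1 x + b * g1 x) - (a * f2 x + b * g2 x) = a * (f1 x - f2 x) + b * (g1 x - g2 x)" by (simp add: algebra_simps)
      then show ?case unfolding elim by simp
    qed
    then show "\<exists>g h. has_trace \<Omega> (exterior \<Omega>) (\<lambda>x. a * us x + b * vs x) g \<and> has_trace \<Omega> \<Omega> (\<lambda>x. a * u x + b * v x) h \<and>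
        (AE x in arc_length \<Omega>. g x - h x = - (a * ui x + b * vi x))"
      using has_trace_linear[OF open_exterior C(1,2) f(1) g(1), of a b] has_trace_linear[OF O(1) C(3,4) f(2) g(2), of a b]
      by (intro exI conjI)
    fix \<phi> assume \<phi>: "test_function \<phi>"
    have "dnu_ext \<Omega> (\<lambda>x. a * us x + b * vs x) \<phi> - of_real lam * dnu_int \<Omega> (\<lambda>x. a * u x + b * v x) \<phi>
      = a * (dnu_ext \<Omega> us \<phi> - of_real lam * dnu_int \<Omega> u \<phi>) + b * (dnu_ext \<Omega> vs \<phi> - of_real lam * dnu_int \<Omega> v \<phi>)"
      unfolding ds[OF \<phi>] dnu_int_def green_form_linear[OF O(1) Hi \<phi>] by (simp add: algebra_simps)
    also have "\<dots> = - dnu_ext \<Omega> (\<lambda>x. a * ui x + b * vi x) \<phi>"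
      unfolding sd[OF \<phi>] di[OF \<phi>] by simp
    finally show "dnu_ext \<Omega> (\<lambda>x. a * us x + b * vs x) \<phi> - of_real lam * dnu_int \<Omega> (\<lambda>x. a * u x + b * v x) \<phi>
      = - dnu_ext \<Omega> (\<lambda>x. a * ui x + b * vi x) \<phi>" .
  qed
qed

theorem scattered_field_linear:
  assumes \<Omega>: "obstacle \<Omega>" and inc: "incident_field k ui" "incident_field k vi"
    and sol: "scattered_field P k \<Omega> ui us" "scattered_field P k \<Omega> vi vs"
  shows "scattered_field P k \<Omega> (\<lambda>x. a * ui x + b * vi x) (\<lambda>x. a * us x + b * vs x)"
proof (cases P)
  case (Impenetrable bc)
  then show ?thesis
    using sol boundary_cond_linear[OF \<Omega> inc] radiating_field_linear \<Omega>
    by (auto simp: impenetrable_solution_def obstacle_def)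
next
  case (Transmission n0 lam)
  obtain u where u: "transmission_solution n0 lam k \<Omega> ui us u" using sol(1) Transmission by auto
  obtain v where v: "transmission_solution n0 lam k \<Omega> vi vs v" using sol(2) Transmission by auto
  show ?thesis
    unfolding Transmission scattered_field.simps
    by (rule exI, rule transmission_solution_linear[OF \<Omega> inc u v])
qed

section \<open>Translating the scattering problem\<close>

lemma image_shift_iff: "y \<in> (\<lambda>x. x + h) ` S \<longleftrightarrow> y - h \<in> (S :: plane set)"
  by (auto simp: image_iff intro: bexI[of _ "y - h"])

lemma shift_as_translation: "(\<lambda>x. x + h) = (\<lambda>x. h + (x :: plane))"
  by (simp add: add.commute)

lemma closure_shift: "closure ((\<lambda>x. x + h) ` S) = (\<lambda>x. x + h) ` closure (S :: plane set)"
  unfolding shift_as_translation by (rule closure_translation)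

lemma frontier_shift: "frontier ((\<lambda>x. x + h) ` S) = (\<lambda>x. x + h) ` frontier (S :: plane set)"
  unfolding shift_as_translation by (rule frontier_translation)

lemma open_shift: "open S \<Longrightarrow> open ((\<lambda>x. x + h) ` (S :: plane set))"
  unfolding shift_as_translation by (rule open_translation)

lemma exterior_shift: "exterior ((\<lambda>x. x + h) ` \<Omega>) = (\<lambda>x. x + h) ` exterior \<Omega>"
  by (rule set_eqI) (simp add: exterior_def closure_shift image_shift_iff)

lemma distr_lborel_shift: "distr lborel borel (\<lambda>x. x + h) = (lborel :: plane measure)"
  unfolding shift_as_translation by (rule lborel_distr_plus)

lemma nn_integral_lborel_shift:
  assumes "F \<in> borel_measurable (borel :: plane measure)"
  shows "(\<integral>\<^sup>+x. F (x + h) \<partial>lborel) = (\<integral>\<^sup>+x. F x \<partial>lborel)"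
proof -
  have "(\<integral>\<^sup>+x. F x \<partial>distr lborel borel (\<lambda>x. x + h)) = (\<integral>\<^sup>+x. F (x + h) \<partial>lborel)"
    using assms by (intro nn_integral_distr) auto
  then show ?thesis by (simp only: distr_lborel_shift)
qed

lemma H1_density_shift: "H1_density (\<lambda>x. f (x + h)) x = H1_density f (x + h)"
  by (simp add: H1_density_def partial_shift)

lemma H1_norm2_mono: "A \<subseteq> B \<Longrightarrow> H1_norm2 A u \<le> H1_norm2 B u"
  unfolding H1_norm2_eq by (intro nn_integral_mono) (auto split: split_indicator)

lemma H1_norm2_shift:
  assumes A: "open A" and f: "C1_on ((\<lambda>x. x + h) ` A) f"
  shows "H1_norm2 A (\<lambda>x. f (x + h)) = H1_norm2 ((\<lambda>x. x + h) ` A) f"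
proof -
  have "H1_norm2 A (\<lambda>x. f (x + h)) = (\<integral>\<^sup>+x. ennreal (H1_density f (x + h)) * indicator ((\<lambda>x. x + h) ` A) (x + h) \<partial>lborel)"
    unfolding H1_norm2_eq H1_density_shift by (intro nn_integral_cong) (auto simp: indicator_def)
  also have "\<dots> = H1_norm2 ((\<lambda>x. x + h) ` A) f"
    unfolding H1_norm2_eq by (rule nn_integral_lborel_shift[OF H1_density_measurable[OF open_shift[OF A] f]])
  finally show ?thesis .
qed

lemma shift_ball_subset: "(\<lambda>x. x + h) ` (D \<inter> ball 0 R) \<subseteq> (\<lambda>x. x + h) ` D \<inter> ball 0 (R + norm (h :: plane))"
  using norm_triangle_ineq[of _ h] by (fastforce intro: le_less_trans)

lemma H1_norm2_shift_le:
  assumes D: "open D" and f: "C1_on ((\<lambda>x. x + h) ` D) f"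
  shows "H1_norm2 (D \<inter> ball 0 R) (\<lambda>x. f (x + h)) \<le> H1_norm2 ((\<lambda>x. x + h) ` D \<inter> ball 0 (R + norm h)) f"
proof -
  have "H1_norm2 (D \<inter> ball 0 R) (\<lambda>x. f (x + h)) = H1_norm2 ((\<lambda>x. x + h) ` (D \<inter> ball 0 R)) f"
    using D by (intro H1_norm2_shift C1_on_subset[OF f]) auto
  also have "\<dots> \<le> H1_norm2 ((\<lambda>x. x + h) ` D \<inter> ball 0 (R + norm h)) f"
    by (rule H1_norm2_mono[OF shift_ball_subset])
  finally show ?thesis .
qed

lemma in_H1loc_shift:
  assumes D: "open D" and f: "in_H1loc ((\<lambda>x. x + h) ` D) f"
  shows "in_H1loc D (\<lambda>x. f (x + h))"
  unfolding in_H1loc_def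
proof (intro conjI allI impI)
  have C: "C1_on ((\<lambda>x. x + h) ` D) f" using f by (simp add: in_H1loc_def)
  then show "C1_on D (\<lambda>x. f (x + h))" by (rule C1_on_shift)
  fix R :: real assume "R > 0"
  then have "R + norm h > 0" by (intro add_pos_nonneg) auto
  then have "H1_norm2 ((\<lambda>x. x + h) ` D \<inter> ball 0 (R + norm h)) f < \<infinity>" using f by (simp add: in_H1loc_def)
  then show "H1_norm2 (D \<inter> ball 0 R) (\<lambda>x. f (x + h)) < \<infinity>"
    by (rule le_less_trans[OF H1_norm2_shift_le[OF D C]])
qed

lemma shift_measurable_arc_length:
  "(\<lambda>x. x + h) \<in> measurable (arc_length \<Omega>) (arc_length ((\<lambda>x. x + h) ` \<Omega>))"
proof (rule measurableI)
  fix x assume "x \<in> space (arc_length \<Omega>)"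
  then show "x + h \<in> space (arc_length ((\<lambda>x. x + h) ` \<Omega>))" by (simp add: frontier_shift)
next
  fix A assume "A \<in> sets (arc_length ((\<lambda>x. x + h) ` \<Omega>))"
  then have "A \<in> sets borel" by (simp add: sets_arc_length)
  then have "(\<lambda>x. x + h) -` A \<inter> space borel \<in> sets borel" by (intro measurable_sets) auto
  then have "(\<lambda>x. x + h) -` A \<in> sets borel" by simp
  then show "(\<lambda>x. x + h) -` A \<inter> space (arc_length \<Omega>) \<in> sets (arc_length \<Omega>)"
    by (auto simp: sets_arc_length)
qed

lemma arc_length_shift:
  "arc_length ((\<lambda>x. x + h) ` \<Omega>) = distr (arc_length \<Omega>) (arc_length ((\<lambda>x. x + h) ` \<Omega>)) (\<lambda>x. x + h)"
proof (rule measure_eqI)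
  fix A assume A: "A \<in> sets (arc_length ((\<lambda>x. x + h) ` \<Omega>))"
  then have A': "A \<in> sets borel" "A \<subseteq> (\<lambda>x. x + h) ` frontier \<Omega>" by (auto simp: sets_arc_length frontier_shift)
  let ?B = "(\<lambda>x. x + h) -` A \<inter> space (arc_length \<Omega>)"
  have B: "?B \<in> sets (arc_length \<Omega>)" using measurable_sets[OF shift_measurable_arc_length A] .
  have "(\<lambda>x. x + h) ` ?B = A" using A'(2) by (auto simp: image_iff)
  then have "hausdorff1 A = hausdorff1 ?B" using hausdorff1_translation[of h ?B] by simp
  moreover have "emeasure (arc_length ((\<lambda>x. x + h) ` \<Omega>)) A = hausdorff1 A"
    using A by (intro emeasure_arc_length) (auto simp: sets_arc_length)
  moreover have "emeasure (arc_length \<Omega>) ?B = hausdorff1 ?B"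
    using B by (intro emeasure_arc_length) (auto simp: sets_arc_length)
  ultimately show "emeasure (arc_length ((\<lambda>x. x + h) ` \<Omega>)) A
     = emeasure (distr (arc_length \<Omega>) (arc_length ((\<lambda>x. x + h) ` \<Omega>)) (\<lambda>x. x + h)) A"
    by (simp add: emeasure_distr[OF shift_measurable_arc_length A])
qed simp

lemma nn_integral_arc_length_shift:
  assumes "F \<in> borel_measurable (arc_length ((\<lambda>x. x + h) ` \<Omega>))"
  shows "(\<integral>\<^sup>+x. F (x + h) \<partial>arc_length \<Omega>) = (\<integral>\<^sup>+x. F x \<partial>arc_length ((\<lambda>x. x + h) ` \<Omega>))"
proof -
  have "(\<integral>\<^sup>+x. F x \<partial>distr (arc_length \<Omega>) (arc_length ((\<lambda>x. x + h) ` \<Omega>)) (\<lambda>x. x + h)) = (\<integral>\<^sup>+x. F (x + h) \<partial>arc_length \<Omega>)"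
    using assms by (intro nn_integral_distr shift_measurable_arc_length) simp
  then show ?thesis by (simp only: arc_length_shift[symmetric])
qed

lemma has_trace_shift:
  assumes D: "open D" and u: "C1_on ((\<lambda>x. x + h) ` D) u"
    and tr: "has_trace ((\<lambda>x. x + h) ` \<Omega>) ((\<lambda>x. x + h) ` D) u g"
  shows "has_trace \<Omega> D (\<lambda>x. u (x + h)) (\<lambda>x. g (x + h))"
proof -
  let ?\<Omega> = "(\<lambda>x. x + h) ` \<Omega>" and ?D = "(\<lambda>x. x + h) ` D"
  have g: "g \<in> borel_measurable (arc_length ?\<Omega>)" "(\<integral>\<^sup>+x. ennreal ((cmod (g x))\<^sup>2) \<partial>arc_length ?\<Omega>) < \<infinity>"
    using tr by (auto simp: has_trace_def)
  obtain \<phi> :: "nat \<Rightarrow> field" where \<phi>: "\<And>n. C1_on UNIV (\<phi> n)"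
      "\<And>R. R > 0 \<Longrightarrow> (\<lambda>n. H1_norm2 (?D \<inter> ball 0 R) (\<lambda>x. \<phi> n x - u x)) \<longlonglongrightarrow> 0"
      "(\<lambda>n. \<integral>\<^sup>+ x. ennreal ((cmod (\<phi> n x - g x))\<^sup>2) \<partial>arc_length ?\<Omega>) \<longlonglongrightarrow> 0"
    using tr unfolding has_trace_def by blast
  have C: "C1_on ?D (\<lambda>x. \<phi> n x - u x)" for n
    using C1_on_linear[OF C1_on_subset[OF \<phi>(1) subset_UNIV] u, of 1 n "-1"] by simp
  have m\<phi>: "\<phi> n \<in> borel_measurable (arc_length ?\<Omega>)" for n
    by (intro borel_measurable_arc_length borel_measurable_continuous_onI C1_on_imp_continuous_on \<phi>)
  show ?thesis unfolding has_trace_def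
  proof (intro conjI exI[of _ "\<lambda>n x. \<phi> n (x + h)"] allI impI)
    show "(\<lambda>x. g (x + h)) \<in> borel_measurable (arc_length \<Omega>)"
      by (rule measurable_compose[OF shift_measurable_arc_length g(1)])
    show "(\<integral>\<^sup>+x. ennreal ((cmod (g (x + h)))\<^sup>2) \<partial>arc_length \<Omega>) < \<infinity>"
      using g by (subst nn_integral_arc_length_shift[where F="\<lambda>x. ennreal ((cmod (g x))\<^sup>2)"]) auto
    show "C1_on UNIV (\<lambda>x. \<phi> n (x + h))" for n by (rule C1_on_shift[OF C1_on_subset[OF \<phi>(1) subset_UNIV]])
    show "(\<lambda>n. H1_norm2 (D \<inter> ball 0 R) (\<lambda>x. \<phi> n (x + h) - u (x + h))) \<longlonglongrightarrow> 0" if R: "R > 0" for R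
    proof (rule tendsto_sandwich[OF _ _ tendsto_const])
      show "(\<lambda>n. H1_norm2 (?D \<inter> ball 0 (R + norm h)) (\<lambda>x. \<phi> n x - u x)) \<longlonglongrightarrow> 0"
        using R by (intro \<phi> add_pos_nonneg) auto
      show "\<forall>\<^sub>F n in sequentially. H1_norm2 (D \<inter> ball 0 R) (\<lambda>x. \<phi> n (x + h) - u (x + h))
          \<le> H1_norm2 (?D \<inter> ball 0 (R + norm h)) (\<lambda>x. \<phi> n x - u x)"
        by (intro always_eventually allI H1_norm2_shift_le[OF D C])
    qed simp
    have "(\<integral>\<^sup>+ x. ennreal ((cmod (\<phi> n (x + h) - g (x + h)))\<^sup>2) \<partial>arc_length \<Omega>)
       = (\<integral>\<^sup>+ x. ennreal ((cmod (\<phi> n x - g x))\<^sup>2) \<partial>arc_length ?\<Omega>)" for n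
      using g(1) m\<phi>[of n] by (intro nn_integral_arc_length_shift[where F="\<lambda>x. ennreal ((cmod (\<phi> n x - g x))\<^sup>2)"]) auto
    then show "(\<lambda>n. \<integral>\<^sup>+ x. ennreal ((cmod (\<phi> n (x + h) - g (x + h)))\<^sup>2) \<partial>arc_length \<Omega>) \<longlonglongrightarrow> 0"
      using \<phi>(3) by simp
  qed
qed

lemma test_function_shift:
  assumes "test_function \<phi>"
  shows "test_function (\<lambda>x. \<phi> (x + h))"
proof -
  have "C1_on ((\<lambda>x. x + h) ` UNIV) \<phi>" using assms C1_on_subset[OF _ subset_UNIV] by (auto simp: test_function_def)
  then have "C1_on UNIV (\<lambda>x. \<phi> (x + h))" by (rule C1_on_shift)
  moreover have "bounded {x. \<phi> (x + h) \<noteq> 0}"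
  proof -
    have "bounded {x. \<phi> x \<noteq> 0}" using assms by (simp add: test_function_def)
    then have "bounded ((\<lambda>x. - h + x) ` {x. \<phi> x \<noteq> 0})" by (rule bounded_translation)
    moreover have "{x. \<phi> (x + h) \<noteq> 0} \<subseteq> (\<lambda>x. - h + x) ` {x. \<phi> x \<noteq> 0}"
    proof
      fix x assume "x \<in> {x. \<phi> (x + h) \<noteq> 0}"
      then have "x + h \<in> {x. \<phi> x \<noteq> 0}" by simp
      then show "x \<in> (\<lambda>x. - h + x) ` {x. \<phi> x \<noteq> 0}" by (rule image_eqI[rotated]) simp
    qed
    ultimately show ?thesis by (rule bounded_subset)
  qed
  ultimately show ?thesis by (simp add: test_function_def)
qed

lemma green_form_shift:
  assumes D: "open D" and u: "helmholtz q ((\<lambda>x. x + h) ` D) u" and \<phi>: "C1_on UNIV \<phi>"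
  shows "green_form D (\<lambda>x. u (x + h)) (\<lambda>x. \<phi> (x + h)) = green_form ((\<lambda>x. x + h) ` D) u \<phi>"
proof -
  let ?D = "(\<lambda>x. x + h) ` D"
  let ?F = "\<lambda>x. indicator ?D x *\<^sub>R green_integrand u \<phi> x"
  have m: "?F \<in> borel_measurable borel"
    by (rule borel_measurable_continuous_on_indicator[OF borel_open[OF open_shift[OF D]] continuous_on_green_integrand[OF u \<phi>]])
  have "green_form D (\<lambda>x. u (x + h)) (\<lambda>x. \<phi> (x + h)) = (LINT x|lborel. ?F (x + h))"
    unfolding green_form_eq set_lebesgue_integral_def
    by (intro Bochner_Integration.integral_cong)
      (auto simp: green_integrand_def partial_shift laplacian_shift indicator_def)
  also have "\<dots> = (LINT x|distr lborel borel (\<lambda>x. x + h). ?F x)"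
    using m by (intro integral_distr[symmetric]) auto
  also have "\<dots> = green_form ?D u \<phi>"
    unfolding distr_lborel_shift green_form_eq set_lebesgue_integral_def ..
  finally show ?thesis .
qed

lemma green_form_shift':
  assumes D: "open D" and u: "helmholtz q ((\<lambda>x. x + h) ` D) u" and \<phi>: "test_function \<phi>"
  shows "green_form D (\<lambda>x. u (x + h)) \<phi> = green_form ((\<lambda>x. x + h) ` D) u (\<lambda>x. \<phi> (x + - h))"
proof -
  have "C1_on UNIV (\<lambda>x. \<phi> (x + - h))" using test_function_shift[OF \<phi>, of "- h"] by (simp add: test_function_def)
  from green_form_shift[OF D u this] show ?thesis by simp
qed

lemma dnu_ext_shift:
  assumes "helmholtz q (exterior ((\<lambda>x. x + h) ` \<Omega>)) u" "test_function \<phi>"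
  shows "dnu_ext \<Omega> (\<lambda>x. u (x + h)) \<phi> = dnu_ext ((\<lambda>x. x + h) ` \<Omega>) u (\<lambda>x. \<phi> (x + - h))"
  using green_form_shift'[OF open_exterior assms(1)[unfolded exterior_shift] assms(2)]
  by (simp add: dnu_ext_def exterior_shift)

lemma pairing_shift:
  assumes g: "g \<in> borel_measurable (arc_length ((\<lambda>x. x + h) ` \<Omega>))" and \<phi>: "test_function \<phi>"
  shows "pairing \<Omega> (\<lambda>x. g (x + h)) \<phi> = pairing ((\<lambda>x. x + h) ` \<Omega>) g (\<lambda>x. \<phi> (x + - h))"
proof -
  let ?M = "arc_length ((\<lambda>x. x + h) ` \<Omega>)"
  let ?F = "\<lambda>x. g x * \<phi> (x + - h)"
  have "(\<lambda>x. \<phi> (x + - h)) \<in> borel_measurable ?M"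
    by (intro borel_measurable_arc_length borel_measurable_continuous_onI test_function_continuous test_function_shift \<phi>)
  then have m: "?F \<in> borel_measurable ?M" by (rule borel_measurable_times[OF g])
  have "(LINT x|distr (arc_length \<Omega>) ?M (\<lambda>x. x + h). ?F x) = (LINT x|arc_length \<Omega>. ?F (x + h))"
    by (rule integral_distr[OF shift_measurable_arc_length m])
  then show ?thesis unfolding pairing_def by (simp add: arc_length_shift[symmetric])
qed

lemma radiating_field_shift:
  assumes \<Omega>: "bounded \<Omega>" and u: "radiating_field k ((\<lambda>x. x + h) ` \<Omega>) u" and far: "far_limit k u A"
  shows "radiating_field k \<Omega> (\<lambda>x. u (x + h))"
  unfolding radiating_field_def
proof (intro conjI)
  have b: "bounded ((\<lambda>x. x + h) ` \<Omega>)" using \<Omega> by (simp add: bounded_translation_plus)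
  have H: "in_H1loc (exterior ((\<lambda>x. x + h) ` \<Omega>)) u" "helmholtz (of_real (k\<^sup>2)) (exterior ((\<lambda>x. x + h) ` \<Omega>)) u"
    and som: "sommerfeld k u" using u by (auto simp: radiating_field_def)
  show "in_H1loc (exterior \<Omega>) (\<lambda>x. u (x + h))"
    by (rule in_H1loc_shift[OF open_exterior H(1)[unfolded exterior_shift]])
  show "helmholtz (of_real (k\<^sup>2)) (exterior \<Omega>) (\<lambda>x. u (x + h))"
    by (rule helmholtz_shift[OF H(2)[unfolded exterior_shift]])
  obtain R where R: "\<And>x. norm x \<ge> R \<Longrightarrow> x \<in> exterior ((\<lambda>x. x + h) ` \<Omega>)"
    using eventually_exterior[OF b] unfolding eventually_at_infinity by blast
  have "{x. norm x > R} \<subseteq> exterior ((\<lambda>x. x + h) ` \<Omega>)" using R by auto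
  then have hel: "helmholtz (of_real (k\<^sup>2)) {x. norm x > R} u"
    using H(2) C2_on_subset unfolding helmholtz_def by blast
  show "sommerfeld k (\<lambda>x. u (x + h))"
    by (rule sommerfeld_shift[OF hel som far_limit_continuous[OF hel far] far])
qed

theorem scattered_field_shift:
  assumes \<Omega>: "obstacle \<Omega>" and inc: "incident_field k ui"
    and sol: "scattered_field P k ((\<lambda>x. x + h) ` \<Omega>) ui us" and far: "far_limit k us A"
  shows "scattered_field P k \<Omega> (\<lambda>x. ui (x + h)) (\<lambda>x. us (x + h))"
proof -
  let ?\<Omega> = "(\<lambda>x. x + h) ` \<Omega>"
  have O: "open \<Omega>" "bounded \<Omega>" using \<Omega> by (auto simp: obstacle_def)
  note I = incident_fieldD[OF inc]
  have mui: "ui \<in> borel_measurable (arc_length ?\<Omega>)"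
    by (intro borel_measurable_arc_length borel_measurable_continuous_onI I)
  note sh = test_function_shift[of _ "- h"]
  show ?thesis
  proof (cases P)
    case (Impenetrable bc)
    then have rad: "radiating_field k ?\<Omega> us" and bc: "boundary_cond bc ?\<Omega> ui us"
      using sol by (auto simp: impenetrable_solution_def)
    have H: "helmholtz (of_real (k\<^sup>2)) (exterior ?\<Omega>) us" "C1_on ((\<lambda>x. x + h) ` exterior \<Omega>) us"
      using rad by (auto simp: radiating_field_def in_H1loc_def exterior_shift)
    note trs = has_trace_shift[OF open_exterior H(2)]
    have "boundary_cond bc \<Omega> (\<lambda>x. ui (x + h)) (\<lambda>x. us (x + h))"
    proof (cases bc)
      case Dirichlet
      then show ?thesis using trs[of \<Omega> "\<lambda>x. - ui x"] bc by (simp add: exterior_shift)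
    next
      case Neumann
      then show ?thesis using bc sh by (auto simp: dnu_ext_shift[OF H(1)] dnu_ext_shift[OF I(4)])
    next
      case (Impedance \<mu>)
      obtain g where g: "has_trace ?\<Omega> (exterior ?\<Omega>) us g"
        "\<And>\<phi>. test_function \<phi> \<Longrightarrow> dnu_ext ?\<Omega> us \<phi> + \<mu> * pairing ?\<Omega> g \<phi> = - (dnu_ext ?\<Omega> ui \<phi> + \<mu> * pairing ?\<Omega> ui \<phi>)"
        using bc Impedance by auto
      have mg: "g \<in> borel_measurable (arc_length ?\<Omega>)" using g(1) by (simp add: has_trace_def)
      have t: "has_trace \<Omega> (exterior \<Omega>) (\<lambda>x. us (x + h)) (\<lambda>x. g (x + h))"
        using trs[of \<Omega> g] g(1) by (simp add: exterior_shift)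
      have "dnu_ext \<Omega> (\<lambda>x. us (x + h)) \<phi> + \<mu> * pairing \<Omega> (\<lambda>x. g (x + h)) \<phi>
          = - (dnu_ext \<Omega> (\<lambda>x. ui (x + h)) \<phi> + \<mu> * pairing \<Omega> (\<lambda>x. ui (x + h)) \<phi>)" if \<phi>: "test_function \<phi>" for \<phi>
        unfolding dnu_ext_shift[OF H(1) \<phi>] dnu_ext_shift[OF I(4) \<phi>] pairing_shift[OF mg \<phi>] pairing_shift[OF mui \<phi>]
        by (rule g(2)[OF sh[OF \<phi>]])
      with t show ?thesis unfolding Impedance boundary_cond.simps by (intro exI[of _ "\<lambda>x. g (x + h)"]) blast
    qed
    then show ?thesis using Impenetrable radiating_field_shift[OF O(2) rad far] by (simp add: impenetrable_solution_def)
  next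
    case (Transmission n0 lam)
    obtain u where u: "transmission_solution n0 lam k ?\<Omega> ui us u" using sol Transmission by auto
    have rad: "radiating_field k ?\<Omega> us" and Hi: "in_H1loc ?\<Omega> u" "helmholtz (of_real (k\<^sup>2) * n0) ?\<Omega> u"
      and d: "\<And>\<phi>. test_function \<phi> \<Longrightarrow> dnu_ext ?\<Omega> us \<phi> - of_real lam * dnu_int ?\<Omega> u \<phi> = - dnu_ext ?\<Omega> ui \<phi>"
      using u unfolding transmission_solution_def by blast+
    obtain f g where fg: "has_trace ?\<Omega> (exterior ?\<Omega>) us f" "has_trace ?\<Omega> ?\<Omega> u g" "AE x in arc_length ?\<Omega>. f x - g x = - ui x"
      using u unfolding transmission_solution_def by blast
    have H: "helmholtz (of_real (k\<^sup>2)) (exterior ?\<Omega>) us" "C1_on ((\<lambda>x. x + h) ` exterior \<Omega>) us" "C1_on ?\<Omega> u"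
      using rad Hi by (auto simp: radiating_field_def in_H1loc_def exterior_shift)
    have "transmission_solution n0 lam k \<Omega> (\<lambda>x. ui (x + h)) (\<lambda>x. us (x + h)) (\<lambda>x. u (x + h))"
      unfolding transmission_solution_def
    proof (intro conjI allI impI)
      show "radiating_field k \<Omega> (\<lambda>x. us (x + h))" by (rule radiating_field_shift[OF O(2) rad far])
      show "in_H1loc \<Omega> (\<lambda>x. u (x + h))" by (rule in_H1loc_shift[OF O(1) Hi(1)])
      show "helmholtz (of_real (k\<^sup>2) * n0) \<Omega> (\<lambda>x. u (x + h))" by (rule helmholtz_shift[OF Hi(2)])
      have "AE x in distr (arc_length \<Omega>) (arc_length ?\<Omega>) (\<lambda>x. x + h). f x - g x = - ui x"
        using fg(3) by (simp only: arc_length_shift[symmetric])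
      then have "AE x in arc_length \<Omega>. f (x + h) - g (x + h) = - ui (x + h)"
        by (rule AE_distrD[OF shift_measurable_arc_length])
      moreover have "has_trace \<Omega> (exterior \<Omega>) (\<lambda>x. us (x + h)) (\<lambda>x. f (x + h))"
        using has_trace_shift[OF open_exterior H(2)] fg(1) by (simp add: exterior_shift)
      moreover have "has_trace \<Omega> \<Omega> (\<lambda>x. u (x + h)) (\<lambda>x. g (x + h))"
        by (rule has_trace_shift[OF O(1) H(3) fg(2)])
      ultimately show "\<exists>ga ha. has_trace \<Omega> (exterior \<Omega>) (\<lambda>x. us (x + h)) ga \<and> has_trace \<Omega> \<Omega> (\<lambda>x. u (x + h)) ha \<and>
          (AE x in arc_length \<Omega>. ga x - ha x = - ui (x + h))" by (intro exI conjI)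
      fix \<phi> assume \<phi>: "test_function \<phi>"
      show "dnu_ext \<Omega> (\<lambda>x. us (x + h)) \<phi> - of_real lam * dnu_int \<Omega> (\<lambda>x. u (x + h)) \<phi> = - dnu_ext \<Omega> (\<lambda>x. ui (x + h)) \<phi>"
        unfolding dnu_ext_shift[OF H(1) \<phi>] dnu_ext_shift[OF I(4) \<phi>] dnu_int_def green_form_shift'[OF O(1) Hi(2) \<phi>]
        using d[OF sh[OF \<phi>]] unfolding dnu_int_def .
    qed
    then show ?thesis unfolding Transmission scattered_field.simps by blast
  qed
qed

section \<open>Plane waves are always scattered\<close>

definition ramp_square :: "real \<Rightarrow> real" where
  "ramp_square t = (max 0 t)\<^sup>2"

lemma ramp_square_deriv: "(ramp_square has_real_derivative 2 * max 0 t) (at t)"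
proof -
  consider "t > 0" | "t < 0" | "t = 0" by linarith
  then show ?thesis
  proof cases
    case 1
    have "((\<lambda>t::real. t\<^sup>2) has_real_derivative 2 * t) (at t)" by (auto intro!: derivative_eq_intros)
    then have "(ramp_square has_real_derivative 2 * t) (at t)"
      by (rule has_field_derivative_transform_within_open[of _ _ _ "{0<..}"]) (use 1 in \<open>auto simp: ramp_square_def\<close>)
    then show ?thesis using 1 by simp
  next
    case 2
    have "((\<lambda>t::real. 0) has_real_derivative 0) (at t)" by simp
    then have "(ramp_square has_real_derivative 0) (at t)"
      by (rule has_field_derivative_transform_within_open[of _ _ _ "{..<0}"]) (use 2 in \<open>auto simp: ramp_square_def\<close>)
    then show ?thesis using 2 by simp
  next
    case 3
    have "((\<lambda>y. (ramp_square y - ramp_square 0) / (y - 0)) \<longlongrightarrow> 0) (at 0)"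
    proof (rule Lim_null_comparison)
      show "\<forall>\<^sub>F y in at 0. norm ((ramp_square y - ramp_square 0) / (y - 0)) \<le> \<bar>y\<bar>"
      proof (intro always_eventually allI)
        fix y :: real
        show "norm ((ramp_square y - ramp_square 0) / (y - 0)) \<le> \<bar>y\<bar>"
          by (cases "y > 0") (auto simp: ramp_square_def max_def power2_eq_square)
      qed
      show "((\<lambda>y::real. \<bar>y\<bar>) \<longlongrightarrow> 0) (at 0)" by (rule tendsto_rabs_zero[OF tendsto_ident_at])
    qed
    then show ?thesis using 3 by (simp add: has_field_derivative_iff)
  qed
qed

text \<open>A \<open>C\<^sup>1\<close> cutoff function, equal to 1 on the ball of radius \<open>R\<close>.\<close>

definition cutoff :: "real \<Rightarrow> field" where
  "cutoff R x = of_real (ramp_square (1 - ramp_square (x \<bullet> x - R\<^sup>2)))"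

lemma cutoff_C1: "C1_on UNIV (cutoff R)"
proof (rule C1_on_partialI)
  define s where "s x = x \<bullet> x - R\<^sup>2" for x :: plane
  fix x :: plane
  have ds: "(s has_derivative (\<lambda>h. 2 * (x \<bullet> h))) (at x)"
    unfolding s_def by (auto intro!: derivative_eq_intros simp: inner_commute)
  have d1: "((\<lambda>x. 1 - ramp_square (s x)) has_derivative (\<lambda>h. - (2 * max 0 (s x) * (2 * (x \<bullet> h))))) (at x)"
    using has_derivative_diff[OF has_derivative_const has_derivative_compose[OF ds ramp_square_deriv[unfolded has_field_derivative_def]], of 1] by simp
  have "((\<lambda>x. ramp_square (1 - ramp_square (s x))) has_derivative
      (\<lambda>h. 2 * max 0 (1 - ramp_square (s x)) * - (2 * max 0 (s x) * (2 * (x \<bullet> h))))) (at x)"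
    by (rule has_derivative_compose[OF d1 ramp_square_deriv[unfolded has_field_derivative_def]])
  from has_derivative_of_real[OF this, where 'a=complex]
  show "(cutoff R has_derivative (\<lambda>h. of_real (2 * max 0 (1 - ramp_square (x \<bullet> x - R\<^sup>2)) * - (2 * max 0 (x \<bullet> x - R\<^sup>2) * (2 * (x \<bullet> h)))))) (at x)"
    unfolding cutoff_def[abs_def] s_def .
next
  fix i :: 2
  show "continuous_on UNIV (\<lambda>x. complex_of_real (2 * max 0 (1 - ramp_square (x \<bullet> x - R\<^sup>2)) * - (2 * max 0 (x \<bullet> x - R\<^sup>2) * (2 * (x \<bullet> axis i 1)))))"
    unfolding ramp_square_def by (intro continuous_intros)
qed

lemma cutoff_one:
  assumes "R > 0" "x \<in> ball 0 R"
  shows "cutoff R x = 1" "partial i (cutoff R) x = 0"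
proof -
  have one: "cutoff R y = 1" if "y \<in> ball 0 R" for y
  proof -
    have "(norm y)\<^sup>2 \<le> R\<^sup>2" using that by (intro power_mono) auto
    then show ?thesis by (simp add: cutoff_def ramp_square_def power2_norm_eq_inner)
  qed
  show "cutoff R x = 1" by (rule one[OF assms(2)])
  have "partial i (cutoff R) x = partial i (\<lambda>_. 1) x" by (rule partial_cong_open[OF open_ball assms(2) one])
  then show "partial i (cutoff R) x = 0" using partial_eqI[OF has_derivative_const] by metis
qed

lemma cutoff_test: "test_function (cutoff R)"
proof -
  have "{x. cutoff R x \<noteq> 0} \<subseteq> cball 0 (\<bar>R\<bar> + 1)"
  proof
    fix x :: plane assume "x \<in> {x. cutoff R x \<noteq> 0}"
    then have "ramp_square (x \<bullet> x - R\<^sup>2) < 1" by (auto simp: cutoff_def ramp_square_def max_def split: if_splits)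
    then have "x \<bullet> x - R\<^sup>2 < 1" by (smt (verit) max.absorb2 one_le_power ramp_square_def)
    moreover have "(norm x)\<^sup>2 = x \<bullet> x" by (simp add: power2_norm_eq_inner)
    moreover have "(\<bar>R\<bar> + 1)\<^sup>2 = R\<^sup>2 + 2 * \<bar>R\<bar> + 1" by (simp add: power2_eq_square algebra_simps)
    ultimately have "(norm x)\<^sup>2 \<le> (\<bar>R\<bar> + 1)\<^sup>2" by linarith
    then show "x \<in> cball 0 (\<bar>R\<bar> + 1)" by (simp add: power2_le_iff_abs_le)
  qed
  then show ?thesis using cutoff_C1 bounded_subset[OF bounded_cball] by (auto simp: test_function_def)
qed

lemma test_function_mult:
  assumes "C1_on UNIV w" "test_function \<phi>"
  shows "test_function (\<lambda>x. w x * \<phi> x)"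
proof -
  have "{x. w x * \<phi> x \<noteq> 0} \<subseteq> {x. \<phi> x \<noteq> 0}" by auto
  then show ?thesis using assms C1_on_mult bounded_subset unfolding test_function_def by blast
qed

lemma integral_partial_test:
  assumes F: "test_function F"
  shows "integrable lborel (partial i F)" "(LINT x|lborel. partial i F x) = 0"
proof -
  obtain R where R: "R > 0" "\<And>x. x \<notin> ball 0 R \<Longrightarrow> F x = 0 \<and> (\<forall>i. partial i F x = 0)"
    using test_function_support[OF F] by blast
  have C: "continuous_on UNIV (partial i F)" "\<And>x. F differentiable (at x)" using F by (auto simp: test_function_def C1_on_def)
  have "integrable lborel (\<lambda>x. indicator (cball 0 R) x *\<^sub>R partial i F x)"
    by (intro borel_integrable_compact continuous_on_subset[OF C(1)]) auto
  moreover have ind: "(\<lambda>x. indicator (cball 0 R) x *\<^sub>R partial i F x) = partial i F"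
    using R(2) by (auto simp: indicator_def)
  ultimately show int: "integrable lborel (partial i F)" by simp
  define j :: 2 where "j = (if i = 1 then 2 else 1)"
  have ij: "i \<noteq> j" by (simp add: j_def)
  have ax: "axis i 1 $ i = (1::real)" "axis i 1 $ j = (0::real)" "axis j 1 $ j = (1::real)" "axis j 1 $ i = (0::real)"
    using ij by (auto simp: axis_def)
  let ?T = "\<lambda>p :: real \<times> real. fst p *\<^sub>R axis j 1 + snd p *\<^sub>R axis i 1 :: plane"
  have mT: "?T \<in> measurable (lborel \<Otimes>\<^sub>M lborel) borel" by measurable
  have mF: "partial i F \<in> borel_measurable borel" by (rule borel_measurable_continuous_onI[OF C(1)])
  have inner: "(LINT y|lborel. partial i F (?T (t, y))) = 0" for t
  proof -
    let ?c = "\<lambda>y. t *\<^sub>R axis j 1 + y *\<^sub>R axis i 1 :: plane"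
    have out: "?c y \<notin> ball 0 R" if "\<bar>y\<bar> \<ge> R" for y
      using component_le_norm_cart[of "?c y" i] that by (simp add: ax)
    have "(LINT y|lborel. indicator {-R..R} y *\<^sub>R partial i F (?c y)) = F (?c R) - F (?c (-R))"
    proof (rule integral_FTC_Icc)
      fix y :: real
      have "((\<lambda>y. t *\<^sub>R axis j 1 + y *\<^sub>R axis i 1 :: plane) has_vector_derivative axis i 1) (at y within {-R..R})"
        by (rule has_vector_derivative_ray)
      from partial_along_curve[where f=F, OF C(2) this]
      show "((\<lambda>y. F (?c y)) has_vector_derivative partial i F (?c y)) (at y within {-R..R})"
        using exhaust_2[of i] by (auto simp: axis_def)
      show "continuous_on {-R..R} (\<lambda>y. partial i F (?c y))"
        by (intro continuous_on_compose2[OF C(1)] continuous_intros) auto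
    qed (use R in auto)
    moreover have "(\<lambda>y. indicator {-R..R} y *\<^sub>R partial i F (?c y)) = (\<lambda>y. partial i F (?c y))"
    proof
      fix y show "indicator {-R..R} y *\<^sub>R partial i F (?c y) = partial i F (?c y)"
        using R(2)[OF out[of y]] by (cases "y \<in> {-R..R}") auto
    qed
    moreover have "F (?c R) = 0" "F (?c (-R)) = 0" using R(2)[OF out[of R]] R(2)[OF out[of "-R"]] R(1) by simp_all
    ultimately show ?thesis by simp
  qed
  have "integrable (distr (lborel \<Otimes>\<^sub>M lborel) borel ?T) (partial i F)"
    using int by (simp only: lborel_plane[OF ij, symmetric])
  then have intp: "integrable (lborel \<Otimes>\<^sub>M lborel) (\<lambda>p. partial i F (?T p))"
    by (subst (asm) integrable_distr_eq[OF mT]) (use mF in simp_all)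
  have "(LINT x|lborel. partial i F x) = (LINT x|distr (lborel \<Otimes>\<^sub>M lborel) borel ?T. partial i F x)"
    by (simp only: lborel_plane[OF ij, symmetric])
  also have "\<dots> = (LINT p|(lborel \<Otimes>\<^sub>M lborel). partial i F (?T p))"
    using mF by (intro integral_distr[OF mT]) simp
  also have "\<dots> = (LINT t|lborel. LINT y|lborel. partial i F (?T (t, y)))"
    using lborel_pair.integral_fst'[OF intp] by simp
  also have "\<dots> = 0" unfolding inner by simp
  finally show "(LINT x|lborel. partial i F x) = 0" .
qed

text \<open>For a field that is smooth across \<open>\<Gamma>\<close> the interior and exterior normal derivatives agree, because
  \<open>\<nabla>w \<bullet> \<nabla>\<phi> + \<phi> \<Delta>w = div (\<phi> \<nabla>w)\<close> has integral zero over the plane.\<close>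

lemma dnu_ext_eq_dnu_int:
  assumes \<Omega>: "obstacle \<Omega>" and w: "incident_field k w" and \<phi>: "test_function \<phi>"
  shows "dnu_ext \<Omega> w \<phi> = dnu_int \<Omega> w \<phi>"
proof -
  have O: "open \<Omega>" using \<Omega> by (simp add: obstacle_def)
  have C2: "C1_on UNIV (partial i w)" for i using w by (simp add: incident_field_def helmholtz_def C2_on_def)
  define G where "G = green_integrand w \<phi>"
  have "G x = partial 1 (\<lambda>x. partial 1 w x * \<phi> x) x + partial 2 (\<lambda>x. partial 2 w x * \<phi> x) x" for x
  proof -
    have "partial i (\<lambda>x. partial i w x * \<phi> x) x = partial i w x * partial i \<phi> x + partial i (partial i w) x * \<phi> x" for i
      using C2 \<phi> by (intro partial_mult(1)) (auto simp: C1_on_def test_function_def)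
    then show ?thesis by (simp add: G_def green_integrand_def laplacian_def sum_2 algebra_simps)
  qed
  then have Geq: "G = (\<lambda>x. partial 1 (\<lambda>x. partial 1 w x * \<phi> x) x + partial 2 (\<lambda>x. partial 2 w x * \<phi> x) x)" by auto
  note T = integral_partial_test[OF test_function_mult[OF C2 \<phi>]]
  have intG: "integrable lborel G" unfolding Geq by (intro Bochner_Integration.integrable_add T)
  have "(LINT x|lborel. G x) = 0" unfolding Geq by (subst Bochner_Integration.integral_add[OF T(1) T(1)]) (simp add: T(2))
  moreover have "(LINT x|lborel. G x) = (LINT x|lborel. indicator (exterior \<Omega>) x *\<^sub>R G x + indicator \<Omega> x *\<^sub>R G x)"
  proof (rule integral_cong_AE)
    have mG: "G \<in> borel_measurable lborel" using intG by (rule borel_measurable_integrable)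
    show "G \<in> borel_measurable lborel" by (rule mG)
    show "(\<lambda>x. indicator (exterior \<Omega>) x *\<^sub>R G x + indicator \<Omega> x *\<^sub>R G x) \<in> borel_measurable lborel"
      using mG O open_exterior
      by (intro borel_measurable_add borel_measurable_scaleR borel_measurable_indicator) auto
    have "AE x in lborel. x \<notin> frontier \<Omega>" by (rule AE_not_in[OF frontier_null[OF \<Omega>]])
    then show "AE x in lborel. G x = indicator (exterior \<Omega>) x *\<^sub>R G x + indicator \<Omega> x *\<^sub>R G x"
    proof eventually_elim
      case (elim x)
      then show ?case by (cases "x \<in> \<Omega>") (auto simp: indicator_def exterior_iff)
    qed
  qed
  moreover have "(LINT x|lborel. indicator (exterior \<Omega>) x *\<^sub>R G x + indicator \<Omega> x *\<^sub>R G x)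
     = green_form (exterior \<Omega>) w \<phi> + green_form \<Omega> w \<phi>"
    unfolding green_form_eq set_lebesgue_integral_def G_def[symmetric]
    using intG O open_exterior by (intro Bochner_Integration.integral_add integrable_mult_indicator) auto
  ultimately show ?thesis unfolding dnu_ext_def dnu_int_def by (simp add: add_eq_0_iff)
qed

lemma dnu_ext_zero:
  assumes us: "helmholtz q (exterior \<Omega>) us" "\<And>x. x \<in> exterior \<Omega> \<Longrightarrow> us x = 0"
  shows "dnu_ext \<Omega> us \<phi> = 0"
proof -
  have "indicator (exterior \<Omega>) x *\<^sub>R green_integrand us \<phi> x = 0" for x
  proof (cases "x \<in> exterior \<Omega>")
    case True
    have "partial i us x = partial i (\<lambda>_. 0) x" for i by (rule partial_cong_open[OF open_exterior True us(2)])
    then have "partial i us x = 0" for i using partial_eqI[OF has_derivative_const] by metis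
    then show ?thesis using helmholtz_laplacian[OF us(1) True] us(2)[OF True] by (simp add: green_integrand_def)
  qed simp
  then have "(\<lambda>x. indicator (exterior \<Omega>) x *\<^sub>R green_integrand us \<phi> x) = (\<lambda>x. 0)" by (rule ext)
  then show ?thesis unfolding dnu_ext_def green_form_eq set_lebesgue_integral_def by (simp only:) simp
qed

lemma dnu_int_plane_wave:
  fixes \<psi> :: field and c :: complex
  assumes \<Omega>: "open \<Omega>" "\<Omega> \<subseteq> ball 0 R" "R > 0" and d: "norm d = 1"
    and \<psi>: "C1_on UNIV \<psi>" "\<And>x. x \<in> \<Omega> \<Longrightarrow> d$1 * partial 1 \<psi> x + d$2 * partial 2 \<psi> x = c"
  shows "dnu_int \<Omega> (plane_wave k d) (\<lambda>x. plane_wave k (- d) x * \<psi> x * cutoff R x) = \<i> * of_real k * c * of_real (measure lborel \<Omega>)"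
proof -
  let ?w = "plane_wave k d"
  let ?\<phi> = "\<lambda>x. plane_wave k (- d) x * \<psi> x * cutoff R x"
  have g: "green_integrand ?w ?\<phi> x = \<i> * of_real k * c" if x: "x \<in> \<Omega>" for x
  proof -
    have xR: "x \<in> ball 0 R" using \<Omega> x by blast
    have wd: "?w y * plane_wave k (- d) y = 1" for y by (simp add: plane_wave_def flip: exp_add)
    have D: "plane_wave k (- d) differentiable (at x)" "\<psi> differentiable (at x)" "cutoff R differentiable (at x)"
      using C1_on_plane_wave[of UNIV k "- d"] \<psi> cutoff_C1[of R] by (auto simp: C1_on_def)
    have p: "partial i ?\<phi> x = plane_wave k (- d) x * partial i \<psi> x - \<i> * of_real (k * d$i) * plane_wave k (- d) x * \<psi> x" for i
    proof -
      have "partial i ?\<phi> x = (plane_wave k (- d) x * \<psi> x) * partial i (cutoff R) x + partial i (\<lambda>x. plane_wave k (- d) x * \<psi> x) x * cutoff R x"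
        by (rule partial_mult(1)[OF partial_mult(2)[OF D(1,2)] D(3)])
      also have "\<dots> = partial i (\<lambda>x. plane_wave k (- d) x * \<psi> x) x" using cutoff_one[OF \<Omega>(3) xR] by simp
      also have "\<dots> = plane_wave k (- d) x * partial i \<psi> x + partial i (plane_wave k (- d)) x * \<psi> x"
        by (rule partial_mult(1)[OF D(1,2)])
      finally show ?thesis by (simp add: partial_plane_wave)
    qed
    have dd: "(complex_of_real (d$1))\<^sup>2 + (of_real (d$2))\<^sup>2 = 1"
    proof -
      have "(d$1)\<^sup>2 + (d$2)\<^sup>2 = 1" using d by (simp add: plane_norm)
      then show ?thesis by (metis of_real_1 of_real_add of_real_power)
    qed
    have L: "laplacian ?w x = - ((of_real k)\<^sup>2 * ?w x)"
      using incident_plane_wave[OF d, of k] unfolding incident_field_def helmholtz_def by (simp add: eq_neg_iff_add_eq_0)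
    define W V K D1 D2 S where "W = ?w x" and "V = plane_wave k (- d) x" and "K = complex_of_real k"
      and "D1 = complex_of_real (d$1)" and "D2 = complex_of_real (d$2)" and "S = \<psi> x"
    have "green_integrand ?w ?\<phi> x
       = (\<i> * (K * D1) * W) * (V * partial 1 \<psi> x - \<i> * (K * D1) * V * S) + (\<i> * (K * D2) * W) * (V * partial 2 \<psi> x - \<i> * (K * D2) * V * S)
         - K\<^sup>2 * W * (V * S)"
      unfolding green_integrand_def sum_2 p L partial_plane_wave
      using cutoff_one(1)[OF \<Omega>(3) xR] by (simp add: W_def V_def K_def D1_def D2_def S_def)
    also have "\<dots> = \<i> * K * (W * V) * (D1 * partial 1 \<psi> x + D2 * partial 2 \<psi> x) + K\<^sup>2 * (W * V) * S * (D1\<^sup>2 + D2\<^sup>2 - 1)"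
    proof -
      have "\<i> * \<i> = -1" by simp
      then show ?thesis by algebra
    qed
    also have "\<dots> = \<i> * of_real k * c"
      using wd[of x] dd \<psi>(2)[OF x] by (simp add: W_def V_def K_def D1_def D2_def)
    finally show ?thesis .
  qed
  have "dnu_int \<Omega> ?w ?\<phi> = (LINT x:\<Omega>|lborel. \<i> * of_real k * c)"
    unfolding dnu_int_def green_form_eq using \<Omega>(1) g by (intro set_lebesgue_integral_cong) auto
  also have "\<dots> = \<i> * of_real k * c * of_real (measure lborel \<Omega>)"
  proof -
    have "emeasure lborel \<Omega> < \<infinity>"
      using emeasure_bounded_finite[OF bounded_subset[OF bounded_ball \<Omega>(2)]] by simp
    then show ?thesis using \<Omega>(1)
      by (subst set_integral_const) (auto simp: scaleR_conv_of_real mult.commute)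
  qed
  finally show ?thesis .
qed

lemma obstacle_measure_pos:
  assumes "obstacle \<Omega>"
  shows "measure lborel \<Omega> > 0"
proof -
  have \<Omega>: "open \<Omega>" "bounded \<Omega>" "\<Omega> \<noteq> {}" using assms by (auto simp: obstacle_def)
  have "emeasure lborel \<Omega> \<noteq> 0"
  proof
    assume "emeasure lborel \<Omega> = 0"
    then have "\<Omega> \<in> null_sets lborel" using \<Omega>(1) by auto
    then show False using open_not_negligible[OF \<Omega>(1,3)] by (simp add: negligible_iff_null_sets null_sets_completionI)
  qed
  moreover have "emeasure lborel \<Omega> < \<infinity>" by (rule emeasure_bounded_finite[OF \<Omega>(2)])
  ultimately show ?thesis by (simp add: measure_def enn2real_positive_iff zero_less_iff_neq_zero)
qed

text \<open>If the scattered field vanished, the plane wave would satisfy the homogeneous boundary condition. Testing with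
  the conjugate wave times \<open>\<psi>\<close> turns the normal derivative into \<open>ik \<integral>\<^sub>\<Omega> d \<bullet> \<nabla>\<psi>\<close>; the choices \<open>\<psi> = 1\<close> and
  \<open>\<psi> = d \<bullet> x\<close> give a contradiction.\<close>

theorem plane_wave_scatters:
  assumes k: "k > 0" and \<Omega>: "obstacle \<Omega>" and d: "norm d = 1" and sol: "scattered_field P k \<Omega> (plane_wave k d) us"
    and ev: "\<And>n0 lam. P = Transmission n0 lam \<Longrightarrow> \<not> transmission_eigenvalue n0 lam \<Omega> k"
    and us: "\<And>x. x \<in> exterior \<Omega> \<Longrightarrow> us x = 0"
  shows False
proof -
  let ?w = "plane_wave k d"
  have O: "open \<Omega>" "bounded \<Omega>" "\<Omega> \<noteq> {}" using \<Omega> by (auto simp: obstacle_def)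
  obtain R0 where R0: "\<And>x. x \<in> \<Omega> \<Longrightarrow> norm x \<le> R0" using O(2) by (auto simp: bounded_iff)
  define R where "R = \<bar>R0\<bar> + 1"
  have R: "R > 0" "\<Omega> \<subseteq> ball 0 R" using R0 by (force simp: R_def)+
  have Rf: "x \<in> ball 0 R" if "x \<in> frontier \<Omega>" for x
  proof -
    have "closure \<Omega> \<subseteq> cball 0 \<bar>R0\<bar>" by (rule closure_minimal) (use R0 in force)+
    then show ?thesis using that by (auto simp: frontier_def R_def)
  qed
  have inc: "incident_field k ?w" by (rule incident_plane_wave[OF d])
  note I = incident_fieldD[OF inc]
  have mpos: "measure (arc_length \<Omega>) (frontier \<Omega>) > 0"
  proof -
    interpret finite_measure "arc_length \<Omega>" by (rule finite_arc_length[OF \<Omega>])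
    have "emeasure (arc_length \<Omega>) (frontier \<Omega>) > 0"
      using hausdorff1_frontier_pos[OF \<Omega>] by (simp add: emeasure_arc_length)
    then show ?thesis by (simp add: emeasure_eq_measure)
  qed
  have notAE: "\<not> (AE x in arc_length \<Omega>. False)"
  proof
    assume "AE x in arc_length \<Omega>. False"
    then have "frontier \<Omega> \<in> null_sets (arc_length \<Omega>)" using AE_iff_null[of "arc_length \<Omega>" "\<lambda>_. False"] sets.top[of "arc_length \<Omega>"] by simp
    then show False using mpos by (simp add: measure_def null_sets_def)
  qed
  have tf: "test_function (\<lambda>x. plane_wave k (- d) x * \<psi> x * cutoff R x)" if "C1_on UNIV \<psi>" for \<psi>
    by (intro test_function_mult cutoff_test C1_on_mult C1_on_plane_wave that)
  define \<psi>1 where "\<psi>1 x = complex_of_real (d \<bullet> x)" for x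
  have d1: "(\<psi>1 has_derivative (\<lambda>h. complex_of_real (d \<bullet> h))) (at x)" for x
    unfolding \<psi>1_def by (auto intro!: derivative_eq_intros)
  have C\<psi>1: "C1_on UNIV \<psi>1" by (rule C1_on_partialI[OF d1]) (intro continuous_intros)
  have p1: "partial i \<psi>1 x = of_real (d$i)" for i x by (simp add: partial_eqI[OF d1] inner_axis)
  have dd: "complex_of_real (d$1) * of_real (d$1) + of_real (d$2) * of_real (d$2) = 1"
  proof -
    have "d$1 * d$1 + d$2 * d$2 = 1" using d by (simp add: plane_norm power2_eq_square)
    then show ?thesis by (metis of_real_1 of_real_add of_real_mult)
  qed
  have C1: "C1_on UNIV (\<lambda>_. 1 :: complex)" by (rule C1_on_partialI[OF has_derivative_const]) (intro continuous_intros)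
  have p0: "partial i (\<lambda>_. 1 :: complex) x = 0" for i x by (simp add: partial_eqI[OF has_derivative_const])
  have n1: "dnu_int \<Omega> ?w (\<lambda>x. plane_wave k (- d) x * \<psi>1 x * cutoff R x) = \<i> * of_real k * 1 * of_real (measure lborel \<Omega>)"
    by (rule dnu_int_plane_wave[OF O(1) R(2,1) d C\<psi>1]) (simp add: p1 dd)
  have n0: "dnu_int \<Omega> ?w (\<lambda>x. plane_wave k (- d) x * 1 * cutoff R x) = \<i> * of_real k * 0 * of_real (measure lborel \<Omega>)"
    by (rule dnu_int_plane_wave[OF O(1) R(2,1) d C1]) (simp add: p0)
  have neumann: False if "\<And>\<phi>. test_function \<phi> \<Longrightarrow> dnu_ext \<Omega> ?w \<phi> = 0"
    using that[OF tf[OF C\<psi>1]] n1 obstacle_measure_pos[OF \<Omega>] k by (simp add: dnu_ext_eq_dnu_int[OF \<Omega> inc tf[OF C\<psi>1]])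
  show False
  proof (cases P)
    case (Impenetrable bc)
    then have H: "helmholtz (of_real (k\<^sup>2)) (exterior \<Omega>) us" and bc: "boundary_cond bc \<Omega> ?w us"
      using sol by (auto simp: impenetrable_solution_def radiating_field_def)
    note z = dnu_ext_zero[OF H us]
    show False
    proof (cases bc)
      case Dirichlet
      then have "AE x in arc_length \<Omega>. - ?w x = 0" using bc by (intro trace_of_zero[OF \<Omega> _ us]) simp_all
      then have "AE x in arc_length \<Omega>. False"
      proof eventually_elim
        case (elim x)
        then show ?case using norm_plane_wave[of k d x] by simp
      qed
      then show False using notAE by blast
    next
      case Neumann
      then show False using bc z by (intro neumann) auto
    next
      case (Impedance \<mu>)
      obtain g where g: "has_trace \<Omega> (exterior \<Omega>) us g"
        "\<And>\<phi>. test_function \<phi> \<Longrightarrow> dnu_ext \<Omega> us \<phi> + \<mu> * pairing \<Omega> g \<phi> = - (dnu_ext \<Omega> ?w \<phi> + \<mu> * pairing \<Omega> ?w \<phi>)"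
        using bc Impedance by auto
      have "AE x in arc_length \<Omega>. g x = 0" by (rule trace_of_zero[OF \<Omega> g(1) us])
      then have "AE x in arc_length \<Omega>. g x * \<phi> x = 0" for \<phi> by eventually_elim simp
      then have "pairing \<Omega> g \<phi> = 0" for \<phi> unfolding pairing_def by (rule integral_eq_zero_AE)
      then have eq: "dnu_ext \<Omega> ?w \<phi> + \<mu> * pairing \<Omega> ?w \<phi> = 0" if "test_function \<phi>" for \<phi>
      proof -
        have pg: "pairing \<Omega> g \<phi> = 0" by fact
        have zz: "dnu_ext \<Omega> us \<phi> = 0" using that by (simp add: z)
        have "0 = - (dnu_ext \<Omega> ?w \<phi> + \<mu> * pairing \<Omega> ?w \<phi>)"
          using g(2)[OF that] by (simp only: zz pg mult_zero_right add_0)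
        then show ?thesis by (simp only: neg_0_equal_iff_equal)
      qed
      let ?\<phi> = "\<lambda>x. plane_wave k (- d) x * 1 * cutoff R x"
      have "pairing \<Omega> ?w ?\<phi> = (LINT x|arc_length \<Omega>. 1)"
        unfolding pairing_def
      proof (rule Bochner_Integration.integral_cong)
        fix x assume "x \<in> space (arc_length \<Omega>)"
        then have "cutoff R x = 1" using cutoff_one(1)[OF R(1) Rf] by simp
        moreover have "?w x * plane_wave k (- d) x = 1" by (simp add: plane_wave_def flip: exp_add)
        ultimately show "?w x * ?\<phi> x = 1" by simp
      qed simp
      also have "\<dots> = of_real (measure (arc_length \<Omega>) (frontier \<Omega>))" by (simp add: scaleR_conv_of_real)
      finally have "pairing \<Omega> ?w ?\<phi> \<noteq> 0" using mpos by simp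
      moreover have "dnu_ext \<Omega> ?w ?\<phi> = 0" using n0 by (simp add: dnu_ext_eq_dnu_int[OF \<Omega> inc tf[OF C1]] del: mult_1_right)
      ultimately have "\<mu> = 0" using eq[OF tf[OF C1]] by simp
      then show False using eq by (intro neumann) simp
    qed
  next
    case (Transmission n0 lam)
    obtain u where u: "transmission_solution n0 lam k \<Omega> ?w us u" using sol Transmission by auto
    have rad: "radiating_field k \<Omega> us" and Hi: "in_H1loc \<Omega> u" "helmholtz (of_real (k\<^sup>2) * n0) \<Omega> u"
      and dn: "\<And>\<phi>. test_function \<phi> \<Longrightarrow> dnu_ext \<Omega> us \<phi> - of_real lam * dnu_int \<Omega> u \<phi> = - dnu_ext \<Omega> ?w \<phi>"
      using u unfolding transmission_solution_def by blast+
    obtain g h where gh: "has_trace \<Omega> (exterior \<Omega>) us g" "has_trace \<Omega> \<Omega> u h" "AE x in arc_length \<Omega>. g x - h x = - ?w x"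
      using u unfolding transmission_solution_def by blast
    have H: "helmholtz (of_real (k\<^sup>2)) (exterior \<Omega>) us" using rad by (simp add: radiating_field_def)
    have g0: "AE x in arc_length \<Omega>. g x = 0" by (rule trace_of_zero[OF \<Omega> gh(1) us])
    have tw: "has_trace \<Omega> \<Omega> ?w ?w"
      unfolding has_trace_def
    proof (intro conjI exI[of _ "\<lambda>n. ?w"] allI impI)
      show "?w \<in> borel_measurable (arc_length \<Omega>)" "(\<integral>\<^sup>+x. ennreal ((cmod (?w x))\<^sup>2) \<partial>arc_length \<Omega>) < \<infinity>"
        by (rule continuous_square_integral[OF \<Omega> I(2)])+
      show "C1_on UNIV ?w" by (rule I(1))
      have "partial i (\<lambda>_. 0 :: complex) x = 0" for i x by (simp add: partial_eqI[OF has_derivative_const])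
      then show "(\<lambda>n. H1_norm2 (\<Omega> \<inter> ball 0 R) (\<lambda>x. ?w x - ?w x)) \<longlonglongrightarrow> 0" for R by (simp add: H1_norm2_def)
    qed simp
    have "itp_solution n0 lam k \<Omega> u ?w"
      unfolding itp_solution_def
    proof (intro conjI allI impI Hi I)
      have "AE x in arc_length \<Omega>. h x - ?w x = 0" using g0 gh(3) by eventually_elim simp
      then show "\<exists>g h. has_trace \<Omega> \<Omega> u g \<and> has_trace \<Omega> \<Omega> ?w h \<and> (AE x in arc_length \<Omega>. g x - h x = 0)"
        using gh(2) tw by blast
      fix \<phi> assume \<phi>: "test_function \<phi>"
      show "of_real lam * dnu_int \<Omega> u \<phi> - dnu_int \<Omega> ?w \<phi> = 0"
        using dn[OF \<phi>] by (simp add: dnu_ext_zero[OF H us] dnu_ext_eq_dnu_int[OF \<Omega> inc \<phi>])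
    qed
    moreover obtain x where "x \<in> \<Omega>" using O(3) by blast
    moreover have "?w x \<noteq> 0" using norm_plane_wave[of k d x] by force
    ultimately have "transmission_eigenvalue n0 lam \<Omega> k" unfolding transmission_eigenvalue_def using k by blast
    then show False using ev[OF Transmission] by blast
  qed
qed

section \<open>Far fields of the translates\<close>

lemma far_limit_has_far_field:
  assumes "has_far_field k u A"
  shows "far_limit k u A"
proof -
  let ?f = "\<lambda>x. u x * of_real (sqrt (norm x)) / exp (\<i> * of_real (k * norm x)) - A (x /\<^sub>R norm x)"
  obtain c where "\<forall>\<^sub>F x in at_infinity. norm (?f x) \<le> c * norm (complex_of_real (1 / norm x))"
    using assms unfolding has_far_field_def by (elim landau_o.bigE) auto
  then have "\<forall>\<^sub>F x in at_infinity. norm (?f x) \<le> c / norm x"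
    by (rule eventually_mono) (simp add: norm_divide)
  then show ?thesis unfolding far_limit_def by (rule Lim_null_comparison[OF _ inverse_norm_tendsto_0])
qed

lemma far_limit_cong:
  assumes "far_limit k u A" "\<forall>\<^sub>F x in at_infinity. u x = v x"
  shows "far_limit k v A"
proof -
  have "\<forall>\<^sub>F x in at_infinity. u x * of_real (sqrt (norm x)) / exp (\<i> * of_real (k * norm x)) - A (x /\<^sub>R norm x)
     = v x * of_real (sqrt (norm x)) / exp (\<i> * of_real (k * norm x)) - A (x /\<^sub>R norm x)"
    using assms(2) by (rule eventually_mono) simp
  then show ?thesis using assms(1) unfolding far_limit_def by (rule Lim_transform_eventually[rotated])
qed

lemma far_limit_linear:
  assumes "far_limit k u A" "far_limit k v B"
  shows "far_limit k (\<lambda>x. a * u x + b * v x) (\<lambda>x. a * A x + b * B x)"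
proof -
  let ?F = "\<lambda>u A x. u x * of_real (sqrt (norm x)) / exp (\<i> * of_real (k * norm x)) - A (x /\<^sub>R norm x)"
  have "((\<lambda>x. a * ?F u A x + b * ?F v B x) \<longlongrightarrow> a * 0 + b * 0) at_infinity"
    using assms unfolding far_limit_def by (intro tendsto_intros)
  moreover have "(\<lambda>x. a * ?F u A x + b * ?F v B x) = ?F (\<lambda>x. a * u x + b * v x) (\<lambda>x. a * A x + b * B x)"
    by (rule ext) (simp add: algebra_simps add_divide_distrib)
  ultimately show ?thesis unfolding far_limit_def by simp
qed

lemma far_limit_unique:
  assumes "far_limit k u A" "far_limit k u B" and x: "x \<in> sphere 0 1"
  shows "A x = B x"
proof -
  let ?F = "\<lambda>A x. u x * of_real (sqrt (norm x)) / exp (\<i> * of_real (k * norm x)) - A (x /\<^sub>R norm x)"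
  have "((\<lambda>y. ?F B y - ?F A y) \<longlongrightarrow> 0 - 0) at_infinity"
    using assms unfolding far_limit_def by (intro tendsto_diff)
  then have l: "((\<lambda>y. A (y /\<^sub>R norm y) - B (y /\<^sub>R norm y)) \<longlongrightarrow> 0) at_infinity" by simp
  have "filterlim (\<lambda>r. r *\<^sub>R x) at_infinity at_top"
    unfolding filterlim_at_infinity[OF order_refl]
  proof (intro allI impI)
    fix r :: real assume "r > 0"
    show "\<forall>\<^sub>F s in at_top. r \<le> norm (s *\<^sub>R x)"
      using eventually_ge_at_top[of r] by (rule eventually_mono) (use x in auto)
  qed
  from filterlim_compose[OF l this]
  have "((\<lambda>r. A ((r *\<^sub>R x) /\<^sub>R norm (r *\<^sub>R x)) - B ((r *\<^sub>R x) /\<^sub>R norm (r *\<^sub>R x))) \<longlongrightarrow> 0) at_top" .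
  moreover have "\<forall>\<^sub>F r in at_top. A ((r *\<^sub>R x) /\<^sub>R norm (r *\<^sub>R x)) - B ((r *\<^sub>R x) /\<^sub>R norm (r *\<^sub>R x)) = A x - B x"
    using eventually_gt_at_top[of 0] by (rule eventually_mono) (use x in simp)
  ultimately have "((\<lambda>r::real. A x - B x) \<longlongrightarrow> 0) at_top" by (rule Lim_transform_eventually)
  then show ?thesis by (simp add: tendsto_const_iff trivial_limit_at_top_linorder)
qed

lemma well_posed_exists:
  assumes "well_posed P k \<Omega>" "incident_field k ui"
  obtains us where "scattered_field P k \<Omega> ui us"
proof (cases P)
  case (Impenetrable bc)
  then show ?thesis using assms that by auto
next
  case (Transmission n0 lam)
  then obtain us u where "transmission_solution n0 lam k \<Omega> ui us u" using assms by fastforce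
  then show ?thesis using that Transmission by auto
qed

lemma well_posed_unique:
  assumes wp: "well_posed P k \<Omega>" "incident_field k ui"
    and sol: "scattered_field P k \<Omega> ui us" "scattered_field P k \<Omega> ui vs" and x: "x \<in> exterior \<Omega>"
  shows "us x = vs x"
proof (cases P)
  case (Impenetrable bc)
  from wp(1)[unfolded Impenetrable well_posed.simps, rule_format, OF wp(2)]
  obtain ws where w: "\<forall>us'. impenetrable_solution bc k \<Omega> ui us' \<longrightarrow> (\<forall>x\<in>exterior \<Omega>. us' x = ws x)"
    by blast
  have "impenetrable_solution bc k \<Omega> ui us" "impenetrable_solution bc k \<Omega> ui vs"
    using sol Impenetrable by simp_all
  then show ?thesis using w x by metis
next
  case (Transmission n0 lam)
  from wp(1)[unfolded Transmission well_posed.simps, rule_format, OF wp(2)]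
  obtain ws where w: "\<forall>us' u'. transmission_solution n0 lam k \<Omega> ui us' u' \<longrightarrow> (\<forall>x\<in>exterior \<Omega>. us' x = ws x)"
    by blast
  obtain u v where "transmission_solution n0 lam k \<Omega> ui us u" "transmission_solution n0 lam k \<Omega> ui vs v"
    using sol Transmission by auto
  then show ?thesis using w x by metis
qed

lemma scattered_field_radiating: "scattered_field P k \<Omega> ui us \<Longrightarrow> radiating_field k \<Omega> us"
  by (cases P) (auto simp: impenetrable_solution_def transmission_solution_def)

lemma radiating_field_outside:
  assumes "bounded \<Omega>"
  obtains R where "R \<ge> 0" "{x. norm x > R} \<subseteq> exterior \<Omega>" "\<And>k u. radiating_field k \<Omega> u \<Longrightarrow> radiating_outside k R u"
proof -
  obtain b where b: "\<And>x. norm x \<ge> b \<Longrightarrow> x \<in> exterior \<Omega>"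
    using eventually_exterior[OF assms] unfolding eventually_at_infinity by blast
  then have sub: "{x. norm x > \<bar>b\<bar>} \<subseteq> exterior \<Omega>" by force
  have "radiating_outside k \<bar>b\<bar> u" if "radiating_field k \<Omega> u" for k u
    using that sub C2_on_subset unfolding radiating_field_def radiating_outside_def helmholtz_def by blast
  then show ?thesis using that[of "\<bar>b\<bar>"] sub by simp
qed

lemma radiating_far_limit_continuous:
  assumes "bounded \<Omega>" "radiating_field k \<Omega> u" "far_limit k u A"
  shows "continuous_on (sphere 0 1) A"
proof (rule radiating_field_outside[OF assms(1)])
  fix R assume "\<And>k u. radiating_field k \<Omega> u \<Longrightarrow> radiating_outside k R u"
  from this[OF assms(2)] have h: "helmholtz (of_real (k\<^sup>2)) {x. norm x > R} u"
    unfolding radiating_outside_def by (elim conjE)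
  show ?thesis by (rule far_limit_continuous[OF h assms(3)])
qed

text \<open>The patterns \<open>A\<close> and \<open>B\<close> of the two single plane waves are recovered from \<open>\<Omega>\<close> and from one translate for
  which the two phases are opposite. The product \<open>A B\<close> does not vanish identically.\<close>

theorem two_wave_patterns:
  assumes k: "k > 0" and \<Omega>: "obstacle \<Omega>" and wp: "well_posed P k \<Omega>"
    and ev: "\<And>n0 lam. P = Transmission n0 lam \<Longrightarrow> \<not> transmission_eigenvalue n0 lam \<Omega> k"
    and d: "norm d1 = 1" "norm d2 = 1" "d1 \<noteq> d2"
    and U: "far_field_pattern P k \<Omega> (two_waves k d1 d2) U"
    and V: "\<And>h. far_field_pattern P k ((\<lambda>x. x + h) ` \<Omega>) (two_waves k d1 d2) (V h)"
  obtains A B where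
    "\<And>x. x \<in> sphere 0 1 \<Longrightarrow> cmod (U x) = cmod (A x + B x)"
    "\<And>h x. x \<in> sphere 0 1 \<Longrightarrow> cmod (V h x) = cmod (plane_wave k d1 h * A x + plane_wave k d2 h * B x)"
    "\<exists>x\<in>sphere 0 1. A x * B x \<noteq> 0"
proof -
  have bO: "bounded \<Omega>" using \<Omega> by (simp add: obstacle_def)
  note inc = incident_plane_wave[OF d(1), of k] incident_plane_wave[OF d(2), of k]
  have inc2: "incident_field k (two_waves k d1 d2)"
    using incident_linear[OF inc, of 1 1] by (simp add: two_waves_def[abs_def])
  obtain u1 where u1: "scattered_field P k \<Omega> (plane_wave k d1) u1" using well_posed_exists[OF wp inc(1)] .
  obtain u2 where u2: "scattered_field P k \<Omega> (plane_wave k d2) u2" using well_posed_exists[OF wp inc(2)] .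
  have key: "far_limit k (\<lambda>x. plane_wave k d1 h * u1 x + plane_wave k d2 h * u2 x) (\<lambda>x. exp (\<i> * of_real (k * (x \<bullet> h))) * W x)"
    if W: "far_field_pattern P k ((\<lambda>x. x + h) ` \<Omega>) (two_waves k d1 d2) W" for h W
  proof -
    obtain us where us: "scattered_field P k ((\<lambda>x. x + h) ` \<Omega>) (two_waves k d1 d2) us" "has_far_field k us W"
      using W unfolding far_field_pattern_def by blast
    have fW: "far_limit k us W" by (rule far_limit_has_far_field[OF us(2)])
    have "bounded ((\<lambda>x. x + h) ` \<Omega>)" using bO by (simp add: bounded_translation_plus)
    then have cW: "continuous_on (sphere 0 1) W"
      by (rule radiating_far_limit_continuous[OF _ scattered_field_radiating[OF us(1)] fW])
    have tw: "(\<lambda>x. two_waves k d1 d2 (x + h)) = (\<lambda>x. plane_wave k d1 h * plane_wave k d1 x + plane_wave k d2 h * plane_wave k d2 x)"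
      by (simp add: two_waves_def plane_wave_shift)
    have s1: "scattered_field P k \<Omega> (\<lambda>x. plane_wave k d1 h * plane_wave k d1 x + plane_wave k d2 h * plane_wave k d2 x) (\<lambda>x. us (x + h))"
      using scattered_field_shift[OF \<Omega> inc2 us(1) fW] unfolding tw .
    have s2: "scattered_field P k \<Omega> (\<lambda>x. plane_wave k d1 h * plane_wave k d1 x + plane_wave k d2 h * plane_wave k d2 x)
        (\<lambda>x. plane_wave k d1 h * u1 x + plane_wave k d2 h * u2 x)"
      by (rule scattered_field_linear[OF \<Omega> inc u1 u2])
    have "us (x + h) = plane_wave k d1 h * u1 x + plane_wave k d2 h * u2 x" if "x \<in> exterior \<Omega>" for x
      by (rule well_posed_unique[OF wp incident_linear[OF inc] s1 s2 that])
    then have "\<forall>\<^sub>F x in at_infinity. us (x + h) = plane_wave k d1 h * u1 x + plane_wave k d2 h * u2 x"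
      by (rule eventually_mono[OF eventually_exterior[OF bO]])
    with far_limit_shift[OF cW fW, of h] show ?thesis by (rule far_limit_cong)
  qed
  have pw0: "plane_wave k d 0 = 1" for d by (simp add: plane_wave_def)
  have fU: "far_limit k (\<lambda>x. u1 x + u2 x) U"
    using key[of 0 U] U by (simp add: pw0)
  define D where "D = d1 - d2"
  have D: "D \<noteq> 0" using d(3) by (simp add: D_def)
  define h0 where "h0 = (pi / (k * (D \<bullet> D))) *\<^sub>R D"
  define c where "c = plane_wave k d1 h0"
  have c: "c \<noteq> 0" by (simp add: c_def plane_wave_def)
  have c2: "plane_wave k d2 h0 = - c"
  proof -
    have "k * (d1 \<bullet> h0) = k * (d2 \<bullet> h0) + k * (D \<bullet> h0)" by (simp add: D_def inner_diff_left algebra_simps)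
    also have "k * (D \<bullet> h0) = pi" using D k by (simp add: h0_def)
    finally have "c = plane_wave k d2 h0 * exp (\<i> * of_real pi)"
      unfolding c_def plane_wave_def by (simp add: exp_add distrib_left)
    also have "exp (\<i> * of_real pi) = -1" by (metis exp_pi_i mult.commute)
    finally show ?thesis by simp
  qed
  define W where "W x = exp (\<i> * of_real (k * (x \<bullet> h0))) * V h0 x" for x
  have fW: "far_limit k (\<lambda>x. c * u1 x + - c * u2 x) W"
    using key[OF V[of h0]] unfolding W_def c2 c_def[symmetric] .
  define A where "A x = 1/2 * U x + 1/(2*c) * W x" for x
  define B where "B x = 1/2 * U x + - (1/(2*c)) * W x" for x
  have fA: "far_limit k u1 A"
  proof -
    have "far_limit k (\<lambda>x. 1/2 * (u1 x + u2 x) + 1/(2*c) * (c * u1 x + - c * u2 x)) A"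
      unfolding A_def by (rule far_limit_linear[OF fU fW])
    moreover have "(\<lambda>x. 1/2 * (u1 x + u2 x) + 1/(2*c) * (c * u1 x + - c * u2 x)) = u1" using c by (auto simp: field_simps)
    ultimately show ?thesis by simp
  qed
  have fB: "far_limit k u2 B"
  proof -
    have "far_limit k (\<lambda>x. 1/2 * (u1 x + u2 x) + - (1/(2*c)) * (c * u1 x + - c * u2 x)) B"
      unfolding B_def by (rule far_limit_linear[OF fU fW])
    moreover have "(\<lambda>x. 1/2 * (u1 x + u2 x) + - (1/(2*c)) * (c * u1 x + - c * u2 x)) = u2" using c by (auto simp: field_simps)
    ultimately show ?thesis by simp
  qed
  have "cmod (U x) = cmod (A x + B x)" for x by (simp add: A_def B_def)
  moreover have "cmod (V h x) = cmod (plane_wave k d1 h * A x + plane_wave k d2 h * B x)" if x: "x \<in> sphere 0 1" for h x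
  proof -
    have "exp (\<i> * of_real (k * (x \<bullet> h))) * V h x = plane_wave k d1 h * A x + plane_wave k d2 h * B x"
      by (rule far_limit_unique[OF key[OF V] far_limit_linear[OF fA fB] x])
    then have "cmod (exp (\<i> * of_real (k * (x \<bullet> h))) * V h x) = cmod (plane_wave k d1 h * A x + plane_wave k d2 h * B x)" by simp
    then show ?thesis by (simp add: norm_mult)
  qed
  moreover have "\<exists>x\<in>sphere 0 1. A x * B x \<noteq> 0"
  proof (rule ccontr)
    assume "\<not> ?thesis"
    then have AB: "\<And>x. x \<in> sphere 0 1 \<Longrightarrow> A x * B x = 0" by blast
    obtain R where R: "R \<ge> 0" "{x. norm x > R} \<subseteq> exterior \<Omega>" "\<And>k u. radiating_field k \<Omega> u \<Longrightarrow> radiating_outside k R u"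
    proof (rule radiating_field_outside[OF bO])
      fix R assume "R \<ge> 0" "{x. norm x > R} \<subseteq> exterior \<Omega>" "\<And>k u. radiating_field k \<Omega> u \<Longrightarrow> radiating_outside k R u"
      then show thesis by (rule that)
    qed
    note rad = scattered_field_radiating[OF u1] scattered_field_radiating[OF u2]
    have zero: False if "\<forall>x. norm x > R \<longrightarrow> w x = 0" "norm d = 1" "scattered_field P k \<Omega> (plane_wave k d) w" for w d
    proof (rule plane_wave_scatters[OF k \<Omega> that(2,3) ev])
      fix x assume x: "x \<in> exterior \<Omega>"
      have hz: "helmholtz (of_real (k\<^sup>2)) (exterior \<Omega>) w"
        using scattered_field_radiating[OF that(3)] by (simp add: radiating_field_def)
      have "{x::plane. norm x > R} \<noteq> {}"
      proof -
        have "(R + 1) *\<^sub>R axis 1 1 \<in> {x::plane. norm x > R}" using R(1) by simp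
        then show ?thesis by blast
      qed
      then show "w x = 0"
        by (rule unique_continuation[OF open_exterior connected_exterior[OF \<Omega>] hz open_outside _ R(2) _ x])
          (use that(1) in simp)
    qed assumption
    have "\<not> (\<forall>x. norm x > R \<longrightarrow> u1 x = 0)" by (rule notI) (rule zero[OF _ d(1) u1])
    moreover have "\<not> (\<forall>x. norm x > R \<longrightarrow> u2 x = 0)" by (rule notI) (rule zero[OF _ d(2) u2])
    ultimately show False
      using far_field_product_nonzero[OF k R(1) R(3)[OF rad(1)] fA R(3)[OF rad(2)] fB AB] by blast
  qed
  ultimately show ?thesis by (rule that)
qed

section \<open>Phases and lines\<close>

text \<open>Writing \<open>z = |z| e\<^sup>i\<^sup>\<beta>\<close>, the condition reads \<open>cos (\<alpha> + \<beta>) = cos \<beta>\<close>, so \<open>\<alpha>\<close> is \<open>0\<close> or \<open>-2\<beta>\<close> modulo \<open>2\<pi>\<close>.\<close>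

lemma single_phase:
  assumes "z \<noteq> 0"
  obtains \<tau> where "\<tau> \<in> {0<..<2*pi}"
    "\<And>\<alpha>. Re (z * (cis \<alpha> - 1)) = 0 \<Longrightarrow> \<exists>n::int. \<alpha> = 2 * pi * of_int n \<or> \<alpha> = 2 * pi * of_int n + \<tau>"
proof -
  define \<beta> where "\<beta> = Arg z"
  have z: "z = of_real (cmod z) * cis \<beta>" using rcis_cmod_Arg[of z] by (simp add: \<beta>_def rcis_def)
  define m where "m = \<lfloor>- \<beta> / pi\<rfloor>"
  define \<tau>0 where "\<tau>0 = - 2 * \<beta> - 2 * pi * of_int m"
  have "of_int m \<le> - \<beta> / pi" "- \<beta> / pi < of_int m + 1" unfolding m_def by linarith+
  then have "of_int m * pi \<le> - \<beta>" "- \<beta> < (of_int m + 1) * pi"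
    by (simp_all only: pos_le_divide_eq[OF pi_gt_zero] pos_divide_less_eq[OF pi_gt_zero])
  then have t0: "0 \<le> \<tau>0" "\<tau>0 < 2 * pi" by (simp_all add: \<tau>0_def algebra_simps)
  define \<tau> where "\<tau> = (if \<tau>0 = 0 then pi else \<tau>0)"
  have "\<tau> \<in> {0<..<2*pi}" using t0 by (auto simp: \<tau>_def)
  moreover have "\<exists>n::int. \<alpha> = 2 * pi * of_int n \<or> \<alpha> = 2 * pi * of_int n + \<tau>" if "Re (z * (cis \<alpha> - 1)) = 0" for \<alpha>
  proof -
    have "z * (cis \<alpha> - 1) = of_real (cmod z) * (cis (\<alpha> + \<beta>) - cis \<beta>)"
      by (subst z) (simp add: algebra_simps cis_mult)
    then have "cmod z * (cos (\<alpha> + \<beta>) - cos \<beta>) = 0" using that by simp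
    then have "cos (\<alpha> + \<beta>) = cos \<beta>" using assms by simp
    then obtain n where n: "n \<in> \<int>" "\<alpha> + \<beta> = \<beta> + 2 * n * pi \<or> \<alpha> + \<beta> = - \<beta> + 2 * n * pi"
      unfolding cos_eq by blast
    obtain N :: int where N: "n = of_int N" using n(1) by (auto elim: Ints_cases)
    show ?thesis using n(2)
    proof
      assume "\<alpha> + \<beta> = \<beta> + 2 * n * pi"
      then show ?thesis unfolding N by (intro exI[of _ N]) simp
    next
      assume a: "\<alpha> + \<beta> = - \<beta> + 2 * n * pi"
      then have "\<alpha> = 2 * pi * of_int (N + m) + \<tau>0" unfolding N \<tau>0_def by (simp add: algebra_simps)
      then show ?thesis unfolding \<tau>_def by (intro exI[of _ "N + m"]) auto
    qed
  qed
  ultimately show ?thesis by (rule that)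
qed

lemma plane_orthogonal_decomposition:
  fixes e D h :: plane
  assumes e: "norm e = 1" and D: "e \<bullet> D = 0" "D \<noteq> 0"
  shows "h = (h \<bullet> e) *\<^sub>R e + ((h \<bullet> D) / (norm D)\<^sup>2) *\<^sub>R D"
proof -
  define a b p q where "a = e$1" and "b = e$2" and "p = D$1" and "q = D$2"
  have ab: "a * a + b * b = 1" using e by (simp add: a_def b_def plane_norm power2_eq_square)
  have orth: "a * p + b * q = 0" using D(1) by (simp add: a_def b_def p_def q_def inner_vec_def sum_2)
  define s where "s = a * q - b * p"
  have p: "p = - b * s" unfolding s_def using ab orth by algebra
  have q: "q = a * s" unfolding s_def using ab orth by algebra
  have nD: "(norm D)\<^sup>2 = s * s"
  proof -
    have "(norm D)\<^sup>2 = p * p + q * q" by (simp add: plane_norm p_def q_def power2_eq_square)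
    then show ?thesis using p q ab by algebra
  qed
  have s: "s \<noteq> 0" using D(2) nD by auto
  define x y where "x = h$1" and "y = h$2"
  have he: "h \<bullet> e = x * a + y * b" and hD: "h \<bullet> D = x * p + y * q"
    by (simp_all add: x_def y_def a_def b_def p_def q_def inner_vec_def sum_2)
  have hs: "h \<bullet> D = (- x * b + y * a) * s" unfolding hD p q by (simp add: algebra_simps)
  have co: "(h \<bullet> D) / (norm D)\<^sup>2 = (- x * b + y * a) / s" unfolding hs nD using s by simp
  have "x = (x * a + y * b) * a + (- x * b + y * a) / s * p"
  proof -
    have "(- x * b + y * a) / s * p = (- x * b + y * a) * (- b)" unfolding p using s by simp
    then show ?thesis using ab by algebra
  qed
  moreover have "y = (x * a + y * b) * b + (- x * b + y * a) / s * q"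
  proof -
    have "(- x * b + y * a) / s * q = (- x * b + y * a) * a" unfolding q using s by simp
    then show ?thesis using ab by algebra
  qed
  ultimately show ?thesis
    unfolding co he by (simp add: vec_eq_iff forall_2 x_def y_def a_def b_def p_def q_def)
qed

lemma line_nt_iff:
  assumes k: "k > 0" and e: "norm e = 1" "e \<bullet> d1 = e \<bullet> d2" and d: "d1 \<noteq> d2"
  shows "h \<in> line_nt k d1 d2 e n t \<longleftrightarrow> k * (h \<bullet> (d1 - d2)) = 2 * pi * of_int n + t"
proof -
  let ?D = "d1 - d2"
  have D: "e \<bullet> ?D = 0" "?D \<noteq> 0" using e d by (auto simp: inner_diff_right)
  have n0: "(norm ?D)\<^sup>2 \<noteq> 0" using D(2) by simp
  show ?thesis
  proof
    assume "h \<in> line_nt k d1 d2 e n t"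
    then obtain a where h: "h = a *\<^sub>R e + ((2 * pi * of_int n + t) / (k * (norm ?D)\<^sup>2)) *\<^sub>R ?D" by (auto simp: line_nt_def)
    have "h \<bullet> ?D = (2 * pi * of_int n + t) / (k * (norm ?D)\<^sup>2) * (norm ?D)\<^sup>2"
      unfolding h inner_add_left inner_scaleR_left D(1) power2_norm_eq_inner by simp
    also have "\<dots> = (2 * pi * of_int n + t) / k" using n0 by simp
    finally show "k * (h \<bullet> ?D) = 2 * pi * of_int n + t" using k by simp
  next
    assume a: "k * (h \<bullet> ?D) = 2 * pi * of_int n + t"
    have "(h \<bullet> ?D) / (norm ?D)\<^sup>2 = (2 * pi * of_int n + t) / (k * (norm ?D)\<^sup>2)"
      unfolding a[symmetric] using k by simp
    then have "h = (h \<bullet> e) *\<^sub>R e + ((2 * pi * of_int n + t) / (k * (norm ?D)\<^sup>2)) *\<^sub>R ?D"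
      using plane_orthogonal_decomposition[OF e(1) D, of h] by simp
    then show "h \<in> line_nt k d1 d2 e n t" unfolding line_nt_def by blast
  qed
qed

lemma line_family_iff:
  assumes "k > 0" "norm e = 1" "e \<bullet> d1 = e \<bullet> d2" "d1 \<noteq> d2"
  shows "(\<exists>L\<in>line_family k d1 d2 e \<tau>. h \<in> L) \<longleftrightarrow>
     (\<exists>n::int. k * (h \<bullet> (d1 - d2)) = 2 * pi * of_int n \<or> k * (h \<bullet> (d1 - d2)) = 2 * pi * of_int n + \<tau>)"
  unfolding line_family_def using line_nt_iff[OF assms, of h _ 0] line_nt_iff[OF assms, of h _ \<tau>] by auto

text \<open>The two inner products with \<open>D 1\<close> and \<open>D 2\<close> are independent coordinates of the
  plane because \<open>e 1\<close> and \<open>e 2\<close> are; the set is the preimage of a product of countable sets,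
  and it contains a whole lattice of points on one line.\<close>

lemma intersection_points_countable_infinite:
  fixes d1 d2 e :: "nat \<Rightarrow> plane" and \<tau>\<^sub>1 \<tau>\<^sub>2 :: real
  assumes k: "k > 0" and d: "\<And>l. l \<in> {1, 2} \<Longrightarrow> d1 l \<noteq> d2 l"
    and e: "\<And>l. l \<in> {1, 2} \<Longrightarrow> norm (e l) = 1 \<and> e l \<bullet> d1 l = e l \<bullet> d2 l"
    and nc: "\<not> collinear {0, e 1, e 2}"
  defines "S \<equiv> intersection_points (line_family k (d1 1) (d2 1) (e 1) \<tau>\<^sub>1) (line_family k (d1 2) (d2 2) (e 2) \<tau>\<^sub>2)"
  shows "countable S" "infinite S"
proof -
  define D where "D l = d1 l - d2 l" for l
  have D: "e 1 \<bullet> D 1 = 0" "D 1 \<noteq> 0" "e 2 \<bullet> D 2 = 0" "D 2 \<noteq> 0"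
    using d[of 1] d[of 2] e[of 1] e[of 2] by (auto simp: D_def inner_diff_right)
  have ne: "norm (e 1) = 1" "norm (e 2) = 1" using e[of 1] e[of 2] by auto
  define Q where "Q \<tau> = (\<Union>n::int. {2 * pi * of_int n, 2 * pi * of_int n + \<tau>})" for \<tau> :: real
  have S: "h \<in> S \<longleftrightarrow> k * (h \<bullet> D 1) \<in> Q \<tau>\<^sub>1 \<and> k * (h \<bullet> D 2) \<in> Q \<tau>\<^sub>2" for h
  proof -
    have "h \<in> S \<longleftrightarrow> (\<exists>L\<in>line_family k (d1 1) (d2 1) (e 1) \<tau>\<^sub>1. h \<in> L) \<and> (\<exists>L\<in>line_family k (d1 2) (d2 2) (e 2) \<tau>\<^sub>2. h \<in> L)"
      by (auto simp: S_def intersection_points_def)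
    also have "\<dots> \<longleftrightarrow> k * (h \<bullet> D 1) \<in> Q \<tau>\<^sub>1 \<and> k * (h \<bullet> D 2) \<in> Q \<tau>\<^sub>2"
      using line_family_iff[of k "e 1" "d1 1" "d2 1" \<tau>\<^sub>1 h] line_family_iff[of k "e 2" "d1 2" "d2 2" \<tau>\<^sub>2 h] k d[of 1] d[of 2] e[of 1] e[of 2]
      by (simp add: Q_def D_def)
    finally show ?thesis .
  qed
  have par: False if "e 2 = c *\<^sub>R e 1" for c using nc that unfolding collinear_lemma by blast
  have inj: "v = 0" if "v \<bullet> D 1 = 0" "v \<bullet> D 2 = 0" for v
  proof (rule ccontr)
    assume v: "v \<noteq> 0"
    have v1: "v = (v \<bullet> e 1) *\<^sub>R e 1" using plane_orthogonal_decomposition[OF ne(1) D(1,2), of v] that(1) by simp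
    have v2: "v = (v \<bullet> e 2) *\<^sub>R e 2" using plane_orthogonal_decomposition[OF ne(2) D(3,4), of v] that(2) by simp
    have "v \<bullet> e 2 \<noteq> 0" using v v2 by auto
    have "e 2 = (1 / (v \<bullet> e 2)) *\<^sub>R ((v \<bullet> e 2) *\<^sub>R e 2)" using \<open>v \<bullet> e 2 \<noteq> 0\<close> by simp
    also have "(v \<bullet> e 2) *\<^sub>R e 2 = (v \<bullet> e 1) *\<^sub>R e 1" using v1 v2 by metis
    finally show False using par by (metis scaleR_scaleR)
  qed
  show "countable S"
  proof (rule countable_image_inj_on)
    let ?f = "\<lambda>h. (k * (h \<bullet> D 1), k * (h \<bullet> D 2))"
    have sub: "?f ` S \<subseteq> Q \<tau>\<^sub>1 \<times> Q \<tau>\<^sub>2" using S by auto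
    have cQ: "countable (Q \<tau>)" for \<tau> unfolding Q_def by (intro countable_UN) auto
    have "countable (Q \<tau>\<^sub>1 \<times> Q \<tau>\<^sub>2)" by (intro countable_SIGMA cQ)
    then show "countable (?f ` S)" by (rule countable_subset[OF sub])
    show "inj_on ?f S"
    proof (rule inj_onI)
      fix h h' assume "?f h = ?f h'"
      then have "(h - h') \<bullet> D 1 = 0" "(h - h') \<bullet> D 2 = 0" using k by (auto simp: inner_diff_left)
      then show "h = h'" using inj[of "h - h'"] by simp
    qed
  qed
  have e21: "e 2 \<bullet> D 1 \<noteq> 0"
  proof
    assume "e 2 \<bullet> D 1 = 0"
    then have "e 2 = (e 2 \<bullet> e 1) *\<^sub>R e 1" using plane_orthogonal_decomposition[OF ne(1) D(1,2), of "e 2"] by simp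
    then show False by (rule par)
  qed
  define g where "g n = (2 * pi * real n / (k * (e 2 \<bullet> D 1))) *\<^sub>R e 2" for n :: nat
  have "range g \<subseteq> S"
  proof
    fix h assume "h \<in> range g"
    then obtain n where h: "h = g n" by blast
    have "k * (h \<bullet> D 1) = 2 * pi * of_int (int n)" using e21 k by (simp add: h g_def)
    moreover have "k * (h \<bullet> D 2) = 2 * pi * of_int 0" by (simp add: h g_def D(3))
    ultimately show "h \<in> S" unfolding S Q_def
      by (intro conjI UN_I[of "int n"] UN_I[of "0::int"]) simp_all
  qed
  moreover have "inj g"
  proof (rule injI)
    fix m n assume "g m = g n"
    then have "g m \<bullet> D 1 = g n \<bullet> D 1" by simp
    then show "m = n" using e21 k by (simp add: g_def)
  qed
  then have "infinite (range g)" by (rule range_inj_infinite)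
  ultimately show "infinite S" by (rule infinite_super)
qed

lemma phase_condition:
  assumes "cmod (A + B) = cmod (c1 * A + c2 * B)" "cmod c1 = 1" "cmod c2 = 1"
  shows "Re (A * cnj B * (c1 * cnj c2 - 1)) = 0"
proof -
  have sq: "(cmod (x + y))\<^sup>2 = (cmod x)\<^sup>2 + (cmod y)\<^sup>2 + 2 * Re (x * cnj y)" for x y
    unfolding cmod_power2 by (simp add: power2_eq_square algebra_simps)
  have "(cmod (A + B))\<^sup>2 = (cmod (c1 * A + c2 * B))\<^sup>2" using assms(1) by simp
  then have "Re (A * cnj B) = Re (c1 * A * cnj (c2 * B))"
    unfolding sq by (simp add: norm_mult assms)
  also have "c1 * A * cnj (c2 * B) = A * cnj B * (c1 * cnj c2)" by (simp add: mult_ac)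
  finally show ?thesis by (simp add: right_diff_distrib)
qed

text \<open>One direction in which both patterns are nonzero suffices to determine the second phase
  \<open>\<tau>\<close>, and it does not depend on the translation.\<close>

theorem single_pair_phase:
  assumes k: "k > 0" and \<Omega>: "obstacle \<Omega>" and wp: "well_posed P k \<Omega>"
    and ev: "\<And>n0 lam. P = Transmission n0 lam \<Longrightarrow> \<not> transmission_eigenvalue n0 lam \<Omega> k"
    and d: "norm d1 = 1" "norm d2 = 1" "d1 \<noteq> d2"
    and U: "far_field_pattern P k \<Omega> (two_waves k d1 d2) U"
    and V: "\<And>h. far_field_pattern P k ((\<lambda>x. x + h) ` \<Omega>) (two_waves k d1 d2) (V h)"
  obtains \<tau> where "\<tau> \<in> {0<..<2*pi}"
    "\<And>h. (\<And>x. x \<in> sphere 0 1 \<Longrightarrow> cmod (U x) = cmod (V h x)) \<Longrightarrow>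
       \<exists>n::int. k * (h \<bullet> (d1 - d2)) = 2 * pi * of_int n \<or> k * (h \<bullet> (d1 - d2)) = 2 * pi * of_int n + \<tau>"
proof -
  obtain A B where AB: "\<And>x. x \<in> sphere 0 1 \<Longrightarrow> cmod (U x) = cmod (A x + B x)"
    "\<And>h x. x \<in> sphere 0 1 \<Longrightarrow> cmod (V h x) = cmod (plane_wave k d1 h * A x + plane_wave k d2 h * B x)"
    "\<exists>x\<in>sphere 0 1. A x * B x \<noteq> 0"
  proof (rule two_wave_patterns[OF k \<Omega> wp ev d U V])
    fix A B
    assume "\<And>x. x \<in> sphere 0 1 \<Longrightarrow> cmod (U x) = cmod (A x + B x)"
      "\<And>h x. x \<in> sphere 0 1 \<Longrightarrow> cmod (V h x) = cmod (plane_wave k d1 h * A x + plane_wave k d2 h * B x)"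
      "\<exists>x\<in>sphere 0 1. A x * B x \<noteq> 0"
    then show thesis by (rule that)
  qed assumption
  obtain x where x: "x \<in> sphere 0 1" "A x * B x \<noteq> 0" using AB(3) by blast
  then have z: "A x * cnj (B x) \<noteq> 0" by simp
  obtain \<tau> where \<tau>: "\<tau> \<in> {0<..<2*pi}"
    "\<And>\<alpha>. Re (A x * cnj (B x) * (cis \<alpha> - 1)) = 0 \<Longrightarrow> \<exists>n::int. \<alpha> = 2 * pi * of_int n \<or> \<alpha> = 2 * pi * of_int n + \<tau>"
  proof (rule single_phase[OF z])
    fix \<tau> assume "\<tau> \<in> {0<..<2*pi}"
      "\<And>\<alpha>. Re (A x * cnj (B x) * (cis \<alpha> - 1)) = 0 \<Longrightarrow> \<exists>n::int. \<alpha> = 2 * pi * of_int n \<or> \<alpha> = 2 * pi * of_int n + \<tau>"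
    then show thesis by (rule that)
  qed
  have "\<exists>n::int. k * (h \<bullet> (d1 - d2)) = 2 * pi * of_int n \<or> k * (h \<bullet> (d1 - d2)) = 2 * pi * of_int n + \<tau>"
    if eq: "\<And>x. x \<in> sphere 0 1 \<Longrightarrow> cmod (U x) = cmod (V h x)" for h
  proof (rule \<tau>(2))
    have "cmod (A x + B x) = cmod (plane_wave k d1 h * A x + plane_wave k d2 h * B x)"
      using AB(1)[OF x(1)] AB(2)[OF x(1), of h] eq[OF x(1)] by simp
    then have "Re (A x * cnj (B x) * (plane_wave k d1 h * cnj (plane_wave k d2 h) - 1)) = 0"
      by (rule phase_condition) simp_all
    moreover have "plane_wave k d h = cis (k * (d \<bullet> h))" for d by (simp add: plane_wave_def cis_conv_exp)
    then have "plane_wave k d1 h * cnj (plane_wave k d2 h) = cis (k * (h \<bullet> (d1 - d2)))"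
      by (simp add: cis_cnj cis_mult inner_diff_right inner_commute algebra_simps)
    ultimately show "Re (A x * cnj (B x) * (cis (k * (h \<bullet> (d1 - d2))) - 1)) = 0" by simp
  qed
  with \<tau>(1) show ?thesis by (rule that)
qed

theorem corollary2p5:
  fixes k :: real
    and d1 d2 e :: "nat \<Rightarrow> plane"
    and \<Omega> :: "plane set"
    and P :: scattering_problem
    and U :: "nat \<Rightarrow> field"
    and V :: "plane \<Rightarrow> nat \<Rightarrow> field"
  assumes "k > 0"
    and "\<And>l. l \<in> {1, 2} \<Longrightarrow> d1 l \<in> sphere 0 1 \<and> d2 l \<in> sphere 0 1 \<and> d1 l \<noteq> d2 l"
    and "\<And>l. l \<in> {1, 2} \<Longrightarrow> e l \<in> sphere 0 1 \<and> e l \<bullet> d1 l = e l \<bullet> d2 l"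
    and "\<not> collinear {0, e 1, e 2}"
    and "obstacle \<Omega>"
    and "admissible P"
    and "well_posed P k \<Omega>"
    and "\<And>n0 lam. P = Transmission n0 lam \<Longrightarrow> \<not> transmission_eigenvalue n0 lam \<Omega> k"
    and "\<And>l. l \<in> {1, 2} \<Longrightarrow>
           far_field_pattern P k \<Omega> (two_waves k (d1 l) (d2 l)) (U l)"
    and "\<And>h l. l \<in> {1, 2} \<Longrightarrow>
           far_field_pattern P k ((\<lambda>x. x + h) ` \<Omega>) (two_waves k (d1 l) (d2 l)) (V h l)"
  shows "\<exists>\<tau>\<^sub>1\<in>{0<..<2*pi}. \<exists>\<tau>\<^sub>2\<in>{0<..<2*pi}.
    (let S = intersection_points (line_family k (d1 1) (d2 1) (e 1) \<tau>\<^sub>1)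
                                 (line_family k (d1 2) (d2 2) (e 2) \<tau>\<^sub>2)
     in countable S \<and> infinite S \<and>
        (\<forall>h. (\<forall>l\<in>{1, 2}. \<forall>x\<in>sphere 0 1. cmod (U l x) = cmod (V h l x)) \<longrightarrow> h \<in> S))"
proof -
  have d: "norm (d1 l) = 1" "norm (d2 l) = 1" "d1 l \<noteq> d2 l" if "l \<in> {1, 2}" for l
    using assms(2)[OF that] by auto
  have e: "norm (e l) = 1" "e l \<bullet> d1 l = e l \<bullet> d2 l" if "l \<in> {1, 2}" for l
    using assms(3)[OF that] by auto
  have "\<exists>\<tau>\<in>{0<..<2*pi}. \<forall>h. (\<forall>x\<in>sphere 0 1. cmod (U l x) = cmod (V h l x)) \<longrightarrow>
      (\<exists>L\<in>line_family k (d1 l) (d2 l) (e l) \<tau>. h \<in> L)" if l: "l \<in> {1, 2}" for l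
  proof (rule single_pair_phase[OF assms(1,5,7,8) d[OF l] assms(9)[OF l] assms(10)[OF l]])
    fix \<tau> assume \<tau>: "\<tau> \<in> {0<..<2*pi}" and h: "\<And>h. (\<And>x. x \<in> sphere 0 1 \<Longrightarrow> cmod (U l x) = cmod (V h l x)) \<Longrightarrow>
       \<exists>n::int. k * (h \<bullet> (d1 l - d2 l)) = 2 * pi * of_int n \<or> k * (h \<bullet> (d1 l - d2 l)) = 2 * pi * of_int n + \<tau>"
    have "\<forall>h. (\<forall>x\<in>sphere 0 1. cmod (U l x) = cmod (V h l x)) \<longrightarrow> (\<exists>L\<in>line_family k (d1 l) (d2 l) (e l) \<tau>. h \<in> L)"
    proof (intro allI impI)
      fix v assume v: "\<forall>x\<in>sphere 0 1. cmod (U l x) = cmod (V v l x)"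
      show "\<exists>L\<in>line_family k (d1 l) (d2 l) (e l) \<tau>. v \<in> L"
        unfolding line_family_iff[OF assms(1) e[OF l] d(3)[OF l]] by (rule h) (rule bspec[OF v])
    qed
    with \<tau> show ?thesis by (rule bexI[rotated])
  qed assumption
  note pair = this
  obtain \<tau>\<^sub>1 where t1: "\<tau>\<^sub>1 \<in> {0<..<2*pi}"
    "\<forall>h. (\<forall>x\<in>sphere 0 1. cmod (U 1 x) = cmod (V h 1 x)) \<longrightarrow> (\<exists>L\<in>line_family k (d1 1) (d2 1) (e 1) \<tau>\<^sub>1. h \<in> L)"
    using pair[of 1, OF insertI1] by (rule bexE)
  obtain \<tau>\<^sub>2 where t2: "\<tau>\<^sub>2 \<in> {0<..<2*pi}"
    "\<forall>h. (\<forall>x\<in>sphere 0 1. cmod (U 2 x) = cmod (V h 2 x)) \<longrightarrow> (\<exists>L\<in>line_family k (d1 2) (d2 2) (e 2) \<tau>\<^sub>2. h \<in> L)"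
    using pair[of 2, OF insertI2[OF insertI1]] by (rule bexE)
  let ?S = "intersection_points (line_family k (d1 1) (d2 1) (e 1) \<tau>\<^sub>1) (line_family k (d1 2) (d2 2) (e 2) \<tau>\<^sub>2)"
  have "countable ?S" "infinite ?S"
    using intersection_points_countable_infinite[where ?d1.0 = d1 and ?d2.0 = d2 and e = e, OF assms(1) d(3) conjI[OF e] assms(4)] by simp_all
  moreover have "h \<in> ?S" if "\<forall>l\<in>{1, 2}. \<forall>x\<in>sphere 0 1. cmod (U l x) = cmod (V h l x)" for h
  proof -
    have "\<exists>L\<in>line_family k (d1 1) (d2 1) (e 1) \<tau>\<^sub>1. h \<in> L"
      using t1(2)[rule_format, of h] that by simp
    moreover have "\<exists>L\<in>line_family k (d1 2) (d2 2) (e 2) \<tau>\<^sub>2. h \<in> L"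
      using t2(2)[rule_format, of h] that by simp
    ultimately show ?thesis unfolding intersection_points_def by blast
  qed
  ultimately have "let S = ?S in countable S \<and> infinite S \<and>
      (\<forall>h. (\<forall>l\<in>{1, 2}. \<forall>x\<in>sphere 0 1. cmod (U l x) = cmod (V h l x)) \<longrightarrow> h \<in> S)"
    unfolding Let_def by (intro conjI allI impI)
  then show ?thesis by (intro bexI[OF _ t1(1)] bexI[OF _ t2(1)])
qed

end
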